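(* Let $k\ge1$. If for some $\beta\in(0,\pi/2)$ the operator $\mathcal{A}^{\Omega_\beta}$ has $k$ eigenvalues (counted with multiplicities) below the threshold $\pi^2$, then for all $\alpha\in(0,\beta)$ the operator $\mathcal{A}^{\Omega_\alpha}$ has at least $k$ eigenvalues (counted with multiplicities) below the threshold $\pi^2$. Moreover, for every $1\le j\le k$ the $j$-th eigenvalue $\lambda_j(\mathcal{A}^{\Omega_\alpha})$ is a monotonically increasing function of $\alpha$.
   Context: For a domain $\Omega$, let $H_0^1(\Omega)$ be the Sobolev space of $H^1(\Omega)$ functions with zero trace on $\partial\Omega$. The Dirichlet Laplacian $\mathcal{A}^{\Omega}$ is the self-adjoint operator in $L_2(\Omega)$ generated by the closed positive form $\mathfrak{a}_\Omega[u,v]=(\nabla u,\nabla v)_{L_2(\Omega)}$ with domain $H_0^1(\Omega)$. For $\theta\in(0,\pi/2)$ the broken (V-shaped) waveguide $\Omega_\theta\subset\mathbb{R}^2$ of unit width is the set of points inside a planar angle of magnitude $2\theta$ whose distance to the boundary of the angle is less than one. In Cartesian coordinates $(x,z)$ with the vertex at the origin and the symmetry axis along the $z$-axis, $\Omega_\theta=\{(x,z):0<z\sin\theta-|x|\cos\theta<1\}$. For every $\theta\in(0,\pi/2)$ the essential spectrum of $\mathcal{A}^{\Omega_\theta}$ is $[\pi^2,+\infty)$, so the threshold is $\pi^2$. The eigenvalues $\lambda_1\le\lambda_2\le\dots$ below the threshold are listed in nondecreasing order, counted with multiplicity. *)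

theory Defs
  imports "HOL-Analysis.Analysis" "HOL-Library.Extended_Nat"
begin

subsection \<open>Smooth functions\<close>

fun k_times_differentiable :: "nat \<Rightarrow> ('a::euclidean_space \<Rightarrow> complex) \<Rightarrow> bool" where
  "k_times_differentiable 0 f \<longleftrightarrow> True"
| "k_times_differentiable (Suc k) f \<longleftrightarrow>
     (\<forall>x. f differentiable (at x)) \<and>
     (\<forall>v. k_times_differentiable k (\<lambda>x. frechet_derivative f (at x) v))"

definition smooth_compact_support :: "('a::euclidean_space \<Rightarrow> complex) set" where
  "smooth_compact_support =
     {\<phi>. (\<forall>k. k_times_differentiable k \<phi>) \<and> compact (closure {x. \<phi> x \<noteq> 0})}"

definition test_functions :: "'a::euclidean_space set \<Rightarrow> ('a \<Rightarrow> complex) set" where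
  "test_functions \<Omega> = {\<phi> \<in> smooth_compact_support. closure {x. \<phi> x \<noteq> 0} \<subseteq> \<Omega>}"

subsection \<open>The spaces \<open>L\<^sub>2\<close>, \<open>H\<^sup>1\<close> and \<open>H\<^sup>1\<^sub>0\<close>\<close>

text \<open>
  Elements of the function spaces over \<open>\<Omega>\<close> are represented by functions on the whole type; only
  their values on \<open>\<Omega>\<close> matter, and only up to null sets.
\<close>

abbreviation leb :: "'a::euclidean_space set \<Rightarrow> 'a measure" where
  "leb \<Omega> \<equiv> restrict_space lborel \<Omega>"

definition L2 :: "'a::euclidean_space set \<Rightarrow> ('a \<Rightarrow> complex) set" where
  "L2 \<Omega> = {f \<in> borel_measurable (leb \<Omega>). integrable (leb \<Omega>) (\<lambda>x. (norm (f x))\<^sup>2)}"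

definition L2_inner :: "'a::euclidean_space set \<Rightarrow> ('a \<Rightarrow> complex) \<Rightarrow> ('a \<Rightarrow> complex) \<Rightarrow> complex" where
  "L2_inner \<Omega> f g = (\<integral>x. f x * cnj (g x) \<partial>(leb \<Omega>))"

definition L2_norm :: "'a::euclidean_space set \<Rightarrow> ('a \<Rightarrow> complex) \<Rightarrow> real" where
  "L2_norm \<Omega> f = sqrt (\<integral>x. (norm (f x))\<^sup>2 \<partial>(leb \<Omega>))"

definition has_weak_partial ::
  "'a::euclidean_space set \<Rightarrow> 'a \<Rightarrow> ('a \<Rightarrow> complex) \<Rightarrow> ('a \<Rightarrow> complex) \<Rightarrow> bool" where
  "has_weak_partial \<Omega> e u g \<longleftrightarrow>
     (\<forall>\<phi> \<in> test_functions \<Omega>.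
        (\<integral>x. u x * frechet_derivative \<phi> (at x) e \<partial>(leb \<Omega>)) = - (\<integral>x. g x * \<phi> x \<partial>(leb \<Omega>)))"

definition H1 :: "'a::euclidean_space set \<Rightarrow> ('a \<Rightarrow> complex) set" where
  "H1 \<Omega> = {u \<in> L2 \<Omega>. \<forall>e\<in>Basis. \<exists>g \<in> L2 \<Omega>. has_weak_partial \<Omega> e u g}"

text \<open>For open \<open>\<Omega>\<close> and \<open>u \<in> H1 \<Omega>\<close> this is well defined up to null sets.\<close>

definition weak_partial :: "'a::euclidean_space set \<Rightarrow> 'a \<Rightarrow> ('a \<Rightarrow> complex) \<Rightarrow> ('a \<Rightarrow> complex)" where
  "weak_partial \<Omega> e u = (SOME g. g \<in> L2 \<Omega> \<and> has_weak_partial \<Omega> e u g)"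

definition H1_dist :: "'a::euclidean_space set \<Rightarrow> ('a \<Rightarrow> complex) \<Rightarrow> ('a \<Rightarrow> complex) \<Rightarrow> real" where
  "H1_dist \<Omega> u v = sqrt ((L2_norm \<Omega> (\<lambda>x. u x - v x))\<^sup>2 +
     (\<Sum>e\<in>Basis. (L2_norm \<Omega> (\<lambda>x. weak_partial \<Omega> e u x - weak_partial \<Omega> e v x))\<^sup>2))"

text \<open>
  The boundary of a planar domain is given by a finite set \<open>\<Gamma>\<close> of injective curves, parametrised by
  the real line, which cover it up to sets of zero length. The integral of \<open>\<bar>g\<bar>\<^sup>2\<close> over the boundary
  is taken with respect to arc length.
\<close>

definition boundary_sq_integral ::
  "(real \<Rightarrow> 'a::euclidean_space) set \<Rightarrow> ('a \<Rightarrow> complex) \<Rightarrow> ennreal" where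
  "boundary_sq_integral \<Gamma> g =
     (\<Sum>\<gamma>\<in>\<Gamma>. \<integral>\<^sup>+ s. ennreal ((norm (g (\<gamma> s)))\<^sup>2 * norm (vector_derivative \<gamma> (at s))) \<partial>lborel)"

text \<open>
  The trace operator is the extension by continuity, from \<open>H\<^sup>1(\<Omega>)\<close> to \<open>L\<^sub>2\<close> of the boundary, of the
  map which restricts functions smooth up to the boundary to the boundary. The following is its
  graph.
\<close>

definition has_trace ::
  "'a::euclidean_space set \<Rightarrow> (real \<Rightarrow> 'a) set \<Rightarrow> ('a \<Rightarrow> complex) \<Rightarrow> ('a \<Rightarrow> complex) \<Rightarrow> bool" where
  "has_trace \<Omega> \<Gamma> u g \<longleftrightarrow>
     (\<exists>\<phi> :: nat \<Rightarrow> 'a \<Rightarrow> complex.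
        (\<forall>n. \<phi> n \<in> smooth_compact_support) \<and>
        (\<lambda>n. H1_dist \<Omega> (\<phi> n) u) \<longlonglongrightarrow> 0 \<and>
        (\<lambda>n. boundary_sq_integral \<Gamma> (\<lambda>x. \<phi> n x - g x)) \<longlonglongrightarrow> 0)"

definition H10 :: "'a::euclidean_space set \<Rightarrow> (real \<Rightarrow> 'a) set \<Rightarrow> ('a \<Rightarrow> complex) set" where
  "H10 \<Omega> \<Gamma> = {u \<in> H1 \<Omega>. has_trace \<Omega> \<Gamma> u (\<lambda>_. 0)}"

subsection \<open>The Dirichlet Laplacian\<close>

definition dirichlet_form ::
  "'a::euclidean_space set \<Rightarrow> ('a \<Rightarrow> complex) \<Rightarrow> ('a \<Rightarrow> complex) \<Rightarrow> complex" where
  "dirichlet_form \<Omega> u v = (\<Sum>e\<in>Basis. L2_inner \<Omega> (weak_partial \<Omega> e u) (weak_partial \<Omega> e v))"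

text \<open>
  The graph of the self-adjoint operator generated by the form on \<open>H\<^sup>1\<^sub>0(\<Omega>)\<close>: \<open>u\<close> is in the
  domain, with image \<open>f\<close>, iff \<open>u\<close> is in the form domain and the form satisfies \<open>a[u,v] = (f,v)\<close> for
  all \<open>v\<close> in the form domain.
\<close>

definition dirichlet_laplacian ::
  "'a::euclidean_space set \<Rightarrow> (real \<Rightarrow> 'a) set \<Rightarrow> (('a \<Rightarrow> complex) \<times> ('a \<Rightarrow> complex)) set" where
  "dirichlet_laplacian \<Omega> \<Gamma> =
     {(u, f). u \<in> H10 \<Omega> \<Gamma> \<and> f \<in> L2 \<Omega> \<and>
        (\<forall>v \<in> H10 \<Omega> \<Gamma>. dirichlet_form \<Omega> u v = L2_inner \<Omega> f v)}"

subsection \<open>Eigenvalues counted with multiplicity\<close>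

text \<open>Below, \<open>A\<close> is the graph of an operator in \<open>L2 \<Omega>\<close>.\<close>

definition eigenspace ::
  "(('a \<Rightarrow> complex) \<times> ('a \<Rightarrow> complex)) set \<Rightarrow> real \<Rightarrow> ('a \<Rightarrow> complex) set" where
  "eigenspace A \<mu> = {u. (u, \<lambda>x. complex_of_real \<mu> * u x) \<in> A}"

definition L2_independent ::
  "'a::euclidean_space set \<Rightarrow> nat \<Rightarrow> (nat \<Rightarrow> 'a \<Rightarrow> complex) \<Rightarrow> bool" where
  "L2_independent \<Omega> n u \<longleftrightarrow>
     (\<forall>c :: nat \<Rightarrow> complex.
        (AE x in leb \<Omega>. (\<Sum>i<n. c i * u i x) = 0) \<longrightarrow> (\<forall>i<n. c i = 0))"

text \<open>The complex dimension of the eigenspace; it is 0 iff \<open>\<mu>\<close> is not an eigenvalue.\<close>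

definition multiplicity_of ::
  "'a::euclidean_space set \<Rightarrow> (('a \<Rightarrow> complex) \<times> ('a \<Rightarrow> complex)) set \<Rightarrow> real \<Rightarrow> enat" where
  "multiplicity_of \<Omega> A \<mu> =
     Sup {enat n | n u. (\<forall>i<n. u i \<in> eigenspace A \<mu>) \<and> L2_independent \<Omega> n u}"

definition eigenvalue_count ::
  "'a::euclidean_space set \<Rightarrow> (('a \<Rightarrow> complex) \<times> ('a \<Rightarrow> complex)) set \<Rightarrow> real set \<Rightarrow> enat" where
  "eigenvalue_count \<Omega> A S = (SUP F \<in> {F. finite F \<and> F \<subseteq> S}. \<Sum>\<mu>\<in>F. multiplicity_of \<Omega> A \<mu>)"

text \<open>
  In the nondecreasing list of eigenvalues, repeated according to multiplicity and numbered from 1,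
  the entry at position \<open>j\<close> is the number \<open>\<mu>\<close> such that fewer than \<open>j\<close> entries are \<open>< \<mu>\<close> and at
  least \<open>j\<close> entries are \<open>\<le> \<mu>\<close>.
\<close>

definition nth_eigenvalue ::
  "'a::euclidean_space set \<Rightarrow> (('a \<Rightarrow> complex) \<times> ('a \<Rightarrow> complex)) set \<Rightarrow> nat \<Rightarrow> real" where
  "nth_eigenvalue \<Omega> A j =
     (THE \<mu>. eigenvalue_count \<Omega> A {..<\<mu>} < enat j \<and> enat j \<le> eigenvalue_count \<Omega> A {..\<mu>})"

subsection \<open>The broken waveguide\<close>

definition broken_guide :: "real \<Rightarrow> (real \<times> real) set" where
  "broken_guide \<theta> = {(x, z). 0 < z * sin \<theta> - \<bar>x\<bar> * cos \<theta> \<and> z * sin \<theta> - \<bar>x\<bar> * cos \<theta> < 1}"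

definition guide_boundary :: "real \<Rightarrow> (real \<Rightarrow> real \<times> real) set" where
  "guide_boundary \<theta> =
     {\<lambda>x. (x, \<bar>x\<bar> * cos \<theta> / sin \<theta>), \<lambda>x. (x, (\<bar>x\<bar> * cos \<theta> + 1) / sin \<theta>)}"

lemma frontier_broken_guide:
  assumes "0 < \<theta>" "\<theta> < pi / 2"
  shows "frontier (broken_guide \<theta>) = (\<Union>\<gamma> \<in> guide_boundary \<theta>. range \<gamma>)"
proof -
  define f where "f = (\<lambda>p::real\<times>real. snd p * sin \<theta> - \<bar>fst p\<bar> * cos \<theta>)"
  have s: "sin \<theta> > 0" using assms by (intro sin_gt_zero) auto
  have cf: "continuous_on UNIV f" unfolding f_def by (intro continuous_intros)
  have O: "broken_guide \<theta> = f -` {0<..<1}" by (auto simp: broken_guide_def f_def)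
  have "open (broken_guide \<theta>)" unfolding O by (intro open_vimage cf) auto
  hence int: "interior (broken_guide \<theta>) = broken_guide \<theta>" by (rule interior_open)
  have "closed (f -` {0..1})" by (intro closed_vimage cf) auto
  moreover have "broken_guide \<theta> \<subseteq> f -` {0..1}" unfolding O by auto
  ultimately have 1: "closure (broken_guide \<theta>) \<subseteq> f -` {0..1}" by (rule closure_minimal[rotated])
  have 2: "f -` {0..1} \<subseteq> closure (broken_guide \<theta>)"
  proof
    fix p assume p: "p \<in> f -` {0..1}"
    define q where "q = (\<lambda>n::nat. p + (0, (1/2 - f p) / sin \<theta> * inverse (real (Suc (Suc n)))))"
    have fq: "f (q n) = f p + (1/2 - f p) * inverse (real (Suc (Suc n)))" for n
    proof -
      have shift: "f (p + (0, c)) = f p + c * sin \<theta>" for c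
        by (simp add: f_def algebra_simps)
      show ?thesis unfolding q_def shift using s by simp
    qed
    have "q n \<in> broken_guide \<theta>" for n
    proof -
      define t where "t = inverse (real (Suc (Suc n)))"
      have t: "0 < t" "t < 1" by (auto simp: t_def field_simps)
      have e: "f (q n) = (1 - t) * f p + t * (1/2)" using fq[of n] by (simp add: t_def algebra_simps)
      define a where "a = (1 - t) * f p"
      have "0 \<le> a" "a \<le> 1 - t"
        using p t by (auto simp: a_def intro!: mult_nonneg_nonneg mult_left_le)
      then have "0 < f (q n) \<and> f (q n) < 1" using t e unfolding a_def[symmetric] by auto
      then show ?thesis unfolding O by auto
    qed
    moreover have "q \<longlonglongrightarrow> p"
    proof -
      have "(\<lambda>n. inverse (real (Suc (Suc n)))) \<longlonglongrightarrow> 0"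
        using LIMSEQ_inverse_real_of_nat by (rule LIMSEQ_Suc)
      then have "(\<lambda>n. (1/2 - f p) / sin \<theta> * inverse (real (Suc (Suc n)))) \<longlonglongrightarrow> (1/2 - f p) / sin \<theta> * 0"
        by (rule tendsto_mult_left)
      then have "q \<longlonglongrightarrow> p + (0, (1/2 - f p) / sin \<theta> * 0)"
        unfolding q_def by (intro tendsto_add tendsto_Pair tendsto_const)
      then show ?thesis by (simp flip: zero_prod_def)
    qed
    ultimately show "p \<in> closure (broken_guide \<theta>)"
      by (auto simp: closure_sequential)
  qed
  have "frontier (broken_guide \<theta>) = f -` {0..1} - f -` {0<..<1}"
    using 1 2 int O by (auto simp: frontier_def)
  also have "\<dots> = {p. f p = 0} \<union> {p. f p = 1}" by (auto)
  also have "\<dots> = (\<Union>\<gamma> \<in> guide_boundary \<theta>. range \<gamma>)"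
    using s by (fastforce simp: guide_boundary_def f_def field_simps image_iff)
  finally show ?thesis .
qed

definition guide_laplacian ::
  "real \<Rightarrow> ((real \<times> real \<Rightarrow> complex) \<times> (real \<times> real \<Rightarrow> complex)) set" where
  "guide_laplacian \<theta> = dirichlet_laplacian (broken_guide \<theta>) (guide_boundary \<theta>)"

text \<open>Number of eigenvalues below \<open>\<mu>\<close> and the eigenvalue at position \<open>j\<close>, for the angle \<open>\<theta>\<close>.\<close>

definition guide_count_below :: "real \<Rightarrow> real \<Rightarrow> enat" where
  "guide_count_below \<theta> \<mu> = eigenvalue_count (broken_guide \<theta>) (guide_laplacian \<theta>) {..<\<mu>}"

definition guide_eigenvalue :: "nat \<Rightarrow> real \<Rightarrow> real" where
  "guide_eigenvalue j \<theta> = nth_eigenvalue (broken_guide \<theta>) (guide_laplacian \<theta>) j"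

end

theory Submission
  imports Defs "HOL-Library.Function_Algebras" "HOL-Real_Asymp.Real_Asymp"
begin

text \<open>
  For \<open>\<alpha> < \<beta>\<close> the guides are compared through the map \<open>T\<close> which, on either side of the symmetry
  axis, is a rigid motion composed with the contraction by the factor \<open>tan \<alpha> / tan \<beta> < 1\<close> along the
  arm. It maps \<open>\<Omega>\<^sub>\<alpha>\<close> onto \<open>\<Omega>\<^sub>\<beta>\<close> and the boundary onto the boundary, it is continuous across the axis, and
  its Jacobian is constant. Hence \<open>u \<mapsto> u \<circ> T\<close> maps the form domain for \<open>\<beta>\<close> into the form domain for \<open>\<alpha>\<close>,
  multiplies all \<open>L\<^sub>2\<close> inner products by one and the same constant, and, up to that constant, lowers the
  Dirichlet energy by a positive multiple of the squared norm of the derivative of \<open>u\<close> along the arms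
  (\<open>energy_identity\<close>). This derivative vanishes only for \<open>u = 0\<close>, because a function in \<open>L\<^sub>2\<close> that is
  constant along infinitely long arms is zero (\<open>zero_of_arm_derivative_zero\<close>). So every nonzero \<open>u\<close> has
  its Rayleigh quotient strictly lowered.

  By the variational principle, a space of dimension \<open>k\<close> of trial functions on which the Rayleigh
  quotient is less than \<open>\<mu> \<le> \<pi>\<^sup>2\<close> yields \<open>k\<close> eigenvalues below \<open>\<mu>\<close> (\<open>trial_space\<close>). Applied to the
  transplanted span of eigenfunctions for the eigenvalues \<open>\<le> \<mu>\<close> of \<open>\<Omega>\<^sub>\<beta>\<close>, this gives
  \<open>eigfamily_transplant\<close>: if \<open>\<Omega>\<^sub>\<beta>\<close> has \<open>k\<close> eigenvalues \<open>\<le> \<mu>\<close>, then \<open>\<Omega>\<^sub>\<alpha>\<close> has \<open>k\<close> eigenvalues \<open>< \<mu>\<close>.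
  With \<open>\<mu> = \<pi>\<^sup>2\<close> this is the first claim, and with \<open>\<mu> = \<lambda>\<^sub>j(\<beta>)\<close> it is strict monotonicity.

  The variational principle needs the essential spectrum to start at \<open>\<pi>\<^sup>2\<close> or later. This enters in the
  form that, for every \<open>c < \<pi>\<^sup>2\<close>, the energy dominates \<open>c\<close> times the squared norm up to finitely many
  bounded functionals (\<open>guide_lower_bound\<close>). The functionals are mean values over small cells near the
  corner; away from the corner every cross section has length one and vanishing boundary values, so
  the one-dimensional inequality with constant \<open>\<pi>\<^sup>2\<close> applies. Minimising sequences on which finitely
  many functionals converge are then Cauchy, which yields minimisers and hence eigenvectors without
  compact embeddings or the spectral theorem.

  The form domain is defined through a limit of smooth functions together with their boundary
  integrals. The relation \<open>trace_free\<close> keeps track of a function and its gradient as a simultaneous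
  limit of this kind; linearity, completeness, the lower bound and the transplantation are all
  obtained for smooth functions first and then passed to the limit.
\<close>

section \<open>Eigenvalues below the bottom of the essential spectrum\<close>

lemma underdetermined_system:
  fixes A :: "nat \<Rightarrow> 'i \<Rightarrow> complex"
  assumes "finite J" "m < card J"
  shows "\<exists>c. (\<exists>j\<in>J. c j \<noteq> 0) \<and> (\<forall>i<m. (\<Sum>j\<in>J. A i j * c j) = 0)"
  using assms
proof (induction m arbitrary: J)
  case 0
  then have "J \<noteq> {}" by auto
  then show ?case by (intro exI[of _ "\<lambda>_. 1"]) auto
next
  case (Suc m)
  obtain c where c: "\<exists>j\<in>J. c j \<noteq> 0" "\<forall>i<m. (\<Sum>j\<in>J. A i j * c j) = 0"
    using Suc.IH[of J] Suc.prems by auto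
  then obtain j0 where j0: "j0 \<in> J" "c j0 \<noteq> 0" by auto
  obtain d where d: "\<exists>j\<in>J - {j0}. d j \<noteq> 0" "\<forall>i<m. (\<Sum>j\<in>J - {j0}. A i j * d j) = 0"
    using Suc.IH[of "J - {j0}"] Suc.prems j0 by (metis card_Diff_singleton finite_Diff less_diff_conv Suc_eq_plus1)
  define d' where "d' = d(j0 := 0)"
  have sumd: "(\<Sum>j\<in>J. A i j * d' j) = (\<Sum>j\<in>J - {j0}. A i j * d j)" for i
    using Suc.prems j0 by (simp add: sum.remove d'_def)
  define r where "r = (\<Sum>j\<in>J. A m j * c j)"
  define r' where "r' = (\<Sum>j\<in>J. A m j * d' j)"
  define e where "e = (\<lambda>j. r * d' j - r' * c j)"
  have sume: "(\<Sum>j\<in>J. A i j * e j) = r * (\<Sum>j\<in>J. A i j * d' j) - r' * (\<Sum>j\<in>J. A i j * c j)" for i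
    by (simp add: e_def sum_distrib_left algebra_simps sum_subtractf)
  show ?case
  proof (cases "r = 0 \<or> r' = 0")
    case True
    then show ?thesis
    proof
      assume "r = 0"
      then show ?thesis using c j0 by (intro exI[of _ c]) (auto simp: r_def less_Suc_eq)
    next
      assume r': "r' = 0"
      have "\<exists>j\<in>J. d' j \<noteq> 0" using d(1) by (auto simp: d'_def)
      then show ?thesis using r' d(2) sumd by (intro exI[of _ d']) (auto simp: r'_def less_Suc_eq)
    qed
  next
    case False
    have "e j0 \<noteq> 0" using False j0 by (simp add: e_def d'_def)
    then show ?thesis using j0 sume c(2) d(2) sumd
      by (intro exI[of _ e]) (auto simp: r_def r'_def less_Suc_eq)
  qed
qed

text \<open>
  Two forms live on the same domain, and after subtracting a multiple of one from the other they are
  only semidefinite. Elements of the function spaces are moreover functions and not classes modulo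
  null sets, so even the \<open>L\<^sub>2\<close> product is not definite. Therefore the carrier is a subspace of an
  ambient vector space and positivity is not strict.
\<close>

locale semi_inner = vector_space scale
  for scale :: "complex \<Rightarrow> 'v::ab_group_add \<Rightarrow> 'v" (infixr "\<odot>" 75) +
  fixes D :: "'v set" and q :: "'v \<Rightarrow> 'v \<Rightarrow> complex"
  assumes subspace_D: "subspace D"
    and add_left: "\<And>u v w. u \<in> D \<Longrightarrow> v \<in> D \<Longrightarrow> w \<in> D \<Longrightarrow> q (u + v) w = q u w + q v w"
    and scale_left: "\<And>c u w. u \<in> D \<Longrightarrow> w \<in> D \<Longrightarrow> q (c \<odot> u) w = c * q u w"
    and herm: "\<And>u v. u \<in> D \<Longrightarrow> v \<in> D \<Longrightarrow> q v u = cnj (q u v)"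
    and nonneg: "\<And>u. u \<in> D \<Longrightarrow> 0 \<le> Re (q u u)"
begin

lemma D_zero [simp]: "0 \<in> D"
  and D_add [simp]: "u \<in> D \<Longrightarrow> v \<in> D \<Longrightarrow> u + v \<in> D"
  and D_scale [simp]: "u \<in> D \<Longrightarrow> c \<odot> u \<in> D"
  and D_diff [simp]: "u \<in> D \<Longrightarrow> v \<in> D \<Longrightarrow> u - v \<in> D"
  and D_sum: "(\<And>i. i \<in> I \<Longrightarrow> f i \<in> D) \<Longrightarrow> sum f I \<in> D"
  using subspace_D subspace_0 subspace_add subspace_scale subspace_diff subspace_sum by blast+

lemma add_right: "u \<in> D \<Longrightarrow> v \<in> D \<Longrightarrow> w \<in> D \<Longrightarrow> q w (u + v) = q w u + q w v"
  by (metis D_add add_left complex_cnj_add herm)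

lemma scale_right: "u \<in> D \<Longrightarrow> w \<in> D \<Longrightarrow> q w (c \<odot> u) = cnj c * q w u"
  by (metis D_scale scale_left complex_cnj_mult herm)

lemma diff_left: "u \<in> D \<Longrightarrow> v \<in> D \<Longrightarrow> w \<in> D \<Longrightarrow> q (u - v) w = q u w - q v w"
  by (metis D_diff add_left diff_add_cancel add_diff_cancel_right')

lemma diff_right: "u \<in> D \<Longrightarrow> v \<in> D \<Longrightarrow> w \<in> D \<Longrightarrow> q w (u - v) = q w u - q w v"
  by (metis D_diff add_right diff_add_cancel add_diff_cancel_right')

lemma zero_left [simp]: "w \<in> D \<Longrightarrow> q 0 w = 0"
  using diff_left[of 0 0 w] by simp

lemma zero_right [simp]: "w \<in> D \<Longrightarrow> q w 0 = 0"
  using diff_right[of 0 0 w] by simp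

lemma sum_left:
  "(\<And>i. i \<in> I \<Longrightarrow> f i \<in> D) \<Longrightarrow> w \<in> D \<Longrightarrow> q (sum f I) w = (\<Sum>i\<in>I. q (f i) w)"
  by (induction I rule: infinite_finite_induct) (auto simp: add_left D_sum)

lemma sum_right:
  "(\<And>i. i \<in> I \<Longrightarrow> f i \<in> D) \<Longrightarrow> w \<in> D \<Longrightarrow> q w (sum f I) = (\<Sum>i\<in>I. q w (f i))"
  by (induction I rule: infinite_finite_induct) (auto simp: add_right D_sum)

lemma comb_left:
  assumes "\<And>i. i \<in> I \<Longrightarrow> f i \<in> D" "w \<in> D"
  shows "q (\<Sum>i\<in>I. c i \<odot> f i) w = (\<Sum>i\<in>I. c i * q (f i) w)"
  by (subst sum_left) (use assms in \<open>auto intro!: sum.cong scale_left\<close>)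

lemma comb_right:
  assumes "\<And>i. i \<in> I \<Longrightarrow> f i \<in> D" "w \<in> D"
  shows "q w (\<Sum>i\<in>I. c i \<odot> f i) = (\<Sum>i\<in>I. cnj (c i) * q w (f i))"
  by (subst sum_right) (use assms in \<open>auto intro!: sum.cong scale_right\<close>)

lemma Im_self [simp]: "u \<in> D \<Longrightarrow> Im (q u u) = 0"
  using herm[of u u] by (metis complex_cnj_cancel_iff complex_In_mult_cnj_zero complex_cnj cnj.simps(2) neg_equal_zero)

lemma self_real: "u \<in> D \<Longrightarrow> q u u = of_real (Re (q u u))"
  by (simp add: complex_eq_iff)

lemma Re_add: "u \<in> D \<Longrightarrow> v \<in> D \<Longrightarrow> Re (q (u + v) (u + v)) = Re (q u u) + 2 * Re (q u v) + Re (q v v)"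
  using herm[of u v] by (simp add: add_left add_right)

lemma Re_diff: "u \<in> D \<Longrightarrow> v \<in> D \<Longrightarrow> Re (q (u - v) (u - v)) = Re (q u u) - 2 * Re (q u v) + Re (q v v)"
  using herm[of u v] by (simp add: diff_left diff_right)

lemma Re_scale: "u \<in> D \<Longrightarrow> Re (q (c \<odot> u) (c \<odot> u)) = (norm c)\<^sup>2 * Re (q u u)"
  unfolding cmod_power2 by (simp add: scale_left scale_right power2_eq_square algebra_simps)

text \<open>
  A minimum of a nonnegative quadratic form: its derivative in every direction vanishes. Applied to
  \<open>a - \<Lambda> b\<close>, this is the Euler--Lagrange equation of the minimisation below.
\<close>

lemma null_vector_orthogonal:
  assumes "u \<in> D" "v \<in> D" "Re (q u u) = 0"
  shows "q u v = 0"
proof (rule ccontr)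
  assume ne: "q u v \<noteq> 0"
  define s where "s = - (of_real (Re (q v v) + 1) / (norm (q u v))\<^sup>2) * cnj (q u v)"
  have "Re (q (s \<odot> u + v) (s \<odot> u + v)) = 2 * Re (s * q u v) + Re (q v v)"
    using assms Re_scale[of u s] by (simp add: Re_add scale_left del: times_complex.sel)
  also have "s * q u v = of_real (- (Re (q v v) + 1))"
    using ne by (simp add: s_def complex_norm_square mult.commute field_simps del: of_real_power)
  also have "2 * Re (complex_of_real (- (Re (q v v) + 1))) + Re (q v v) < 0"
    using nonneg[OF assms(2)] by simp
  finally show False using nonneg[of "s \<odot> u + v"] assms by simp
qed

lemma Cauchy_Schwarz_Re:
  assumes "u \<in> D" "v \<in> D"
  shows "\<bar>Re (q u v)\<bar> \<le> sqrt (Re (q u u)) * sqrt (Re (q v v))"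
proof -
  have *: "2 * Re (q u v) * r \<le> Re (q u u) + r\<^sup>2 * Re (q v v)" for r :: real
    using nonneg[of "u - of_real r \<odot> v"] Re_scale[of v "of_real r"] assms
    by (simp add: Re_diff scale_right mult_ac del: of_real_power)
  define A B C where "A = Re (q u u)" and "B = Re (q u v)" and "C = Re (q v v)"
  have AC: "A \<ge> 0" "C \<ge> 0" using assms nonneg by (auto simp: A_def C_def)
  have *: "2 * B * r \<le> A + r\<^sup>2 * C" for r using * by (simp add: A_def B_def C_def)
  have "B\<^sup>2 \<le> A * C"
  proof (cases "C = 0")
    case True
    show ?thesis
    proof (rule ccontr)
      assume "\<not> ?thesis"
      then have "B \<noteq> 0" using True by auto
      then show False using *[of "(A + 1) / (2 * B)"] True by simp
    qed
  next
    case False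
    then show ?thesis using *[of "B / C"] AC by (simp add: field_simps power2_eq_square)
  qed
  then have "sqrt (B\<^sup>2) \<le> sqrt (A * C)" by (rule real_sqrt_le_mono)
  then show ?thesis by (simp add: real_sqrt_mult A_def B_def C_def)
qed

lemma norm_triangle:
  assumes "u \<in> D" "v \<in> D"
  shows "sqrt (Re (q (u + v) (u + v))) \<le> sqrt (Re (q u u)) + sqrt (Re (q v v))"
proof (rule real_le_lsqrt)
  show "Re (q (u + v) (u + v)) \<le> (sqrt (Re (q u u)) + sqrt (Re (q v v)))\<^sup>2"
    using Cauchy_Schwarz_Re[OF assms] nonneg[OF assms(1)] nonneg[OF assms(2)] assms
    by (simp add: Re_add power2_sum)
qed (use assms nonneg in \<open>auto intro!: add_nonneg_nonneg\<close>)

lemma norm_diff_triangle: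
  assumes "u \<in> D" "v \<in> D"
  shows "\<bar>sqrt (Re (q u u)) - sqrt (Re (q v v))\<bar> \<le> sqrt (Re (q (u - v) (u - v)))"
proof -
  have "sqrt (Re (q u u)) \<le> sqrt (Re (q (u - v) (u - v))) + sqrt (Re (q v v))"
    using norm_triangle[of "u - v" v] assms by simp
  moreover have "sqrt (Re (q v v)) \<le> sqrt (Re (q (u - v) (u - v))) + sqrt (Re (q u u))"
    using norm_triangle[of "v - u" u] assms herm[of u v] by (simp add: Re_diff algebra_simps)
  ultimately show ?thesis by linarith
qed

lemma tendsto_self:
  assumes "\<And>n. u n \<in> D" "w \<in> D" "(\<lambda>n. Re (q (u n - w) (u n - w))) \<longlonglongrightarrow> 0"
  shows "(\<lambda>n. Re (q (u n) (u n))) \<longlonglongrightarrow> Re (q w w)"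
proof -
  have "(\<lambda>n. sqrt (Re (q (u n - w) (u n - w)))) \<longlonglongrightarrow> sqrt 0"
    by (intro tendsto_real_sqrt assms)
  then have "(\<lambda>n. sqrt (Re (q (u n) (u n))) - sqrt (Re (q w w))) \<longlonglongrightarrow> 0"
    using norm_diff_triangle assms by (auto intro!: Lim_null_comparison[of _ "\<lambda>n. sqrt (Re (q (u n - w) (u n - w)))"])
  then have "(\<lambda>n. sqrt (Re (q (u n) (u n)))) \<longlonglongrightarrow> sqrt (Re (q w w))"
    by (simp add: LIM_zero_iff)
  then have "(\<lambda>n. (sqrt (Re (q (u n) (u n))))\<^sup>2) \<longlonglongrightarrow> (sqrt (Re (q w w)))\<^sup>2"
    by (rule tendsto_power)
  then show ?thesis using nonneg assms by simp
qed

definition ortho :: "nat \<Rightarrow> (nat \<Rightarrow> 'v) \<Rightarrow> bool" where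
  "ortho n e \<longleftrightarrow> (\<forall>i<n. e i \<in> D) \<and> (\<forall>i<n. \<forall>j<n. q (e i) (e j) = (if i = j then 1 else 0))"

lemma ortho_self_comb:
  assumes "ortho n e"
  shows "q (\<Sum>i<n. c i \<odot> e i) (\<Sum>i<n. d i \<odot> e i) = (\<Sum>i<n. c i * cnj (d i))"
proof -
  have D: "e i \<in> D" if "i < n" for i using assms that by (auto simp: ortho_def)
  have "q (\<Sum>i<n. c i \<odot> e i) (\<Sum>j<n. d j \<odot> e j) = (\<Sum>i<n. q (c i \<odot> e i) (\<Sum>j<n. d j \<odot> e j))"
    using D by (intro sum_left D_sum) auto
  also have "\<dots> = (\<Sum>i<n. \<Sum>j<n. q (c i \<odot> e i) (d j \<odot> e j))"
    using D by (intro sum.cong refl sum_right) auto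
  also have "\<dots> = (\<Sum>i<n. \<Sum>j<n. c i * (cnj (d j) * q (e i) (e j)))"
    using D by (intro sum.cong refl) (simp add: scale_left scale_right)
  also have "\<dots> = (\<Sum>i<n. \<Sum>j<n. if i = j then c i * cnj (d j) else 0)"
    using assms by (intro sum.cong refl) (auto simp: ortho_def)
  also have "\<dots> = (\<Sum>i<n. c i * cnj (d i))"
    by (simp add: sum.delta)
  finally show ?thesis .
qed

lemma normalize:
  assumes "u \<in> D" "Re (q u u) > 0"
  obtains r :: real where "r > 0" "q (of_real r \<odot> u) (of_real r \<odot> u) = 1"
proof
  have e: "q u u = of_real (Re (q u u))" using self_real[OF assms(1)] .
  show "1 / sqrt (Re (q u u)) > 0" using assms by simp
  define t where "t = 1 / sqrt (Re (q u u))"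
  have "q (of_real t \<odot> u) (of_real t \<odot> u) = of_real t * of_real t * q u u"
    using assms by (simp add: scale_left scale_right)
  also have "\<dots> = of_real (t * t * Re (q u u))" by (subst e) simp
  also have "t * t * Re (q u u) = 1" using assms by (simp add: t_def field_simps)
  finally show "q (of_real (1 / sqrt (Re (q u u))) \<odot> u) (of_real (1 / sqrt (Re (q u u))) \<odot> u) = 1"
    by (simp add: t_def)
qed

lemma exists_orthogonal_combination:
  fixes m n :: nat
  assumes "\<And>i. i < n \<Longrightarrow> v i \<in> D" "\<And>i. i < m \<Longrightarrow> e i \<in> D" "m < n"
  obtains c where "\<exists>i<n. c i \<noteq> 0" "\<forall>i<m. q (\<Sum>j<n. c j \<odot> v j) (e i) = 0"
proof -
  obtain c where c: "\<exists>j\<in>{..<n}. c j \<noteq> 0" "\<forall>i<m. (\<Sum>j<n. q (v j) (e i) * c j) = 0"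
    using underdetermined_system[of "{..<n}" m "\<lambda>i (j::nat). q (v j) (e i)"] assms(3) by auto
  have "q (\<Sum>j<n. c j \<odot> v j) (e i) = 0" if "i < m" for i
    using c(2) that assms by (subst comb_left) (auto simp: mult.commute)
  with c(1) that show thesis by blast
qed

lemma extend_ortho:
  assumes e: "ortho m e" and u: "u \<in> D" "q u u = 1" "\<And>i. i < m \<Longrightarrow> q u (e i) = 0"
  shows "ortho (Suc m) (e(m := u))"
proof -
  have "q (e i) u = 0" if "i < m" for i using u(3)[OF that] e that u(1) herm[of u "e i"]
    by (auto simp: ortho_def)
  then show ?thesis using e u unfolding ortho_def by (auto simp: less_Suc_eq)
qed

text \<open>
  A Gram--Schmidt process which picks, in every step, a combination of the given vectors that is
  orthogonal to the vectors found so far; a count of equations and unknowns provides it.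
\<close>

lemma orthonormalize:
  assumes W: "subspace W" "W \<subseteq> D" and v: "\<And>i. i < n \<Longrightarrow> v i \<in> W"
    and ind: "\<And>c. \<exists>i<n. c i \<noteq> 0 \<Longrightarrow> Re (q (\<Sum>i<n. c i \<odot> v i) (\<Sum>i<n. c i \<odot> v i)) > 0"
    and "m \<le> n"
  shows "\<exists>e. ortho m e \<and> (\<forall>i<m. e i \<in> W)"
  using \<open>m \<le> n\<close>
proof (induction m)
  case 0
  then show ?case by (auto simp: ortho_def)
next
  case (Suc m)
  then obtain e where e: "ortho m e" "\<forall>i<m. e i \<in> W" by auto
  obtain c where c: "\<exists>i<n. c i \<noteq> 0" "\<forall>i<m. q (\<Sum>j<n. c j \<odot> v j) (e i) = 0"
    by (rule exists_orthogonal_combination[of n v m e]) (use Suc.prems v e W in auto)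
  define u where "u = (\<Sum>j<n. c j \<odot> v j)"
  have uW: "u \<in> W" unfolding u_def using W v by (intro subspace_sum subspace_scale) auto
  obtain r where r: "q (of_real r \<odot> u) (of_real r \<odot> u) = 1"
    using normalize[of u] uW W ind[OF c(1)] by (auto simp: u_def)
  have "ortho (Suc m) (e(m := of_real r \<odot> u))"
    using e r uW W c(2) u_def[symmetric] by (intro extend_ortho) (auto simp: scale_left subset_iff ortho_def)
  moreover have "\<forall>i<Suc m. (e(m := of_real r \<odot> u)) i \<in> W"
    using e uW W by (auto simp: less_Suc_eq subspace_scale)
  ultimately show ?case by blast
qed

end

text \<open>
  Bolzano--Weierstrass for finitely many sequences at once. It replaces the compactness of embeddings.
\<close>

lemma simultaneous_convergent_subsequence:
  fixes X :: "nat \<Rightarrow> nat \<Rightarrow> complex"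
  assumes "\<And>i. i < M \<Longrightarrow> Bseq (X i)"
  shows "\<exists>r. strict_mono r \<and> (\<forall>i<M. Cauchy (X i \<circ> r))"
  using assms
proof (induction M)
  case 0
  then show ?case by (intro exI[of _ id]) (auto simp: strict_mono_def)
next
  case (Suc M)
  then obtain r where r: "strict_mono r" "\<forall>i<M. Cauchy (X i \<circ> r)" by (metis less_SucI)
  have "bounded (range (X M \<circ> r))"
    using Suc.prems[of M] by (auto simp: Bseq_def bounded_iff)
  then obtain l s where s: "strict_mono s" "(X M \<circ> r \<circ> s) \<longlonglongrightarrow> l"
    using bounded_imp_convergent_subsequence by blast
  have "Cauchy (X i \<circ> (r \<circ> s))" if "i < Suc M" for i
  proof (cases "i = M")
    case True
    then show ?thesis using s(2) by (metis LIMSEQ_imp_Cauchy comp_assoc)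
  next
    case False
    then have "Cauchy (X i \<circ> r)" using r that by auto
    then show ?thesis using s(1) by (metis Cauchy_subseq_Cauchy comp_assoc)
  qed
  then show ?case using r(1) s(1) strict_mono_o by blast
qed

text \<open>
  The form \<open>b\<close> is the inner product of the Hilbert space, \<open>a\<close> is a closed nonnegative form, and \<open>\<kappa>\<close> is a
  lower bound for the essential spectrum. The latter is expressed by \<open>finite_defect\<close>: for \<open>c < \<kappa>\<close> the
  form \<open>a - c b\<close> is nonnegative on the common kernel of finitely many bounded functionals, in the
  quantitative version with a penalty.
\<close>

locale form_pair =
  b: semi_inner scale D b + a: semi_inner scale D a
  for scale :: "complex \<Rightarrow> 'v::ab_group_add \<Rightarrow> 'v" (infixr "\<odot>" 75) and D b a +
  fixes \<kappa> :: real
  assumes complete: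
    "\<And>u. (\<And>n. u n \<in> D) \<Longrightarrow>
       (\<And>\<epsilon>. \<epsilon> > 0 \<Longrightarrow> \<exists>N. \<forall>m\<ge>N. \<forall>n\<ge>N. Re (b (u m - u n) (u m - u n)) + Re (a (u m - u n) (u m - u n)) < \<epsilon>) \<Longrightarrow>
       \<exists>w\<in>D. (\<lambda>n. Re (b (u n - w) (u n - w))) \<longlonglongrightarrow> 0 \<and> (\<lambda>n. Re (a (u n - w) (u n - w))) \<longlonglongrightarrow> 0"
    and finite_defect:
    "\<And>c. c < \<kappa> \<Longrightarrow> \<exists>(M::nat) C l. C \<ge> 0 \<and>
       (\<forall>i<M. \<forall>u\<in>D. \<forall>v\<in>D. l i (u + v) = l i u + (l i v :: complex)) \<and>
       (\<forall>i<M. \<forall>u\<in>D. \<forall>r. l i (r \<odot> u) = r * l i u) \<and>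
       (\<forall>i<M. \<forall>u\<in>D. (norm (l i u))\<^sup>2 \<le> C * Re (b u u)) \<and>
       (\<forall>u\<in>D. c * Re (b u u) \<le> Re (a u u) + C * (\<Sum>i<M. (norm (l i u))\<^sup>2))"
begin

definition eig :: "real \<Rightarrow> 'v set" where
  "eig \<mu> = {u \<in> D. \<forall>v\<in>D. a u v = of_real \<mu> * b u v}"

text \<open>
  Eigenvalues in \<open>S\<close> counted with multiplicity are orthonormal families of eigenvectors; the values
  \<open>\<mu> i\<close> may repeat.
\<close>

definition eigfamily :: "real set \<Rightarrow> nat \<Rightarrow> (nat \<Rightarrow> 'v) \<Rightarrow> (nat \<Rightarrow> real) \<Rightarrow> bool" where
  "eigfamily S k e \<mu> \<longleftrightarrow> b.ortho k e \<and> (\<forall>i<k. e i \<in> eig (\<mu> i) \<and> \<mu> i \<in> S)"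

lemma eig_subset: "eig \<mu> \<subseteq> D" by (auto simp: eig_def)

lemma subspace_eig: "b.subspace (eig \<mu>)"
  unfolding b.subspace_def eig_def
  by (auto simp: a.add_left b.add_left a.scale_left b.scale_left algebra_simps)

lemma eigvectors_orthogonal:
  assumes "u \<in> eig \<mu>" "v \<in> eig \<nu>" "\<mu> \<noteq> \<nu>"
  shows "b u v = 0"
proof -
  have D: "u \<in> D" "v \<in> D" using assms by (auto simp: eig_def)
  have "of_real \<mu> * b u v = a u v" using assms D by (simp add: eig_def)
  also have "\<dots> = cnj (a v u)" by (rule a.herm[OF D(2) D(1)])
  also have "\<dots> = cnj (of_real \<nu> * b v u)" using assms D by (simp add: eig_def)
  also have "\<dots> = of_real \<nu> * b u v" using b.herm[OF D(2) D(1)] by simp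
  finally show ?thesis using assms(3) by simp
qed

lemma eigfamily_form:
  assumes "eigfamily S k e \<mu>"
  defines "w \<equiv> \<lambda>c. \<Sum>i<k. c i \<odot> e i"
  shows "w c \<in> D" "Re (b (w c) (w c)) = (\<Sum>i<k. (norm (c i))\<^sup>2)"
    "Re (a (w c) (w c)) = (\<Sum>i<k. \<mu> i * (norm (c i))\<^sup>2)"
proof -
  have e: "b.ortho k e" and ev: "\<And>i. i < k \<Longrightarrow> e i \<in> eig (\<mu> i)" using assms by (auto simp: eigfamily_def)
  have D: "e i \<in> D" if "i < k" for i using ev that by (auto simp: eig_def)
  show wD: "w c \<in> D" unfolding w_def using D by (intro b.D_sum) auto
  show "Re (b (w c) (w c)) = (\<Sum>i<k. (norm (c i))\<^sup>2)"
    unfolding w_def b.ortho_self_comb[OF e] by (simp add: complex_norm_square[symmetric] del: of_real_power flip: of_real_power)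
  have "a (w c) (w c) = (\<Sum>i<k. c i * a (e i) (w c))"
    using wD D unfolding w_def by (subst a.comb_left) auto
  also have "(\<Sum>i<k. c i * a (e i) (w c)) = (\<Sum>i<k. b ((c i * of_real (\<mu> i)) \<odot> e i) (w c))"
    using ev wD D by (intro sum.cong refl) (auto simp: eig_def b.scale_left)
  also have "\<dots> = b (\<Sum>i<k. (c i * of_real (\<mu> i)) \<odot> e i) (w c)"
    using D wD by (subst b.sum_left) auto
  also have "\<dots> = (\<Sum>i<k. c i * of_real (\<mu> i) * cnj (c i))"
    unfolding w_def by (rule b.ortho_self_comb[OF e])
  also have "\<dots> = of_real (\<Sum>i<k. \<mu> i * (norm (c i))\<^sup>2)"
    unfolding of_real_sum of_real_mult complex_norm_square by (intro sum.cong) auto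
  finally show "Re (a (w c) (w c)) = (\<Sum>i<k. \<mu> i * (norm (c i))\<^sup>2)" by simp
qed

lemma sum_norm_pos:
  fixes c :: "nat \<Rightarrow> complex"
  assumes "\<exists>i<k. c i \<noteq> 0" shows "(\<Sum>i<k. (norm (c i))\<^sup>2) > 0"
proof -
  obtain i where "i < k" "c i \<noteq> 0" using assms by auto
  then show ?thesis by (intro sum_pos2[of _ i]) auto
qed

text \<open>
  More than \<open>M\<close> eigenvectors admit a nonzero combination that is annihilated by all \<open>M\<close> functionals. On
  it \<open>a\<close> is at least \<open>c b\<close>, whereas the eigenvalue equations give at most \<open>\<nu> b\<close> with \<open>\<nu> < c\<close>.
\<close>

lemma eigfamily_card_bounded:
  assumes "\<nu> < \<kappa>"
  shows "\<exists>M. \<forall>k e \<mu>. eigfamily {..\<nu>} k e \<mu> \<longrightarrow> k \<le> M"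
proof -
  define c where "c = (\<nu> + \<kappa>) / 2"
  have c: "\<nu> < c" "c < \<kappa>" using assms by (auto simp: c_def)
  obtain M :: nat and C :: real and l where l: "\<forall>i<M. \<forall>u\<in>D. \<forall>v\<in>D. l i (u + v) = l i u + (l i v :: complex)"
       "\<forall>i<M. \<forall>u\<in>D. \<forall>r. l i (r \<odot> u) = r * l i u"
       "\<forall>u\<in>D. c * Re (b u u) \<le> Re (a u u) + C * (\<Sum>i<M. (norm (l i u))\<^sup>2)"
    using finite_defect[OF c(2)] by blast
  have "k \<le> M" if fam: "eigfamily {..\<nu>} k e \<mu>" for k e \<mu>
  proof (rule ccontr)
    assume "\<not> k \<le> M"
    then obtain r where r: "\<exists>j\<in>{..<k}. r j \<noteq> 0" "\<forall>i<M. (\<Sum>j<k. l i (e j) * r j) = 0"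
      using underdetermined_system[of "{..<k}" M "\<lambda>i j. l i (e j)"] by auto
    define w where "w = (\<Sum>i<k. r i \<odot> e i)"
    have D: "e i \<in> D" if "i < k" for i using fam that by (auto simp: eigfamily_def eig_def)
    note f = eigfamily_form[OF fam, of r, folded w_def]
    have l0: "l i 0 = 0" if "i < M" for i using l(2)[rule_format, OF that b.D_zero, of 0] by simp
    have lsum: "l i (\<Sum>j\<in>J. r j \<odot> e j) = (\<Sum>j\<in>J. l i (e j) * r j)" if "i < M" "finite J" "J \<subseteq> {..<k}" for i J
      using that(2,3)
    proof (induction J)
      case (insert x F)
      moreover have "(\<Sum>j\<in>F. r j \<odot> e j) \<in> D" "e x \<in> D" using insert D by (auto intro!: b.D_sum)
      ultimately show ?case using that(1) l(1,2) by (simp add: mult.commute)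
    qed (simp add: l0 that)
    have "l i w = 0" if "i < M" for i using r(2) lsum[OF that, of "{..<k}"] that by (simp add: w_def)
    then have "c * Re (b w w) \<le> Re (a w w)" using l(3) f(1) by fastforce
    also have "\<dots> \<le> \<nu> * Re (b w w)"
      unfolding f(2,3) sum_distrib_left using fam
      by (intro sum_mono mult_right_mono) (auto simp: eigfamily_def)
    finally have "Re (b w w) \<le> 0" using c(1) by (simp add: mult_le_cancel_right)
    then show False using sum_norm_pos[of k r] r(1) f(2) by auto
  qed
  then show ?thesis by blast
qed

text \<open>
  A minimising sequence for \<open>a\<close> on the unit sphere of the orthogonal complement of \<open>e\<close> is, after
  passing to a subsequence, Cauchy with respect to both forms. By the parallelogram identity,
  \<open>a - \<Lambda> b\<close> is small on the differences. Along the subsequence the functionals in \<open>finite_defect\<close>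
  converge, so \<open>a - c b\<close> is almost nonnegative there. As \<open>\<Lambda> < c\<close>, both facts together bound \<open>b\<close> of the
  differences, hence also \<open>a\<close>.
\<close>

lemma minimizer_exists:
  assumes e: "b.ortho m e" and v: "v \<in> D" "\<And>i. i < m \<Longrightarrow> b v (e i) = 0"
    and "Re (a v v) < \<mu> * Re (b v v)" "\<mu> \<le> \<kappa>"
  shows "\<exists>u \<Lambda>. \<Lambda> < \<mu> \<and> u \<in> D \<and> b u u = 1 \<and> (\<forall>i<m. b u (e i) = 0) \<and> Re (a u u) = \<Lambda> \<and>
           (\<forall>w\<in>D. (\<forall>i<m. b w (e i) = 0) \<longrightarrow> \<Lambda> * Re (b w w) \<le> Re (a w w))"
proof -
  define W where "W = {w \<in> D. \<forall>i<m. b w (e i) = 0}"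
  have eD: "e i \<in> D" if "i < m" for i using e that by (auto simp: b.ortho_def)
  have WD: "W \<subseteq> D" by (auto simp: W_def)
  have Wsub: "b.subspace W"
    unfolding b.subspace_def W_def using eD by (auto simp: b.add_left b.scale_left)
  define Q where "Q = {Re (a w w) | w. w \<in> W \<and> Re (b w w) = 1}"
  define \<Lambda> where "\<Lambda> = Inf Q"
  have Qbd: "bdd_below Q" unfolding Q_def using WD a.nonneg by (intro bdd_belowI[of _ 0]) auto
  have bv: "Re (b v v) > 0"
  proof (rule ccontr)
    assume "\<not> ?thesis"
    then have "Re (b v v) = 0" using b.nonneg[OF v(1)] by simp
    then show False using assms(4) a.nonneg[OF v(1)] by simp
  qed
  then obtain r where r: "r > 0" "b (of_real r \<odot> v) (of_real r \<odot> v) = 1" using b.normalize v(1) by blast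
  have "Re (a (of_real r \<odot> v) (of_real r \<odot> v)) = r\<^sup>2 * Re (a v v)"
    using a.Re_scale[OF v(1), of "of_real r"] by simp
  also have "\<dots> < r\<^sup>2 * (\<mu> * Re (b v v))" using r assms(4) by simp
  also have "\<dots> = \<mu>" using b.Re_scale[OF v(1), of "of_real r"] r by simp
  finally have rv: "Re (a (of_real r \<odot> v) (of_real r \<odot> v)) < \<mu>" .
  have rvQ: "Re (a (of_real r \<odot> v) (of_real r \<odot> v)) \<in> Q"
    unfolding Q_def using v r eD by (auto simp: W_def b.scale_left intro!: exI[of _ "of_real r \<odot> v"])
  have \<Lambda>: "\<Lambda> < \<mu>" using cInf_lower[OF rvQ Qbd] rv by (simp add: \<Lambda>_def)
  have low: "\<Lambda> * Re (b w w) \<le> Re (a w w)" if "w \<in> W" for w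
  proof (cases "Re (b w w) = 0")
    case True then show ?thesis using a.nonneg that WD by auto
  next
    case False
    then have pos: "Re (b w w) > 0" using b.nonneg[of w] that WD by auto
    have wD: "w \<in> D" using that WD by auto
    obtain s where s: "s > 0" "b (of_real s \<odot> w) (of_real s \<odot> w) = 1" using b.normalize wD pos by blast
    have "of_real s \<odot> w \<in> W" using that Wsub by (simp add: b.subspace_scale)
    then have "Re (a (of_real s \<odot> w) (of_real s \<odot> w)) \<in> Q" using s by (auto simp: Q_def)
    then have "\<Lambda> \<le> Re (a (of_real s \<odot> w) (of_real s \<odot> w))" unfolding \<Lambda>_def by (rule cInf_lower[OF _ Qbd])
    also have "\<dots> = s\<^sup>2 * Re (a w w)" using a.Re_scale[OF wD, of "of_real s"] by simp
    finally have "\<Lambda> \<le> s\<^sup>2 * Re (a w w)" .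
    moreover have "s\<^sup>2 * Re (b w w) = 1" using b.Re_scale[OF wD, of "of_real s"] s by simp
    ultimately have "s\<^sup>2 * (\<Lambda> * Re (b w w)) \<le> s\<^sup>2 * Re (a w w)" by (simp add: mult.left_commute)
    then show ?thesis using s by simp
  qed
  \<comment> \<open>a minimising sequence\<close>
  have "\<exists>w\<in>W. Re (b w w) = 1 \<and> Re (a w w) < \<Lambda> + 1 / real (Suc n)" for n
  proof -
    have "\<exists>x\<in>Q. x < \<Lambda> + 1 / real (Suc n)"
      using rvQ by (intro cInf_lessD) (auto simp: \<Lambda>_def)
    then show ?thesis by (auto simp: Q_def)
  qed
  then obtain u where u: "\<And>n. u n \<in> W" "\<And>n. Re (b (u n) (u n)) = 1" "\<And>n. Re (a (u n) (u n)) < \<Lambda> + 1 / real (Suc n)"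
    by metis
  have uD: "u n \<in> D" for n using u WD by auto
  define c where "c = (\<Lambda> + \<kappa>) / 2"
  have c: "\<Lambda> < c" "c < \<kappa>" using \<Lambda> assms(5) by (auto simp: c_def)
  obtain M :: nat and C :: real and l where C: "C \<ge> 0" and l:
       "\<forall>i<M. \<forall>u\<in>D. \<forall>v\<in>D. l i (u + v) = l i u + (l i v :: complex)"
       "\<forall>i<M. \<forall>u\<in>D. \<forall>r. l i (r \<odot> u) = r * l i u"
       "\<forall>i<M. \<forall>u\<in>D. (norm (l i u))\<^sup>2 \<le> C * Re (b u u)"
       "\<forall>u\<in>D. c * Re (b u u) \<le> Re (a u u) + C * (\<Sum>i<M. (norm (l i u))\<^sup>2)"
    using finite_defect[OF c(2)] by blast
  have "Bseq (\<lambda>n. l i (u n))" if "i < M" for i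
  proof (rule BseqI')
    fix n
    have "(norm (l i (u n)))\<^sup>2 \<le> C" using l(3) that uD u(2) by (metis mult.right_neutral)
    then show "norm (l i (u n)) \<le> sqrt C" by (simp add: real_le_rsqrt)
  qed
  then obtain \<rho> where \<rho>: "strict_mono \<rho>" "\<forall>i<M. Cauchy ((\<lambda>n. l i (u n)) \<circ> \<rho>)"
    using simultaneous_convergent_subsequence[of M "\<lambda>i n. l i (u n)"] by blast
  define w where "w = (\<lambda>n. u (\<rho> n))"
  have wW: "w n \<in> W" and wD: "w n \<in> D" and bw: "Re (b (w n) (w n)) = 1" for n
    using u uD by (auto simp: w_def)
  have aw: "Re (a (w n) (w n)) < \<Lambda> + 1 / real (Suc n)" for n
  proof -
    have "n \<le> \<rho> n" using \<rho>(1) by (rule seq_suble)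
    then have "1 / real (Suc (\<rho> n)) \<le> 1 / real (Suc n)" by (simp add: frac_le)
    then show ?thesis using u(3)[of "\<rho> n"] by (simp add: w_def)
  qed
  have ldiff: "l i (x - y) = l i x - l i y" if "i < M" "x \<in> D" "y \<in> D" for i x y
    using l(1)[rule_format, OF that(1), of "x - y" y] that by simp
  \<comment> \<open>nonnegativity of \<open>a - \<Lambda> b\<close> on the sum bounds its value on the difference\<close>
  have qadd: "\<Lambda> * Re (b (x + y) (x + y)) \<le> Re (a (x + y) (x + y))" if "x \<in> W" "y \<in> W" for x y
    using low Wsub that b.subspace_add by blast
  have qd: "Re (a (w p - w n) (w p - w n)) - \<Lambda> * Re (b (w p - w n) (w p - w n)) \<le> 2 / real (Suc p) + 2 / real (Suc n)" for p n
  proof -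
    have "Re (a (w p + w n) (w p + w n)) - \<Lambda> * Re (b (w p + w n) (w p + w n)) \<ge> 0" using qadd wW by simp
    then have "Re (a (w p - w n) (w p - w n)) - \<Lambda> * Re (b (w p - w n) (w p - w n))
        \<le> 2 * (Re (a (w p) (w p)) - \<Lambda>) + 2 * (Re (a (w n) (w n)) - \<Lambda>)"
      unfolding a.Re_add[OF wD wD] a.Re_diff[OF wD wD] b.Re_add[OF wD wD] b.Re_diff[OF wD wD] bw
      by (simp add: algebra_simps)
    also have "\<dots> \<le> 2 / real (Suc p) + 2 / real (Suc n)" using aw[of p] aw[of n] by simp
    finally show ?thesis .
  qed
  \<comment> \<open>chosen such that \<open>Re (b d d) \<le> 5 * \<delta> / (c - \<Lambda>)\<close> and \<open>Re (a d d) \<le> 4 * \<delta> + \<bar>\<Lambda>\<bar> * Re (b d d)\<close>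
    together give at most \<open>5 * \<delta> * K\<close>\<close>
  define K where "K = 1 + (\<bar>\<Lambda>\<bar> + 1) / (c - \<Lambda>)"
  have "\<exists>N. \<forall>p\<ge>N. \<forall>n\<ge>N. Re (b (w p - w n) (w p - w n)) + Re (a (w p - w n) (w p - w n)) < \<epsilon>" if "\<epsilon> > 0" for \<epsilon>
  proof -
    have Kpos: "K > 0" using c by (simp add: K_def add_pos_nonneg)
    define \<delta> where "\<delta> = \<epsilon> / K / 8"
    have \<delta>: "\<delta> > 0" using that Kpos by (simp add: \<delta>_def)
    define \<eta> where "\<eta> = sqrt (\<delta> / ((C + 1) * (real M + 1)))"
    have \<eta>: "\<eta> > 0" using \<delta> C by (simp add: \<eta>_def)
    have "\<exists>N. \<forall>i<M. \<forall>p\<ge>N. \<forall>n\<ge>N. norm (l i (w p) - l i (w n)) < \<eta>"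
    proof -
      have "\<exists>N. \<forall>p\<ge>N. \<forall>n\<ge>N. norm (l i (w p) - l i (w n)) < \<eta>" if "i < M" for i
        using \<rho>(2) that \<eta> unfolding Cauchy_iff w_def comp_def by blast
      then obtain N where N: "\<And>i. i < M \<Longrightarrow> \<forall>p\<ge>N i. \<forall>n\<ge>N i. norm (l i (w p) - l i (w n)) < \<eta>" by metis
      have NM: "N i \<le> Max (N ` {..<M})" if "i < M" for i using that by (intro Max_ge) auto
      show ?thesis
        by (rule exI[of _ "Max (N ` {..<M})"]) (use N NM in \<open>meson le_trans\<close>)
    qed
    then obtain N1 where N1: "\<And>i p n. i < M \<Longrightarrow> p \<ge> N1 \<Longrightarrow> n \<ge> N1 \<Longrightarrow> norm (l i (w p) - l i (w n)) < \<eta>" by blast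
    obtain N2 :: nat where N2: "1 / real (Suc N2) < \<delta>" using \<delta> by (metis nat_approx_posE)
    have "Re (b (w p - w n) (w p - w n)) + Re (a (w p - w n) (w p - w n)) < \<epsilon>" if pn: "p \<ge> max N1 N2" "n \<ge> max N1 N2" for p n
    proof -
      define d where "d = w p - w n"
      have dD: "d \<in> D" using wD by (simp add: d_def)
      have "1 / real (Suc p) \<le> 1 / real (Suc N2)" "1 / real (Suc n) \<le> 1 / real (Suc N2)"
        using pn by (auto intro!: frac_le)
      then have q: "Re (a d d) - \<Lambda> * Re (b d d) \<le> 4 * \<delta>" using qd[of p n] N2 by (simp add: d_def)
      have "C * (\<Sum>i<M. (norm (l i d))\<^sup>2) \<le> (C + 1) * (\<Sum>i<M. \<eta>\<^sup>2)"
        using C N1 pn wD \<eta> unfolding d_def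
        by (intro mult_mono sum_mono power_mono) (auto simp: ldiff sum_nonneg less_imp_le)
      also have "\<dots> = (C + 1) * real M * (\<delta> / ((C + 1) * (real M + 1)))"
        using C \<delta> by (simp add: \<eta>_def)
      also have "\<dots> = \<delta> * (real M / (real M + 1))" using C by simp
      also have "\<dots> \<le> \<delta>" using \<delta> by (intro mult_left_le) auto
      finally have "c * Re (b d d) \<le> Re (a d d) + \<delta>" using l(4) dD by fastforce
      then have *: "(c - \<Lambda>) * Re (b d d) \<le> 5 * \<delta>" using q by (simp add: algebra_simps)
      have b: "Re (b d d) \<le> 5 * \<delta> / (c - \<Lambda>)" using * c by (simp add: field_simps)
      have "Re (a d d) \<le> 4 * \<delta> + \<bar>\<Lambda>\<bar> * Re (b d d)"
        using q abs_ge_self[of \<Lambda>] b.nonneg[OF dD] mult_right_mono[of \<Lambda> "\<bar>\<Lambda>\<bar>" "Re (b d d)"] by linarith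
      then have "Re (b d d) + Re (a d d) \<le> 4 * \<delta> + (\<bar>\<Lambda>\<bar> + 1) * Re (b d d)" by (simp add: algebra_simps)
      also have "\<dots> \<le> 4 * \<delta> + (\<bar>\<Lambda>\<bar> + 1) * (5 * \<delta> / (c - \<Lambda>))" using b by (intro add_left_mono mult_left_mono) auto
      also have "\<dots> \<le> 5 * \<delta> * K" using \<delta> by (simp add: K_def algebra_simps)
      also have "\<dots> < \<epsilon>" using that(1) Kpos \<open>\<epsilon> > 0\<close> by (simp add: \<delta>_def)
      finally show ?thesis by (simp add: d_def)
    qed
    then show ?thesis by blast
  qed
  then obtain z where z: "z \<in> D" "(\<lambda>n. Re (b (w n - z) (w n - z))) \<longlonglongrightarrow> 0" "(\<lambda>n. Re (a (w n - z) (w n - z))) \<longlonglongrightarrow> 0"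
    using complete[of w] wD by blast
  have "(\<lambda>n. Re (b (w n) (w n))) \<longlonglongrightarrow> Re (b z z)" using z wD by (intro b.tendsto_self) auto
  then have bz: "Re (b z z) = 1" using bw LIMSEQ_unique[OF _ tendsto_const] by fastforce
  have az: "(\<lambda>n. Re (a (w n) (w n))) \<longlonglongrightarrow> Re (a z z)" using z wD by (intro a.tendsto_self) auto
  have "(\<lambda>n. \<Lambda> + 1 / real (Suc n)) \<longlonglongrightarrow> \<Lambda> + 0"
    by (intro tendsto_add tendsto_const) (use LIMSEQ_inverse_real_of_nat in \<open>simp add: inverse_eq_divide\<close>)
  then have azl: "Re (a z z) \<le> \<Lambda>"
    using aw by (intro LIMSEQ_le[OF az]) (auto intro: less_imp_le)
  \<comment> \<open>orthogonality to \<open>e i\<close> survives the limit by the Cauchy--Schwarz inequality\<close>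
  have zW: "b z (e i) = 0" if i: "i < m" for i
  proof -
    have "norm (b z (e i)) \<le> sqrt (Re (b (w n - z) (w n - z)))" for n
    proof -
      define s where "s = b z (e i)"
      have bx: "b (w n - z) (e i) = - s" using wW[of n] i z wD eD by (simp add: W_def b.diff_left s_def)
      show ?thesis
      proof (cases "s = 0")
        case True then show ?thesis using b.nonneg[of "w n - z"] wD z by (simp add: s_def)
      next
        case False
        have "\<bar>Re (b (cnj s \<odot> (w n - z)) (e i))\<bar> \<le> sqrt (Re (b (cnj s \<odot> (w n - z)) (cnj s \<odot> (w n - z)))) * sqrt (Re (b (e i) (e i)))"
          using wD z eD[OF i] by (intro b.Cauchy_Schwarz_Re) auto
        also have "Re (b (e i) (e i)) = 1" using e i by (simp add: b.ortho_def)
        also have "b (cnj s \<odot> (w n - z)) (e i) = - of_real ((norm s)\<^sup>2)"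
          using wD z eD[OF i] bx complex_norm_square[of s] by (simp add: b.scale_left mult.commute)
        also have "Re (b (cnj s \<odot> (w n - z)) (cnj s \<odot> (w n - z))) = (norm s)\<^sup>2 * Re (b (w n - z) (w n - z))"
          using wD z by (subst b.Re_scale) auto
        finally have "(norm s)\<^sup>2 \<le> norm s * sqrt (Re (b (w n - z) (w n - z)))" by (simp add: real_sqrt_mult)
        then show ?thesis using False by (simp add: power2_eq_square s_def)
      qed
    qed
    moreover have "(\<lambda>n. sqrt (Re (b (w n - z) (w n - z)))) \<longlonglongrightarrow> sqrt 0" by (intro tendsto_real_sqrt z)
    ultimately have "norm (b z (e i)) \<le> 0" by (intro LIMSEQ_le_const[of _ _ "norm (b z (e i))"]) auto
    then show ?thesis by simp
  qed
  have "z \<in> W" using z zW by (simp add: W_def)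
  then have "Re (a z z) = \<Lambda>" using low[of z] bz azl by simp
  moreover have "b z z = 1" using bz b.self_real[OF z(1)] by simp
  ultimately show ?thesis using \<Lambda> z zW low by (intro exI[of _ z] exI[of _ \<Lambda>]) (auto simp: W_def)
qed

text \<open>
  The minimiser satisfies the eigenvalue equation against the orthogonal complement of the \<open>e i\<close>, and
  against each \<open>e i\<close> because both sides vanish there; these directions span everything.
\<close>

lemma new_eigenvector:
  assumes fam: "eigfamily {..<\<mu>} m e \<nu>" and v: "v \<in> D" "\<And>i. i < m \<Longrightarrow> b v (e i) = 0"
    and "Re (a v v) < \<mu> * Re (b v v)" "\<mu> \<le> \<kappa>"
  shows "\<exists>e \<nu>. eigfamily {..<\<mu>} (Suc m) e \<nu>"
proof -
  have e: "b.ortho m e" using fam by (simp add: eigfamily_def)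
  have eD: "e i \<in> D" if "i < m" for i using e that by (auto simp: b.ortho_def)
  obtain u \<Lambda> where u: "\<Lambda> < \<mu>" "u \<in> D" "b u u = 1" "\<forall>i<m. b u (e i) = 0" "Re (a u u) = \<Lambda>"
    and min: "\<And>w. w \<in> D \<Longrightarrow> \<forall>i<m. b w (e i) = 0 \<Longrightarrow> \<Lambda> * Re (b w w) \<le> Re (a w w)"
    using minimizer_exists[OF e v assms(4,5)] by blast
  define W where "W = {w \<in> D. \<forall>i<m. b w (e i) = 0}"
  have Wsub: "b.subspace W"
    unfolding b.subspace_def W_def using eD by (auto simp: b.add_left b.scale_left)
  interpret q: semi_inner scale W "\<lambda>u v. a u v - of_real \<Lambda> * b u v"
  proof
    show "b.subspace W" by fact
  next
    fix u v assume "u \<in> W" "v \<in> W"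
    then have D: "u \<in> D" "v \<in> D" by (auto simp: W_def)
    show "a v u - of_real \<Lambda> * b v u = cnj (a u v - of_real \<Lambda> * b u v)"
      using a.herm[OF D] b.herm[OF D] by simp
  next
    fix u assume "u \<in> W" then show "0 \<le> Re (a u u - of_real \<Lambda> * b u u)" using min by (simp add: W_def)
  qed (auto simp: W_def a.add_left b.add_left a.scale_left b.scale_left algebra_simps)
  have uW: "u \<in> W" using u by (simp add: W_def)
  \<comment> \<open>Euler--Lagrange equation\<close>
  have onW: "a u w = of_real \<Lambda> * b u w" if "w \<in> W" for w
    using q.null_vector_orthogonal[OF uW that] u by simp
  have one: "a u (e i) = 0" if "i < m" for i
  proof -
    have "a u (e i) = cnj (a (e i) u)" using a.herm u eD that by blast
    also have "a (e i) u = of_real (\<nu> i) * b (e i) u" using fam that u by (simp add: eigfamily_def eig_def)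
    also have "b (e i) u = cnj (b u (e i))" using b.herm u eD that by blast
    finally show ?thesis using u that by simp
  qed
  have "a u x = of_real \<Lambda> * b u x" if x: "x \<in> D" for x
  proof -
    define p where "p = (\<Sum>i<m. b x (e i) \<odot> e i)"
    have pD: "p \<in> D" unfolding p_def using eD by (intro b.D_sum) auto
    have "b p (e j) = b x (e j)" if j: "j < m" for j
    proof -
      have "b p (e j) = (\<Sum>i<m. b x (e i) * b (e i) (e j))"
        unfolding p_def using eD j by (subst b.comb_left) auto
      also have "\<dots> = (\<Sum>i<m. if i = j then b x (e i) else 0)"
        using e j by (intro sum.cong refl) (auto simp: b.ortho_def)
      finally show ?thesis using j by simp
    qed
    then have "x - p \<in> W" using x pD eD by (auto simp: W_def b.diff_left)
    then have "a u (x - p) = of_real \<Lambda> * b u (x - p)" by (rule onW)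
    moreover have "a u p = 0" "b u p = 0"
      unfolding p_def using eD u one
      by (subst a.comb_right b.comb_right; auto intro!: sum.neutral)+
    ultimately show ?thesis using x pD u by (simp add: a.diff_right b.diff_right)
  qed
  then have "u \<in> eig \<Lambda>" using u by (simp add: eig_def)
  then have "eigfamily {..<\<mu>} (Suc m) (e(m := u)) (\<nu>(m := \<Lambda>))"
    using b.extend_ortho[OF e u(2,3)] u fam by (auto simp: eigfamily_def less_Suc_eq)
  then show ?thesis by blast
qed

text \<open>
  The variational principle. As long as fewer than \<open>k\<close> eigenvectors have been found, the trial space
  contains a nonzero vector orthogonal to all of them, so the minimisation on their complement
  produces a further eigenvalue below \<open>\<mu>\<close>.
\<close>

lemma trial_space:
  assumes v: "\<And>i. i < k \<Longrightarrow> v i \<in> D" and "\<mu> \<le> \<kappa>"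
    and "\<And>c. \<exists>i<k. c i \<noteq> 0 \<Longrightarrow>
      Re (a (\<Sum>i<k. c i \<odot> v i) (\<Sum>i<k. c i \<odot> v i)) < \<mu> * Re (b (\<Sum>i<k. c i \<odot> v i) (\<Sum>i<k. c i \<odot> v i))"
  shows "\<exists>e \<nu>. eigfamily {..<\<mu>} k e \<nu>"
proof -
  have "\<exists>e \<nu>. eigfamily {..<\<mu>} m e \<nu>" if "m \<le> k" for m
    using that
  proof (induction m)
    case 0
    then show ?case by (auto simp: eigfamily_def b.ortho_def)
  next
    case (Suc m)
    then obtain e \<nu> where fam: "eigfamily {..<\<mu>} m e \<nu>" by auto
    obtain c where c: "\<exists>i<k. c i \<noteq> 0" "\<forall>i<m. b (\<Sum>j<k. c j \<odot> v j) (e i) = 0"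
      by (rule b.exists_orthogonal_combination[of k v m e])
        (use v Suc.prems fam in \<open>auto simp: eigfamily_def b.ortho_def\<close>)
    show ?case
      by (rule new_eigenvector[OF fam _ _ assms(3)[OF c(1)] assms(2)])
        (use c v in \<open>auto intro!: b.D_sum\<close>)
  qed
  then show ?thesis by simp
qed

text \<open>
  Eigenvectors for different eigenvalues are orthogonal, so infinitely many eigenvalues would
  contradict \<open>eigfamily_card_bounded\<close>.
\<close>

lemma finite_eigenvalues_below:
  assumes "\<nu> < \<kappa>"
  shows "finite {\<mu>. \<mu> \<le> \<nu> \<and> (\<exists>u\<in>eig \<mu>. b u u = 1)}" (is "finite ?E")
proof (rule ccontr)
  assume inf: "infinite ?E"
  obtain M where M: "\<And>k e \<mu>. eigfamily {..\<nu>} k e \<mu> \<Longrightarrow> k \<le> M" using eigfamily_card_bounded[OF assms] by blast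
  obtain F where F: "F \<subseteq> ?E" "finite F" "card F = Suc M" using infinite_arbitrarily_large[OF inf] by blast
  obtain h where h: "bij_betw h {..<Suc M} F" using F ex_bij_betw_nat_finite[of F] by (auto simp: atLeast0LessThan)
  have "\<forall>\<mu>\<in>F. \<exists>u\<in>eig \<mu>. b u u = 1" using F by auto
  then obtain f where f: "\<And>\<mu>. \<mu> \<in> F \<Longrightarrow> f \<mu> \<in> eig \<mu> \<and> b (f \<mu>) (f \<mu>) = 1" by metis
  have hF: "h i \<in> F" if "i < Suc M" for i using h that by (auto simp: bij_betw_def)
  have ne: "h i \<noteq> h j" if "i < Suc M" "j < Suc M" "i \<noteq> j" for i j
    using h that by (auto simp: bij_betw_def inj_on_def)
  have "eigfamily {..\<nu>} (Suc M) (f \<circ> h) h"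
    unfolding eigfamily_def b.ortho_def
  proof (intro conjI allI impI)
    fix i j assume "i < Suc M" "j < Suc M"
    then show "b ((f \<circ> h) i) ((f \<circ> h) j) = (if i = j then 1 else 0)"
      using f hF ne eigvectors_orthogonal[of "f (h i)" "h i" "f (h j)" "h j"] by (cases "i = j") auto
  qed (use f hF F in \<open>auto simp: eig_def\<close>)
  then show False using M by fastforce
qed

text \<open>
  The \<open>j\<close>-th entry of the list is the least eigenvalue \<open>\<mu>\<close> such that there are \<open>j\<close> eigenvalues \<open>\<le> \<mu>\<close>; the
  minimum is attained because eigenvalues below \<open>\<kappa>\<close> do not accumulate below \<open>\<kappa>\<close>.
\<close>

lemma nth_eigenvalue_exists:
  assumes "1 \<le> j" "\<exists>e \<nu>. eigfamily {..<\<kappa>} j e \<nu>"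
  obtains \<mu> where "\<mu> < \<kappa>" "\<exists>e \<nu>. eigfamily {..\<mu>} j e \<nu>" "\<nexists>e \<nu>. eigfamily {..<\<mu>} j e \<nu>"
proof -
  have top: "\<exists>m. m < \<mu> \<and> (\<exists>u\<in>eig m. b u u = 1) \<and> (\<exists>e \<nu>. eigfamily {..m} j e \<nu>)"
    if fam: "eigfamily {..<\<mu>} j e \<nu>" for \<mu> e \<nu>
  proof -
    define m where "m = Max (\<nu> ` {..<j})"
    have "m \<in> \<nu> ` {..<j}" unfolding m_def using assms(1) by (intro Max_in) (auto simp: lessThan_empty_iff)
    then obtain i where i: "i < j" "m = \<nu> i" by auto
    have le: "\<nu> l \<le> m" if "l < j" for l unfolding m_def using that by (intro Max_ge) auto
    have "eigfamily {..m} j e \<nu>" using fam le by (auto simp: eigfamily_def)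
    moreover have "e i \<in> eig m" "b (e i) (e i) = 1" "m < \<mu>" using fam i by (auto simp: eigfamily_def b.ortho_def)
    ultimately show ?thesis by blast
  qed
  obtain m0 where m0: "m0 < \<kappa>" "\<exists>u\<in>eig m0. b u u = 1" "\<exists>e \<nu>. eigfamily {..m0} j e \<nu>" using assms(2) top by blast
  define S where "S = {m. m \<le> m0 \<and> (\<exists>u\<in>eig m. b u u = 1) \<and> (\<exists>e \<nu>. eigfamily {..m} j e \<nu>)}"
  have fin: "finite S" using finite_eigenvalues_below[OF m0(1)] by (rule finite_subset[rotated]) (auto simp: S_def)
  have m0S: "m0 \<in> S" using m0 by (simp add: S_def)
  have MinS: "Min S \<in> S" using fin m0S by (intro Min_in) auto
  show thesis
  proof (rule that[of "Min S"])
    show "Min S < \<kappa>" using Min_le[OF fin m0S] m0(1) by linarith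
    show "\<exists>e \<nu>. eigfamily {..Min S} j e \<nu>" using MinS by (simp add: S_def)
    show "\<nexists>e \<nu>. eigfamily {..<Min S} j e \<nu>"
    proof
      assume "\<exists>e \<nu>. eigfamily {..<Min S} j e \<nu>"
      then obtain m where m: "m < Min S" "\<exists>u\<in>eig m. b u u = 1" "\<exists>e \<nu>. eigfamily {..m} j e \<nu>" using top by blast
      have "m \<in> S" using m MinS by (auto simp: S_def)
      then show False using Min_le[OF fin] m(1) by fastforce
    qed
  qed
qed

end

section \<open>Smooth functions\<close>

lemma k_times_differentiable_SucI:
  assumes "\<And>x. (f has_derivative f' x) (at x)" "\<And>v. k_times_differentiable k (\<lambda>x. f' x v)"
  shows "k_times_differentiable (Suc k) f"
proof -
  have "f' x = frechet_derivative f (at x)" for x using assms(1) by (rule frechet_derivative_at)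
  then have "(\<lambda>x. frechet_derivative f (at x) v) = (\<lambda>x. f' x v)" for v by simp
  then show ?thesis using assms by (auto simp: differentiable_def)
qed

lemma k_times_differentiable_Suc_derivative:
  "k_times_differentiable (Suc k) f \<Longrightarrow> (f has_derivative frechet_derivative f (at x)) (at x)"
  by (simp add: frechet_derivative_works)

lemma k_times_differentiable_lower:
  "k_times_differentiable (Suc k) f \<Longrightarrow> k_times_differentiable k f"
proof (induction k arbitrary: f)
  case (Suc k)
  then show ?case by (auto intro!: Suc.IH)
qed simp

lemma k_times_differentiable_const: "k_times_differentiable k (\<lambda>_. c)"
proof (induction k arbitrary: c)
  case (Suc k)
  show ?case by (rule k_times_differentiable_SucI[of _ "\<lambda>_ _. 0"]) (auto intro: Suc)
qed simp

lemma k_times_differentiable_add: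
  "k_times_differentiable k f \<Longrightarrow> k_times_differentiable k g \<Longrightarrow> k_times_differentiable k (\<lambda>x. f x + g x)"
proof (induction k arbitrary: f g)
  case (Suc k)
  show ?case
    by (rule k_times_differentiable_SucI[OF has_derivative_add[OF k_times_differentiable_Suc_derivative k_times_differentiable_Suc_derivative]])
      (use Suc in auto)
qed simp

lemma k_times_differentiable_mult:
  "k_times_differentiable k f \<Longrightarrow> k_times_differentiable k g \<Longrightarrow> k_times_differentiable k (\<lambda>x. f x * g x)"
proof (induction k arbitrary: f g)
  case (Suc k)
  have "k_times_differentiable k f" "k_times_differentiable k g"
    using Suc.prems k_times_differentiable_lower by blast+
  then show ?case
    by (intro k_times_differentiable_SucI[OF has_derivative_mult[OF k_times_differentiable_Suc_derivative k_times_differentiable_Suc_derivative]])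
      (use Suc in \<open>auto intro!: k_times_differentiable_add\<close>)
qed simp

lemma k_times_differentiable_cmult:
  "k_times_differentiable k f \<Longrightarrow> k_times_differentiable k (\<lambda>x. c * f x)"
  by (rule k_times_differentiable_mult[OF k_times_differentiable_const])

lemma k_times_differentiable_prod:
  "(\<And>i. i \<in> I \<Longrightarrow> k_times_differentiable k (f i)) \<Longrightarrow> k_times_differentiable k (\<lambda>x. \<Prod>i\<in>I. f i x)"
  by (induction I rule: infinite_finite_induct)
    (auto intro: k_times_differentiable_const k_times_differentiable_mult)

text \<open>
  For functions of one real variable the derivative is again such a function. This makes closure
  properties easier to prove than for Frechet derivatives; \<open>k_times_differentiable_of_real_linear\<close>
  transfers them to several variables.
\<close>

fun real_differentiable :: "nat \<Rightarrow> (real \<Rightarrow> real) \<Rightarrow> bool" where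
  "real_differentiable 0 g \<longleftrightarrow> True"
| "real_differentiable (Suc k) g \<longleftrightarrow>
     (\<exists>g'. (\<forall>x. (g has_real_derivative g' x) (at x)) \<and> real_differentiable k g')"

lemma real_differentiable_SucI:
  "(\<And>x. (g has_real_derivative g' x) (at x)) \<Longrightarrow> real_differentiable k g' \<Longrightarrow> real_differentiable (Suc k) g"
  by auto

lemma real_differentiable_lower:
  "real_differentiable (Suc k) g \<Longrightarrow> real_differentiable k g"
proof (induction k arbitrary: g)
  case (Suc k)
  then obtain g' where "\<forall>x. (g has_real_derivative g' x) (at x)" "real_differentiable (Suc k) g'"
    unfolding real_differentiable.simps(2)[of "Suc k" g] by blast
  then show ?case using Suc.IH[of g'] by auto
qed simp

lemma real_differentiable_add:
  "real_differentiable k f \<Longrightarrow> real_differentiable k g \<Longrightarrow> real_differentiable k (\<lambda>x. f x + g x)"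
proof (induction k arbitrary: f g)
  case (Suc k)
  then obtain f' g' where d: "\<And>x. (f has_real_derivative f' x) (at x)" "real_differentiable k f'"
      "\<And>x. (g has_real_derivative g' x) (at x)" "real_differentiable k g'" by auto
  show ?case by (rule real_differentiable_SucI[OF DERIV_add[OF d(1,3)] Suc.IH[OF d(2,4)]])
qed simp

lemma real_differentiable_const: "real_differentiable k (\<lambda>_. c)"
proof (induction k arbitrary: c)
  case (Suc k)
  show ?case by (rule real_differentiable_SucI[OF DERIV_const Suc])
qed simp

lemma real_differentiable_mult:
  "real_differentiable k f \<Longrightarrow> real_differentiable k g \<Longrightarrow> real_differentiable k (\<lambda>x. f x * g x)"
proof (induction k arbitrary: f g)
  case (Suc k)
  then obtain f' g' where d: "\<And>x. (f has_real_derivative f' x) (at x)" "real_differentiable k f'"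
      "\<And>x. (g has_real_derivative g' x) (at x)" "real_differentiable k g'" by auto
  have l: "real_differentiable k f" "real_differentiable k g"
    using Suc.prems real_differentiable_lower by blast+
  have "\<forall>x. ((\<lambda>x. f x * g x) has_real_derivative f' x * g x + g' x * f x) (at x)"
    using d by (auto intro!: DERIV_mult)
  moreover have "real_differentiable k (\<lambda>x. f' x * g x + g' x * f x)"
    by (intro real_differentiable_add Suc.IH d l)
  ultimately show ?case unfolding real_differentiable.simps(2) by (intro exI[of _ "\<lambda>x. f' x * g x + g' x * f x"]) simp
qed simp

lemma real_differentiable_ident: "real_differentiable k (\<lambda>x. x)"
proof (cases k)
  case (Suc n)
  show ?thesis unfolding Suc by (rule real_differentiable_SucI[OF DERIV_ident real_differentiable_const])
qed simp

lemma real_differentiable_affine: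
  "real_differentiable k g \<Longrightarrow> real_differentiable k (\<lambda>x. g (a * x + b))"
proof (induction k arbitrary: g)
  case (Suc k)
  then obtain g' where d: "\<And>x. (g has_real_derivative g' x) (at x)" "real_differentiable k g'" by auto
  have "\<forall>x. ((\<lambda>x. g (a * x + b)) has_real_derivative g' (a * x + b) * a) (at x)"
    by (intro allI DERIV_chain2[OF d(1)]) (auto intro!: derivative_eq_intros)
  moreover have "real_differentiable k (\<lambda>x. g' (a * x + b) * a)"
    by (rule real_differentiable_mult[OF Suc.IH[OF d(2)] real_differentiable_const])
  ultimately show ?case by (intro real_differentiable_SucI) auto
qed simp

lemma k_times_differentiable_of_real_linear:
  assumes L: "bounded_linear L" and "real_differentiable k g"
  shows "k_times_differentiable k (\<lambda>p. of_real (g (L p)))"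
  using assms(2)
proof (induction k arbitrary: g)
  case (Suc k)
  then obtain g' where d: "\<And>x. (g has_real_derivative g' x) (at x)" "real_differentiable k g'" by auto
  show ?case
  proof (rule k_times_differentiable_SucI)
    fix p
    have "((\<lambda>p. g (L p)) has_derivative (\<lambda>v. g' (L p) * L v)) (at p)"
      using has_derivative_compose[OF bounded_linear_imp_has_derivative[OF L], of g "\<lambda>v. g' (L p) * v" p UNIV]
        d(1)[of "L p"] by (simp add: has_field_derivative_def)
    then show "((\<lambda>p. of_real (g (L p)) :: complex) has_derivative (\<lambda>v. of_real (L v) * of_real (g' (L p)))) (at p)"
      by (drule_tac has_derivative_of_real) (simp add: mult.commute)
  next
    fix v show "k_times_differentiable k (\<lambda>x. of_real (L v) * complex_of_real (g' (L x)))"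
      by (intro k_times_differentiable_cmult Suc.IH d)
  qed
qed simp

subsection \<open>A smooth approximation of the absolute value\<close>

lemma real_differentiable_powr:
  assumes "e > 0"
  shows "real_differentiable k (\<lambda>x. (x\<^sup>2 + e) powr r)"
proof (induction k arbitrary: r)
  case (Suc k)
  have pos: "x\<^sup>2 + e > 0" for x :: real using assms by (simp add: add_nonneg_pos)
  have "\<forall>x. ((\<lambda>x. (x\<^sup>2 + e) powr r) has_real_derivative (2 * r * x) * (x\<^sup>2 + e) powr (r - 1)) (at x)"
    using pos by (auto intro!: derivative_eq_intros)
  moreover have "real_differentiable k (\<lambda>x. (2 * r * x) * (x\<^sup>2 + e) powr (r - 1))"
    by (intro real_differentiable_mult Suc.IH real_differentiable_const real_differentiable_ident)
  ultimately show ?case unfolding real_differentiable.simps(2)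
    by (intro exI[of _ "\<lambda>x. (2 * r * x) * (x\<^sup>2 + e) powr (r - 1)"]) simp
qed simp

text \<open>
  The transplantation map has a kink on the axis of symmetry, caused by \<open>\<bar>x\<bar>\<close>. With this replacement it
  becomes smooth.
\<close>

definition smooth_abs :: "real \<Rightarrow> real \<Rightarrow> real" where
  "smooth_abs e x = sqrt (x\<^sup>2 + e)"

lemma real_differentiable_smooth_abs:
  assumes "e > 0"
  shows "real_differentiable k (smooth_abs e)"
proof -
  have "smooth_abs e = (\<lambda>x. (x\<^sup>2 + e) powr (1/2))"
    using assms by (auto simp: smooth_abs_def powr_half_sqrt)
  then show ?thesis using real_differentiable_powr[OF assms] by simp
qed

lemma smooth_abs_deriv:
  assumes "e > 0"
  shows "(smooth_abs e has_real_derivative x / smooth_abs e x) (at x)"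
proof -
  have "x\<^sup>2 + e > 0" using assms by (simp add: add_nonneg_pos)
  then show ?thesis unfolding smooth_abs_def by (auto intro!: derivative_eq_intros simp: field_simps)
qed

subsection \<open>The function exp(-1/x)\<close>

text \<open>
  The powers \<open>(1 / x) ^ n\<close> are included because they occur in the derivatives of \<open>exp (- 1 / x)\<close>: the
  derivative of a member of the family is a combination of members.
\<close>

definition bump_profile :: "nat \<Rightarrow> real \<Rightarrow> real" where
  "bump_profile n x = (if x > 0 then (1 / x) ^ n * exp (- (1 / x)) else 0)"

lemma bump_profile_deriv:
  "(bump_profile n has_real_derivative bump_profile (n + 2) x - real n * bump_profile (n + 1) x) (at x)"
proof -
  consider "x > 0" | "x < 0" | "x = 0" by linarith
  then show ?thesis
  proof cases
    case 1
    have "((\<lambda>x. (1 / x) ^ n * exp (- (1 / x))) has_real_derivative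
        (1 / x) ^ (n + 2) * exp (- (1 / x)) - real n * ((1 / x) ^ (n + 1) * exp (- (1 / x)))) (at x)"
    proof -
      have 2: "((\<lambda>x. 1 / x) has_real_derivative - ((1 / x)\<^sup>2)) (at x)"
        using 1 by (auto intro!: derivative_eq_intros simp: power2_eq_square)
      have 3: "((\<lambda>x. exp (- (1 / x))) has_real_derivative exp (- (1 / x)) * (- (- ((1 / x)\<^sup>2)))) (at x)"
        by (rule DERIV_fun_exp[OF DERIV_minus[OF 2]])
      have 4: "real n * (- (y\<^sup>2) * y ^ (n - Suc 0)) * E + E * (- (- (y\<^sup>2))) * y ^ n
          = y ^ (n + 2) * E - real n * (y ^ (n + 1) * E)" for y E :: real
        by (cases n) (auto simp: algebra_simps power2_eq_square)
      show ?thesis using DERIV_mult[OF DERIV_power[OF 2, of n] 3] unfolding 4 by simp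
    qed
    then have "((\<lambda>x. (1 / x) ^ n * exp (- (1 / x))) has_real_derivative
         bump_profile (n + 2) x - real n * bump_profile (n + 1) x) (at x)"
      using 1 by (simp add: bump_profile_def)
    then show ?thesis
      by (rule DERIV_cong_ev[THEN iffD1, rotated -1])
        (use eventually_nhds_in_open[of "{0<..}" x] 1 in \<open>auto simp: bump_profile_def elim!: eventually_mono\<close>)
  next
    case 2
    have "((\<lambda>x. 0) has_real_derivative bump_profile (n + 2) x - real n * bump_profile (n + 1) x) (at x)"
      using 2 by (simp add: bump_profile_def)
    then show ?thesis
      by (rule DERIV_cong_ev[THEN iffD1, rotated -1])
        (use eventually_nhds_in_open[of "{..<0}" x] 2 in \<open>auto simp: bump_profile_def elim!: eventually_mono\<close>)
  next
    case 3
    have "((\<lambda>y. (1 / y) ^ n * exp (- (1 / y)) / y) \<longlongrightarrow> 0) (at_right (0::real))"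
      by real_asymp
    then have r: "((\<lambda>y. bump_profile n y / y) \<longlongrightarrow> 0) (at_right 0)"
      by (rule Lim_transform_eventually)
        (auto simp: bump_profile_def eventually_at_right_field intro!: exI[of _ 1])
    have l: "((\<lambda>y. bump_profile n y / y) \<longlongrightarrow> 0) (at_left 0)"
      by (rule tendsto_eventually)
        (auto simp: bump_profile_def eventually_at_left_field intro!: exI[of _ "-1"])
    have "((\<lambda>y. bump_profile n y / y) \<longlongrightarrow> 0) (at 0)"
      using r l by (simp add: filterlim_at_split)
    then show ?thesis using 3 by (simp add: DERIV_def bump_profile_def)
  qed
qed

lemma real_differentiable_bump_profile: "real_differentiable k (bump_profile n)"
proof (induction k arbitrary: n)
  case (Suc k)
  have "real_differentiable k (\<lambda>x. bump_profile (n + 2) x + (- real n) * bump_profile (n + 1) x)"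
    by (intro real_differentiable_add real_differentiable_mult real_differentiable_const Suc.IH)
  then show ?case unfolding real_differentiable.simps(2)
    using bump_profile_deriv[of n]
    by (intro exI[of _ "\<lambda>x. bump_profile (n + 2) x - real n * bump_profile (n + 1) x"]) simp
qed simp

lemma bump_profile_bounds: "0 \<le> bump_profile 0 x" "bump_profile 0 x \<le> 1"
  by (auto simp: bump_profile_def)

lemma bump_profile_limit:
  assumes "y > 0"
  shows "(\<lambda>n. bump_profile 0 (real n * y - 1)) \<longlonglongrightarrow> 1"
proof -
  have "(\<lambda>n. exp (- (1 / (real n * y - 1)))) \<longlonglongrightarrow> 1"
    using assms by real_asymp
  moreover have "eventually (\<lambda>n. real n * y - 1 > 0) sequentially"
    using assms by real_asymp
  ultimately show ?thesis
    by (rule Lim_transform_eventually[OF _ eventually_mono]) (auto simp: bump_profile_def)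
qed

subsection \<open>Compactly supported smooth functions\<close>

abbreviation dpartial :: "'a::euclidean_space \<Rightarrow> ('a \<Rightarrow> complex) \<Rightarrow> 'a \<Rightarrow> complex" where
  "dpartial v \<phi> \<equiv> \<lambda>x. frechet_derivative \<phi> (at x) v"

lemma smooth_compact_support_iff:
  "\<phi> \<in> smooth_compact_support \<longleftrightarrow> (\<forall>k. k_times_differentiable k \<phi>) \<and> bounded {x. \<phi> x \<noteq> 0}"
  by (simp add: smooth_compact_support_def)

lemma smooth_has_derivative:
  assumes "\<phi> \<in> smooth_compact_support"
  shows "(\<phi> has_derivative frechet_derivative \<phi> (at x)) (at x)"
proof -
  have "k_times_differentiable (Suc 0) \<phi>" using assms unfolding smooth_compact_support_iff by blast
  then show ?thesis by (rule k_times_differentiable_Suc_derivative)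
qed

lemma smooth_continuous: "\<phi> \<in> smooth_compact_support \<Longrightarrow> continuous_on A \<phi>"
  by (rule has_derivative_continuous_on) (rule has_derivative_at_withinI[OF smooth_has_derivative])

lemma smooth_measurable [measurable_dest]:
  "\<phi> \<in> smooth_compact_support \<Longrightarrow> \<phi> \<in> borel_measurable borel"
  by (rule borel_measurable_continuous_onI[OF smooth_continuous])

lemma dpartial_support:
  assumes "\<phi> \<in> smooth_compact_support" "x \<notin> closure {x. \<phi> x \<noteq> 0}"
  shows "dpartial v \<phi> x = 0"
proof -
  have "eventually (\<lambda>y. y \<in> - closure {x. \<phi> x \<noteq> 0}) (nhds x)"
    using assms(2) by (intro eventually_nhds_in_open) auto
  then have ev: "eventually (\<lambda>y. \<phi> y = 0) (nhds x)"
    by (rule eventually_mono) (use closure_subset[of "{x. \<phi> x \<noteq> 0}"] in auto)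
  have "(\<phi> has_derivative (\<lambda>_. 0)) (at x)"
    by (rule has_derivative_transform_eventually[OF has_derivative_const[of 0]])
      (use ev eventually_nhds_x_imp_x[OF ev] in \<open>auto simp: eventually_at_filter elim!: eventually_mono\<close>)
  from fun_cong[OF frechet_derivative_at[OF this], of v] show ?thesis by simp
qed

lemma dpartial_smooth:
  assumes "\<phi> \<in> smooth_compact_support"
  shows "dpartial v \<phi> \<in> smooth_compact_support"
proof -
  have "k_times_differentiable (Suc k) \<phi>" for k using assms unfolding smooth_compact_support_iff by blast
  then have "k_times_differentiable k (dpartial v \<phi>)" for k by simp
  moreover have "bounded {x. dpartial v \<phi> x \<noteq> 0}"
  proof (rule bounded_subset)
    show "bounded (closure {x. \<phi> x \<noteq> 0})"
      using assms unfolding smooth_compact_support_iff by (intro bounded_closure) blast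
    show "{x. dpartial v \<phi> x \<noteq> 0} \<subseteq> closure {x. \<phi> x \<noteq> 0}"
      using dpartial_support[OF assms] by blast
  qed
  ultimately show ?thesis unfolding smooth_compact_support_iff by blast
qed

lemma smooth_add:
  assumes "\<phi> \<in> smooth_compact_support" "\<psi> \<in> smooth_compact_support"
  shows "(\<lambda>x. \<phi> x + \<psi> x) \<in> smooth_compact_support"
    "dpartial v (\<lambda>x. \<phi> x + \<psi> x) = (\<lambda>x. dpartial v \<phi> x + dpartial v \<psi> x)"
proof -
  have "bounded ({x. \<phi> x \<noteq> 0} \<union> {x. \<psi> x \<noteq> 0})" using assms by (simp add: smooth_compact_support_iff)
  then have "bounded {x. \<phi> x + \<psi> x \<noteq> 0}" by (rule bounded_subset) auto
  then show "(\<lambda>x. \<phi> x + \<psi> x) \<in> smooth_compact_support"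
    using assms by (auto simp: smooth_compact_support_iff intro: k_times_differentiable_add)
  have "frechet_derivative \<phi> (at x) v + frechet_derivative \<psi> (at x) v
      = frechet_derivative (\<lambda>x. \<phi> x + \<psi> x) (at x) v" for x
    using frechet_derivative_at[OF has_derivative_add[OF smooth_has_derivative[OF assms(1), of x] smooth_has_derivative[OF assms(2), of x]]]
    by (rule fun_cong)
  then show "dpartial v (\<lambda>x. \<phi> x + \<psi> x) = (\<lambda>x. dpartial v \<phi> x + dpartial v \<psi> x)" by auto
qed

lemma smooth_mult:
  assumes "\<phi> \<in> smooth_compact_support" "\<psi> \<in> smooth_compact_support"
  shows "(\<lambda>x. \<phi> x * \<psi> x) \<in> smooth_compact_support"
    "dpartial v (\<lambda>x. \<phi> x * \<psi> x) = (\<lambda>x. \<phi> x * dpartial v \<psi> x + dpartial v \<phi> x * \<psi> x)"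
proof -
  have "bounded {x. \<phi> x \<noteq> 0}" using assms by (simp add: smooth_compact_support_iff)
  then have "bounded {x. \<phi> x * \<psi> x \<noteq> 0}" by (rule bounded_subset) auto
  then show "(\<lambda>x. \<phi> x * \<psi> x) \<in> smooth_compact_support"
    using assms by (auto simp: smooth_compact_support_iff intro: k_times_differentiable_mult)
  have "\<phi> x * frechet_derivative \<psi> (at x) v + frechet_derivative \<phi> (at x) v * \<psi> x
      = frechet_derivative (\<lambda>x. \<phi> x * \<psi> x) (at x) v" for x
    using frechet_derivative_at[OF has_derivative_mult[OF smooth_has_derivative[OF assms(1), of x] smooth_has_derivative[OF assms(2), of x]]]
    by (rule fun_cong)
  then show "dpartial v (\<lambda>x. \<phi> x * \<psi> x) = (\<lambda>x. \<phi> x * dpartial v \<psi> x + dpartial v \<phi> x * \<psi> x)" by auto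
qed

lemma smooth_cmult:
  assumes "\<phi> \<in> smooth_compact_support"
  shows "(\<lambda>x. c * \<phi> x) \<in> smooth_compact_support"
    "dpartial v (\<lambda>x. c * \<phi> x) = (\<lambda>x. c * dpartial v \<phi> x)"
proof -
  have "bounded {x. \<phi> x \<noteq> 0}" using assms by (simp add: smooth_compact_support_iff)
  then have "bounded {x. c * \<phi> x \<noteq> 0}" by (rule bounded_subset) auto
  then show "(\<lambda>x. c * \<phi> x) \<in> smooth_compact_support"
    using assms by (auto simp: smooth_compact_support_iff intro: k_times_differentiable_cmult)
  have "c * frechet_derivative \<phi> (at x) v = frechet_derivative (\<lambda>x. c * \<phi> x) (at x) v" for x
    using frechet_derivative_at[OF has_derivative_mult_right[OF smooth_has_derivative[OF assms(1), of x], of c]]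
    by (rule fun_cong)
  then show "dpartial v (\<lambda>x. c * \<phi> x) = (\<lambda>x. c * dpartial v \<phi> x)" by auto
qed

lemma smooth_bounded:
  assumes "\<phi> \<in> smooth_compact_support"
  obtains B where "B \<ge> 0" "\<And>x. norm (\<phi> x) \<le> B"
proof -
  have "compact (\<phi> ` closure {x. \<phi> x \<noteq> 0})"
    using assms by (intro compact_continuous_image smooth_continuous) (auto simp: smooth_compact_support_def)
  then obtain B where B: "\<And>x. x \<in> closure {x. \<phi> x \<noteq> 0} \<Longrightarrow> norm (\<phi> x) \<le> B"
    using compact_imp_bounded bounded_iff by (metis (no_types, lifting) image_eqI)
  have "norm (\<phi> x) \<le> max B 0" for x
    using B[of x] closure_subset[of "{x. \<phi> x \<noteq> 0}"] by (cases "\<phi> x = 0") auto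
  then show thesis using that[of "max B 0"] by auto
qed

lemma smooth_support_ball:
  assumes "\<phi> \<in> smooth_compact_support"
  obtains R where "R > 0" "\<And>x. norm x \<ge> R \<Longrightarrow> \<phi> x = 0"
proof -
  obtain R where R: "\<And>x. \<phi> x \<noteq> 0 \<Longrightarrow> norm x \<le> R"
    using assms by (auto simp: smooth_compact_support_iff bounded_iff)
  show thesis
    by (rule that[of "\<bar>R\<bar> + 1"]) (use R in \<open>force+\<close>)
qed

lemma integrable_bounded_support:
  fixes f :: "'a::euclidean_space \<Rightarrow> 'b::{banach,second_countable_topology}"
  assumes "f \<in> borel_measurable borel" "\<And>x. norm (f x) \<le> B" "\<And>x. norm x \<ge> R \<Longrightarrow> f x = 0"
  shows "integrable lborel f"
proof (rule Bochner_Integration.integrable_bound[where f = "\<lambda>x. B * indicator (cball 0 R) x"])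
  show "integrable lborel (\<lambda>x. B * indicator (cball 0 R) x)"
    using emeasure_lborel_cball_finite[of 0 R] by (intro integrable_mult_right integrable_real_indicator) auto
  have "B \<ge> 0" using assms(2)[of undefined] norm_ge_zero order_trans by blast
  then show "AE x in lborel. norm (f x) \<le> norm (B * indicator (cball 0 R) x)"
    using assms(2,3) by (intro AE_I2) (auto simp: indicator_def dist_norm)
qed (use assms in auto)

lemma smooth_integrable:
  assumes "\<phi> \<in> smooth_compact_support"
  shows "integrable lborel \<phi>"
  using smooth_bounded[OF assms] smooth_support_ball[OF assms] integrable_bounded_support smooth_measurable[OF assms]
  by metis

text \<open>
  A uniform bound for the difference quotients, which justifies the passage to the limit under the
  integral in \<open>integral_dpartial_zero\<close>.
\<close>

lemma smooth_Lipschitz: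
  assumes "\<phi> \<in> smooth_compact_support" "\<And>x. norm (dpartial v \<phi> x) \<le> B"
  shows "norm (\<phi> (x + t *\<^sub>R v) - \<phi> x) \<le> B * \<bar>t\<bar>"
proof -
  have "norm ((\<lambda>s. \<phi> (x + s *\<^sub>R v)) t - (\<lambda>s. \<phi> (x + s *\<^sub>R v)) 0) \<le> B * norm (t - 0)"
  proof (rule differentiable_bound[of UNIV])
    fix s :: real
    have "((\<lambda>s. x + s *\<^sub>R v) has_derivative (\<lambda>h. h *\<^sub>R v)) (at s)"
      by (auto intro!: derivative_eq_intros)
    from has_derivative_compose[OF this smooth_has_derivative[OF assms(1)]]
    have "((\<lambda>s. \<phi> (x + s *\<^sub>R v)) has_derivative (\<lambda>h. frechet_derivative \<phi> (at (x + s *\<^sub>R v)) (h *\<^sub>R v))) (at s)" .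
    moreover have "frechet_derivative \<phi> (at y) (h *\<^sub>R v) = h *\<^sub>R frechet_derivative \<phi> (at y) v" for h y
      using has_derivative_bounded_linear[OF smooth_has_derivative[OF assms(1), of y]] by (intro linear_scale bounded_linear.linear)
    ultimately show "((\<lambda>s. \<phi> (x + s *\<^sub>R v)) has_derivative (\<lambda>h. h *\<^sub>R dpartial v \<phi> (x + s *\<^sub>R v))) (at s)" by simp
    show "onorm (\<lambda>h. h *\<^sub>R dpartial v \<phi> (x + s *\<^sub>R v)) \<le> B"
      using assms(2)[of "x + s *\<^sub>R v"]
      by (intro onorm_le) (auto simp: mult.commute[of B] intro: mult_left_mono)
  qed auto
  then show ?thesis by simp
qed

lemma dpartial_limit:
  assumes "\<phi> \<in> smooth_compact_support"
  shows "(\<lambda>n. (\<phi> (x + (1 / real (Suc n)) *\<^sub>R v) - \<phi> x) * of_nat (Suc n)) \<longlonglongrightarrow> dpartial v \<phi> x"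
proof -
  have "((\<lambda>s. x + s *\<^sub>R v) has_derivative (\<lambda>h. h *\<^sub>R v)) (at 0)"
    by (auto intro!: derivative_eq_intros)
  from has_derivative_compose[OF this smooth_has_derivative[OF assms]]
  have "((\<lambda>s. \<phi> (x + s *\<^sub>R v)) has_derivative (\<lambda>h. frechet_derivative \<phi> (at (x + 0 *\<^sub>R v)) (h *\<^sub>R v))) (at 0)" .
  moreover have "frechet_derivative \<phi> (at y) (h *\<^sub>R v) = h *\<^sub>R frechet_derivative \<phi> (at y) v" for h y
    using has_derivative_bounded_linear[OF smooth_has_derivative[OF assms(1), of y]] by (intro linear_scale bounded_linear.linear)
  ultimately have "((\<lambda>s. \<phi> (x + s *\<^sub>R v)) has_derivative (\<lambda>h. h *\<^sub>R dpartial v \<phi> x)) (at 0)"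
    by simp
  then have "(\<lambda>h. norm (\<phi> (x + h *\<^sub>R v) - \<phi> x - h *\<^sub>R dpartial v \<phi> x) / norm h) \<midarrow>0\<rightarrow> 0"
    by (simp add: has_derivative_at)
  moreover have "filterlim (\<lambda>n. 1 / real (Suc n)) (at 0) sequentially"
    unfolding filterlim_at using LIMSEQ_inverse_real_of_nat by (auto simp: inverse_eq_divide)
  ultimately have lim: "(\<lambda>n. norm (\<phi> (x + (1 / real (Suc n)) *\<^sub>R v) - \<phi> x - (1 / real (Suc n)) *\<^sub>R dpartial v \<phi> x) / norm (1 / real (Suc n))) \<longlonglongrightarrow> 0"
    by (rule filterlim_compose)
  have eq: "norm (\<phi> (x + (1 / real (Suc n)) *\<^sub>R v) - \<phi> x - (1 / real (Suc n)) *\<^sub>R dpartial v \<phi> x) / norm (1 / real (Suc n))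
      = norm ((\<phi> (x + (1 / real (Suc n)) *\<^sub>R v) - \<phi> x) * of_nat (Suc n) - dpartial v \<phi> x)" for n
  proof -
    define A where "A = \<phi> (x + (1 / real (Suc n)) *\<^sub>R v) - \<phi> x"
    have "A * of_nat (Suc n) - dpartial v \<phi> x = of_nat (Suc n) * (A - (1 / real (Suc n)) *\<^sub>R dpartial v \<phi> x)"
      by (simp add: scaleR_conv_of_real field_simps del: of_nat_Suc)
    then have "norm (A * of_nat (Suc n) - dpartial v \<phi> x) = real (Suc n) * norm (A - (1 / real (Suc n)) *\<^sub>R dpartial v \<phi> x)"
      by (simp only: norm_mult norm_of_nat)
    then show ?thesis unfolding A_def[symmetric] by (simp add: mult.commute del: of_nat_Suc)
  qed
  show ?thesis using lim unfolding eq by (simp only: tendsto_norm_zero_iff LIM_zero_iff)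
qed

text \<open>
  The integral of each difference quotient vanishes by translation invariance; the quotients are
  dominated and supported in a fixed ball.
\<close>

lemma integral_dpartial_zero:
  assumes "\<phi> \<in> smooth_compact_support"
  shows "(\<integral>x. dpartial v \<phi> x \<partial>lborel) = 0"
proof -
  define d where "d = (\<lambda>n x. (\<phi> (x + (1 / real (Suc n)) *\<^sub>R v) - \<phi> x) * of_nat (Suc n))"
  note int = smooth_integrable[OF assms]
  note [measurable] = smooth_measurable[OF assms] smooth_measurable[OF dpartial_smooth[OF assms]]
  have sh: "integrable lborel (\<lambda>x. \<phi> (x + c))" "(\<integral>x. \<phi> (x + c) \<partial>lborel) = (\<integral>x. \<phi> x \<partial>lborel)" for c
  proof -
    have "integrable (distr lborel borel ((+) c)) \<phi>" using int by (simp add: lborel_distr_plus)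
    then show "integrable lborel (\<lambda>x. \<phi> (x + c))" by (subst (asm) integrable_distr_eq) (auto simp: add.commute)
    have "(\<integral>x. \<phi> x \<partial>lborel) = (\<integral>x. \<phi> x \<partial>distr lborel borel ((+) c))" by (simp add: lborel_distr_plus)
    also have "\<dots> = (\<integral>x. \<phi> (x + c) \<partial>lborel)" by (subst integral_distr) (auto simp: add.commute)
    finally show "(\<integral>x. \<phi> (x + c) \<partial>lborel) = (\<integral>x. \<phi> x \<partial>lborel)" by simp
  qed
  have zero: "(\<integral>x. d n x \<partial>lborel) = 0" for n
    unfolding d_def using sh int by simp
  obtain B where B: "\<And>x. norm (dpartial v \<phi> x) \<le> B" using smooth_bounded[OF dpartial_smooth[OF assms]] by metis
  obtain R where R: "R > 0" "\<And>x. norm x \<ge> R \<Longrightarrow> \<phi> x = 0" using smooth_support_ball[OF assms] by blast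
  have B0: "B \<ge> 0" using B[of undefined] norm_ge_zero order_trans by blast
  have "(\<lambda>n. \<integral>x. d n x \<partial>lborel) \<longlonglongrightarrow> (\<integral>x. dpartial v \<phi> x \<partial>lborel)"
  proof (rule integral_dominated_convergence[where w = "\<lambda>x. B * indicator (cball 0 (R + norm v)) x"])
    show "integrable lborel (\<lambda>x. B * indicator (cball 0 (R + norm v)) x)"
      using emeasure_lborel_cball_finite[of 0 "R + norm v"] by (intro integrable_mult_right integrable_real_indicator) auto
    show "AE x in lborel. (\<lambda>n. d n x) \<longlonglongrightarrow> dpartial v \<phi> x"
      unfolding d_def using dpartial_limit[OF assms] by simp
    show "AE x in lborel. norm (d n x) \<le> B * indicator (cball 0 (R + norm v)) x" for n
    proof (rule AE_I2)
      fix x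
      have "norm (d n x) = norm (\<phi> (x + (1 / real (Suc n)) *\<^sub>R v) - \<phi> x) * real (Suc n)"
        unfolding d_def by (simp only: norm_mult norm_of_nat)
      also have "\<dots> \<le> B * \<bar>1 / real (Suc n)\<bar> * real (Suc n)"
        by (intro mult_right_mono smooth_Lipschitz[OF assms B]) auto
      finally have 1: "norm (d n x) \<le> B" by simp
      have 2: "d n x = 0" if "norm x > R + norm v"
      proof -
        have "norm ((1 / real (Suc n)) *\<^sub>R v) \<le> norm v" by (simp add: divide_le_eq mult_left_le_one_le algebra_simps)
        then have "norm (x + (1 / real (Suc n)) *\<^sub>R v) \<ge> R"
          using that norm_diff_ineq[of x "(1 / real (Suc n)) *\<^sub>R v"] by linarith
        moreover have "norm x \<ge> R" using that norm_ge_zero[of v] by linarith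
        ultimately show ?thesis using R(2) by (simp add: d_def)
      qed
      show "norm (d n x) \<le> B * indicator (cball 0 (R + norm v)) x"
        using 1 2 B0 by (cases "norm x > R + norm v") (auto simp: indicator_def)
    qed
  qed (auto simp: d_def)
  then show ?thesis using zero LIMSEQ_unique by (simp add: LIMSEQ_const_iff)
qed

lemma integration_by_parts:
  assumes "\<phi> \<in> smooth_compact_support" "\<psi> \<in> smooth_compact_support"
  shows "(\<integral>x. \<phi> x * dpartial v \<psi> x \<partial>lborel) = - (\<integral>x. dpartial v \<phi> x * \<psi> x \<partial>lborel)"
proof -
  have "(\<integral>x. \<phi> x * dpartial v \<psi> x + dpartial v \<phi> x * \<psi> x \<partial>lborel) = 0"
    using integral_dpartial_zero[OF smooth_mult(1)[OF assms], of v] by (simp only: smooth_mult(2)[OF assms])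
  then show ?thesis
    by (subst (asm) Bochner_Integration.integral_add)
      (auto intro!: smooth_integrable smooth_mult dpartial_smooth assms simp: add_eq_0_iff2)
qed

subsection \<open>Test functions separate functions\<close>

text \<open>
  Smooth functions supported in the box which converge to its indicator as \<open>n\<close> grows.
\<close>

definition box_bump :: "'a::euclidean_space \<Rightarrow> 'a \<Rightarrow> nat \<Rightarrow> 'a \<Rightarrow> complex" where
  "box_bump a b n x = (\<Prod>i\<in>Basis. of_real (bump_profile 0 (real n * (x \<bullet> i - a \<bullet> i) - 1)) *
      of_real (bump_profile 0 (real n * (b \<bullet> i - x \<bullet> i) - 1)))"

lemma box_bump_support:
  assumes "box_bump a b n x \<noteq> 0" "i \<in> Basis"
  shows "real n * (x \<bullet> i - a \<bullet> i) > 1" "real n * (b \<bullet> i - x \<bullet> i) > 1"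
  using assms by (auto simp: box_bump_def bump_profile_def split: if_splits)

lemma box_bump_test:
  assumes "box a b \<subseteq> \<Omega>" "n \<ge> 1"
  shows "box_bump a b n \<in> test_functions \<Omega>"
proof -
  have real: "k_times_differentiable k (\<lambda>x::'a. complex_of_real (bump_profile 0 (c * (x \<bullet> i) + d)))" for k i c d
    by (rule k_times_differentiable_of_real_linear[OF bounded_linear_inner_left
          real_differentiable_affine[OF real_differentiable_bump_profile]])
  have 1: "real n * (x \<bullet> i - a \<bullet> i) - 1 = real n * (x \<bullet> i) + (- real n * (a \<bullet> i) - 1)"
    and 2: "real n * (b \<bullet> i - x \<bullet> i) - 1 = (- real n) * (x \<bullet> i) + (real n * (b \<bullet> i) - 1)" for x i :: 'a
    by (auto simp: algebra_simps)
  have "k_times_differentiable k (box_bump a b n)" for k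
    unfolding box_bump_def[abs_def] 1 2
    by (intro k_times_differentiable_prod k_times_differentiable_mult real)
  moreover
  define a' b' where "a' = a + (1 / real n) *\<^sub>R One" and "b' = b - (1 / real n) *\<^sub>R One"
  have n: "1 / real n > 0" using assms(2) by simp
  have a'b': "a' \<bullet> i = a \<bullet> i + 1 / real n" "b' \<bullet> i = b \<bullet> i - 1 / real n" if "i \<in> Basis" for i
    using that by (simp_all add: a'_def b'_def inner_add_left inner_diff_left)
  have sub: "{x. box_bump a b n x \<noteq> 0} \<subseteq> cbox a' b'"
  proof
    fix x assume "x \<in> {x. box_bump a b n x \<noteq> 0}"
    then have *: "real n * (x \<bullet> i - a \<bullet> i) > 1" "real n * (b \<bullet> i - x \<bullet> i) > 1" if "i \<in> Basis" for i
      using box_bump_support[OF _ that] by auto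
    have "x \<bullet> i - a \<bullet> i > 1 / real n" "b \<bullet> i - x \<bullet> i > 1 / real n" if "i \<in> Basis" for i
      using *[OF that] assms(2) by (auto simp: divide_less_eq mult.commute)
    then show "x \<in> cbox a' b'" using a'b' by (force simp: mem_box)
  qed
  have "cbox a' b' \<subseteq> box a b"
  proof
    fix x assume "x \<in> cbox a' b'"
    then have le: "a \<bullet> i + 1 / real n \<le> x \<bullet> i \<and> x \<bullet> i \<le> b \<bullet> i - 1 / real n" if "i \<in> Basis" for i
      using a'b' that by (auto simp: mem_box)
    have "a \<bullet> i < x \<bullet> i \<and> x \<bullet> i < b \<bullet> i" if "i \<in> Basis" for i
      using le[OF that] n by linarith
    then show "x \<in> box a b" by (simp add: mem_box)
  qed
  then have "closure {x. box_bump a b n x \<noteq> 0} \<subseteq> \<Omega>"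
    using closure_minimal[OF sub closed_cbox] assms(1) by blast
  moreover have "bounded {x. box_bump a b n x \<noteq> 0}" using sub bounded_cbox bounded_subset by blast
  ultimately show ?thesis unfolding test_functions_def smooth_compact_support_iff by blast
qed

lemma box_bump_norm: "norm (box_bump a b n x) \<le> 1"
  unfolding box_bump_def prod_norm[symmetric] norm_mult
  using bump_profile_bounds by (intro prod_le_1) (auto intro!: mult_le_one)

lemma box_bump_outside: "x \<notin> box a b \<Longrightarrow> box_bump a b n x = 0"
proof (rule ccontr)
  assume x: "x \<notin> box a b" "box_bump a b n x \<noteq> 0"
  have "a \<bullet> i < x \<bullet> i \<and> x \<bullet> i < b \<bullet> i" if "i \<in> Basis" for i
    using box_bump_support[OF x(2) that] by (smt (verit) mult_less_0_iff mult_nonneg_nonpos of_nat_0_le_iff)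
  then show False using x(1) by (simp add: mem_box)
qed

lemma box_bump_limit: "(\<lambda>n. box_bump a b n x) \<longlonglongrightarrow> indicator (box a b) x"
proof (cases "x \<in> box a b")
  case True
  have "(\<lambda>n. box_bump a b n x) \<longlonglongrightarrow> (\<Prod>i\<in>(Basis::'a set). of_real 1 * of_real 1)"
    unfolding box_bump_def using True
    by (intro tendsto_prod tendsto_mult tendsto_of_real bump_profile_limit) (auto simp: mem_box)
  then show ?thesis using True by simp
qed (simp add: box_bump_outside)

text \<open>
  The fundamental lemma of the calculus of variations. Integrals over boxes vanish as limits of
  integrals against \<open>box_bump\<close>, boxes generate the Borel sets, and an open set is a countable union of
  boxes.
\<close>

lemma AE_zero_of_test_functions:
  fixes g :: "'a::euclidean_space \<Rightarrow> complex"
  assumes "open \<Omega>" and g: "g \<in> borel_measurable (leb \<Omega>)" "integrable (leb \<Omega>) (\<lambda>x. (norm (g x))\<^sup>2)"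
    and zero: "\<And>\<psi>. \<psi> \<in> test_functions \<Omega> \<Longrightarrow> (\<integral>x. g x * \<psi> x \<partial>leb \<Omega>) = 0"
  shows "AE x in leb \<Omega>. g x = 0"
proof -
  define G where "G = (\<lambda>x. indicator \<Omega> x *\<^sub>R g x)"
  have \<Omega>[measurable]: "\<Omega> \<in> sets borel" using assms(1) by auto
  have G[measurable]: "G \<in> borel_measurable borel"
    using g(1) unfolding G_def by (simp add: borel_measurable_restrict_space_iff)
  have G2: "integrable lborel (\<lambda>x. (norm (G x))\<^sup>2)"
  proof -
    have "integrable lborel (\<lambda>x. indicator \<Omega> x *\<^sub>R (norm (g x))\<^sup>2)"
      using g(2) by (simp add: integrable_restrict_space)
    also have "(\<lambda>x. indicator \<Omega> x *\<^sub>R (norm (g x))\<^sup>2) = (\<lambda>x. (norm (G x))\<^sup>2)"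
      by (auto simp: G_def indicator_def)
    finally show ?thesis .
  qed
  have loc: "integrable lborel (\<lambda>x. indicator (box a b) x *\<^sub>R G x)" for a b
  proof (rule Bochner_Integration.integrable_bound)
    show "integrable lborel (\<lambda>x. indicator (box a b) x + (norm (G x))\<^sup>2)"
      using emeasure_lborel_box_finite[of a b] by (intro Bochner_Integration.integrable_add G2 integrable_real_indicator) auto
    show "AE x in lborel. norm (indicator (box a b) x *\<^sub>R G x) \<le> norm (indicator (box a b) x + (norm (G x))\<^sup>2)"
    proof (rule AE_I2)
      fix x
      have "norm (G x) \<le> 1 + (norm (G x))\<^sup>2"
        using self_le_power[of "norm (G x)" 2] by (cases "norm (G x) \<ge> 1") (auto intro: order_trans[of _ 1])
      then show "norm (indicator (box a b) x *\<^sub>R G x) \<le> norm (indicator (box a b) x + (norm (G x))\<^sup>2)"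
        by (auto simp: indicator_def)
    qed
  qed auto
  have box0: "(\<integral>x. indicator (box a b) x *\<^sub>R G x \<partial>lborel) = 0" if "box a b \<subseteq> \<Omega>" for a b
  proof -
    have "(\<lambda>n. \<integral>x. G x * box_bump a b (Suc n) x \<partial>lborel) \<longlonglongrightarrow> (\<integral>x. indicator (box a b) x *\<^sub>R G x \<partial>lborel)"
    proof (rule integral_dominated_convergence[where w = "\<lambda>x. norm (indicator (box a b) x *\<^sub>R G x)"])
      have [measurable]: "box_bump a b (Suc n) \<in> borel_measurable borel" for n
        using box_bump_test[of a b UNIV "Suc n"] smooth_measurable by (auto simp: test_functions_def)
      show "(\<lambda>x. G x * box_bump a b (Suc n) x) \<in> borel_measurable lborel" for n by measurable
      show "AE x in lborel. (\<lambda>n. G x * box_bump a b (Suc n) x) \<longlonglongrightarrow> indicator (box a b) x *\<^sub>R G x"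
      proof (rule AE_I2)
        fix x
        have "(\<lambda>n. G x * box_bump a b (Suc n) x) \<longlonglongrightarrow> G x * indicator (box a b) x"
          by (intro tendsto_mult tendsto_const LIMSEQ_Suc[OF box_bump_limit])
        then show "(\<lambda>n. G x * box_bump a b (Suc n) x) \<longlonglongrightarrow> indicator (box a b) x *\<^sub>R G x"
          by (auto simp: indicator_def split: if_splits)
      qed
      show "AE x in lborel. norm (G x * box_bump a b (Suc n) x) \<le> norm (indicator (box a b) x *\<^sub>R G x)" for n
        using box_bump_norm[of a b "Suc n"] box_bump_outside[of _ a b "Suc n"]
        by (intro AE_I2) (auto simp: indicator_def norm_mult mult_left_le)
      show "integrable lborel (\<lambda>x. norm (indicator (box a b) x *\<^sub>R G x))"
        by (rule integrable_norm[OF loc])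
    qed (use loc in auto)
    moreover have "(\<integral>x. G x * box_bump a b (Suc n) x \<partial>lborel) = 0" for n
    proof -
      have "(\<integral>x. g x * box_bump a b (Suc n) x \<partial>leb \<Omega>) = 0"
        using box_bump_test[OF that] by (intro zero) auto
      then show ?thesis by (simp add: integral_restrict_space G_def)
    qed
    ultimately show ?thesis by (simp add: LIMSEQ_const_iff)
  qed
  have AEbox: "AE x in lborel. indicator (box a b) x *\<^sub>R G x = 0" if ab: "box a b \<subseteq> \<Omega>" for a b
  proof (rule sigma_finite_measure.density_zero[OF sigma_finite_lborel loc])
    define H where "H = (\<lambda>x. indicator (box a b) x *\<^sub>R G x)"
    have Hint: "integrable lborel H" unfolding H_def by (rule loc)
    have Hset: "set_integrable lborel A H" if "A \<in> sets borel" for A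
      unfolding set_integrable_def by (rule integrable_mult_indicator[OF _ Hint]) (use that in simp)
    have H0: "(\<integral>x. H x \<partial>lborel) = 0" unfolding H_def by (rule box0[OF ab])
    fix A :: "'a set" assume "A \<in> sets lborel"
    then have Asig: "A \<in> sigma_sets UNIV (range (\<lambda>(a, b). box a b))"
      by (simp add: borel_eq_box sets_measure_of)
    have "Int_stable (range (\<lambda>(a, b). box a b :: 'a set))"
      by (auto simp: Int_stable_def box_Int_box)
    moreover have "range (\<lambda>(a, b). box a b :: 'a set) \<subseteq> Pow UNIV" by simp
    ultimately have "(LINT x:A|lborel. H x) = 0" using Asig
    proof (induction rule: sigma_sets_induct_disjoint)
      case (basic A)
      then obtain c d where A: "A = box c d" by auto
      obtain e f where ef: "box c d \<inter> box a b = box e f" using box_Int_box by blast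
      have "(LINT x:A|lborel. H x) = (\<integral>x. indicator (box e f) x *\<^sub>R G x \<partial>lborel)"
        unfolding set_lebesgue_integral_def A H_def ef[symmetric]
        by (intro Bochner_Integration.integral_cong) (auto simp: indicator_def)
      also have "\<dots> = 0" using ef ab by (intro box0) auto
      finally show "(LINT x:A|lborel. H x) = 0" .
    next
      case (compl A)
      note A = compl(1) and IH = compl(2)
      have A': "A \<in> sets borel" using A by (simp add: borel_eq_box sets_measure_of)
      have "(LINT x:A \<union> (UNIV - A)|lborel. H x) = (LINT x:A|lborel. H x) + (LINT x:UNIV - A|lborel. H x)"
        using A' by (intro set_integral_Un Hset) auto
      then show "(LINT x:UNIV - A|lborel. H x) = 0"
        using IH H0 by (simp add: set_lebesgue_integral_def)
    next
      case (union A)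
      note d = union(1) and A = union(2) and IH = union(3)
      have A': "A i \<in> sets borel" for i using A by (auto simp: borel_eq_box sets_measure_of)
      have "(LINT x:(\<Union>i. A i)|lborel. H x) = (\<Sum>i. (LINT x:(A i)|lborel. H x))"
        using A' d by (intro lebesgue_integral_countable_add Hset) (auto simp: disjoint_family_on_def)
      then show "(LINT x:(\<Union>i. A i)|lborel. H x) = 0" using IH by simp
    qed (simp_all add: set_lebesgue_integral_def)
    then show "(LINT x:A|lborel. indicator (box a b) x *\<^sub>R G x) = 0" by (simp add: H_def)
  qed
  obtain \<D> where D: "countable \<D>" "\<D> \<subseteq> Pow \<Omega>" "\<And>X. X \<in> \<D> \<Longrightarrow> \<exists>a b. X = box a b" "\<Union>\<D> = \<Omega>"
    using open_countable_Union_open_box[OF assms(1)] by metis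
  have "AE x in lborel. \<forall>X\<in>\<D>. indicator X x *\<^sub>R G x = 0"
    using D(2,3) AEbox by (subst AE_ball_countable[OF D(1)]) blast
  then have "AE x in lborel. x \<in> \<Omega> \<longrightarrow> g x = 0"
    by (rule AE_mp) (use D(4) in \<open>auto simp: G_def indicator_def\<close>)
  then show ?thesis by (simp add: AE_restrict_space_iff)
qed

section \<open>Square integrable functions\<close>

text \<open>
  Pointwise scaling turns the functions into a complex vector space, for use as an instance of the
  abstract setting of form pairs.
\<close>

definition cscale :: "complex \<Rightarrow> ('a \<Rightarrow> complex) \<Rightarrow> 'a \<Rightarrow> complex" where
  "cscale c u = (\<lambda>x. c * u x)"

lemma vector_space_cscale: "vector_space (cscale :: complex \<Rightarrow> ('a \<Rightarrow> complex) \<Rightarrow> _)"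
  by unfold_locales (auto simp: cscale_def fun_eq_iff algebra_simps)

text \<open>
  The squared \<open>L\<^sub>2\<close> norm as an extended nonnegative number. It is meaningful, and monotone and additive,
  before integrability is known.
\<close>

definition sqint :: "'a::euclidean_space set \<Rightarrow> ('a \<Rightarrow> complex) \<Rightarrow> ennreal" where
  "sqint \<Omega> f = (\<integral>\<^sup>+x. ennreal ((norm (f x))\<^sup>2) \<partial>leb \<Omega>)"

lemma L2_iff: "f \<in> L2 \<Omega> \<longleftrightarrow> f \<in> borel_measurable (leb \<Omega>) \<and> sqint \<Omega> f < \<infinity>"
  unfolding L2_def sqint_def by (auto simp: integrable_iff_bounded)

lemma L2_measurable [measurable_dest]: "f \<in> L2 \<Omega> \<Longrightarrow> f \<in> borel_measurable (leb \<Omega>)"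
  by (simp add: L2_def)

lemma norm_add_sq_le: "(norm (a + b))\<^sup>2 \<le> 2 * (norm a)\<^sup>2 + 2 * (norm b)\<^sup>2" for a b :: "'b::real_normed_vector"
proof -
  have "(norm (a + b))\<^sup>2 \<le> (norm a + norm b)\<^sup>2" by (intro power_mono norm_triangle_ineq) auto
  also have "\<dots> \<le> 2 * (norm a)\<^sup>2 + 2 * (norm b)\<^sup>2"
    using zero_le_power2[of "norm a - norm b"] by (simp add: power2_sum power2_diff)
  finally show ?thesis .
qed

lemma sqint_add_le:
  assumes "f \<in> borel_measurable (leb \<Omega>)" "g \<in> borel_measurable (leb \<Omega>)"
  shows "sqint \<Omega> (\<lambda>x. f x + g x) \<le> 2 * sqint \<Omega> f + 2 * sqint \<Omega> g"
proof -
  have "sqint \<Omega> (\<lambda>x. f x + g x) \<le> (\<integral>\<^sup>+x. 2 * ennreal ((norm (f x))\<^sup>2) + 2 * ennreal ((norm (g x))\<^sup>2) \<partial>leb \<Omega>)"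
    unfolding sqint_def
  proof (intro nn_integral_mono)
    fix x
    have "ennreal ((norm (f x + g x))\<^sup>2) \<le> ennreal (2 * (norm (f x))\<^sup>2 + 2 * (norm (g x))\<^sup>2)"
      by (intro ennreal_leI norm_add_sq_le)
    then show "ennreal ((norm (f x + g x))\<^sup>2) \<le> 2 * ennreal ((norm (f x))\<^sup>2) + 2 * ennreal ((norm (g x))\<^sup>2)"
      by (simp add: ennreal_plus ennreal_mult)
  qed
  also have "\<dots> = 2 * sqint \<Omega> f + 2 * sqint \<Omega> g"
    unfolding sqint_def using assms by (subst nn_integral_add) (auto simp: nn_integral_cmult)
  finally show ?thesis .
qed

lemma sqint_triangle:
  assumes "f \<in> borel_measurable (leb \<Omega>)" "g \<in> borel_measurable (leb \<Omega>)" "h \<in> borel_measurable (leb \<Omega>)"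
  shows "sqint \<Omega> (\<lambda>x. f x - h x) \<le> 2 * sqint \<Omega> (\<lambda>x. f x - g x) + 2 * sqint \<Omega> (\<lambda>x. g x - h x)"
  using sqint_add_le[of "\<lambda>x. f x - g x" \<Omega> "\<lambda>x. g x - h x"] assms by simp

lemma sqint_cmult:
  assumes "f \<in> borel_measurable (leb \<Omega>)"
  shows "sqint \<Omega> (\<lambda>x. c * f x) = ennreal ((norm c)\<^sup>2) * sqint \<Omega> f"
  unfolding sqint_def using assms
  by (subst nn_integral_cmult[symmetric]) (auto simp: norm_mult power_mult_distrib ennreal_mult)

lemma sqint_cong_AE: "AE x in leb \<Omega>. f x = g x \<Longrightarrow> sqint \<Omega> f = sqint \<Omega> g"
  unfolding sqint_def by (rule nn_integral_cong_AE) auto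

lemma L2_add: "f \<in> L2 \<Omega> \<Longrightarrow> g \<in> L2 \<Omega> \<Longrightarrow> (\<lambda>x. f x + g x) \<in> L2 \<Omega>"
  using sqint_add_le[of f \<Omega> g] by (auto simp: L2_iff ennreal_mult_less_top intro: le_less_trans)

lemma L2_cmult: "f \<in> L2 \<Omega> \<Longrightarrow> (\<lambda>x. c * f x) \<in> L2 \<Omega>"
  by (auto simp: L2_iff sqint_cmult ennreal_mult_less_top)

lemma L2_diff: "f \<in> L2 \<Omega> \<Longrightarrow> g \<in> L2 \<Omega> \<Longrightarrow> (\<lambda>x. f x - g x) \<in> L2 \<Omega>"
  using L2_add[of f \<Omega> "\<lambda>x. - 1 * g x"] L2_cmult[of g \<Omega> "-1"] by simp

lemma L2_zero: "(\<lambda>_. 0) \<in> L2 \<Omega>"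
  by (simp add: L2_iff sqint_def)

lemma L2_product_integrable:
  assumes "f \<in> L2 \<Omega>" "g \<in> L2 \<Omega>"
  shows "integrable (leb \<Omega>) (\<lambda>x. f x * g x)"
proof (rule Bochner_Integration.integrable_bound)
  show "integrable (leb \<Omega>) (\<lambda>x. (norm (f x))\<^sup>2 + (norm (g x))\<^sup>2)"
    using assms by (auto simp: L2_def)
  have "norm (f x) * norm (g x) \<le> (norm (f x))\<^sup>2 + (norm (g x))\<^sup>2" for x
    using sum_squares_bound[of "norm (f x)" "norm (g x)"] mult_nonneg_nonneg[of "norm (f x)" "norm (g x)"]
    by (simp del: mult_nonneg_nonneg)
  then show "AE x in leb \<Omega>. norm (f x * g x) \<le> norm ((norm (f x))\<^sup>2 + (norm (g x))\<^sup>2)"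
    by (intro AE_I2) (simp add: norm_mult)
  show "(\<lambda>x. f x * g x) \<in> borel_measurable (leb \<Omega>)" using assms by measurable
qed

lemma L2_cnj: "f \<in> L2 \<Omega> \<Longrightarrow> (\<lambda>x. cnj (f x)) \<in> L2 \<Omega>"
proof -
  assume f: "f \<in> L2 \<Omega>"
  then have [measurable]: "f \<in> borel_measurable (leb \<Omega>)" by measurable
  have "(\<lambda>x. cnj (f x)) \<in> borel_measurable (leb \<Omega>)"
    by (rule borel_measurable_continuous_on[OF continuous_on_cnj[OF continuous_on_id], unfolded id_def]) auto
  then show ?thesis using f by (simp add: L2_def)
qed

lemma L2_inner_integrable:
  "f \<in> L2 \<Omega> \<Longrightarrow> g \<in> L2 \<Omega> \<Longrightarrow> integrable (leb \<Omega>) (\<lambda>x. f x * cnj (g x))"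
  by (intro L2_product_integrable L2_cnj)

lemma L2_inner_self:
  assumes "f \<in> L2 \<Omega>"
  shows "L2_inner \<Omega> f f = of_real ((L2_norm \<Omega> f)\<^sup>2)"
    "ennreal (Re (L2_inner \<Omega> f f)) = sqint \<Omega> f" "(L2_norm \<Omega> f)\<^sup>2 = Re (L2_inner \<Omega> f f)"
proof -
  have "L2_inner \<Omega> f f = (\<integral>x. complex_of_real ((norm (f x))\<^sup>2) \<partial>leb \<Omega>)"
    by (simp add: L2_inner_def complex_norm_square del: of_real_power)
  also have "\<dots> = of_real (\<integral>x. (norm (f x))\<^sup>2 \<partial>leb \<Omega>)" by (rule integral_complex_of_real)
  finally have e: "L2_inner \<Omega> f f = of_real (\<integral>x. (norm (f x))\<^sup>2 \<partial>leb \<Omega>)" .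
  then show 1: "L2_inner \<Omega> f f = of_real ((L2_norm \<Omega> f)\<^sup>2)"
    by (simp add: L2_norm_def del: of_real_power)
  then show "(L2_norm \<Omega> f)\<^sup>2 = Re (L2_inner \<Omega> f f)" by simp
  show "ennreal (Re (L2_inner \<Omega> f f)) = sqint \<Omega> f"
    unfolding e sqint_def using assms by (subst nn_integral_eq_integral) (auto simp: L2_def)
qed

lemma L2_norm_eq: "f \<in> L2 \<Omega> \<Longrightarrow> L2_norm \<Omega> f = sqrt (Re (L2_inner \<Omega> f f))"
  using L2_inner_self(3)[of f \<Omega>] by (simp add: L2_norm_def)

lemma L2_inner_semi_inner: "semi_inner cscale (L2 \<Omega>) (L2_inner \<Omega>)"
proof -
  interpret vector_space "cscale :: complex \<Rightarrow> ('a \<Rightarrow> complex) \<Rightarrow> _" by (rule vector_space_cscale)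
  show ?thesis
  proof unfold_locales
    show "subspace (L2 \<Omega>)"
      unfolding subspace_def using L2_zero L2_add L2_cmult
      by (auto simp: plus_fun_def zero_fun_def cscale_def)
    show "L2_inner \<Omega> (u + v) w = L2_inner \<Omega> u w + L2_inner \<Omega> v w"
      if "u \<in> L2 \<Omega>" "v \<in> L2 \<Omega>" "w \<in> L2 \<Omega>" for u v w
      using that by (simp add: L2_inner_def distrib_right L2_inner_integrable)
    show "L2_inner \<Omega> (cscale c u) w = c * L2_inner \<Omega> u w" if "u \<in> L2 \<Omega>" "w \<in> L2 \<Omega>" for c u w
      using that by (simp add: L2_inner_def cscale_def mult.assoc)
    show "L2_inner \<Omega> v u = cnj (L2_inner \<Omega> u v)" if "u \<in> L2 \<Omega>" "v \<in> L2 \<Omega>" for u v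
      unfolding L2_inner_def Bochner_Integration.integral_cnj[symmetric] by (simp add: mult.commute)
    show "0 \<le> Re (L2_inner \<Omega> u u)" if "u \<in> L2 \<Omega>" for u
      using L2_inner_self(3)[OF that] by (metis zero_le_power2)
  qed
qed

lemma L2_inner_cong_AE:
  assumes "AE x in leb \<Omega>. f x = f' x" "AE x in leb \<Omega>. g x = g' x"
    "f \<in> L2 \<Omega>" "g \<in> L2 \<Omega>" "f' \<in> L2 \<Omega>" "g' \<in> L2 \<Omega>"
  shows "L2_inner \<Omega> f g = L2_inner \<Omega> f' g'"
  unfolding L2_inner_def using assms L2_cnj[of g \<Omega>] L2_cnj[of g' \<Omega>]
  by (intro integral_cong_AE) (auto intro!: borel_measurable_times dest: L2_measurable)

lemma L2_inner_bound:
  assumes "f \<in> L2 \<Omega>" "g \<in> L2 \<Omega>"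
  shows "norm (L2_inner \<Omega> f g) \<le> L2_norm \<Omega> f * L2_norm \<Omega> g"
proof -
  interpret semi_inner cscale "L2 \<Omega>" "L2_inner \<Omega>" by (rule L2_inner_semi_inner)
  define s where "s = cnj (sgn (L2_inner \<Omega> f g))"
  show ?thesis
  proof (cases "L2_inner \<Omega> f g = 0")
    case True
    then show ?thesis by (simp add: L2_norm_def)
  next
    case False
    then have "norm s = 1" by (simp add: s_def norm_sgn)
    have "norm (L2_inner \<Omega> f g) = Re (s * L2_inner \<Omega> f g)"
      using False by (simp add: s_def sgn_eq complex_norm_square[symmetric] mult.commute power2_eq_square
          flip: of_real_mult of_real_divide)
    also have "\<dots> = Re (L2_inner \<Omega> (cscale s f) g)" using assms by (simp add: scale_left)
    also have "\<dots> \<le> sqrt (Re (L2_inner \<Omega> (cscale s f) (cscale s f))) * sqrt (Re (L2_inner \<Omega> g g))"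
      using Cauchy_Schwarz_Re[of "cscale s f" g] assms by simp
    also have "Re (L2_inner \<Omega> (cscale s f) (cscale s f)) = Re (L2_inner \<Omega> f f)"
      using Re_scale[OF assms(1), of s] \<open>norm s = 1\<close> by simp
    finally show ?thesis using assms by (simp add: L2_norm_eq)
  qed
qed

text \<open>
  The proof of Riesz and Fischer, with squared norms throughout: along a subsequence whose consecutive
  differences have squared norm at most \<open>(1/4)^k\<close>, the series \<open>\<Sum> 2^k \<bar>d k x\<bar>\<^sup>2\<close> is finite almost
  everywhere, so \<open>d k x\<close> decreases geometrically.
\<close>

lemma L2_complete:
  fixes u :: "nat \<Rightarrow> 'a::euclidean_space \<Rightarrow> complex"
  assumes u: "\<And>n. u n \<in> L2 \<Omega>"
    and Cau: "\<And>\<epsilon>::real. \<epsilon> > 0 \<Longrightarrow> \<exists>N. \<forall>m\<ge>N. \<forall>n\<ge>N. sqint \<Omega> (\<lambda>x. u m x - u n x) < ennreal \<epsilon>"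
  obtains w where "w \<in> L2 \<Omega>" "\<And>\<epsilon>::real. \<epsilon> > 0 \<Longrightarrow> \<exists>N. \<forall>n\<ge>N. sqint \<Omega> (\<lambda>x. u n x - w x) < ennreal \<epsilon>"
proof -
  note [measurable] = L2_measurable[OF u]
  have "\<exists>N. \<forall>m\<ge>N. \<forall>n\<ge>N. sqint \<Omega> (\<lambda>x. u m x - u n x) < ennreal ((1/4) ^ k)" for k
    by (rule Cau) simp
  then obtain N where N: "\<And>k m n. m \<ge> N k \<Longrightarrow> n \<ge> N k \<Longrightarrow> sqint \<Omega> (\<lambda>x. u m x - u n x) < ennreal ((1/4) ^ k)"
    by metis
  define r where "r = (\<lambda>k. \<Sum>i\<le>k. N i + 1)"
  have r: "r k \<ge> N k" for k unfolding r_def by (rule order_trans[OF _ member_le_sum[of k]]) auto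
  have rS: "r (Suc k) \<ge> N k" for k using r[of k] by (simp add: r_def)
  have rk: "r k \<ge> k" for k by (induction k) (auto simp: r_def)
  define v where "v = (\<lambda>k. u (r k))"
  define d where "d = (\<lambda>k x. v (Suc k) x - v k x)"
  have [measurable]: "v k \<in> borel_measurable (leb \<Omega>)" "d k \<in> borel_measurable (leb \<Omega>)" for k
    by (auto simp: v_def d_def)
  have d: "sqint \<Omega> (d k) \<le> ennreal ((1/4) ^ k)" for k
    using N[OF rS r, of k] by (simp add: d_def v_def less_imp_le)
  have "(\<integral>\<^sup>+x. (\<Sum>k. ennreal (2 ^ k) * ennreal ((norm (d k x))\<^sup>2)) \<partial>leb \<Omega>)
      = (\<Sum>k. \<integral>\<^sup>+x. ennreal (2 ^ k) * ennreal ((norm (d k x))\<^sup>2) \<partial>leb \<Omega>)"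
    by (rule nn_integral_suminf) measurable
  also have "\<dots> = (\<Sum>k. ennreal (2 ^ k) * sqint \<Omega> (d k))"
    unfolding sqint_def by (simp add: nn_integral_cmult)
  also have "\<dots> \<le> (\<Sum>k. ennreal ((1/2) ^ k))"
  proof (intro suminf_le allI)
    fix k
    have "ennreal (2 ^ k) * sqint \<Omega> (d k) \<le> ennreal (2 ^ k) * ennreal ((1/4) ^ k)"
      by (intro mult_left_mono d) auto
    also have "\<dots> = ennreal ((1/2) ^ k)"
      by (simp add: ennreal_mult[symmetric] power_mult_distrib[symmetric])
    finally show "ennreal (2 ^ k) * sqint \<Omega> (d k) \<le> ennreal ((1/2) ^ k)" .
  qed auto
  also have "\<dots> < \<infinity>"
    by (subst suminf_ennreal_eq[OF _ geometric_sums]) auto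
  finally have "AE x in leb \<Omega>. (\<Sum>k. ennreal (2 ^ k) * ennreal ((norm (d k x))\<^sup>2)) \<noteq> \<infinity>"
    by (intro nn_integral_PInf_AE) auto
  then have conv: "AE x in leb \<Omega>. convergent (\<lambda>k. v k x)"
  proof (rule AE_mp, intro AE_I2 impI)
    fix x assume fin: "(\<Sum>k. ennreal (2 ^ k) * ennreal ((norm (d k x))\<^sup>2)) \<noteq> \<infinity>"
    define C where "C = enn2real (\<Sum>k. ennreal (2 ^ k) * ennreal ((norm (d k x))\<^sup>2))"
    have C: "(norm (d k x))\<^sup>2 \<le> C * (1/2) ^ k" for k
    proof -
      have "ennreal (2 ^ k * (norm (d k x))\<^sup>2) = (\<Sum>i\<in>{k}. ennreal (2 ^ i) * ennreal ((norm (d i x))\<^sup>2))"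
        by (simp add: ennreal_mult)
      also have "\<dots> \<le> (\<Sum>k. ennreal (2 ^ k) * ennreal ((norm (d k x))\<^sup>2))"
        by (rule sum_le_suminf) auto
      also have "\<dots> = ennreal C" using fin by (simp add: C_def top.not_eq_extremum)
      finally have "2 ^ k * (norm (d k x))\<^sup>2 \<le> C"
        by (subst (asm) ennreal_le_iff) (auto simp: C_def)
      then show ?thesis by (simp add: power_divide field_simps)
    qed
    have dk: "norm (d k x) \<le> sqrt C * (sqrt (1/2)) ^ k" for k
    proof -
      have "norm (d k x) \<le> sqrt (C * (1/2) ^ k)" using C by (rule real_le_rsqrt)
      then show ?thesis by (simp only: real_sqrt_mult real_sqrt_power)
    qed
    have "summable (\<lambda>k. sqrt C * (sqrt (1/2)) ^ k)"
      by (intro summable_mult summable_geometric) (simp add: real_sqrt_divide)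
    then have "summable (\<lambda>k. d k x)"
      by (rule summable_comparison_test'[of _ 0]) (rule dk)
    then have "convergent (\<lambda>n. \<Sum>k<n. d k x)" by (simp add: summable_iff_convergent)
    then have "convergent (\<lambda>n. v n x - v 0 x)"
      by (simp add: d_def sum_lessThan_telescope[of "\<lambda>n. v n x"])
    then show "convergent (\<lambda>n. v n x)" by (simp add: convergent_diff_const_right_iff)
  qed
  define w where "w = (\<lambda>x. lim (\<lambda>k. v k x))"
  have [measurable]: "w \<in> borel_measurable (leb \<Omega>)" unfolding w_def by measurable
  have bound: "sqint \<Omega> (\<lambda>x. u n x - w x) \<le> ennreal \<epsilon>"
    if "\<forall>m\<ge>K. \<forall>n\<ge>K. sqint \<Omega> (\<lambda>x. u m x - u n x) < ennreal \<epsilon>" "n \<ge> K" for n K \<epsilon>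
  proof -
    have "sqint \<Omega> (\<lambda>x. u n x - w x) \<le> (\<integral>\<^sup>+x. liminf (\<lambda>k. ennreal ((norm (u n x - v (k + K) x))\<^sup>2)) \<partial>leb \<Omega>)"
      unfolding sqint_def
    proof (rule nn_integral_mono_AE, rule AE_mp[OF conv], intro AE_I2 impI)
      fix x assume "convergent (\<lambda>k. v k x)"
      then have "(\<lambda>k. v k x) \<longlonglongrightarrow> w x" unfolding w_def by (simp add: convergent_LIMSEQ_iff)
      then have "(\<lambda>k. v (k + K) x) \<longlonglongrightarrow> w x" by (rule LIMSEQ_ignore_initial_segment)
      then have "(\<lambda>k. ennreal ((norm (u n x - v (k + K) x))\<^sup>2)) \<longlonglongrightarrow> ennreal ((norm (u n x - w x))\<^sup>2)"
        by (intro tendsto_ennrealI tendsto_intros)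
      then show "ennreal ((norm (u n x - w x))\<^sup>2) \<le> liminf (\<lambda>k. ennreal ((norm (u n x - v (k + K) x))\<^sup>2))"
        by (subst lim_imp_Liminf) (auto simp: trivial_limit_sequentially)
    qed
    \<comment> \<open>Fatou's lemma\<close>
    also have "\<dots> \<le> liminf (\<lambda>k. sqint \<Omega> (\<lambda>x. u n x - v (k + K) x))"
      unfolding sqint_def by (rule nn_integral_liminf) measurable
    also have "\<dots> \<le> ennreal \<epsilon>"
    proof -
      have "eventually (\<lambda>k. sqint \<Omega> (\<lambda>x. u n x - v (k + K) x) \<le> ennreal \<epsilon>) sequentially"
      proof (intro always_eventually allI less_imp_le)
        fix k
        have "r (k + K) \<ge> K" using rk[of "k + K"] by simp
        then show "sqint \<Omega> (\<lambda>x. u n x - v (k + K) x) < ennreal \<epsilon>" using that unfolding v_def by blast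
      qed
      then have "liminf (\<lambda>k. sqint \<Omega> (\<lambda>x. u n x - v (k + K) x)) \<le> liminf (\<lambda>k. ennreal \<epsilon>)"
        by (rule Liminf_mono)
      then show ?thesis by (simp add: Liminf_const)
    qed
    finally show ?thesis .
  qed
  have ev: "\<exists>N. \<forall>n\<ge>N. sqint \<Omega> (\<lambda>x. u n x - w x) < ennreal \<epsilon>" if "\<epsilon> > 0" for \<epsilon> :: real
  proof -
    obtain K where "\<forall>m\<ge>K. \<forall>n\<ge>K. sqint \<Omega> (\<lambda>x. u m x - u n x) < ennreal (\<epsilon> / 2)" using Cau[of "\<epsilon> / 2"] \<open>\<epsilon> > 0\<close> by auto
    then have "sqint \<Omega> (\<lambda>x. u n x - w x) \<le> ennreal (\<epsilon> / 2)" if "n \<ge> K" for n using bound that by blast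
    moreover have "ennreal (\<epsilon> / 2) < ennreal \<epsilon>" using that by (simp add: ennreal_less_iff)
    ultimately show ?thesis using le_less_trans by blast
  qed
  obtain n where n: "sqint \<Omega> (\<lambda>x. u n x - w x) < ennreal 1" using ev[of 1] by auto
  then have "(\<lambda>x. u n x - w x) \<in> L2 \<Omega>" by (auto simp: L2_iff intro: less_trans)
  from L2_diff[OF u[of n] this] have "w \<in> L2 \<Omega>" by simp
  then show thesis using ev that by blast
qed

section \<open>Weak derivatives\<close>

lemma smooth_L2:
  assumes "\<phi> \<in> smooth_compact_support" "\<Omega> \<in> sets borel"
  shows "\<phi> \<in> L2 \<Omega>"
proof -
  obtain B where B: "B \<ge> 0" "\<And>x. norm (\<phi> x) \<le> B" using smooth_bounded[OF assms(1)] by blast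
  obtain R where R: "\<And>x. norm x \<ge> R \<Longrightarrow> \<phi> x = 0" using smooth_support_ball[OF assms(1)] by blast
  have m[measurable]: "\<phi> \<in> borel_measurable borel" using smooth_measurable[OF assms(1)] .
  have "integrable lborel (\<lambda>x. (norm (\<phi> x))\<^sup>2)"
    by (rule integrable_bounded_support[of _ "B\<^sup>2" R]) (use B R in \<open>auto intro: power_mono\<close>)
  then have "integrable (leb \<Omega>) (\<lambda>x. (norm (\<phi> x))\<^sup>2)"
    using integrable_mult_indicator[of \<Omega> lborel "\<lambda>x. (norm (\<phi> x))\<^sup>2"] assms(2) by (simp add: integrable_restrict_space)
  moreover have "\<phi> \<in> borel_measurable (leb \<Omega>)" using m by (intro measurable_restrict_space1) auto
  ultimately show ?thesis by (simp add: L2_def)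
qed

lemma test_function_smooth: "\<psi> \<in> test_functions \<Omega> \<Longrightarrow> \<psi> \<in> smooth_compact_support"
  by (simp add: test_functions_def)

lemma smooth_has_weak_partial:
  assumes "\<phi> \<in> smooth_compact_support" "\<Omega> \<in> sets borel"
  shows "has_weak_partial \<Omega> e \<phi> (dpartial e \<phi>)"
  unfolding has_weak_partial_def
proof
  fix \<psi> assume psi: "\<psi> \<in> test_functions \<Omega>"
  note sm = test_function_smooth[OF psi]
  have z: "\<psi> x = 0" "dpartial e \<psi> x = 0" if "x \<notin> \<Omega>" for x
    using psi that closure_subset[of "{x. \<psi> x \<noteq> 0}"] dpartial_support[OF sm, of x e] by (auto simp: test_functions_def)
  have *: "(\<integral>x. f x * h x \<partial>leb \<Omega>) = (\<integral>x. f x * h x \<partial>lborel)"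
    if "\<And>x. x \<notin> \<Omega> \<Longrightarrow> h x = 0" for f h :: "'a \<Rightarrow> complex"
    using assms(2) that by (subst integral_restrict_space) (auto intro!: Bochner_Integration.integral_cong simp: indicator_def)
  show "(\<integral>x. \<phi> x * dpartial e \<psi> x \<partial>leb \<Omega>) = - (\<integral>x. dpartial e \<phi> x * \<psi> x \<partial>leb \<Omega>)"
    using integration_by_parts[OF assms(1) sm] z by (simp add: *)
qed

lemma weak_partial_unique:
  assumes "open \<Omega>" "g \<in> L2 \<Omega>" "h \<in> L2 \<Omega>" "has_weak_partial \<Omega> e u g" "has_weak_partial \<Omega> e u h"
  shows "AE x in leb \<Omega>. g x = h x"
proof -
  have "(\<lambda>x. g x - h x) \<in> L2 \<Omega>" using assms L2_diff by blast
  then have "AE x in leb \<Omega>. g x - h x = 0"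
  proof (intro AE_zero_of_test_functions assms(1))
    fix \<psi> assume psi: "\<psi> \<in> test_functions \<Omega>"
    have psi2: "\<psi> \<in> L2 \<Omega>" using test_function_smooth[OF psi] assms(1) by (intro smooth_L2) auto
    have "(\<integral>x. g x * \<psi> x \<partial>leb \<Omega>) = (\<integral>x. h x * \<psi> x \<partial>leb \<Omega>)"
      using assms(4,5) psi unfolding has_weak_partial_def by (metis minus_equation_iff)
    then show "(\<integral>x. (g x - h x) * \<psi> x \<partial>leb \<Omega>) = 0"
      using assms(2,3) psi2 by (simp add: left_diff_distrib L2_product_integrable)
  qed (auto simp: L2_def)
  then show ?thesis by simp
qed

lemma weak_partial_eq:
  assumes "open \<Omega>" "g \<in> L2 \<Omega>" "has_weak_partial \<Omega> e u g"
  shows "weak_partial \<Omega> e u \<in> L2 \<Omega>" "has_weak_partial \<Omega> e u (weak_partial \<Omega> e u)"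
    "AE x in leb \<Omega>. weak_partial \<Omega> e u x = g x"
proof -
  have "weak_partial \<Omega> e u \<in> L2 \<Omega> \<and> has_weak_partial \<Omega> e u (weak_partial \<Omega> e u)"
    unfolding weak_partial_def by (rule someI[of _ g]) (use assms in blast)
  then show "weak_partial \<Omega> e u \<in> L2 \<Omega>" "has_weak_partial \<Omega> e u (weak_partial \<Omega> e u)"
    "AE x in leb \<Omega>. weak_partial \<Omega> e u x = g x"
    using weak_partial_unique assms by blast+
qed

text \<open>
  Continuity of the pairing with a fixed function: strong \<open>L\<^sub>2\<close> convergence passes to the limit in inner products.
\<close>

lemma integral_product_limit:
  assumes "\<And>n. f n \<in> L2 \<Omega>" "f' \<in> L2 \<Omega>" "h \<in> L2 \<Omega>"
    and "(\<lambda>n. sqint \<Omega> (\<lambda>x. f n x - f' x)) \<longlonglongrightarrow> 0"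
  shows "(\<lambda>n. \<integral>x. f n x * h x \<partial>leb \<Omega>) \<longlonglongrightarrow> (\<integral>x. f' x * h x \<partial>leb \<Omega>)"
proof -
  have d: "(\<lambda>x. f n x - f' x) \<in> L2 \<Omega>" for n using assms L2_diff by blast
  have bd: "norm ((\<integral>x. f n x * h x \<partial>leb \<Omega>) - (\<integral>x. f' x * h x \<partial>leb \<Omega>))
      \<le> L2_norm \<Omega> (\<lambda>x. f n x - f' x) * L2_norm \<Omega> (\<lambda>x. cnj (h x))" for n
  proof -
    have "(\<integral>x. f n x * h x \<partial>leb \<Omega>) - (\<integral>x. f' x * h x \<partial>leb \<Omega>) = L2_inner \<Omega> (\<lambda>x. f n x - f' x) (\<lambda>x. cnj (h x))"
      using assms by (simp add: L2_inner_def left_diff_distrib L2_product_integrable)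
    then show ?thesis using L2_inner_bound[OF d L2_cnj[OF assms(3)]] by simp
  qed
  have "(\<lambda>n. L2_norm \<Omega> (\<lambda>x. f n x - f' x)) \<longlonglongrightarrow> 0"
  proof -
    have e: "L2_norm \<Omega> (\<lambda>x. f n x - f' x) = sqrt (enn2real (sqint \<Omega> (\<lambda>x. f n x - f' x)))" for n
      using L2_inner_self(3)[OF d, of n] zero_le_power2[of "L2_norm \<Omega> (\<lambda>x. f n x - f' x)"]
      by (simp add: L2_norm_eq[OF d] L2_inner_self(2)[OF d, symmetric])
    have "(\<lambda>n. sqrt (enn2real (sqint \<Omega> (\<lambda>x. f n x - f' x)))) \<longlonglongrightarrow> sqrt 0"
      using assms(4) by (intro tendsto_real_sqrt tendsto_enn2real) auto
    then show ?thesis by (simp add: e)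
  qed
  then have "(\<lambda>n. L2_norm \<Omega> (\<lambda>x. f n x - f' x) * L2_norm \<Omega> (\<lambda>x. cnj (h x))) \<longlonglongrightarrow> 0"
    by (rule tendsto_mult_left_zero)
  then have "(\<lambda>n. (\<integral>x. f n x * h x \<partial>leb \<Omega>) - (\<integral>x. f' x * h x \<partial>leb \<Omega>)) \<longlonglongrightarrow> 0"
    by (rule Lim_null_comparison[rotated]) (intro always_eventually allI bd)
  then show ?thesis by (rule LIM_zero_cancel)
qed

section \<open>The form domain as a closure of smooth functions\<close>

text \<open>
  The squared distance of a smooth function \<open>\<phi>\<close> from the pair of a function and its gradient, together
  with the squared boundary values of \<open>\<phi>\<close>.
\<close>

definition defect ::
  "'a::euclidean_space set \<Rightarrow> (real \<Rightarrow> 'a) set \<Rightarrow> ('a \<Rightarrow> complex) \<Rightarrow> ('a \<Rightarrow> 'a \<Rightarrow> complex) \<Rightarrow> ('a \<Rightarrow> complex) \<Rightarrow> ennreal" where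
  "defect \<Omega> \<Gamma> u g \<phi> = sqint \<Omega> (\<lambda>x. \<phi> x - u x)
     + (\<Sum>e\<in>Basis. sqint \<Omega> (\<lambda>x. dpartial e \<phi> x - g e x)) + boundary_sq_integral \<Gamma> \<phi>"

text \<open>
  Membership of \<open>u\<close> in \<open>H10 \<Omega> \<Gamma>\<close>, with \<open>g\<close> as its gradient. Carrying the gradient along avoids the choice
  in \<open>weak_partial\<close>, which is neither additive nor homogeneous pointwise.
\<close>

definition trace_free ::
  "'a::euclidean_space set \<Rightarrow> (real \<Rightarrow> 'a) set \<Rightarrow> ('a \<Rightarrow> complex) \<Rightarrow> ('a \<Rightarrow> 'a \<Rightarrow> complex) \<Rightarrow> bool" where
  "trace_free \<Omega> \<Gamma> u g \<longleftrightarrow> u \<in> L2 \<Omega> \<and> (\<forall>e\<in>Basis. g e \<in> L2 \<Omega>) \<and>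
     (\<forall>\<epsilon>::real>0. \<exists>\<phi>\<in>smooth_compact_support. defect \<Omega> \<Gamma> u g \<phi> < ennreal \<epsilon>)"

lemma trace_free_sequence:
  assumes "trace_free \<Omega> \<Gamma> u g"
  obtains \<phi> where "\<And>n. \<phi> n \<in> smooth_compact_support"
    "(\<lambda>n. sqint \<Omega> (\<lambda>x. \<phi> n x - u x)) \<longlonglongrightarrow> 0"
    "\<And>e. e \<in> Basis \<Longrightarrow> (\<lambda>n. sqint \<Omega> (\<lambda>x. dpartial e (\<phi> n) x - g e x)) \<longlonglongrightarrow> 0"
    "(\<lambda>n. boundary_sq_integral \<Gamma> (\<phi> n)) \<longlonglongrightarrow> 0"
proof -
  have "\<exists>\<phi>\<in>smooth_compact_support. defect \<Omega> \<Gamma> u g \<phi> < ennreal (1 / real (Suc n))" for n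
    using assms unfolding trace_free_def by (metis of_nat_0_less_iff zero_less_Suc zero_less_divide_1_iff)
  then obtain \<phi> where \<phi>: "\<And>n. \<phi> n \<in> smooth_compact_support" "\<And>n. defect \<Omega> \<Gamma> u g (\<phi> n) < ennreal (1 / real (Suc n))"
    by metis
  have lim: "(\<lambda>n. ennreal (1 / real (Suc n))) \<longlonglongrightarrow> 0"
    using tendsto_ennrealI[OF LIMSEQ_inverse_real_of_nat] by (simp add: inverse_eq_divide)
  have sq: "f \<longlonglongrightarrow> 0" if "\<And>n. f n \<le> defect \<Omega> \<Gamma> u g (\<phi> n)" for f :: "nat \<Rightarrow> ennreal"
  proof (rule tendsto_sandwich[OF _ _ tendsto_const lim])
    show "\<forall>\<^sub>F n in sequentially. f n \<le> ennreal (1 / real (Suc n))"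
      using that \<phi>(2) by (intro always_eventually allI) (meson le_less_trans less_imp_le)
  qed auto
  show thesis
  proof (rule that[OF \<phi>(1)])
    show "(\<lambda>n. sqint \<Omega> (\<lambda>x. \<phi> n x - u x)) \<longlonglongrightarrow> 0"
      by (rule sq) (simp add: defect_def add.assoc)
    show "(\<lambda>n. boundary_sq_integral \<Gamma> (\<phi> n)) \<longlonglongrightarrow> 0"
      by (rule sq) (simp add: defect_def)
    fix e :: 'a assume e: "e \<in> Basis"
    show "(\<lambda>n. sqint \<Omega> (\<lambda>x. dpartial e (\<phi> n) x - g e x)) \<longlonglongrightarrow> 0"
    proof (rule sq)
      fix n
      have "sqint \<Omega> (\<lambda>x. dpartial e (\<phi> n) x - g e x) \<le> (\<Sum>e\<in>Basis. sqint \<Omega> (\<lambda>x. dpartial e (\<phi> n) x - g e x))"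
        using e by (intro member_le_sum) auto
      also have "\<dots> \<le> defect \<Omega> \<Gamma> u g (\<phi> n)"
        unfolding defect_def by (intro add_increasing2 add_increasing) auto
      finally show "sqint \<Omega> (\<lambda>x. dpartial e (\<phi> n) x - g e x) \<le> defect \<Omega> \<Gamma> u g (\<phi> n)" .
    qed
  qed
qed

text \<open>
  Integration by parts holds for the approximating functions and both sides are continuous.
\<close>

lemma trace_free_weak_partial:
  assumes "open \<Omega>" "trace_free \<Omega> \<Gamma> u g" "e \<in> Basis"
  shows "has_weak_partial \<Omega> e u (g e)"
  unfolding has_weak_partial_def
proof
  fix \<psi> assume psi: "\<psi> \<in> test_functions \<Omega>"
  note sm = test_function_smooth[OF psi]
  have \<Omega>: "\<Omega> \<in> sets borel" using assms(1) by auto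
  obtain \<phi> where \<phi>: "\<And>n. \<phi> n \<in> smooth_compact_support"
    "(\<lambda>n. sqint \<Omega> (\<lambda>x. \<phi> n x - u x)) \<longlonglongrightarrow> 0"
    "\<And>e. e \<in> Basis \<Longrightarrow> (\<lambda>n. sqint \<Omega> (\<lambda>x. dpartial e (\<phi> n) x - g e x)) \<longlonglongrightarrow> 0"
    by (rule trace_free_sequence[OF assms(2)]) blast
  have u: "u \<in> L2 \<Omega>" "g e \<in> L2 \<Omega>" using assms by (auto simp: trace_free_def)
  have "(\<lambda>n. \<integral>x. \<phi> n x * dpartial e \<psi> x \<partial>leb \<Omega>) \<longlonglongrightarrow> (\<integral>x. u x * dpartial e \<psi> x \<partial>leb \<Omega>)"
    by (intro integral_product_limit \<phi> u smooth_L2 dpartial_smooth sm \<Omega>)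
  moreover have "(\<lambda>n. - (\<integral>x. dpartial e (\<phi> n) x * \<psi> x \<partial>leb \<Omega>)) \<longlonglongrightarrow> - (\<integral>x. g e x * \<psi> x \<partial>leb \<Omega>)"
    by (intro tendsto_minus integral_product_limit \<phi> u smooth_L2 dpartial_smooth sm \<Omega> assms(3))
  moreover have "(\<integral>x. \<phi> n x * dpartial e \<psi> x \<partial>leb \<Omega>) = - (\<integral>x. dpartial e (\<phi> n) x * \<psi> x \<partial>leb \<Omega>)" for n
    using smooth_has_weak_partial[OF \<phi>(1)[of n] \<Omega>, of e] psi by (auto simp: has_weak_partial_def)
  ultimately show "(\<integral>x. u x * dpartial e \<psi> x \<partial>leb \<Omega>) = - (\<integral>x. g e x * \<psi> x \<partial>leb \<Omega>)"
    using LIMSEQ_unique by auto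
qed

lemma ennreal_L2_norm_sq:
  assumes "f \<in> L2 \<Omega>"
  shows "ennreal ((L2_norm \<Omega> f)\<^sup>2) = sqint \<Omega> f"
  using L2_inner_self(2,3)[OF assms] by simp

lemma H1_dist_sqint:
  assumes "open \<Omega>" "\<phi> \<in> smooth_compact_support" "u \<in> L2 \<Omega>"
    "\<And>e. e \<in> Basis \<Longrightarrow> g e \<in> L2 \<Omega>" "\<And>e. e \<in> Basis \<Longrightarrow> has_weak_partial \<Omega> e u (g e)"
  shows "ennreal ((H1_dist \<Omega> \<phi> u)\<^sup>2) = sqint \<Omega> (\<lambda>x. \<phi> x - u x) + (\<Sum>e\<in>Basis. sqint \<Omega> (\<lambda>x. dpartial e \<phi> x - g e x))"
proof -
  have \<Omega>: "\<Omega> \<in> sets borel" using assms(1) by auto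
  note phi = smooth_L2[OF assms(2) \<Omega>]
  have w: "ennreal ((L2_norm \<Omega> (\<lambda>x. weak_partial \<Omega> e \<phi> x - weak_partial \<Omega> e u x))\<^sup>2)
      = sqint \<Omega> (\<lambda>x. dpartial e \<phi> x - g e x)" if e: "e \<in> Basis" for e
  proof -
    note p = weak_partial_eq[OF assms(1) smooth_L2[OF dpartial_smooth[OF assms(2), of e] \<Omega>] smooth_has_weak_partial[OF assms(2) \<Omega>]]
    note q = weak_partial_eq[OF assms(1) assms(4)[OF e] assms(5)[OF e]]
    have "ennreal ((L2_norm \<Omega> (\<lambda>x. weak_partial \<Omega> e \<phi> x - weak_partial \<Omega> e u x))\<^sup>2)
      = sqint \<Omega> (\<lambda>x. weak_partial \<Omega> e \<phi> x - weak_partial \<Omega> e u x)"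
      by (intro ennreal_L2_norm_sq L2_diff p q)
    also have "\<dots> = sqint \<Omega> (\<lambda>x. dpartial e \<phi> x - g e x)"
      using p(3) q(3) by (intro sqint_cong_AE) auto
    finally show ?thesis .
  qed
  have "ennreal ((H1_dist \<Omega> \<phi> u)\<^sup>2) = ennreal ((L2_norm \<Omega> (\<lambda>x. \<phi> x - u x))\<^sup>2 +
     (\<Sum>e\<in>Basis. (L2_norm \<Omega> (\<lambda>x. weak_partial \<Omega> e \<phi> x - weak_partial \<Omega> e u x))\<^sup>2))"
    unfolding H1_dist_def by (simp add: sum_nonneg)
  also have "\<dots> = ennreal ((L2_norm \<Omega> (\<lambda>x. \<phi> x - u x))\<^sup>2) +
     (\<Sum>e\<in>Basis. ennreal ((L2_norm \<Omega> (\<lambda>x. weak_partial \<Omega> e \<phi> x - weak_partial \<Omega> e u x))\<^sup>2))"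
    by (simp add: ennreal_plus sum_nonneg sum_ennreal del: of_real_power)
  finally show ?thesis using w ennreal_L2_norm_sq[OF L2_diff[OF phi assms(3)]] by simp
qed

lemma trace_free_imp_H10:
  assumes "open \<Omega>" "trace_free \<Omega> \<Gamma> u g"
  shows "u \<in> H10 \<Omega> \<Gamma>"
proof -
  note wp = trace_free_weak_partial[OF assms]
  have u: "u \<in> L2 \<Omega>" "\<And>e. e \<in> Basis \<Longrightarrow> g e \<in> L2 \<Omega>" using assms by (auto simp: trace_free_def)
  have "u \<in> H1 \<Omega>" using u wp by (auto simp: H1_def)
  moreover
  obtain \<phi> where \<phi>: "\<And>n. \<phi> n \<in> smooth_compact_support"
    "(\<lambda>n. sqint \<Omega> (\<lambda>x. \<phi> n x - u x)) \<longlonglongrightarrow> 0"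
    "\<And>e. e \<in> Basis \<Longrightarrow> (\<lambda>n. sqint \<Omega> (\<lambda>x. dpartial e (\<phi> n) x - g e x)) \<longlonglongrightarrow> 0"
    "(\<lambda>n. boundary_sq_integral \<Gamma> (\<phi> n)) \<longlonglongrightarrow> 0"
    by (rule trace_free_sequence[OF assms(2)]) blast
  have "(\<lambda>n. sqint \<Omega> (\<lambda>x. \<phi> n x - u x) + (\<Sum>e\<in>Basis. sqint \<Omega> (\<lambda>x. dpartial e (\<phi> n) x - g e x))) \<longlonglongrightarrow> 0 + (\<Sum>e\<in>(Basis::'a set). 0)"
    by (intro tendsto_add tendsto_sum \<phi>)
  then have "(\<lambda>n. ennreal ((H1_dist \<Omega> (\<phi> n) u)\<^sup>2)) \<longlonglongrightarrow> ennreal 0"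
    using H1_dist_sqint[OF assms(1) \<phi>(1) u wp] by simp
  then have "(\<lambda>n. (H1_dist \<Omega> (\<phi> n) u)\<^sup>2) \<longlonglongrightarrow> 0" by (subst (asm) tendsto_ennreal_iff) auto
  then have "(\<lambda>n. sqrt ((H1_dist \<Omega> (\<phi> n) u)\<^sup>2)) \<longlonglongrightarrow> sqrt 0" by (rule tendsto_real_sqrt)
  then have "(\<lambda>n. H1_dist \<Omega> (\<phi> n) u) \<longlonglongrightarrow> 0" by (simp add: tendsto_rabs_zero_iff)
  then have "has_trace \<Omega> \<Gamma> u (\<lambda>_. 0)" unfolding has_trace_def using \<phi>(1,4) by auto
  ultimately show ?thesis by (simp add: H10_def)
qed

lemma H10_imp_trace_free:
  assumes "open \<Omega>" "u \<in> H10 \<Omega> \<Gamma>"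
  shows "trace_free \<Omega> \<Gamma> u (\<lambda>e. weak_partial \<Omega> e u)"
proof -
  have u: "u \<in> L2 \<Omega>" using assms(2) by (auto simp: H10_def H1_def)
  have wp: "weak_partial \<Omega> e u \<in> L2 \<Omega>" "has_weak_partial \<Omega> e u (weak_partial \<Omega> e u)" if e: "e \<in> Basis" for e
  proof -
    obtain g where "g \<in> L2 \<Omega>" "has_weak_partial \<Omega> e u g" using assms(2) e by (auto simp: H10_def H1_def)
    then show "weak_partial \<Omega> e u \<in> L2 \<Omega>" "has_weak_partial \<Omega> e u (weak_partial \<Omega> e u)"
      using weak_partial_eq[OF assms(1)] by blast+
  qed
  obtain \<phi> where \<phi>: "\<And>n. \<phi> n \<in> smooth_compact_support"
    "(\<lambda>n. H1_dist \<Omega> (\<phi> n) u) \<longlonglongrightarrow> 0" "(\<lambda>n. boundary_sq_integral \<Gamma> (\<phi> n)) \<longlonglongrightarrow> 0"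
    using assms(2) by (auto simp: H10_def has_trace_def)
  have "(\<lambda>n. (H1_dist \<Omega> (\<phi> n) u)\<^sup>2) \<longlonglongrightarrow> 0\<^sup>2" by (intro tendsto_power \<phi>)
  then have "(\<lambda>n. ennreal ((H1_dist \<Omega> (\<phi> n) u)\<^sup>2) + boundary_sq_integral \<Gamma> (\<phi> n)) \<longlonglongrightarrow> ennreal (0\<^sup>2) + 0"
    by (intro tendsto_add tendsto_ennrealI \<phi>)
  moreover have "ennreal ((H1_dist \<Omega> (\<phi> n) u)\<^sup>2) + boundary_sq_integral \<Gamma> (\<phi> n) = defect \<Omega> \<Gamma> u (\<lambda>e. weak_partial \<Omega> e u) (\<phi> n)" for n
    unfolding defect_def by (subst H1_dist_sqint[OF assms(1) \<phi>(1) u wp]) auto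
  ultimately have "(\<lambda>n. defect \<Omega> \<Gamma> u (\<lambda>e. weak_partial \<Omega> e u) (\<phi> n)) \<longlonglongrightarrow> 0" by simp
  then have "\<exists>\<phi>\<in>smooth_compact_support. defect \<Omega> \<Gamma> u (\<lambda>e. weak_partial \<Omega> e u) \<phi> < ennreal \<epsilon>" if "\<epsilon> > 0" for \<epsilon> :: real
    using order_tendstoD(2)[of _ 0 sequentially "ennreal \<epsilon>"] that \<phi>(1) eventually_happens'[OF sequentially_bot]
    by (metis (mono_tags, lifting) ennreal_less_zero_iff)
  then show ?thesis using u wp by (simp add: trace_free_def)
qed

lemma trace_free_AE:
  assumes "open \<Omega>" "trace_free \<Omega> \<Gamma> u g" "e \<in> Basis"
  shows "AE x in leb \<Omega>. weak_partial \<Omega> e u x = g e x" "weak_partial \<Omega> e u \<in> L2 \<Omega>"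
  using weak_partial_eq[OF assms(1) _ trace_free_weak_partial[OF assms]] assms(2,3)
  by (auto simp: trace_free_def)

subsection \<open>Linearity\<close>

text \<open>
  What is needed to treat the boundary integral as a sum of squared norms.
\<close>

definition measurable_curves :: "(real \<Rightarrow> 'a::euclidean_space) set \<Rightarrow> bool" where
  "measurable_curves \<Gamma> \<longleftrightarrow> (\<forall>\<gamma>\<in>\<Gamma>. \<gamma> \<in> borel_measurable borel \<and>
     (\<lambda>s. norm (vector_derivative \<gamma> (at s))) \<in> borel_measurable borel)"

lemma boundary_add_le:
  assumes "measurable_curves \<Gamma>" "f \<in> borel_measurable borel" "g \<in> borel_measurable borel"
  shows "boundary_sq_integral \<Gamma> (\<lambda>x. f x + g x) \<le> 2 * boundary_sq_integral \<Gamma> f + 2 * boundary_sq_integral \<Gamma> g"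
  unfolding boundary_sq_integral_def sum_distrib_left sum.distrib[symmetric]
proof (intro sum_mono)
  fix \<gamma> assume "\<gamma> \<in> \<Gamma>"
  then have [measurable]: "\<gamma> \<in> borel_measurable borel" "(\<lambda>s. norm (vector_derivative \<gamma> (at s))) \<in> borel_measurable borel"
    using assms(1) by (auto simp: measurable_curves_def)
  note [measurable] = assms(2,3)
  let ?v = "\<lambda>s. norm (vector_derivative \<gamma> (at s))"
  have "(\<integral>\<^sup>+s. ennreal ((norm (f (\<gamma> s) + g (\<gamma> s)))\<^sup>2 * ?v s) \<partial>lborel)
      \<le> (\<integral>\<^sup>+s. 2 * ennreal ((norm (f (\<gamma> s)))\<^sup>2 * ?v s) + 2 * ennreal ((norm (g (\<gamma> s)))\<^sup>2 * ?v s) \<partial>lborel)"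
  proof (intro nn_integral_mono)
    fix s
    have "ennreal ((norm (f (\<gamma> s) + g (\<gamma> s)))\<^sup>2 * ?v s) \<le> ennreal ((2 * (norm (f (\<gamma> s)))\<^sup>2 + 2 * (norm (g (\<gamma> s)))\<^sup>2) * ?v s)"
      by (intro ennreal_leI mult_right_mono norm_add_sq_le) auto
    also have "\<dots> = 2 * ennreal ((norm (f (\<gamma> s)))\<^sup>2 * ?v s) + 2 * ennreal ((norm (g (\<gamma> s)))\<^sup>2 * ?v s)"
      by (simp add: distrib_right ennreal_plus ennreal_mult mult.assoc)
    finally show "ennreal ((norm (f (\<gamma> s) + g (\<gamma> s)))\<^sup>2 * ?v s)
      \<le> 2 * ennreal ((norm (f (\<gamma> s)))\<^sup>2 * ?v s) + 2 * ennreal ((norm (g (\<gamma> s)))\<^sup>2 * ?v s)" .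
  qed
  also have "\<dots> = 2 * (\<integral>\<^sup>+s. ennreal ((norm (f (\<gamma> s)))\<^sup>2 * ?v s) \<partial>lborel) + 2 * (\<integral>\<^sup>+s. ennreal ((norm (g (\<gamma> s)))\<^sup>2 * ?v s) \<partial>lborel)"
    by (subst nn_integral_add) (auto simp: nn_integral_cmult)
  finally show "(\<integral>\<^sup>+s. ennreal ((norm (f (\<gamma> s) + g (\<gamma> s)))\<^sup>2 * ?v s) \<partial>lborel)
    \<le> 2 * (\<integral>\<^sup>+s. ennreal ((norm (f (\<gamma> s)))\<^sup>2 * ?v s) \<partial>lborel) + 2 * (\<integral>\<^sup>+s. ennreal ((norm (g (\<gamma> s)))\<^sup>2 * ?v s) \<partial>lborel)" .
qed

lemma boundary_cmult:
  assumes "measurable_curves \<Gamma>" "f \<in> borel_measurable borel"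
  shows "boundary_sq_integral \<Gamma> (\<lambda>x. c * f x) = ennreal ((norm c)\<^sup>2) * boundary_sq_integral \<Gamma> f"
  unfolding boundary_sq_integral_def sum_distrib_left
proof (intro sum.cong refl)
  fix \<gamma> assume "\<gamma> \<in> \<Gamma>"
  then have [measurable]: "\<gamma> \<in> borel_measurable borel" "(\<lambda>s. norm (vector_derivative \<gamma> (at s))) \<in> borel_measurable borel"
    using assms(1) by (auto simp: measurable_curves_def)
  note [measurable] = assms(2)
  show "(\<integral>\<^sup>+s. ennreal ((norm (c * f (\<gamma> s)))\<^sup>2 * norm (vector_derivative \<gamma> (at s))) \<partial>lborel)
     = ennreal ((norm c)\<^sup>2) * (\<integral>\<^sup>+s. ennreal ((norm (f (\<gamma> s)))\<^sup>2 * norm (vector_derivative \<gamma> (at s))) \<partial>lborel)"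
    by (subst nn_integral_cmult[symmetric])
      (auto simp: norm_mult power_mult_distrib ennreal_mult[symmetric] mult.assoc)
qed

lemma trace_free_add:
  assumes "open \<Omega>" "measurable_curves \<Gamma>" "trace_free \<Omega> \<Gamma> u g" "trace_free \<Omega> \<Gamma> v h"
  shows "trace_free \<Omega> \<Gamma> (\<lambda>x. u x + v x) (\<lambda>e x. g e x + h e x)"
proof -
  have \<Omega>: "\<Omega> \<in> sets borel" using assms(1) by auto
  have L: "u \<in> L2 \<Omega>" "v \<in> L2 \<Omega>" "\<And>e. e \<in> Basis \<Longrightarrow> g e \<in> L2 \<Omega>" "\<And>e. e \<in> Basis \<Longrightarrow> h e \<in> L2 \<Omega>"
    using assms by (auto simp: trace_free_def)
  have "\<exists>\<phi>\<in>smooth_compact_support. defect \<Omega> \<Gamma> (\<lambda>x. u x + v x) (\<lambda>e x. g e x + h e x) \<phi> < ennreal \<epsilon>" if "\<epsilon> > 0" for \<epsilon> :: real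
  proof -
    obtain \<phi> \<psi> where p: "\<phi> \<in> smooth_compact_support" "\<psi> \<in> smooth_compact_support"
      "defect \<Omega> \<Gamma> u g \<phi> < ennreal (\<epsilon> / 4)" "defect \<Omega> \<Gamma> v h \<psi> < ennreal (\<epsilon> / 4)"
      using assms(3,4) \<open>\<epsilon> > 0\<close> unfolding trace_free_def by (metis zero_less_divide_iff zero_less_numeral)
    note m = L2_measurable[OF smooth_L2[OF p(1) \<Omega>]] L2_measurable[OF smooth_L2[OF p(2) \<Omega>]]
      L2_measurable[OF smooth_L2[OF dpartial_smooth[OF p(1)] \<Omega>]] L2_measurable[OF smooth_L2[OF dpartial_smooth[OF p(2)] \<Omega>]]
    have "defect \<Omega> \<Gamma> (\<lambda>x. u x + v x) (\<lambda>e x. g e x + h e x) (\<lambda>x. \<phi> x + \<psi> x)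
      \<le> (2 * sqint \<Omega> (\<lambda>x. \<phi> x - u x) + 2 * sqint \<Omega> (\<lambda>x. \<psi> x - v x))
        + (\<Sum>e\<in>Basis. 2 * sqint \<Omega> (\<lambda>x. dpartial e \<phi> x - g e x) + 2 * sqint \<Omega> (\<lambda>x. dpartial e \<psi> x - h e x))
        + (2 * boundary_sq_integral \<Gamma> \<phi> + 2 * boundary_sq_integral \<Gamma> \<psi>)"
      unfolding defect_def fun_cong[OF smooth_add(2)[OF p(1,2)]] add_diff_add
      using m L by (intro add_mono sum_mono sqint_add_le boundary_add_le assms(2) smooth_measurable p)
        (auto intro!: borel_measurable_diff dest: L2_measurable)
    also have "\<dots> = 2 * defect \<Omega> \<Gamma> u g \<phi> + 2 * defect \<Omega> \<Gamma> v h \<psi>"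
      unfolding defect_def sum.distrib sum_distrib_left[symmetric] by (simp add: distrib_left add_ac)
    also have "\<dots> < ennreal \<epsilon>"
    proof -
      have "2 * defect \<Omega> \<Gamma> u g \<phi> < 2 * ennreal (\<epsilon> / 4)" "2 * defect \<Omega> \<Gamma> v h \<psi> < 2 * ennreal (\<epsilon> / 4)"
        using p(3,4) by (auto intro!: ennreal_mult_strict_left_mono)
      then have "2 * defect \<Omega> \<Gamma> u g \<phi> + 2 * defect \<Omega> \<Gamma> v h \<psi> < 2 * ennreal (\<epsilon> / 4) + 2 * ennreal (\<epsilon> / 4)"
        by (rule add_strict_mono)
      also have "\<dots> = ennreal \<epsilon>"
        using that by (simp add: ennreal_plus[symmetric] ennreal_mult[symmetric] flip: ennreal_numeral del: ennreal_plus)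
      finally show ?thesis .
    qed
    finally show ?thesis using smooth_add(1)[OF p(1,2)] by blast
  qed
  then show ?thesis using L by (auto simp: trace_free_def intro: L2_add)
qed

lemma trace_free_cmult:
  assumes "open \<Omega>" "measurable_curves \<Gamma>" "trace_free \<Omega> \<Gamma> u g"
  shows "trace_free \<Omega> \<Gamma> (\<lambda>x. c * u x) (\<lambda>e x. c * g e x)"
proof -
  have \<Omega>: "\<Omega> \<in> sets borel" using assms(1) by auto
  have L: "u \<in> L2 \<Omega>" "\<And>e. e \<in> Basis \<Longrightarrow> g e \<in> L2 \<Omega>"
    using assms by (auto simp: trace_free_def)
  have "\<exists>\<phi>\<in>smooth_compact_support. defect \<Omega> \<Gamma> (\<lambda>x. c * u x) (\<lambda>e x. c * g e x) \<phi> < ennreal \<epsilon>" if "\<epsilon> > 0" for \<epsilon> :: real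
  proof -
    define \<delta> where "\<delta> = \<epsilon> / ((norm c)\<^sup>2 + 1)"
    have pos: "(norm c)\<^sup>2 + 1 > 0" by (simp add: add_nonneg_pos)
    have \<delta>: "\<delta> > 0" using that pos by (simp add: \<delta>_def)
    obtain \<phi> where p: "\<phi> \<in> smooth_compact_support" "defect \<Omega> \<Gamma> u g \<phi> < ennreal \<delta>"
      using assms(3) \<delta> unfolding trace_free_def by blast
    note m = L2_measurable[OF smooth_L2[OF p(1) \<Omega>]] L2_measurable[OF smooth_L2[OF dpartial_smooth[OF p(1)] \<Omega>]]
    have "defect \<Omega> \<Gamma> (\<lambda>x. c * u x) (\<lambda>e x. c * g e x) (\<lambda>x. c * \<phi> x) = ennreal ((norm c)\<^sup>2) * defect \<Omega> \<Gamma> u g \<phi>"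
      unfolding defect_def fun_cong[OF smooth_cmult(2)[OF p(1)]] right_diff_distrib[symmetric] distrib_left sum_distrib_left
      using m L
      by (intro arg_cong2[where f = "(+)"] sum.cong refl sqint_cmult boundary_cmult assms(2) smooth_measurable p)
        (auto intro!: borel_measurable_diff dest: L2_measurable)
    also have "\<dots> \<le> ennreal ((norm c)\<^sup>2) * ennreal \<delta>" using p(2) by (intro mult_left_mono) auto
    also have "\<dots> = ennreal ((norm c)\<^sup>2 * \<delta>)" using \<delta> by (simp add: ennreal_mult)
    also have "\<dots> < ennreal \<epsilon>"
    proof -
      have "(norm c)\<^sup>2 * \<delta> < ((norm c)\<^sup>2 + 1) * \<delta>" using \<delta> by simp
      also have "\<dots> = \<epsilon>" using pos by (simp add: \<delta>_def)
      finally show ?thesis using \<delta> by (simp add: ennreal_less_iff)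
    qed
    finally show ?thesis using smooth_cmult(1)[OF p(1), of c] by blast
  qed
  then show ?thesis using L by (auto simp: trace_free_def intro: L2_cmult)
qed

subsection \<open>Completeness\<close>

text \<open>
  A diagonal argument: approximate a late member of the sequence by a smooth function.
\<close>

lemma trace_free_closed:
  assumes "open \<Omega>" "measurable_curves \<Gamma>" "\<And>n. trace_free \<Omega> \<Gamma> (u n) (g n)"
    and w: "w \<in> L2 \<Omega>" "\<And>e. e \<in> Basis \<Longrightarrow> h e \<in> L2 \<Omega>"
    and lim: "(\<lambda>n. sqint \<Omega> (\<lambda>x. u n x - w x)) \<longlonglongrightarrow> 0"
      "\<And>e. e \<in> Basis \<Longrightarrow> (\<lambda>n. sqint \<Omega> (\<lambda>x. g n e x - h e x)) \<longlonglongrightarrow> 0"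
  shows "trace_free \<Omega> \<Gamma> w h"
proof -
  have \<Omega>: "\<Omega> \<in> sets borel" using assms(1) by auto
  have L: "u n \<in> L2 \<Omega>" "\<And>e. e \<in> Basis \<Longrightarrow> g n e \<in> L2 \<Omega>" for n
    using assms(3)[of n] by (auto simp: trace_free_def)
  have "\<exists>\<phi>\<in>smooth_compact_support. defect \<Omega> \<Gamma> w h \<phi> < ennreal \<epsilon>" if "\<epsilon> > 0" for \<epsilon> :: real
  proof -
    have "(\<lambda>n. sqint \<Omega> (\<lambda>x. u n x - w x) + (\<Sum>e\<in>Basis. sqint \<Omega> (\<lambda>x. g n e x - h e x))) \<longlonglongrightarrow> 0 + (\<Sum>e\<in>(Basis::'a set). 0)"
      by (intro tendsto_add tendsto_sum lim)
    then have "\<forall>\<^sub>F n in sequentially. sqint \<Omega> (\<lambda>x. u n x - w x) + (\<Sum>e\<in>Basis. sqint \<Omega> (\<lambda>x. g n e x - h e x)) < ennreal (\<epsilon> / 4)"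
      using that by (intro order_tendstoD) auto
    then obtain n where n: "sqint \<Omega> (\<lambda>x. u n x - w x) + (\<Sum>e\<in>Basis. sqint \<Omega> (\<lambda>x. g n e x - h e x)) < ennreal (\<epsilon> / 4)"
      using eventually_happens'[OF sequentially_bot] by blast
    have "\<epsilon> / 4 > 0" using that by simp
    then obtain \<phi> where p: "\<phi> \<in> smooth_compact_support" "defect \<Omega> \<Gamma> (u n) (g n) \<phi> < ennreal (\<epsilon> / 4)"
      using assms(3)[of n] unfolding trace_free_def by blast
    note m = L2_measurable[OF smooth_L2[OF p(1) \<Omega>]] L2_measurable[OF smooth_L2[OF dpartial_smooth[OF p(1)] \<Omega>]]
    have "defect \<Omega> \<Gamma> w h \<phi> \<le> (2 * sqint \<Omega> (\<lambda>x. \<phi> x - u n x) + 2 * sqint \<Omega> (\<lambda>x. u n x - w x))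
        + (\<Sum>e\<in>Basis. 2 * sqint \<Omega> (\<lambda>x. dpartial e \<phi> x - g n e x) + 2 * sqint \<Omega> (\<lambda>x. g n e x - h e x))
        + 2 * boundary_sq_integral \<Gamma> \<phi>"
      unfolding defect_def using m L w
      by (intro add_mono sum_mono sqint_triangle) (auto dest: L2_measurable simp: mult_2)
    also have "\<dots> = 2 * defect \<Omega> \<Gamma> (u n) (g n) \<phi> + 2 * (sqint \<Omega> (\<lambda>x. u n x - w x) + (\<Sum>e\<in>Basis. sqint \<Omega> (\<lambda>x. g n e x - h e x)))"
      unfolding defect_def sum.distrib sum_distrib_left[symmetric] by (simp add: distrib_left add_ac)
    also have "\<dots> < 2 * ennreal (\<epsilon> / 4) + 2 * ennreal (\<epsilon> / 4)"
      using p(2) n by (intro add_strict_mono ennreal_mult_strict_left_mono) auto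
    also have "\<dots> = ennreal \<epsilon>"
      using that by (simp add: ennreal_plus[symmetric] ennreal_mult[symmetric] flip: ennreal_numeral del: ennreal_plus)
    finally show ?thesis using p(1) by blast
  qed
  then show ?thesis using w by (auto simp: trace_free_def)
qed

subsection \<open>The form\<close>

lemma dirichlet_form_trace_free:
  assumes "open \<Omega>" "trace_free \<Omega> \<Gamma> u g" "trace_free \<Omega> \<Gamma> v h"
  shows "dirichlet_form \<Omega> u v = (\<Sum>e\<in>Basis. L2_inner \<Omega> (g e) (h e))"
  unfolding dirichlet_form_def
  using trace_free_AE[OF assms(1,2)] trace_free_AE[OF assms(1,3)] assms(2,3)
  by (intro sum.cong refl L2_inner_cong_AE) (auto simp: trace_free_def)

lemma dirichlet_form_self:
  assumes "open \<Omega>" "trace_free \<Omega> \<Gamma> u g"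
  shows "ennreal (Re (dirichlet_form \<Omega> u u)) = (\<Sum>e\<in>Basis. sqint \<Omega> (g e))"
proof -
  interpret semi_inner cscale "L2 \<Omega>" "L2_inner \<Omega>" by (rule L2_inner_semi_inner)
  have L: "\<And>e. e \<in> Basis \<Longrightarrow> g e \<in> L2 \<Omega>" using assms by (auto simp: trace_free_def)
  have "ennreal (Re (dirichlet_form \<Omega> u u)) = ennreal (\<Sum>e\<in>Basis. Re (L2_inner \<Omega> (g e) (g e)))"
    by (simp add: dirichlet_form_trace_free[OF assms assms(2)])
  also have "\<dots> = (\<Sum>e\<in>Basis. ennreal (Re (L2_inner \<Omega> (g e) (g e))))"
    using L nonneg by (subst sum_ennreal) auto
  also have "\<dots> = (\<Sum>e\<in>Basis. sqint \<Omega> (g e))" using L by (intro sum.cong refl L2_inner_self) auto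
  finally show ?thesis .
qed

lemma H10_L2: "u \<in> H10 \<Omega> \<Gamma> \<Longrightarrow> u \<in> L2 \<Omega>"
  by (simp add: H10_def H1_def)

lemma subspace_H10:
  assumes "open \<Omega>" "measurable_curves \<Gamma>"
  shows "module.subspace cscale (H10 \<Omega> \<Gamma>)"
proof -
  interpret vector_space "cscale :: complex \<Rightarrow> ('a \<Rightarrow> complex) \<Rightarrow> _" by (rule vector_space_cscale)
  have zero: "trace_free \<Omega> \<Gamma> (\<lambda>_. 0) (\<lambda>_ _. 0)"
  proof -
    have z: "(\<lambda>_::'a. 0::complex) \<in> smooth_compact_support"
      by (auto simp: smooth_compact_support_iff k_times_differentiable_const)
    have "dpartial e (\<lambda>_. 0) = (\<lambda>_. 0)" for e :: 'a
      using smooth_cmult(2)[OF z, where v = e and c = 0] by simp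
    then have "defect \<Omega> \<Gamma> (\<lambda>_. 0) (\<lambda>_ _. 0) (\<lambda>_. 0) = 0"
      by (simp add: defect_def sqint_def boundary_sq_integral_def)
    then show ?thesis using z by (auto simp: trace_free_def L2_zero intro!: bexI[of _ "\<lambda>_. 0"])
  qed
  show ?thesis unfolding subspace_def
  proof (intro conjI ballI allI)
    show "0 \<in> H10 \<Omega> \<Gamma>" using trace_free_imp_H10[OF assms(1) zero] by (simp add: zero_fun_def)
    fix u assume u: "u \<in> H10 \<Omega> \<Gamma>"
    show "cscale c u \<in> H10 \<Omega> \<Gamma>" for c
      using trace_free_imp_H10[OF assms(1) trace_free_cmult[OF assms H10_imp_trace_free[OF assms(1) u]]]
      by (simp add: cscale_def)
    fix v assume v: "v \<in> H10 \<Omega> \<Gamma>"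
    show "u + v \<in> H10 \<Omega> \<Gamma>"
      using trace_free_imp_H10[OF assms(1) trace_free_add[OF assms H10_imp_trace_free[OF assms(1) u] H10_imp_trace_free[OF assms(1) v]]]
      by (simp add: plus_fun_def)
  qed
qed

lemma semi_inner_H10:
  assumes "open \<Omega>" "measurable_curves \<Gamma>"
  shows "semi_inner cscale (H10 \<Omega> \<Gamma>) (L2_inner \<Omega>)" "semi_inner cscale (H10 \<Omega> \<Gamma>) (dirichlet_form \<Omega>)"
proof -
  interpret semi_inner cscale "L2 \<Omega>" "L2_inner \<Omega>" by (rule L2_inner_semi_inner)
  note tf = H10_imp_trace_free[OF assms(1)]
  note df = dirichlet_form_trace_free[OF assms(1)]
  have wp: "weak_partial \<Omega> e u \<in> L2 \<Omega>" if "u \<in> H10 \<Omega> \<Gamma>" "e \<in> Basis" for e u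
    using tf[OF that(1)] that(2) by (simp add: trace_free_def)
  show "semi_inner cscale (H10 \<Omega> \<Gamma>) (L2_inner \<Omega>)"
    by unfold_locales (auto simp: subspace_H10[OF assms] add_left scale_left nonneg H10_L2 intro: herm[OF H10_L2 H10_L2])
  show "semi_inner cscale (H10 \<Omega> \<Gamma>) (dirichlet_form \<Omega>)"
  proof unfold_locales
    show "subspace (H10 \<Omega> \<Gamma>)" by (rule subspace_H10[OF assms])
    show "dirichlet_form \<Omega> (u + v) w = dirichlet_form \<Omega> u w + dirichlet_form \<Omega> v w"
      if "u \<in> H10 \<Omega> \<Gamma>" "v \<in> H10 \<Omega> \<Gamma>" "w \<in> H10 \<Omega> \<Gamma>" for u v w
    proof -
      have "dirichlet_form \<Omega> (u + v) w = (\<Sum>e\<in>Basis. L2_inner \<Omega> (weak_partial \<Omega> e u + weak_partial \<Omega> e v) (weak_partial \<Omega> e w))"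
        using df[OF trace_free_add[OF assms tf[OF that(1)] tf[OF that(2)]] tf[OF that(3)]]
        by (simp add: plus_fun_def)
      also have "\<dots> = dirichlet_form \<Omega> u w + dirichlet_form \<Omega> v w"
        using that wp by (simp add: dirichlet_form_def add_left sum.distrib)
      finally show ?thesis .
    qed
    show "dirichlet_form \<Omega> (cscale c u) w = c * dirichlet_form \<Omega> u w"
      if "u \<in> H10 \<Omega> \<Gamma>" "w \<in> H10 \<Omega> \<Gamma>" for c u w
    proof -
      have "dirichlet_form \<Omega> (cscale c u) w = (\<Sum>e\<in>Basis. L2_inner \<Omega> (cscale c (weak_partial \<Omega> e u)) (weak_partial \<Omega> e w))"
        using df[OF trace_free_cmult[OF assms tf[OF that(1)]] tf[OF that(2)]]
        by (simp add: cscale_def)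
      also have "\<dots> = c * dirichlet_form \<Omega> u w"
        using that wp by (simp add: dirichlet_form_def scale_left sum_distrib_left)
      finally show ?thesis .
    qed
    show "dirichlet_form \<Omega> v u = cnj (dirichlet_form \<Omega> u v)"
      if "u \<in> H10 \<Omega> \<Gamma>" "v \<in> H10 \<Omega> \<Gamma>" for u v
      unfolding dirichlet_form_def cnj_sum using that wp by (intro sum.cong refl herm) auto
    show "0 \<le> Re (dirichlet_form \<Omega> u u)" if "u \<in> H10 \<Omega> \<Gamma>" for u
      unfolding dirichlet_form_def Re_sum using that wp by (intro sum_nonneg nonneg) auto
  qed
qed

text \<open>
  Cauchy sequences converge in \<open>L\<^sub>2\<close> together with their gradients, and the pair of limits is again
  \<open>trace_free\<close>. In other words, the Dirichlet form is closed.
\<close>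

lemma H10_complete:
  fixes u :: "nat \<Rightarrow> 'a::euclidean_space \<Rightarrow> complex"
  assumes "open \<Omega>" "measurable_curves \<Gamma>" "\<And>n. u n \<in> H10 \<Omega> \<Gamma>"
    and Cau: "\<And>\<epsilon>. \<epsilon> > 0 \<Longrightarrow> \<exists>N. \<forall>m\<ge>N. \<forall>n\<ge>N.
       Re (L2_inner \<Omega> (u m - u n) (u m - u n)) + Re (dirichlet_form \<Omega> (u m - u n) (u m - u n)) < \<epsilon>"
  shows "\<exists>w\<in>H10 \<Omega> \<Gamma>. (\<lambda>n. Re (L2_inner \<Omega> (u n - w) (u n - w))) \<longlonglongrightarrow> 0 \<and>
    (\<lambda>n. Re (dirichlet_form \<Omega> (u n - w) (u n - w))) \<longlonglongrightarrow> 0"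
proof -
  interpret b: semi_inner cscale "H10 \<Omega> \<Gamma>" "L2_inner \<Omega>" by (rule semi_inner_H10[OF assms(1,2)])
  interpret a: semi_inner cscale "H10 \<Omega> \<Gamma>" "dirichlet_form \<Omega>" by (rule semi_inner_H10[OF assms(1,2)])
  have tfd: "trace_free \<Omega> \<Gamma> (p - q) (\<lambda>e x. g e x - h e x)"
    if "trace_free \<Omega> \<Gamma> p g" "trace_free \<Omega> \<Gamma> q h" for p q g h
    using trace_free_add[OF assms(1,2) that(1) trace_free_cmult[OF assms(1,2) that(2), of "-1"]]
    by (simp add: fun_diff_def)
  define g where "g = (\<lambda>n e. weak_partial \<Omega> e (u n))"
  have tf: "trace_free \<Omega> \<Gamma> (u n) (g n)" for n unfolding g_def by (rule H10_imp_trace_free[OF assms(1,3)])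
  have L: "u n \<in> L2 \<Omega>" "\<And>e. e \<in> Basis \<Longrightarrow> g n e \<in> L2 \<Omega>" for n
    using tf[of n] by (auto simp: trace_free_def)
  have bnn: "ennreal (Re (L2_inner \<Omega> (p - q) (p - q))) = sqint \<Omega> (\<lambda>x. p x - q x)" if "p \<in> L2 \<Omega>" "q \<in> L2 \<Omega>" for p q
    using L2_inner_self(2)[OF L2_diff[OF that]] by (simp add: fun_diff_def)
  have ann: "ennreal (Re (dirichlet_form \<Omega> (p - q) (p - q))) = (\<Sum>e\<in>Basis. sqint \<Omega> (\<lambda>x. g e x - h e x))"
    if "trace_free \<Omega> \<Gamma> p g" "trace_free \<Omega> \<Gamma> q h" for p q g h
    by (rule dirichlet_form_self[OF assms(1) tfd[OF that]])
  have small: "\<exists>N. \<forall>m\<ge>N. \<forall>n\<ge>N. sqint \<Omega> (\<lambda>x. u m x - u n x) < ennreal \<epsilon> \<and>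
      (\<forall>e\<in>Basis. sqint \<Omega> (\<lambda>x. g m e x - g n e x) < ennreal \<epsilon>)" if "\<epsilon> > 0" for \<epsilon> :: real
  proof -
    obtain N where N: "\<forall>m\<ge>N. \<forall>n\<ge>N.
       Re (L2_inner \<Omega> (u m - u n) (u m - u n)) + Re (dirichlet_form \<Omega> (u m - u n) (u m - u n)) < \<epsilon>"
      using Cau \<open>\<epsilon> > 0\<close> by blast
    show ?thesis
    proof (intro exI[of _ N] allI impI conjI ballI)
      fix m n assume mn: "m \<ge> N" "n \<ge> N"
      have D: "u m - u n \<in> H10 \<Omega> \<Gamma>" using assms(3) by simp
      have lt: "Re (L2_inner \<Omega> (u m - u n) (u m - u n)) < \<epsilon>" "Re (dirichlet_form \<Omega> (u m - u n) (u m - u n)) < \<epsilon>"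
        using N mn a.nonneg[OF D] b.nonneg[OF D] by (smt (verit))+
      show "sqint \<Omega> (\<lambda>x. u m x - u n x) < ennreal \<epsilon>"
        using lt(1) b.nonneg[OF D] that by (subst bnn[symmetric]) (auto simp: L ennreal_less_iff)
      fix e :: 'a assume e: "e \<in> Basis"
      have "sqint \<Omega> (\<lambda>x. g m e x - g n e x) \<le> (\<Sum>e\<in>Basis. sqint \<Omega> (\<lambda>x. g m e x - g n e x))"
        using e by (intro member_le_sum) auto
      also have "\<dots> < ennreal \<epsilon>"
        using lt(2) a.nonneg[OF D] that by (subst ann[OF tf tf, symmetric]) (auto simp: ennreal_less_iff)
      finally show "sqint \<Omega> (\<lambda>x. g m e x - g n e x) < ennreal \<epsilon>" .
    qed
  qed
  have limI: "f \<longlonglongrightarrow> 0" if "\<And>\<epsilon>::real. \<epsilon> > 0 \<Longrightarrow> \<exists>N. \<forall>n\<ge>N. f n < ennreal \<epsilon>" for f :: "nat \<Rightarrow> ennreal"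
  proof (rule order_tendstoI)
    fix x :: ennreal assume "x > 0"
    then obtain y where y: "0 < y" "y < x" using dense by blast
    then obtain r :: real where r: "r > 0" "ennreal r < x"
      by (cases y) (auto simp: top_unique)
    then show "\<forall>\<^sub>F n in sequentially. f n < x"
      using that[OF r(1)] unfolding eventually_sequentially by (meson less_trans)
  qed simp
  have s1: "\<exists>N. \<forall>m\<ge>N. \<forall>n\<ge>N. sqint \<Omega> (\<lambda>x. u m x - u n x) < ennreal \<epsilon>" if "\<epsilon> > 0" for \<epsilon> :: real
    using small[OF that] by meson
  have s2: "\<exists>N. \<forall>m\<ge>N. \<forall>n\<ge>N. sqint \<Omega> (\<lambda>x. g m e x - g n e x) < ennreal \<epsilon>" if "e \<in> Basis" "\<epsilon> > 0" for e and \<epsilon> :: real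
    using small[OF that(2)] that(1) by meson
  obtain w where w: "w \<in> L2 \<Omega>" "\<And>\<epsilon>::real. \<epsilon> > 0 \<Longrightarrow> \<exists>N. \<forall>n\<ge>N. sqint \<Omega> (\<lambda>x. u n x - w x) < ennreal \<epsilon>"
    using L2_complete[OF L(1) s1] by metis
  have "\<exists>h. h \<in> L2 \<Omega> \<and> (\<forall>\<epsilon>::real>0. \<exists>N. \<forall>n\<ge>N. sqint \<Omega> (\<lambda>x. g n e x - h x) < ennreal \<epsilon>)" if e: "e \<in> Basis" for e
    using L2_complete[OF L(2)[OF e] s2[OF e]] by metis
  then obtain h where h: "\<And>e. e \<in> Basis \<Longrightarrow> h e \<in> L2 \<Omega>"
    "\<And>e \<epsilon>. e \<in> Basis \<Longrightarrow> \<epsilon> > (0::real) \<Longrightarrow> \<exists>N. \<forall>n\<ge>N. sqint \<Omega> (\<lambda>x. g n e x - h e x) < ennreal \<epsilon>"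
    by metis
  have lim: "(\<lambda>n. sqint \<Omega> (\<lambda>x. u n x - w x)) \<longlonglongrightarrow> 0"
      "\<And>e. e \<in> Basis \<Longrightarrow> (\<lambda>n. sqint \<Omega> (\<lambda>x. g n e x - h e x)) \<longlonglongrightarrow> 0"
    using w(2) h(2) by (auto intro!: limI)
  have tfw: "trace_free \<Omega> \<Gamma> w h" by (rule trace_free_closed[OF assms(1,2) tf w(1) h(1) lim])
  have wH: "w \<in> H10 \<Omega> \<Gamma>" by (rule trace_free_imp_H10[OF assms(1) tfw])
  have D: "u n - w \<in> H10 \<Omega> \<Gamma>" for n using assms(3) wH by simp
  have "(\<lambda>n. ennreal (Re (L2_inner \<Omega> (u n - w) (u n - w)))) \<longlonglongrightarrow> ennreal 0"
    using lim(1) bnn[OF L(1) w(1)] by simp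
  then have "(\<lambda>n. Re (L2_inner \<Omega> (u n - w) (u n - w))) \<longlonglongrightarrow> 0"
    by (subst (asm) tendsto_ennreal_iff) (auto simp: b.nonneg[OF D])
  moreover have "(\<lambda>n. ennreal (Re (dirichlet_form \<Omega> (u n - w) (u n - w)))) \<longlonglongrightarrow> ennreal 0"
    using tendsto_sum[OF lim(2), of Basis] ann[OF tf tfw] by simp
  then have "(\<lambda>n. Re (dirichlet_form \<Omega> (u n - w) (u n - w))) \<longlonglongrightarrow> 0"
    by (subst (asm) tendsto_ennreal_iff) (auto simp: a.nonneg[OF D])
  ultimately show ?thesis using wH by blast
qed

section \<open>Integrals over the line and the plane\<close>

lemma sqint_eq: "\<Omega> \<in> sets borel \<Longrightarrow> sqint \<Omega> f = (\<integral>\<^sup>+x. ennreal ((norm (f x))\<^sup>2) * indicator \<Omega> x \<partial>lborel)"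
  unfolding sqint_def by (simp add: nn_integral_restrict_space)

lemma L2_bounded_set:
  fixes f :: "'a::euclidean_space \<Rightarrow> complex"
  assumes "S \<in> sets borel" "emeasure lborel S < \<infinity>" "f \<in> borel_measurable borel" "\<And>x. x \<in> S \<Longrightarrow> norm (f x) \<le> B"
  shows "f \<in> L2 S"
proof -
  have "sqint S f \<le> (\<integral>\<^sup>+x. ennreal (B\<^sup>2) * indicator S x \<partial>lborel)"
    unfolding sqint_eq[OF assms(1)] using assms(4)
    by (intro nn_integral_mono) (auto simp: indicator_def intro!: ennreal_leI power_mono)
  also have "\<dots> = ennreal (B\<^sup>2) * emeasure lborel S" using assms(1) by (simp add: nn_integral_cmult_indicator)
  also have "\<dots> < \<infinity>" using assms(2) by (simp add: ennreal_mult_less_top)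
  finally show ?thesis using assms(3) by (auto simp: L2_iff intro!: measurable_restrict_space1)
qed

lemma continuous_L2:
  fixes f :: "'a::euclidean_space \<Rightarrow> complex"
  assumes "continuous_on UNIV f" "S \<in> sets borel" "bounded S"
  shows "f \<in> L2 S"
proof -
  have "bounded (f ` closure S)"
    using assms(3) continuous_on_subset[OF assms(1), of "closure S"]
    by (intro compact_imp_bounded compact_continuous_image) auto
  then obtain B where "\<And>x. x \<in> closure S \<Longrightarrow> norm (f x) \<le> B" by (auto simp: bounded_iff)
  then show ?thesis
    using assms closure_subset[of S] emeasure_bounded_finite[OF assms(3)]
    by (intro L2_bounded_set[of S f B]) (auto intro: borel_measurable_continuous_onI)
qed

text \<open>
  The Cauchy--Schwarz inequality against the constant function one.
\<close>

lemma integral_norm_sq_le: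
  assumes "S \<in> sets borel" "emeasure lborel S = ennreal m" "m \<ge> 0" "f \<in> L2 S"
  shows "ennreal ((norm (\<integral>x. f x \<partial>leb S))\<^sup>2) \<le> ennreal m * sqint S f"
proof -
  have one: "(\<lambda>_. 1) \<in> L2 S" by (rule L2_bounded_set[where B = 1]) (use assms in auto)
  have "norm (\<integral>x. f x \<partial>leb S) \<le> L2_norm S f * L2_norm S (\<lambda>_. 1)"
    using L2_inner_bound[OF assms(4) one] by (simp add: L2_inner_def)
  then have "(norm (\<integral>x. f x \<partial>leb S))\<^sup>2 \<le> (L2_norm S f * L2_norm S (\<lambda>_. 1))\<^sup>2" by (intro power_mono) auto
  then have "ennreal ((norm (\<integral>x. f x \<partial>leb S))\<^sup>2) \<le> ennreal ((L2_norm S (\<lambda>_. 1))\<^sup>2) * ennreal ((L2_norm S f)\<^sup>2)"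
    by (subst ennreal_mult[symmetric]) (auto simp: power_mult_distrib mult.commute intro!: ennreal_leI)
  also have "ennreal ((L2_norm S (\<lambda>_. 1))\<^sup>2) = ennreal m"
    unfolding ennreal_L2_norm_sq[OF one] using assms by (simp add: sqint_eq)
  finally show ?thesis unfolding ennreal_L2_norm_sq[OF assms(4)] .
qed

subsection \<open>Inequalities on an interval\<close>

lemma increment_sq_le:
  fixes f :: "real \<Rightarrow> complex"
  assumes f: "\<And>x. (f has_vector_derivative f' x) (at x)" and c: "continuous_on UNIV f'"
    and "a \<le> y" "y \<le> a + h" "a \<le> z" "z \<le> a + h"
  shows "ennreal ((norm (f y - f z))\<^sup>2) \<le> ennreal h * sqint {a..a + h} f'"
proof -
  have m[measurable]: "f' \<in> borel_measurable borel" using c by (rule borel_measurable_continuous_onI)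
  have *: "ennreal ((norm (f y - f z))\<^sup>2) \<le> ennreal h * sqint {a..a + h} f'"
    if zy: "z \<le> y" "a \<le> z" "y \<le> a + h" for y z
  proof -
    have L: "f' \<in> L2 {z..y}" using c by (intro continuous_L2) auto
    have "f y - f z = (\<integral>x. indicator {z..y} x *\<^sub>R f' x \<partial>lborel)"
      using f c zy by (subst integral_FTC_atLeastAtMost[of z y f f'])
        (auto intro: has_vector_derivative_at_within continuous_on_subset)
    also have "\<dots> = (\<integral>x. f' x \<partial>leb {z..y})" by (simp add: integral_restrict_space)
    finally have "ennreal ((norm (f y - f z))\<^sup>2) \<le> ennreal (y - z) * sqint {z..y} f'"
      using integral_norm_sq_le[of "{z..y}" "y - z" f'] L zy by simp
    also have "\<dots> \<le> ennreal h * sqint {a..a + h} f'"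
      using zy by (intro mult_mono) (auto simp: sqint_eq intro!: ennreal_leI nn_integral_mono split: split_indicator)
    finally show ?thesis .
  qed
  show ?thesis
    using *[of z y] *[of y z] assms(3-6) by (cases "z \<le> y") (auto simp: norm_minus_commute)
qed

lemma sqint_Icc_eq_integral:
  fixes f :: "real \<Rightarrow> complex"
  assumes "continuous_on UNIV f"
  shows "sqint {a..b} f = ennreal (integral {a..b} (\<lambda>x. (norm (f x))\<^sup>2))"
proof -
  have [measurable]: "f \<in> borel_measurable borel" using assms by (rule borel_measurable_continuous_onI)
  have "((\<lambda>x. (norm (f x))\<^sup>2) has_integral integral {a..b} (\<lambda>x. (norm (f x))\<^sup>2)) {a..b}"
    by (intro integrable_integral integrable_continuous_real continuous_intros continuous_on_subset[OF assms]) auto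
  then have "((\<lambda>x. if x \<in> {a..b} then (norm (f x))\<^sup>2 else 0) has_integral integral {a..b} (\<lambda>x. (norm (f x))\<^sup>2)) UNIV"
    by (simp only: has_integral_restrict_UNIV)
  then have "(\<integral>\<^sup>+x. ennreal (if x \<in> {a..b} then (norm (f x))\<^sup>2 else 0) \<partial>lborel) = ennreal (integral {a..b} (\<lambda>x. (norm (f x))\<^sup>2))"
    by (intro nn_integral_has_integral_lborel) auto
  then show ?thesis
    unfolding sqint_eq[OF borel_closed[OF closed_atLeastAtMost]]
    by (auto simp: indicator_def intro!: nn_integral_cong elim!: back_subst[of "\<lambda>x. x = _"])
qed

lemma cot_Riccati:
  fixes k d t :: real
  assumes "sin (d + k * t) \<noteq> 0"
  shows "((\<lambda>t. k * cos (d + k * t) / sin (d + k * t)) has_real_derivative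
     - k\<^sup>2 - (k * cos (d + k * t) / sin (d + k * t))\<^sup>2) (at t)"
proof -
  have "cos (d + k * t) * cos (d + k * t) = 1 - sin (d + k * t) * sin (d + k * t)"
    using sin_cos_squared_add[of "d + k * t"] by (simp add: power2_eq_square)
  then show ?thesis using assms
    by (auto intro!: derivative_eq_intros simp: power2_eq_square field_simps)
qed

text \<open>
  A version of the inequality \<open>\<pi>\<^sup>2 \<integral>\<bar>f\<bar>\<^sup>2 \<le> \<integral>\<bar>f'\<bar>\<^sup>2\<close> that allows for boundary values, at the expense of
  replacing \<open>\<pi>\<close> by \<open>k < \<pi>\<close>. With a solution \<open>G\<close> of the Riccati equation \<open>G' = - k\<^sup>2 - G\<^sup>2\<close> one has
  \<open>0 \<le> \<bar>f' - G f\<bar>\<^sup>2 = \<bar>f'\<bar>\<^sup>2 - k\<^sup>2 \<bar>f\<bar>\<^sup>2 - (G \<bar>f\<bar>\<^sup>2)'\<close>. Such a \<open>G\<close> exists on the whole interval because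
  \<open>k < \<pi>\<close> leaves room for the argument of the cotangent to stay inside \<open>(0, \<pi>)\<close>.
\<close>

lemma Poincare_with_boundary_terms:
  assumes k: "0 < k" "k < pi"
  obtains C :: real where "C \<ge> 0"
    "\<And>f f'. (\<And>t. (f has_vector_derivative f' t) (at t)) \<Longrightarrow> continuous_on UNIV f' \<Longrightarrow>
       ennreal (k\<^sup>2) * sqint {0..1} f \<le> sqint {0..1} f' + ennreal (C * ((norm (f 0))\<^sup>2 + (norm (f (1::real)))\<^sup>2))"
proof -
  \<comment> \<open>centres the interval \<open>[d, d + k]\<close> in \<open>(0, \<pi>)\<close>\<close>
  define d where "d = (pi - k) / 2"
  define G where "G = (\<lambda>t. k * cos (d + k * t) / sin (d + k * t))"
  have sin: "sin (d + k * t) > 0" if "t \<in> {0..1}" for t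
  proof (rule sin_gt_zero)
    show "0 < d + k * t" using k that by (simp add: d_def add_pos_nonneg)
    have "k * t \<le> k" using k that by (simp add: mult_left_le)
    moreover have "d + k < pi" using k by (simp add: d_def field_simps)
    ultimately show "d + k * t < pi" by linarith
  qed
  have G': "(G has_real_derivative - k\<^sup>2 - (G t)\<^sup>2) (at t)" if "t \<in> {0..1}" for t
    unfolding G_def by (rule cot_Riccati) (use sin[OF that] in simp)
  define C where "C = \<bar>G 0\<bar> + \<bar>G 1\<bar>"
  have "ennreal (k\<^sup>2) * sqint {0..1} f \<le> sqint {0..1} f' + ennreal (C * ((norm (f 0))\<^sup>2 + (norm (f 1))\<^sup>2))"
    if f: "\<And>t. (f has_vector_derivative f' t) (at t)" and c: "continuous_on UNIV f'" for f f' :: "real \<Rightarrow> complex"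
  proof -
    have cf: "continuous_on UNIV f"
      using f by (auto intro!: has_vector_derivative_continuous continuous_at_imp_continuous_on)
    define h where "h = (\<lambda>t. G t * (norm (f t))\<^sup>2)"
    define h' where "h' = (\<lambda>t. (- k\<^sup>2 - (G t)\<^sup>2) * (norm (f t))\<^sup>2 + G t * (2 * (f t \<bullet> f' t)))"
    have "(h has_vector_derivative h' t) (at t within {0..1})" if t: "t \<in> {0..1}" for t
    proof -
      have "((\<lambda>t. f t \<bullet> f t) has_vector_derivative (f t \<bullet> f' t + f' t \<bullet> f t)) (at t within {0..1})"
        by (rule bounded_bilinear.has_vector_derivative[OF bounded_bilinear_inner
              has_vector_derivative_at_within[OF f] has_vector_derivative_at_within[OF f]])
      moreover have "(G has_vector_derivative (- k\<^sup>2 - (G t)\<^sup>2)) (at t within {0..1})"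
        using G'[OF t] by (auto intro: has_vector_derivative_at_within simp: has_real_derivative_iff_has_vector_derivative)
      ultimately have "((\<lambda>t. G t * (f t \<bullet> f t)) has_vector_derivative (G t * (f t \<bullet> f' t + f' t \<bullet> f t) + (- k\<^sup>2 - (G t)\<^sup>2) * (f t \<bullet> f t))) (at t within {0..1})"
        by (intro has_vector_derivative_mult)
      then show ?thesis unfolding h_def h'_def
        by (simp add: power2_norm_eq_inner inner_commute algebra_simps)
    qed
    then have int_h: "(h' has_integral (h 1 - h 0)) {0..1}"
      by (intro fundamental_theorem_of_calculus) auto
    have int_f: "((\<lambda>x. (norm (f x))\<^sup>2) has_integral integral {0..1} (\<lambda>x. (norm (f x))\<^sup>2)) {0..1}"
      by (intro integrable_integral integrable_continuous_real continuous_intros continuous_on_subset[OF cf]) auto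
    have int_f': "((\<lambda>x. (norm (f' x))\<^sup>2) has_integral integral {0..1} (\<lambda>x. (norm (f' x))\<^sup>2)) {0..1}"
      by (intro integrable_integral integrable_continuous_real continuous_intros continuous_on_subset[OF c]) auto
    have "h' t + k\<^sup>2 * (norm (f t))\<^sup>2 \<le> (norm (f' t))\<^sup>2" for t
    proof -
      have "0 \<le> (norm (f' t - G t *\<^sub>R f t))\<^sup>2" by simp
      also have "\<dots> = (norm (f' t))\<^sup>2 - 2 * G t * (f t \<bullet> f' t) + (G t)\<^sup>2 * (norm (f t))\<^sup>2"
        unfolding power2_norm_eq_inner power2_eq_square[of "G t"]
        by (simp add: inner_diff_left inner_diff_right inner_commute algebra_simps)
      finally show ?thesis by (simp add: h'_def algebra_simps)
    qed
    then have "h 1 - h 0 + k\<^sup>2 * integral {0..1} (\<lambda>x. (norm (f x))\<^sup>2) \<le> integral {0..1} (\<lambda>x. (norm (f' x))\<^sup>2)"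
      by (intro has_integral_le[OF has_integral_add[OF int_h has_integral_mult_right[OF int_f]] int_f']) auto
    moreover have "- (C * ((norm (f 0))\<^sup>2 + (norm (f 1))\<^sup>2)) \<le> h 1 - h 0"
    proof -
      have "\<bar>h 0\<bar> \<le> C * (norm (f 0))\<^sup>2" "\<bar>h 1\<bar> \<le> C * (norm (f 1))\<^sup>2"
        by (auto simp: h_def C_def abs_mult intro!: mult_right_mono)
      then show ?thesis by (simp add: distrib_left)
    qed
    ultimately have "k\<^sup>2 * integral {0..1} (\<lambda>x. (norm (f x))\<^sup>2)
        \<le> integral {0..1} (\<lambda>x. (norm (f' x))\<^sup>2) + C * ((norm (f 0))\<^sup>2 + (norm (f 1))\<^sup>2)" by simp
    then have "ennreal (k\<^sup>2 * integral {0..1} (\<lambda>x. (norm (f x))\<^sup>2))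
        \<le> ennreal (integral {0..1} (\<lambda>x. (norm (f' x))\<^sup>2) + C * ((norm (f 0))\<^sup>2 + (norm (f 1))\<^sup>2))" by (rule ennreal_leI)
    also have "\<dots> = ennreal (integral {0..1} (\<lambda>x. (norm (f' x))\<^sup>2)) + ennreal (C * ((norm (f 0))\<^sup>2 + (norm (f 1))\<^sup>2))"
      using has_integral_nonneg[OF int_f'] by (intro ennreal_plus) (auto simp: C_def)
    finally show ?thesis
      using has_integral_nonneg[OF int_f]
      by (simp add: sqint_Icc_eq_integral[OF cf] sqint_Icc_eq_integral[OF c] ennreal_mult)
  qed
  moreover have "C \<ge> 0" by (simp add: C_def)
  ultimately show thesis using that by blast
qed

subsection \<open>Fubini and shears\<close>

lemma nn_integral_plane:
  fixes F :: "real \<times> real \<Rightarrow> ennreal"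
  assumes "F \<in> borel_measurable borel"
  shows "(\<integral>\<^sup>+p. F p \<partial>lborel) = (\<integral>\<^sup>+x. \<integral>\<^sup>+y. F (x, y) \<partial>lborel \<partial>lborel)"
    "(\<integral>\<^sup>+p. F p \<partial>lborel) = (\<integral>\<^sup>+y. \<integral>\<^sup>+x. F (x, y) \<partial>lborel \<partial>lborel)"
proof -
  have m: "F \<in> borel_measurable (lborel \<Otimes>\<^sub>M lborel)" using assms by (simp add: lborel_prod)
  show "(\<integral>\<^sup>+p. F p \<partial>lborel) = (\<integral>\<^sup>+x. \<integral>\<^sup>+y. F (x, y) \<partial>lborel \<partial>lborel)"
    using lborel.nn_integral_fst[OF m] by (simp add: lborel_prod)
  show "(\<integral>\<^sup>+p. F p \<partial>lborel) = (\<integral>\<^sup>+y. \<integral>\<^sup>+x. F (x, y) \<partial>lborel \<partial>lborel)"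
    using lborel_pair.nn_integral_snd[OF m] by (simp add: lborel_prod)
qed

text \<open>
  Both the strip coordinates and the transplantation are of this triangular form, so one change of
  variables formula, obtained from Fubini by one-dimensional affine substitutions, serves for both.
\<close>

definition shear :: "real \<Rightarrow> real \<Rightarrow> (real \<Rightarrow> real) \<Rightarrow> real \<times> real \<Rightarrow> real \<times> real" where
  "shear a b s = (\<lambda>(x, y). (a * x, b * y + s x))"

lemma shear_measurable [measurable]:
  assumes [measurable]: "s \<in> borel_measurable borel"
  shows "shear a b s \<in> borel \<rightarrow>\<^sub>M borel"
  unfolding shear_def borel_prod[symmetric] by measurable

lemma nn_integral_shear:
  assumes F[measurable]: "F \<in> borel_measurable borel" and s[measurable]: "s \<in> borel_measurable borel"
    and "a \<noteq> 0" "b \<noteq> 0"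
  shows "(\<integral>\<^sup>+p. F p \<partial>lborel) = ennreal \<bar>a * b\<bar> * (\<integral>\<^sup>+p. F (shear a b s p) \<partial>lborel)"
proof -
  have F2[measurable]: "F \<in> borel_measurable (borel \<Otimes>\<^sub>M borel)" using F by (simp add: borel_prod)
  have FS[measurable]: "(\<lambda>p. F (shear a b s p)) \<in> borel_measurable borel" by measurable
  have "(\<integral>\<^sup>+p. F p \<partial>lborel) = (\<integral>\<^sup>+x. \<integral>\<^sup>+y. F (x, y) \<partial>lborel \<partial>lborel)"
    by (rule nn_integral_plane[OF F])
  also have "\<dots> = ennreal \<bar>a\<bar> * (\<integral>\<^sup>+x. \<integral>\<^sup>+y. F (0 + a * x, y) \<partial>lborel \<partial>lborel)"
    using assms(3) by (intro nn_integral_real_affine) measurable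
  also have "(\<integral>\<^sup>+x. \<integral>\<^sup>+y. F (0 + a * x, y) \<partial>lborel \<partial>lborel)
      = (\<integral>\<^sup>+x. ennreal \<bar>b\<bar> * (\<integral>\<^sup>+y. F (0 + a * x, s x + b * y) \<partial>lborel) \<partial>lborel)"
    using assms(4) by (intro nn_integral_cong nn_integral_real_affine) measurable
  also have "\<dots> = ennreal \<bar>b\<bar> * (\<integral>\<^sup>+x. \<integral>\<^sup>+y. F (0 + a * x, s x + b * y) \<partial>lborel \<partial>lborel)"
    by (intro nn_integral_cmult) measurable
  also have "(\<integral>\<^sup>+x. \<integral>\<^sup>+y. F (0 + a * x, s x + b * y) \<partial>lborel \<partial>lborel) = (\<integral>\<^sup>+p. F (shear a b s p) \<partial>lborel)"
    by (subst nn_integral_plane[OF FS]) (simp add: shear_def add.commute)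
  finally show ?thesis by (simp add: abs_mult ennreal_mult mult.assoc)
qed

lemma lborel_shear:
  assumes s[measurable]: "s \<in> borel_measurable borel" and "a \<noteq> 0" "b \<noteq> 0"
  shows "lborel = density (distr lborel borel (shear a b s)) (\<lambda>_. ennreal \<bar>a * b\<bar>)"
proof (rule measure_eqI)
  fix A :: "(real \<times> real) set" assume "A \<in> sets lborel"
  then have A[measurable]: "A \<in> sets borel" by simp
  have "emeasure lborel A = (\<integral>\<^sup>+p. indicator A p \<partial>lborel)" by simp
  also have "\<dots> = ennreal \<bar>a * b\<bar> * (\<integral>\<^sup>+p. indicator A (shear a b s p) \<partial>lborel)"
    by (rule nn_integral_shear) (use assms in auto)
  also have "\<dots> = emeasure (density (distr lborel borel (shear a b s)) (\<lambda>_. ennreal \<bar>a * b\<bar>)) A"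
    by (subst emeasure_density, simp, simp, subst nn_integral_distr) (auto simp: nn_integral_cmult)
  finally show "emeasure lborel A = emeasure (density (distr lborel borel (shear a b s)) (\<lambda>_. ennreal \<bar>a * b\<bar>)) A" .
qed simp

lemma integral_shear:
  fixes F :: "real \<times> real \<Rightarrow> complex"
  assumes F[measurable]: "F \<in> borel_measurable borel" and s[measurable]: "s \<in> borel_measurable borel"
    and "a \<noteq> 0" "b \<noteq> 0"
  shows "(\<integral>p. F p \<partial>lborel) = of_real \<bar>a * b\<bar> * (\<integral>p. F (shear a b s p) \<partial>lborel)"
proof -
  have "(\<integral>p. F p \<partial>lborel) = (\<integral>p. F p \<partial>density (distr lborel borel (shear a b s)) (\<lambda>_. ennreal \<bar>a * b\<bar>))"
    using lborel_shear[OF s assms(3,4)] by simp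
  also have "\<dots> = (\<integral>p. \<bar>a * b\<bar> *\<^sub>R F (shear a b s p) \<partial>lborel)"
    by (subst integral_density) (auto simp: integral_distr)
  finally show ?thesis by (simp add: scaleR_conv_of_real)
qed

subsection \<open>Poincare inequality on a small square\<close>

lemma emeasure_half_open_square:
  assumes "h > 0"
  shows "emeasure lborel ({y..<y + h} \<times> {t..<t + h} :: (real \<times> real) set) = ennreal (h\<^sup>2)"
proof -
  have "emeasure (lborel \<Otimes>\<^sub>M lborel) ({y..<y + h} \<times> {t..<t + h}) = emeasure lborel {y..<y + h} * emeasure lborel {t..<t + h}"
    by (rule lborel.emeasure_pair_measure_Times) auto
  then show ?thesis using assms by (simp add: lborel_prod power2_eq_square ennreal_mult)
qed

text \<open>
  Two points of the square are joined by two segments parallel to the axes, and the increment on each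
  is controlled by the integral of the squared derivative along the line. Integrating over both points
  compares \<open>w\<close> with its mean value.
\<close>

lemma Poincare_square:
  fixes w wy wt :: "real \<times> real \<Rightarrow> complex"
  assumes h: "h > 0"
    and dy: "\<And>y t. ((\<lambda>y. w (y, t)) has_vector_derivative wy (y, t)) (at y)"
    and dt: "\<And>y t. ((\<lambda>t. w (y, t)) has_vector_derivative wt (y, t)) (at t)"
    and c: "continuous_on UNIV w" "continuous_on UNIV wy" "continuous_on UNIV wt"
    and Q_def: "Q = {y0..<y0 + h} \<times> {t0..<t0 + h}"
  shows "sqint Q w \<le> ennreal (4 * h\<^sup>2) * (sqint Q wy + sqint Q wt)
    + ennreal (2 / h\<^sup>2) * ennreal ((norm (\<integral>p. w p \<partial>leb Q))\<^sup>2)"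
proof -
  have m[measurable]: "w \<in> borel_measurable borel" "wy \<in> borel_measurable borel" "wt \<in> borel_measurable borel"
    using c by (auto intro: borel_measurable_continuous_onI)
  have m2[measurable]: "wy \<in> borel_measurable (borel \<Otimes>\<^sub>M borel)" "wt \<in> borel_measurable (borel \<Otimes>\<^sub>M borel)"
    using m by (auto simp: borel_prod)
  have Q[measurable]: "Q \<in> sets borel" unfolding Q_def by (simp add: borel_prod[symmetric])
  have mQ: "emeasure lborel Q = ennreal (h\<^sup>2)" unfolding Q_def by (rule emeasure_half_open_square[OF h])
  have Qsub: "Q \<subseteq> cbox (y0, t0) (y0 + h, t0 + h)" by (auto simp: Q_def mem_box)
  have L2Q: "f \<in> L2 Q" if "continuous_on UNIV f" for f :: "real \<times> real \<Rightarrow> complex"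
  proof -
    have "bounded Q" using Qsub bounded_cbox bounded_subset by blast
    then show ?thesis using that by (intro continuous_L2) auto
  qed
  define X where "X = (\<lambda>t. \<integral>\<^sup>+y. ennreal ((norm (wy (y, t)))\<^sup>2) * indicator {y0..<y0 + h} y \<partial>lborel)"
  define Y where "Y = (\<lambda>y. \<integral>\<^sup>+t. ennreal ((norm (wt (y, t)))\<^sup>2) * indicator {t0..<t0 + h} t \<partial>lborel)"
  have XY[measurable]: "X \<in> borel_measurable borel" "Y \<in> borel_measurable borel"
    unfolding X_def Y_def by measurable
  have Xe: "X t = sqint {y0..y0 + h} (\<lambda>y. wy (y, t))" for t
    unfolding X_def by (simp add: sqint_eq) (rule nn_integral_cong_AE, rule AE_mp[OF AE_lborel_singleton[of "y0 + h"]], auto split: split_indicator)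
  have Ye: "Y y = sqint {t0..t0 + h} (\<lambda>t. wt (y, t))" for y
    unfolding Y_def by (simp add: sqint_eq) (rule nn_integral_cong_AE, rule AE_mp[OF AE_lborel_singleton[of "t0 + h"]], auto split: split_indicator)
  have cy: "continuous_on UNIV (\<lambda>y. wy (y, t))" for t
    by (rule continuous_on_compose2[OF c(2)]) (auto intro!: continuous_intros)
  have ct: "continuous_on UNIV (\<lambda>t. wt (y, t))" for y
    by (rule continuous_on_compose2[OF c(3)]) (auto intro!: continuous_intros)
  have inc: "ennreal ((norm (w p - w q))\<^sup>2) \<le> 2 * ennreal h * (X (snd p) + Y (fst q))" if "p \<in> Q" "q \<in> Q" for p q
  proof -
    obtain y t y' t' where pq: "p = (y, t)" "q = (y', t')" by fastforce
    have 1: "ennreal ((norm (w (y, t) - w (y', t)))\<^sup>2) \<le> ennreal h * X t"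
      unfolding Xe by (rule increment_sq_le[OF dy cy]) (use that pq in \<open>auto simp: Q_def\<close>)
    have 2: "ennreal ((norm (w (y', t) - w (y', t')))\<^sup>2) \<le> ennreal h * Y y'"
      unfolding Ye by (rule increment_sq_le[OF dt ct]) (use that pq in \<open>auto simp: Q_def\<close>)
    have "(norm (w p - w q))\<^sup>2 \<le> 2 * (norm (w (y, t) - w (y', t)))\<^sup>2 + 2 * (norm (w (y', t) - w (y', t')))\<^sup>2"
      using norm_add_sq_le[of "w (y, t) - w (y', t)" "w (y', t) - w (y', t')"] by (simp add: pq)
    then have "ennreal ((norm (w p - w q))\<^sup>2) \<le> ennreal (2 * (norm (w (y, t) - w (y', t)))\<^sup>2 + 2 * (norm (w (y', t) - w (y', t')))\<^sup>2)"
      by (rule ennreal_leI)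
    also have "\<dots> = 2 * ennreal ((norm (w (y, t) - w (y', t)))\<^sup>2) + 2 * ennreal ((norm (w (y', t) - w (y', t')))\<^sup>2)"
      by (simp add: ennreal_plus ennreal_mult)
    also have "\<dots> \<le> 2 * (ennreal h * X t) + 2 * (ennreal h * Y y')" using 1 2 by (intro add_mono mult_left_mono) auto
    finally show ?thesis by (simp add: pq distrib_left mult.assoc)
  qed
  have indQ: "indicator Q (y, t) = (indicator {y0..<y0 + h} y * indicator {t0..<t0 + h} t :: ennreal)" for y t
    by (auto simp: Q_def indicator_def)
  have intI: "(\<integral>\<^sup>+y. indicator {a..<a + h} y \<partial>lborel) = ennreal h" for a :: real
    using h by simp
  have intX: "(\<integral>\<^sup>+p. X (snd p) * indicator Q p \<partial>lborel) = ennreal h * sqint Q wy"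
  proof -
    have mX: "(\<lambda>p. X (snd p) * indicator Q p) \<in> borel_measurable borel"
      unfolding borel_prod[symmetric] Q_def by measurable
    have "(\<integral>\<^sup>+p. X (snd p) * indicator Q p \<partial>lborel) = (\<integral>\<^sup>+t. \<integral>\<^sup>+y. X t * indicator {t0..<t0 + h} t * indicator {y0..<y0 + h} y \<partial>lborel \<partial>lborel)"
      by (subst nn_integral_plane(2)[OF mX]) (simp add: indQ mult_ac)
    also have "\<dots> = (\<integral>\<^sup>+t. X t * indicator {t0..<t0 + h} t * ennreal h \<partial>lborel)"
      by (subst nn_integral_cmult) (use h in \<open>auto\<close>)
    also have "\<dots> = ennreal h * (\<integral>\<^sup>+t. X t * indicator {t0..<t0 + h} t \<partial>lborel)"
      by (subst mult.commute, subst nn_integral_cmult) auto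
    also have "(\<integral>\<^sup>+t. X t * indicator {t0..<t0 + h} t \<partial>lborel)
       = (\<integral>\<^sup>+t. \<integral>\<^sup>+y. ennreal ((norm (wy (y, t)))\<^sup>2) * indicator Q (y, t) \<partial>lborel \<partial>lborel)"
      unfolding X_def indQ by (subst nn_integral_multc[symmetric]) (auto simp: mult.assoc)
    also have "\<dots> = sqint Q wy"
      unfolding sqint_eq[OF Q] by (rule nn_integral_plane(2)[symmetric]) simp
    finally show ?thesis .
  qed
  have intY: "(\<integral>\<^sup>+q. Y (fst q) * indicator Q q \<partial>lborel) = ennreal h * sqint Q wt"
  proof -
    have mY: "(\<lambda>p. Y (fst p) * indicator Q p) \<in> borel_measurable borel"
      unfolding borel_prod[symmetric] Q_def by measurable
    have "(\<integral>\<^sup>+p. Y (fst p) * indicator Q p \<partial>lborel) = (\<integral>\<^sup>+y. \<integral>\<^sup>+t. Y y * indicator {y0..<y0 + h} y * indicator {t0..<t0 + h} t \<partial>lborel \<partial>lborel)"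
      by (subst nn_integral_plane(1)[OF mY]) (simp add: indQ mult_ac)
    also have "\<dots> = (\<integral>\<^sup>+y. Y y * indicator {y0..<y0 + h} y * ennreal h \<partial>lborel)"
      by (subst nn_integral_cmult) (use h in \<open>auto\<close>)
    also have "\<dots> = ennreal h * (\<integral>\<^sup>+y. Y y * indicator {y0..<y0 + h} y \<partial>lborel)"
      by (subst mult.commute, subst nn_integral_cmult) auto
    also have "(\<integral>\<^sup>+y. Y y * indicator {y0..<y0 + h} y \<partial>lborel)
       = (\<integral>\<^sup>+y. \<integral>\<^sup>+t. ennreal ((norm (wt (y, t)))\<^sup>2) * indicator Q (y, t) \<partial>lborel \<partial>lborel)"
      unfolding Y_def indQ by (subst nn_integral_multc[symmetric]) (auto simp: mult_ac)
    also have "\<dots> = sqint Q wt"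
      unfolding sqint_eq[OF Q] by (rule nn_integral_plane(1)[symmetric]) simp
    finally show ?thesis .
  qed
  define M where "M = (\<integral>p. w p \<partial>leb Q)"
  define r where "r = complex_of_real (h\<^sup>2)"
  have oneL: "(\<lambda>_. a) \<in> L2 Q" for a by (rule L2Q) (intro continuous_intros)
  have measQ: "measure (leb Q) Q = h\<^sup>2"
    using mQ by (simp add: measure_def emeasure_restrict_space)
  have pt: "ennreal ((norm (r * w p - M))\<^sup>2) \<le> 2 * ennreal h * (ennreal (h\<^sup>2) * (ennreal (h\<^sup>2) * X (snd p)) + ennreal (h\<^sup>2) * (ennreal h * sqint Q wt))" if "p \<in> Q" for p
  proof -
    have Ld: "(\<lambda>q. w p - w q) \<in> L2 Q" by (rule L2Q) (intro continuous_intros c)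
    have "integrable (leb Q) (\<lambda>q. w q * 1)" by (intro L2_product_integrable L2Q c oneL)
    moreover have "integrable (leb Q) (\<lambda>q. w p * 1)" by (intro L2_product_integrable oneL)
    ultimately have "(\<integral>q. w p - w q \<partial>leb Q) = r * w p - M"
      by (simp add: M_def measQ r_def scaleR_conv_of_real)
    then have le: "ennreal ((norm (r * w p - M))\<^sup>2) \<le> ennreal (h\<^sup>2) * sqint Q (\<lambda>q. w p - w q)"
      using integral_norm_sq_le[OF Q mQ _ Ld] by simp
    have "sqint Q (\<lambda>q. w p - w q) \<le> (\<integral>\<^sup>+q. 2 * ennreal h * (X (snd p) + Y (fst q)) * indicator Q q \<partial>lborel)"
      unfolding sqint_eq[OF Q] using inc[OF that] by (intro nn_integral_mono) (auto split: split_indicator)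
    also have "\<dots> = (\<integral>\<^sup>+q. 2 * ennreal h * (X (snd p) * indicator Q q + Y (fst q) * indicator Q q) \<partial>lborel)"
      by (simp add: distrib_right mult.assoc)
    also have "\<dots> = 2 * ennreal h * (X (snd p) * ennreal (h\<^sup>2) + ennreal h * sqint Q wt)"
    proof -
      have mY: "(\<lambda>p. Y (fst p) * indicator Q p) \<in> borel_measurable borel"
        unfolding borel_prod[symmetric] Q_def by measurable
      show ?thesis
        using mY by (subst nn_integral_cmult, simp, subst nn_integral_add) (auto simp: intY mQ nn_integral_cmult_indicator)
    qed
    finally have "ennreal (h\<^sup>2) * sqint Q (\<lambda>q. w p - w q)
      \<le> ennreal (h\<^sup>2) * (2 * ennreal h * (X (snd p) * ennreal (h\<^sup>2) + ennreal h * sqint Q wt))"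
      by (rule mult_left_mono) simp
    from order_trans[OF le this] show ?thesis by (simp add: distrib_left mult_ac)
  qed
  have sq1: "ennreal (h ^ 4) * sqint Q (\<lambda>p. w p - M / r) \<le> ennreal (h ^ 4) * (ennreal (2 * h\<^sup>2) * (sqint Q wy + sqint Q wt))"
  proof -
    have r0: "r \<noteq> 0" using h by (simp add: r_def)
    have mX: "(\<lambda>p. X (snd p) * indicator Q p) \<in> borel_measurable borel"
      unfolding borel_prod[symmetric] Q_def by measurable
    have "ennreal (h ^ 4) * sqint Q (\<lambda>p. w p - M / r) = sqint Q (\<lambda>p. r * (w p - M / r))"
      using h by (subst sqint_cmult) (auto simp: r_def norm_power power_mult[symmetric] intro!: measurable_restrict_space1)
    also have "(\<lambda>p. r * (w p - M / r)) = (\<lambda>p. r * w p - M)" using r0 by (auto simp: right_diff_distrib)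
    also have "sqint Q (\<lambda>p. r * w p - M) \<le> (\<integral>\<^sup>+p. 2 * ennreal h * (ennreal (h\<^sup>2) * (ennreal (h\<^sup>2) * (X (snd p) * indicator Q p)) + ennreal (h\<^sup>2) * (ennreal h * sqint Q wt) * indicator Q p) \<partial>lborel)"
      unfolding sqint_eq[OF Q, of "\<lambda>p. r * w p - M"] using pt by (intro nn_integral_mono) (auto split: split_indicator)
    also have "\<dots> = 2 * ennreal h * (ennreal (h\<^sup>2) * (ennreal (h\<^sup>2) * (ennreal h * sqint Q wy)) + ennreal (h\<^sup>2) * (ennreal h * sqint Q wt) * ennreal (h\<^sup>2))"
      using mX by (subst nn_integral_cmult, simp, subst nn_integral_add, simp, simp)
        (simp add: nn_integral_cmult intX mQ nn_integral_cmult_indicator)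
    also have "\<dots> = (2 * ennreal h * ennreal (h\<^sup>2) * ennreal (h\<^sup>2) * ennreal h) * (sqint Q wy + sqint Q wt)"
      by (simp add: distrib_left mult_ac)
    also have "2 * ennreal h * ennreal (h\<^sup>2) * ennreal (h\<^sup>2) * ennreal h = ennreal (h ^ 4) * ennreal (2 * h\<^sup>2)"
      using h by (simp add: ennreal_mult[symmetric] power2_eq_square power4_eq_xxxx mult_ac flip: ennreal_numeral)
    finally show ?thesis by (simp add: mult.assoc)
  qed
  have sq2: "sqint Q (\<lambda>p. w p - M / r) \<le> ennreal (2 * h\<^sup>2) * (sqint Q wy + sqint Q wt)"
  proof -
    have "ennreal (1 / h ^ 4) * (ennreal (h ^ 4) * sqint Q (\<lambda>p. w p - M / r)) \<le> ennreal (1 / h ^ 4) * (ennreal (h ^ 4) * (ennreal (2 * h\<^sup>2) * (sqint Q wy + sqint Q wt)))"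
      by (rule mult_left_mono[OF sq1]) simp
    moreover have "ennreal (1 / h ^ 4) * ennreal (h ^ 4) = 1" using h by (simp add: ennreal_mult[symmetric])
    ultimately show ?thesis by (simp add: mult.assoc[symmetric])
  qed
  have "sqint Q w \<le> 2 * sqint Q (\<lambda>p. w p - M / r) + 2 * sqint Q (\<lambda>_. M / r)"
  proof -
    have "(\<lambda>p. w p - M / r) \<in> borel_measurable (leb Q)"
      by (intro measurable_restrict_space1) simp
    then show ?thesis using sqint_add_le[of "\<lambda>p. w p - M / r" Q "\<lambda>_. M / r"] by simp
  qed
  also have "sqint Q (\<lambda>_. M / r) = ennreal ((norm M)\<^sup>2 / h\<^sup>2)"
  proof -
    have nr: "norm r = h\<^sup>2" unfolding r_def norm_of_real by simp
    have e: "(norm (M / r))\<^sup>2 * h\<^sup>2 = (norm M)\<^sup>2 / h\<^sup>2"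
      unfolding norm_divide nr using h by (simp add: power_divide power2_eq_square)
    have "sqint Q (\<lambda>_. M / r) = ennreal ((norm (M / r))\<^sup>2) * ennreal (h\<^sup>2)"
      by (simp add: sqint_eq mQ nn_integral_cmult_indicator)
    also have "\<dots> = ennreal ((norm (M / r))\<^sup>2 * h\<^sup>2)" by (rule ennreal_mult[symmetric]) auto
    finally show ?thesis unfolding e .
  qed
  also have "2 * sqint Q (\<lambda>p. w p - M / r) + 2 * ennreal ((norm M)\<^sup>2 / h\<^sup>2)
     \<le> 2 * (ennreal (2 * h\<^sup>2) * (sqint Q wy + sqint Q wt)) + 2 * ennreal ((norm M)\<^sup>2 / h\<^sup>2)"
    by (intro add_right_mono mult_left_mono sq2) auto
  also have "\<dots> = ennreal (4 * h\<^sup>2) * (sqint Q wy + sqint Q wt) + ennreal (2 / h\<^sup>2) * ennreal ((norm M)\<^sup>2)"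
    by (simp add: mult.assoc[symmetric] ennreal_mult[symmetric] flip: ennreal_numeral)
  finally show ?thesis by (simp add: M_def)
qed

section \<open>The lower bound on a half strip\<close>

lemma smooth_directional:
  assumes "\<phi> \<in> smooth_compact_support"
  shows "((\<lambda>s. \<phi> (x + s *\<^sub>R v)) has_vector_derivative dpartial v \<phi> (x + s *\<^sub>R v)) (at s)"
proof -
  have "((\<lambda>s. x + s *\<^sub>R v) has_derivative (\<lambda>h. h *\<^sub>R v)) (at s)"
    by (auto intro!: derivative_eq_intros)
  from has_derivative_compose[OF this smooth_has_derivative[OF assms(1)]]
  have "((\<lambda>s. \<phi> (x + s *\<^sub>R v)) has_derivative (\<lambda>h. frechet_derivative \<phi> (at (x + s *\<^sub>R v)) (h *\<^sub>R v))) (at s)" .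
  moreover have "frechet_derivative \<phi> (at y) (h *\<^sub>R v) = h *\<^sub>R frechet_derivative \<phi> (at y) v" for h y
    using has_derivative_bounded_linear[OF smooth_has_derivative[OF assms(1), of y]] by (intro linear_scale bounded_linear.linear)
  ultimately show ?thesis by (simp add: has_vector_derivative_def)
qed

lemma Basis_plane: "Basis = {(1, 0), (0, 1) :: real \<times> real}"
  by (auto simp: Basis_prod_def)

definition grad_sq :: "(real \<times> real \<Rightarrow> complex) \<Rightarrow> real \<times> real \<Rightarrow> real" where
  "grad_sq \<phi> p = (norm (dpartial (1, 0) \<phi> p))\<^sup>2 + (norm (dpartial (0, 1) \<phi> p))\<^sup>2"

lemma dpartial_pair:
  assumes "\<phi> \<in> smooth_compact_support"
  shows "dpartial (v :: real \<times> real) \<phi> p = of_real (fst v) * dpartial (1, 0) \<phi> p + of_real (snd v) * dpartial (0, 1) \<phi> p"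
proof -
  have lin: "linear (frechet_derivative \<phi> (at p))"
    using has_derivative_bounded_linear[OF smooth_has_derivative[OF assms(1), of p]] by (rule bounded_linear.linear)
  have "v = fst v *\<^sub>R (1, 0) + snd v *\<^sub>R (0, 1)" by (simp add: prod_eq_iff)
  then have "dpartial v \<phi> p = frechet_derivative \<phi> (at p) (fst v *\<^sub>R (1, 0) + snd v *\<^sub>R (0, 1))" by simp
  then show ?thesis unfolding linear_add[OF lin] linear_scale[OF lin] scaleR_conv_of_real .
qed

lemma dpartial_le_grad:
  assumes "\<phi> \<in> smooth_compact_support"
  shows "(norm (dpartial v \<phi> p))\<^sup>2 \<le> (norm v)\<^sup>2 * grad_sq \<phi> p"
proof -
  define a b where "a = norm (dpartial (1, 0) \<phi> p)" and "b = norm (dpartial (0, 1) \<phi> p)"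
  obtain v1 v2 where v: "v = (v1, v2)" by fastforce
  have "norm (dpartial v \<phi> p) \<le> \<bar>v1\<bar> * a + \<bar>v2\<bar> * b"
  proof -
    have "dpartial v \<phi> p = of_real v1 * dpartial (1, 0) \<phi> p + of_real v2 * dpartial (0, 1) \<phi> p"
      using dpartial_pair[OF assms, where v = v and p = p] unfolding v by simp
    then show ?thesis unfolding a_def b_def
      by (metis norm_triangle_ineq norm_mult norm_of_real)
  qed
  then have "(norm (dpartial v \<phi> p))\<^sup>2 \<le> (\<bar>v1\<bar> * a + \<bar>v2\<bar> * b)\<^sup>2" by (intro power_mono) auto
  also have "\<dots> \<le> (v1\<^sup>2 + v2\<^sup>2) * (a\<^sup>2 + b\<^sup>2)"
    using zero_le_power2[of "\<bar>v1\<bar> * b - \<bar>v2\<bar> * a"] by (simp add: power2_sum power2_diff power_mult_distrib algebra_simps)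
  finally show ?thesis by (simp add: v norm_prod_def grad_sq_def a_def b_def)
qed

lemma grad_sq_nonneg: "0 \<le> grad_sq \<phi> p" by (simp add: grad_sq_def)

lemma grad_sq_measurable [measurable]:
  assumes "\<phi> \<in> smooth_compact_support"
  shows "grad_sq \<phi> \<in> borel_measurable borel"
proof -
  note [measurable] = smooth_measurable[OF dpartial_smooth[OF assms]]
  show ?thesis unfolding grad_sq_def[abs_def] by measurable
qed

text \<open>
  The oblique coordinates in which each half of the guide becomes a half strip.
\<close>

definition strip_point :: "real \<times> real \<Rightarrow> real \<times> real \<Rightarrow> real \<times> real \<Rightarrow> real \<times> real" where
  "strip_point A B q = fst q *\<^sub>R A + snd q *\<^sub>R B"

lemma strip_point_continuous: "continuous_on UNIV (strip_point A B)"
  unfolding strip_point_def[abs_def] by (intro continuous_intros)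

lemma strip_point_measurable [measurable]: "strip_point A B \<in> borel \<rightarrow>\<^sub>M borel"
  by (rule borel_measurable_continuous_onI[OF strip_point_continuous])

lemma AE_plane:
  "AE p in (lborel :: (real \<times> real) measure). fst p \<noteq> c" "AE p in (lborel :: (real \<times> real) measure). snd p \<noteq> c"
proof -
  have "emeasure (lborel \<Otimes>\<^sub>M lborel) ({c} \<times> (UNIV :: real set)) = emeasure lborel {c} * emeasure (lborel :: real measure) UNIV"
    by (rule lborel.emeasure_pair_measure_Times) auto
  then have "emeasure lborel ({c} \<times> (UNIV :: real set)) = 0" by (simp add: lborel_prod)
  then show "AE p in (lborel :: (real \<times> real) measure). fst p \<noteq> c"
    by (intro AE_I[of _ _ "{c} \<times> UNIV"]) (auto simp: borel_prod[symmetric])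
  have "emeasure (lborel \<Otimes>\<^sub>M lborel) ((UNIV :: real set) \<times> {c}) = emeasure (lborel :: real measure) UNIV * emeasure lborel {c}"
    by (rule lborel.emeasure_pair_measure_Times) auto
  then have "emeasure lborel ((UNIV :: real set) \<times> {c}) = 0" by (simp add: lborel_prod)
  then show "AE p in (lborel :: (real \<times> real) measure). snd p \<noteq> c"
    by (intro AE_I[of _ _ "UNIV \<times> {c}"]) (auto simp: borel_prod[symmetric])
qed

text \<open>
  Integration along the lines \<open>y + t = s\<close>, which are the cross sections of the arm in strip coordinates.
\<close>

lemma nn_integral_diagonal:
  fixes F :: "real \<times> real \<Rightarrow> ennreal"
  assumes [measurable]: "F \<in> borel_measurable borel"
  shows "(\<integral>\<^sup>+p. F p \<partial>lborel) = (\<integral>\<^sup>+s. \<integral>\<^sup>+t. F (s - t, t) \<partial>lborel \<partial>lborel)"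
proof -
  have [measurable]: "F \<in> borel_measurable (borel \<Otimes>\<^sub>M borel)" using assms by (simp add: borel_prod)
  have "(\<integral>\<^sup>+p. F p \<partial>lborel) = (\<integral>\<^sup>+t. \<integral>\<^sup>+y. F (y, t) \<partial>lborel \<partial>lborel)"
    by (rule nn_integral_plane) simp
  also have "\<dots> = (\<integral>\<^sup>+t. \<integral>\<^sup>+s. F (s - t, t) \<partial>lborel \<partial>lborel)"
  proof (rule nn_integral_cong)
    fix t :: real
    have "(\<integral>\<^sup>+y. F (y, t) \<partial>lborel) = ennreal \<bar>1\<bar> * (\<integral>\<^sup>+s. F (- t + 1 * s, t) \<partial>lborel)"
      by (intro nn_integral_real_affine) auto
    then show "(\<integral>\<^sup>+y. F (y, t) \<partial>lborel) = (\<integral>\<^sup>+s. F (s - t, t) \<partial>lborel)" by simp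
  qed
  also have "\<dots> = (\<integral>\<^sup>+s. \<integral>\<^sup>+t. F (s - t, t) \<partial>lborel \<partial>lborel)"
    by (rule lborel_pair.Fubini') measurable
  finally show ?thesis .
qed

text \<open>
  The cross sections \<open>y + t = s\<close> with \<open>s \<ge> 1\<close> run through the half strip from one boundary line to the
  other and make up \<open>far_part\<close>. The points of the half strip left over are contained in the unit square.
\<close>

definition half_strip :: "(real \<times> real) set" where "half_strip = {0..} \<times> {0..<1}"
definition far_part :: "(real \<times> real) set" where "far_part = {(y, t). 1 \<le> y + t \<and> 0 \<le> t \<and> t < 1}"

lemma half_strip_borel [measurable]: "half_strip \<in> sets borel"
  unfolding half_strip_def by (simp add: borel_prod[symmetric])

lemma far_part_borel [measurable]: "far_part \<in> sets borel"
proof -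
  have "{p \<in> space (borel \<Otimes>\<^sub>M borel). 1 \<le> fst p + snd p \<and> 0 \<le> snd p \<and> snd p < (1::real)} \<in> sets (borel \<Otimes>\<^sub>M borel)"
    by measurable
  also have "{p \<in> space (borel \<Otimes>\<^sub>M borel). 1 \<le> fst p + snd p \<and> 0 \<le> snd p \<and> snd p < (1::real)} = far_part"
    by (auto simp: far_part_def space_pair_measure)
  finally show ?thesis unfolding borel_prod .
qed

lemma borel_Ico: "{0..<1::real} \<in> sets borel" by simp

lemma sqint_half_open: "sqint {0..<1::real} f = sqint {0..1} f"
  by (simp add: sqint_eq, rule nn_integral_cong_AE, rule AE_mp[OF AE_lborel_singleton[of 1]], auto split: split_indicator)

text \<open>
  The vector \<open>B - A\<close> is the direction of the cross sections, and its norm one means that they have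
  length one. On each of them the one-dimensional inequality applies.
\<close>

lemma far_estimate:
  assumes C: "C \<ge> 0"
    "\<And>f f'. (\<And>t. (f has_vector_derivative f' t) (at t)) \<Longrightarrow> continuous_on UNIV f' \<Longrightarrow>
       ennreal (k\<^sup>2) * sqint {0..1} f \<le> sqint {0..1} f' + ennreal (C * ((norm (f 0))\<^sup>2 + (norm (f (1::real)))\<^sup>2))"
    and AB: "norm (B - A) = 1" and phi: "\<phi> \<in> smooth_compact_support"
  shows "ennreal (k\<^sup>2) * (\<integral>\<^sup>+q. ennreal ((norm (\<phi> (strip_point A B q)))\<^sup>2) * indicator far_part q \<partial>lborel)
    \<le> (\<integral>\<^sup>+q. ennreal (grad_sq \<phi> (strip_point A B q)) * indicator far_part q \<partial>lborel)
      + ennreal C * ((\<integral>\<^sup>+y. ennreal ((norm (\<phi> (y *\<^sub>R A)))\<^sup>2) * indicator {0..} y \<partial>lborel)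
        + (\<integral>\<^sup>+y. ennreal ((norm (\<phi> (y *\<^sub>R A + B)))\<^sup>2) * indicator {0..} y \<partial>lborel))"
proof -
  note [measurable] = smooth_measurable[OF phi] grad_sq_measurable[OF phi]
  have cA: "(\<lambda>y. y *\<^sub>R A + c) \<in> borel_measurable borel" for c :: "real \<times> real"
    by (intro borel_measurable_continuous_onI continuous_intros)
  note [measurable] = cA[of 0, simplified] cA[of B]
  have pt: "strip_point A B (s - t, t) = s *\<^sub>R A + t *\<^sub>R (B - A)" for s t
    by (simp add: strip_point_def algebra_simps)
  have ind: "indicator far_part (s - t, t) = (indicator {1..} s * indicator {0..<1} t :: ennreal)" for s t
    by (auto simp: far_part_def indicator_def)
  have fibre: "ennreal (k\<^sup>2) * (\<integral>\<^sup>+t. ennreal ((norm (\<phi> (s *\<^sub>R A + t *\<^sub>R (B - A))))\<^sup>2) * indicator {0..<1} t \<partial>lborel)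
      \<le> (\<integral>\<^sup>+t. ennreal (grad_sq \<phi> (s *\<^sub>R A + t *\<^sub>R (B - A))) * indicator {0..<1} t \<partial>lborel)
        + (ennreal C * ennreal ((norm (\<phi> (s *\<^sub>R A)))\<^sup>2) + ennreal C * ennreal ((norm (\<phi> ((s - 1) *\<^sub>R A + B)))\<^sup>2))" for s
  proof -
    let ?f = "\<lambda>t. \<phi> (s *\<^sub>R A + t *\<^sub>R (B - A))"
    let ?f' = "\<lambda>t. dpartial (B - A) \<phi> (s *\<^sub>R A + t *\<^sub>R (B - A))"
    have "continuous_on UNIV ?f'"
      by (rule continuous_on_compose2[OF smooth_continuous[OF dpartial_smooth[OF phi], of UNIV]]) (auto intro!: continuous_intros)
    then have "ennreal (k\<^sup>2) * sqint {0..1} ?f \<le> sqint {0..1} ?f' + ennreal (C * ((norm (?f 0))\<^sup>2 + (norm (?f 1))\<^sup>2))"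
      by (intro C(2) smooth_directional[OF phi])
    also have "sqint {0..1} ?f' \<le> (\<integral>\<^sup>+t. ennreal (grad_sq \<phi> (s *\<^sub>R A + t *\<^sub>R (B - A))) * indicator {0..<1} t \<partial>lborel)"
      unfolding sqint_half_open[symmetric] sqint_eq[OF borel_Ico]
      using dpartial_le_grad[OF phi, where v = "B - A"] AB
      by (intro nn_integral_mono mult_right_mono ennreal_leI) auto
    finally show ?thesis
      using C(1) by (simp add: sqint_half_open[symmetric] sqint_eq distrib_left ennreal_plus ennreal_mult algebra_simps add_right_mono)
  qed
  have far: "(\<integral>\<^sup>+q. ennreal (g (strip_point A B q)) * indicator far_part q \<partial>lborel)
     = (\<integral>\<^sup>+s. (\<integral>\<^sup>+t. ennreal (g (s *\<^sub>R A + t *\<^sub>R (B - A))) * indicator {0..<1} t \<partial>lborel) * indicator {1..} s \<partial>lborel)"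
    if [measurable]: "g \<in> borel_measurable borel" for g
  proof -
    have [measurable]: "(\<lambda>t. g (s *\<^sub>R A + t *\<^sub>R (B - A))) \<in> borel_measurable borel" for s
      by (rule measurable_compose[OF _ that]) (intro borel_measurable_continuous_onI continuous_intros)
    have "(\<integral>\<^sup>+q. ennreal (g (strip_point A B q)) * indicator far_part q \<partial>lborel)
       = (\<integral>\<^sup>+s. \<integral>\<^sup>+t. ennreal (g (strip_point A B (s - t, t))) * indicator far_part (s - t, t) \<partial>lborel \<partial>lborel)"
      by (rule nn_integral_diagonal) measurable
    also have "\<dots> = (\<integral>\<^sup>+s. \<integral>\<^sup>+t. (ennreal (g (s *\<^sub>R A + t *\<^sub>R (B - A))) * indicator {0..<1} t) * indicator {1..} s \<partial>lborel \<partial>lborel)"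
      unfolding pt ind by (simp add: mult_ac)
    finally show ?thesis by (simp add: nn_integral_multc)
  qed
  have fubm: "(\<lambda>s. \<integral>\<^sup>+t. ennreal (g (s *\<^sub>R A + t *\<^sub>R (B - A))) * indicator {0..<1} t \<partial>lborel) \<in> borel_measurable borel"
    if [measurable]: "g \<in> borel_measurable borel" for g
  proof -
    have [measurable]: "(\<lambda>p. fst p *\<^sub>R A + snd p *\<^sub>R (B - A)) \<in> (borel \<Otimes>\<^sub>M borel) \<rightarrow>\<^sub>M borel"
      unfolding borel_prod by (intro borel_measurable_continuous_onI continuous_intros)
    have "case_prod (\<lambda>s t. ennreal (g (fst (s, t) *\<^sub>R A + snd (s, t) *\<^sub>R (B - A))) * indicator {0..<1} t) \<in> borel_measurable (borel \<Otimes>\<^sub>M lborel)"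
      unfolding case_prod_unfold prod.collapse by measurable
    then show ?thesis using lborel.borel_measurable_nn_integral by fastforce
  qed
  let ?a = "\<lambda>s. \<integral>\<^sup>+t. ennreal ((norm (\<phi> (s *\<^sub>R A + t *\<^sub>R (B - A))))\<^sup>2) * indicator {0..<1} t \<partial>lborel"
  let ?b = "\<lambda>s. \<integral>\<^sup>+t. ennreal (grad_sq \<phi> (s *\<^sub>R A + t *\<^sub>R (B - A))) * indicator {0..<1} t \<partial>lborel"
  have [measurable]: "?a \<in> borel_measurable borel" "?b \<in> borel_measurable borel"
    by (rule fubm, measurable)+
  have sA: "(\<lambda>s. (s - 1) *\<^sub>R A + B) \<in> borel_measurable borel"
    by (intro borel_measurable_continuous_onI continuous_intros)
  note [measurable] = sA
  have "ennreal (k\<^sup>2) * (\<integral>\<^sup>+q. ennreal ((norm (\<phi> (strip_point A B q)))\<^sup>2) * indicator far_part q \<partial>lborel)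
     = (\<integral>\<^sup>+s. (ennreal (k\<^sup>2) * ?a s) * indicator {1..} s \<partial>lborel)"
    by (subst far) (simp_all add: nn_integral_cmult mult.assoc)
  also have "\<dots> \<le> (\<integral>\<^sup>+s. (?b s + (ennreal C * ennreal ((norm (\<phi> (s *\<^sub>R A)))\<^sup>2) + ennreal C * ennreal ((norm (\<phi> ((s - 1) *\<^sub>R A + B)))\<^sup>2))) * indicator {1..} s \<partial>lborel)"
    using fibre by (intro nn_integral_mono mult_right_mono) auto
  also have "\<dots> = (\<integral>\<^sup>+s. ?b s * indicator {1..} s + (ennreal C * (ennreal ((norm (\<phi> (s *\<^sub>R A)))\<^sup>2) * indicator {1..} s) + ennreal C * (ennreal ((norm (\<phi> ((s - 1) *\<^sub>R A + B)))\<^sup>2) * indicator {1..} s)) \<partial>lborel)"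
    by (simp add: distrib_right mult.assoc)
  also have "\<dots> = (\<integral>\<^sup>+s. ?b s * indicator {1..} s \<partial>lborel)
      + (ennreal C * (\<integral>\<^sup>+s. ennreal ((norm (\<phi> (s *\<^sub>R A)))\<^sup>2) * indicator {1..} s \<partial>lborel)
       + ennreal C * (\<integral>\<^sup>+s. ennreal ((norm (\<phi> ((s - 1) *\<^sub>R A + B)))\<^sup>2) * indicator {1..} s \<partial>lborel))"
    by (subst nn_integral_add, simp, simp, subst nn_integral_add, simp, simp) (simp add: nn_integral_cmult)
  also have "(\<integral>\<^sup>+s. ?b s * indicator {1..} s \<partial>lborel) = (\<integral>\<^sup>+q. ennreal (grad_sq \<phi> (strip_point A B q)) * indicator far_part q \<partial>lborel)"
    by (rule far[symmetric]) simp
  also have "(\<integral>\<^sup>+s. ennreal ((norm (\<phi> ((s - 1) *\<^sub>R A + B)))\<^sup>2) * indicator {1..} s \<partial>lborel)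
      = (\<integral>\<^sup>+y. ennreal ((norm (\<phi> (y *\<^sub>R A + B)))\<^sup>2) * indicator {0..} y \<partial>lborel)"
  proof -
    have "(\<integral>\<^sup>+s. ennreal ((norm (\<phi> ((s - 1) *\<^sub>R A + B)))\<^sup>2) * indicator {1..} s \<partial>lborel)
       = ennreal \<bar>1\<bar> * (\<integral>\<^sup>+y. ennreal ((norm (\<phi> ((1 + 1 * y - 1) *\<^sub>R A + B)))\<^sup>2) * indicator {1..} (1 + 1 * y) \<partial>lborel)"
      by (intro nn_integral_real_affine) auto
    also have "\<dots> = (\<integral>\<^sup>+y. ennreal ((norm (\<phi> (y *\<^sub>R A + B)))\<^sup>2) * indicator {0..} y \<partial>lborel)"
      by (simp add: indicator_def)
    finally show ?thesis .
  qed
  finally have main: "ennreal (k\<^sup>2) * (\<integral>\<^sup>+q. ennreal ((norm (\<phi> (strip_point A B q)))\<^sup>2) * indicator far_part q \<partial>lborel)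
    \<le> (\<integral>\<^sup>+q. ennreal (grad_sq \<phi> (strip_point A B q)) * indicator far_part q \<partial>lborel)
      + (ennreal C * (\<integral>\<^sup>+s. ennreal ((norm (\<phi> (s *\<^sub>R A)))\<^sup>2) * indicator {1..} s \<partial>lborel)
       + ennreal C * (\<integral>\<^sup>+y. ennreal ((norm (\<phi> (y *\<^sub>R A + B)))\<^sup>2) * indicator {0..} y \<partial>lborel))" .
  have "(\<integral>\<^sup>+s. ennreal ((norm (\<phi> (s *\<^sub>R A)))\<^sup>2) * indicator {1..} s \<partial>lborel)
      \<le> (\<integral>\<^sup>+y. ennreal ((norm (\<phi> (y *\<^sub>R A)))\<^sup>2) * indicator {0..} y \<partial>lborel)"
    by (intro nn_integral_mono mult_left_mono) (auto split: split_indicator)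
  then show ?thesis
    by (intro order_trans[OF main]) (simp add: distrib_left add_left_mono add_right_mono mult_left_mono)
qed

lemma sum_indicator_intervals:
  assumes "h > 0"
  shows "(\<Sum>i<n. indicator {real i * h..<real i * h + h} x) = (indicator {0..<real n * h} x :: ennreal)"
proof (induction n)
  case (Suc n)
  have "0 \<le> real n * h" using assms by simp
  then have "0 \<le> x" if "real n * h \<le> x" using that by (rule order_trans)
  moreover have "real (Suc n) * h = real n * h + h" by (simp add: algebra_simps)
  ultimately have "indicator {0..<real n * h} x + indicator {real n * h..<real n * h + h} x = (indicator {0..<real (Suc n) * h} x :: ennreal)"
    using assms by (auto split: split_indicator)
  then show ?case using Suc by simp
qed simp

definition cell :: "nat \<Rightarrow> nat \<Rightarrow> nat \<Rightarrow> (real \<times> real) set" where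
  "cell n i j = {real i * (1 / real n)..<real i * (1 / real n) + 1 / real n} \<times> {real j * (1 / real n)..<real j * (1 / real n) + 1 / real n}"

lemma cell_borel [measurable]: "cell n i j \<in> sets borel"
  unfolding cell_def by (simp add: borel_prod[symmetric])

lemma sqint_cells:
  assumes "n \<ge> 1" "f \<in> borel_measurable borel"
  shows "(\<Sum>i<n. \<Sum>j<n. sqint (cell n i j) f) = sqint ({0..<1} \<times> {0..<1}) f"
proof -
  have U: "{0..<1} \<times> {0..<1} \<in> sets (borel :: (real \<times> real) measure)" by (simp add: borel_prod[symmetric])
  note [measurable] = assms(2)
  have "(\<Sum>i<n. \<Sum>j<n. sqint (cell n i j) f) = (\<integral>\<^sup>+p. (\<Sum>i<n. \<Sum>j<n. ennreal ((norm (f p))\<^sup>2) * indicator (cell n i j) p) \<partial>lborel)"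
    unfolding sqint_eq[OF cell_borel] by (subst nn_integral_sum, measurable, intro sum.cong refl nn_integral_sum[symmetric], measurable)
  also have "\<dots> = (\<integral>\<^sup>+p. ennreal ((norm (f p))\<^sup>2) * indicator ({0..<1} \<times> {0..<1}) p \<partial>lborel)"
  proof (rule nn_integral_cong)
    fix p :: "real \<times> real"
    obtain y t where p: "p = (y, t)" by fastforce
    define h where "h = 1 / real n"
    have h: "h > 0" "real n * h = 1" using assms(1) by (auto simp: h_def)
    have "indicator (cell n i j) p = (indicator {real i * h..<real i * h + h} y * indicator {real j * h..<real j * h + h} t :: ennreal)" for i j
      by (auto simp: p cell_def h_def indicator_def)
    then have "(\<Sum>i<n. \<Sum>j<n. ennreal ((norm (f p))\<^sup>2) * indicator (cell n i j) p)
       = ennreal ((norm (f p))\<^sup>2) * ((\<Sum>i<n. indicator {real i * h..<real i * h + h} y) * (\<Sum>j<n. indicator {real j * h..<real j * h + h} t))"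
      by (simp only: sum_product) (simp only: sum_distrib_left)
    also have "\<dots> = ennreal ((norm (f p))\<^sup>2) * indicator ({0..<1} \<times> {0..<1}) p"
      unfolding sum_indicator_intervals[OF h(1)] h(2) by (auto simp: p indicator_def)
    finally show "(\<Sum>i<n. \<Sum>j<n. ennreal ((norm (f p))\<^sup>2) * indicator (cell n i j) p) = ennreal ((norm (f p))\<^sup>2) * indicator ({0..<1} \<times> {0..<1}) p" .
  qed
  finally show ?thesis by (simp add: sqint_eq[OF U])
qed

text \<open>
  On a cell of side \<open>1 / n\<close> the constant in Poincare's inequality is of order \<open>1 / n\<^sup>2\<close>, at the expense of
  the mean value over that cell.
\<close>

lemma near_estimate:
  assumes n: "n \<ge> 1" and phi: "\<phi> \<in> smooth_compact_support"
    and K: "(norm A)\<^sup>2 + (norm B)\<^sup>2 \<le> K"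
  shows "sqint ({0..<1} \<times> {0..<1}) (\<lambda>q. \<phi> (strip_point A B q))
    \<le> ennreal (4 / (real n)\<^sup>2 * K) * (\<integral>\<^sup>+q. ennreal (grad_sq \<phi> (strip_point A B q)) * indicator ({0..<1} \<times> {0..<1}) q \<partial>lborel)
      + ennreal (2 * (real n)\<^sup>2) * (\<Sum>i<n. \<Sum>j<n. ennreal ((norm (\<integral>q. \<phi> (strip_point A B q) \<partial>leb (cell n i j)))\<^sup>2))"
proof -
  define h where "h = 1 / real n"
  have h: "h > 0" using n by (simp add: h_def)
  define w wy wt where "w = (\<lambda>q. \<phi> (strip_point A B q))" and "wy = (\<lambda>q. dpartial A \<phi> (strip_point A B q))"
    and "wt = (\<lambda>q. dpartial B \<phi> (strip_point A B q))"
  have comp: "continuous_on UNIV (\<lambda>q. f (strip_point A B q))" if "f \<in> smooth_compact_support" for f :: "real \<times> real \<Rightarrow> complex"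
    by (rule continuous_on_compose2[OF smooth_continuous[OF that, of UNIV] strip_point_continuous]) auto
  have c: "continuous_on UNIV w" "continuous_on UNIV wy" "continuous_on UNIV wt"
    unfolding w_def wy_def wt_def by (intro comp phi dpartial_smooth)+
  have m: "w \<in> borel_measurable borel" "wy \<in> borel_measurable borel" "wt \<in> borel_measurable borel"
    using c by (auto intro: borel_measurable_continuous_onI)
  note [measurable] = m grad_sq_measurable[OF phi]
  have dy: "((\<lambda>y. w (y, t)) has_vector_derivative wy (y, t)) (at y)" for y t
    using smooth_directional[OF phi, of "t *\<^sub>R B" A y] by (simp add: w_def wy_def strip_point_def add.commute)
  have dt: "((\<lambda>t. w (y, t)) has_vector_derivative wt (y, t)) (at t)" for y t
    using smooth_directional[OF phi, of "y *\<^sub>R A" B t] by (simp add: w_def wt_def strip_point_def)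
  let ?U = "{0..<1} \<times> {0..<1} :: (real \<times> real) set"
  have U: "?U \<in> sets borel" by (simp add: borel_prod[symmetric])
  have "sqint ?U w = (\<Sum>i<n. \<Sum>j<n. sqint (cell n i j) w)" using sqint_cells[OF n m(1)] by simp
  also have "\<dots> \<le> (\<Sum>i<n. \<Sum>j<n. ennreal (4 * h\<^sup>2) * (sqint (cell n i j) wy + sqint (cell n i j) wt)
      + ennreal (2 / h\<^sup>2) * ennreal ((norm (\<integral>p. w p \<partial>leb (cell n i j)))\<^sup>2))"
    by (intro sum_mono Poincare_square[OF h dy dt c]) (simp add: cell_def h_def)
  also have "\<dots> = ennreal (4 * h\<^sup>2) * ((\<Sum>i<n. \<Sum>j<n. sqint (cell n i j) wy) + (\<Sum>i<n. \<Sum>j<n. sqint (cell n i j) wt))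
      + ennreal (2 / h\<^sup>2) * (\<Sum>i<n. \<Sum>j<n. ennreal ((norm (\<integral>p. w p \<partial>leb (cell n i j)))\<^sup>2))"
    by (simp only: sum.distrib sum_distrib_left distrib_left)
  also have "(\<Sum>i<n. \<Sum>j<n. sqint (cell n i j) wy) = sqint ?U wy" by (rule sqint_cells[OF n m(2)])
  also have "(\<Sum>i<n. \<Sum>j<n. sqint (cell n i j) wt) = sqint ?U wt" by (rule sqint_cells[OF n m(3)])
  finally have 1: "sqint ?U w \<le> ennreal (4 * h\<^sup>2) * (sqint ?U wy + sqint ?U wt)
      + ennreal (2 / h\<^sup>2) * (\<Sum>i<n. \<Sum>j<n. ennreal ((norm (\<integral>p. w p \<partial>leb (cell n i j)))\<^sup>2))" .
  have "sqint ?U wy + sqint ?U wt = (\<integral>\<^sup>+q. (ennreal ((norm (wy q))\<^sup>2) + ennreal ((norm (wt q))\<^sup>2)) * indicator ?U q \<partial>lborel)"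
    unfolding sqint_eq[OF U] using U by (subst nn_integral_add[symmetric]) (auto simp: distrib_right)
  also have "\<dots> \<le> (\<integral>\<^sup>+q. ennreal K * (ennreal (grad_sq \<phi> (strip_point A B q)) * indicator ?U q) \<partial>lborel)"
  proof (intro nn_integral_mono)
    fix q
    have "(norm (wy q))\<^sup>2 + (norm (wt q))\<^sup>2 \<le> ((norm A)\<^sup>2 + (norm B)\<^sup>2) * grad_sq \<phi> (strip_point A B q)"
      unfolding distrib_right wy_def wt_def by (intro add_mono dpartial_le_grad phi)
    also have "\<dots> \<le> K * grad_sq \<phi> (strip_point A B q)" by (intro mult_right_mono K grad_sq_nonneg)
    finally have "ennreal ((norm (wy q))\<^sup>2 + (norm (wt q))\<^sup>2) \<le> ennreal (K * grad_sq \<phi> (strip_point A B q))" by (rule ennreal_leI)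
    moreover have "K \<ge> 0" using K by (smt (verit) zero_le_power2)
    ultimately show "(ennreal ((norm (wy q))\<^sup>2) + ennreal ((norm (wt q))\<^sup>2)) * indicator ?U q
       \<le> ennreal K * (ennreal (grad_sq \<phi> (strip_point A B q)) * indicator ?U q)"
      by (auto simp: ennreal_mult grad_sq_nonneg split: split_indicator)
  qed
  also have "\<dots> = ennreal K * (\<integral>\<^sup>+q. ennreal (grad_sq \<phi> (strip_point A B q)) * indicator ?U q \<partial>lborel)"
    using U by (intro nn_integral_cmult) auto
  finally have 2: "sqint ?U wy + sqint ?U wt \<le> ennreal K * (\<integral>\<^sup>+q. ennreal (grad_sq \<phi> (strip_point A B q)) * indicator ?U q \<partial>lborel)" .
  have K0: "K \<ge> 0" using K by (smt (verit) zero_le_power2)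
  have "sqint ?U w \<le> ennreal (4 * h\<^sup>2) * (ennreal K * (\<integral>\<^sup>+q. ennreal (grad_sq \<phi> (strip_point A B q)) * indicator ?U q \<partial>lborel))
      + ennreal (2 / h\<^sup>2) * (\<Sum>i<n. \<Sum>j<n. ennreal ((norm (\<integral>p. w p \<partial>leb (cell n i j)))\<^sup>2))"
    by (rule order_trans[OF 1]) (intro add_right_mono mult_left_mono 2, simp)
  then show ?thesis using K0
    by (simp add: w_def h_def power_divide mult.assoc[symmetric] ennreal_mult[symmetric])
qed

text \<open>
  The unit square and the far part overlap, so the energy is divided between them: the square receives
  the fraction \<open>d\<close>, which is enough if the cells are small, and the far part receives the fraction
  \<open>1 - d\<close>, which is enough because its constant \<open>k\<^sup>2\<close> exceeds \<open>c\<close>.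
\<close>

lemma half_strip_estimate:
  assumes c: "c < pi\<^sup>2" and K: "K \<ge> 0"
  obtains n :: nat and C :: real where "n \<ge> 1" "C \<ge> 0"
    "\<And>\<phi> A B. \<phi> \<in> smooth_compact_support \<Longrightarrow> norm (B - A) = 1 \<Longrightarrow> (norm A)\<^sup>2 + (norm B)\<^sup>2 \<le> K \<Longrightarrow>
      ennreal c * (\<integral>\<^sup>+q. ennreal ((norm (\<phi> (strip_point A B q)))\<^sup>2) * indicator half_strip q \<partial>lborel)
      \<le> (\<integral>\<^sup>+q. ennreal (grad_sq \<phi> (strip_point A B q)) * indicator half_strip q \<partial>lborel)
        + ennreal C * (\<Sum>i<n. \<Sum>j<n. ennreal ((norm (\<integral>q. \<phi> (strip_point A B q) \<partial>leb (cell n i j)))\<^sup>2))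
        + ennreal C * ((\<integral>\<^sup>+y. ennreal ((norm (\<phi> (y *\<^sub>R A)))\<^sup>2) * indicator {0..} y \<partial>lborel)
          + (\<integral>\<^sup>+y. ennreal ((norm (\<phi> (y *\<^sub>R A + B)))\<^sup>2) * indicator {0..} y \<partial>lborel))"
proof -
  define c' where "c' = max c (pi\<^sup>2 / 2)"
  have c': "c \<le> c'" "0 < c'" "c' < pi\<^sup>2" using c by (auto simp: c'_def less_max_iff_disj)
  define k where "k = sqrt ((c' + pi\<^sup>2) / 2)"
  have k2: "k\<^sup>2 = (c' + pi\<^sup>2) / 2" using c' by (simp add: k_def)
  have k: "0 < k" "k < pi" "c' < k\<^sup>2"
  proof -
    show "0 < k" using c' by (simp add: k_def add_pos_pos)
    have "k < sqrt (pi\<^sup>2)" unfolding k_def using c' by (intro real_sqrt_less_mono) simp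
    then show "k < pi" by simp
    show "c' < k\<^sup>2" using k2 c' by simp
  qed
  define d where "d = 1 - c' / k\<^sup>2"
  have d: "0 < d" "d < 1" "(1 - d) * k\<^sup>2 = c'" using c' k by (auto simp: d_def)
  obtain C0 where C0: "C0 \<ge> 0"
    "\<And>f f'. (\<And>t. (f has_vector_derivative f' t) (at t)) \<Longrightarrow> continuous_on UNIV f' \<Longrightarrow>
       ennreal (k\<^sup>2) * sqint {0..1} f \<le> sqint {0..1} f' + ennreal (C0 * ((norm (f 0))\<^sup>2 + (norm (f (1::real)))\<^sup>2))"
    using Poincare_with_boundary_terms[OF k(1,2)] by blast
  \<comment> \<open>the cells are so small that the square costs only the fraction \<open>d\<close> of the energy\<close>
  obtain n0 :: nat where n0: "real n0 > c' * 4 * K / d" using reals_Archimedean2 by blast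
  define n where "n = Suc n0"
  have n: "n \<ge> 1" by (simp add: n_def)
  have small: "c' * (4 / (real n)\<^sup>2 * K) \<le> d"
  proof -
    have "c' * 4 * K / d \<le> real n" using n0 by (simp add: n_def)
    also have "\<dots> \<le> (real n)\<^sup>2" using n by (simp add: power2_eq_square)
    finally show ?thesis using d n by (simp add: field_simps)
  qed
  define C where "C = c' * (2 * (real n)\<^sup>2) + C0"
  have C: "C \<ge> 0" "c' * (2 * (real n)\<^sup>2) \<le> C" "(1 - d) * C0 \<le> C"
  proof -
    have "(1 - d) * C0 \<le> C0" using C0(1) d by (intro mult_left_le_one_le) auto
    moreover have "c' * (2 * (real n)\<^sup>2) \<ge> 0" using c' by simp
    ultimately show "C \<ge> 0" "c' * (2 * (real n)\<^sup>2) \<le> C" "(1 - d) * C0 \<le> C"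
      using C0(1) by (auto simp: C_def)
  qed
  show thesis
  proof (rule that[OF n C(1)])
    fix \<phi> :: "real \<times> real \<Rightarrow> complex" and A B :: "real \<times> real"
    assume phi: "\<phi> \<in> smooth_compact_support" and AB: "norm (B - A) = 1" and KAB: "(norm A)\<^sup>2 + (norm B)\<^sup>2 \<le> K"
    let ?U = "{0..<1} \<times> {0..<1} :: (real \<times> real) set"
    let ?w = "\<lambda>q. ennreal ((norm (\<phi> (strip_point A B q)))\<^sup>2)"
    let ?g = "\<lambda>q. ennreal (grad_sq \<phi> (strip_point A B q))"
    let ?S = "\<Sum>i<n. \<Sum>j<n. ennreal ((norm (\<integral>q. \<phi> (strip_point A B q) \<partial>leb (cell n i j)))\<^sup>2)"
    let ?b = "(\<integral>\<^sup>+y. ennreal ((norm (\<phi> (y *\<^sub>R A)))\<^sup>2) * indicator {0..} y \<partial>lborel)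
          + (\<integral>\<^sup>+y. ennreal ((norm (\<phi> (y *\<^sub>R A + B)))\<^sup>2) * indicator {0..} y \<partial>lborel)"
    have U[measurable]: "?U \<in> sets borel" by (simp add: borel_prod[symmetric])
    note [measurable] = smooth_measurable[OF phi] grad_sq_measurable[OF phi]
    have sub: "indicator half_strip q \<le> indicator ?U q + (indicator far_part q :: ennreal)" for q
      by (auto simp: half_strip_def far_part_def split: split_indicator)
    have comb: "ennreal d * indicator ?U q + ennreal (1 - d) * indicator far_part q \<le> (indicator half_strip q :: ennreal)" for q
    proof -
      have "ennreal d + ennreal (1 - d) = 1" using d by (simp flip: ennreal_plus)
      then show ?thesis using d
        by (auto simp: half_strip_def far_part_def ennreal_le_1 split: split_indicator)
    qed
    have near: "(\<integral>\<^sup>+q. ?w q * indicator ?U q \<partial>lborel)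
      \<le> ennreal (4 / (real n)\<^sup>2 * K) * (\<integral>\<^sup>+q. ?g q * indicator ?U q \<partial>lborel) + ennreal (2 * (real n)\<^sup>2) * ?S"
      using near_estimate[OF n phi KAB] by (simp only: sqint_eq[OF U])
    have mm: "ennreal x * (ennreal y * z) = ennreal (x * y) * z" if "x \<ge> 0" "y \<ge> 0" for x y z
      using that by (simp add: ennreal_mult mult.assoc)
    have near2: "ennreal c' * (\<integral>\<^sup>+q. ?w q * indicator ?U q \<partial>lborel)
      \<le> ennreal d * (\<integral>\<^sup>+q. ?g q * indicator ?U q \<partial>lborel) + ennreal C * ?S"
    proof -
      have "ennreal c' * (\<integral>\<^sup>+q. ?w q * indicator ?U q \<partial>lborel)
        \<le> ennreal c' * (ennreal (4 / (real n)\<^sup>2 * K) * (\<integral>\<^sup>+q. ?g q * indicator ?U q \<partial>lborel) + ennreal (2 * (real n)\<^sup>2) * ?S)"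
        by (rule mult_left_mono[OF near]) simp
      also have "\<dots> = ennreal (c' * (4 / (real n)\<^sup>2 * K)) * (\<integral>\<^sup>+q. ?g q * indicator ?U q \<partial>lborel) + ennreal (c' * (2 * (real n)\<^sup>2)) * ?S"
        using c' K by (subst distrib_left, subst mm, simp, simp, subst mm) simp_all
      also have "\<dots> \<le> ennreal d * (\<integral>\<^sup>+q. ?g q * indicator ?U q \<partial>lborel) + ennreal C * ?S"
        by (intro add_mono mult_right_mono ennreal_leI small C) auto
      finally show ?thesis .
    qed
    have far2: "ennreal c' * (\<integral>\<^sup>+q. ?w q * indicator far_part q \<partial>lborel)
      \<le> ennreal (1 - d) * (\<integral>\<^sup>+q. ?g q * indicator far_part q \<partial>lborel) + ennreal C * ?b"
    proof -
      have "ennreal c' * (\<integral>\<^sup>+q. ?w q * indicator far_part q \<partial>lborel)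
          = ennreal (1 - d) * (ennreal (k\<^sup>2) * (\<integral>\<^sup>+q. ?w q * indicator far_part q \<partial>lborel))"
        using d by (subst mm) simp_all
      also have "\<dots> \<le> ennreal (1 - d) * ((\<integral>\<^sup>+q. ?g q * indicator far_part q \<partial>lborel) + ennreal C0 * ?b)"
        by (rule mult_left_mono[OF far_estimate[OF C0 AB phi]]) auto
      also have "\<dots> = ennreal (1 - d) * (\<integral>\<^sup>+q. ?g q * indicator far_part q \<partial>lborel) + ennreal ((1 - d) * C0) * ?b"
        using d C0(1) by (subst distrib_left, subst mm) simp_all
      also have "\<dots> \<le> ennreal (1 - d) * (\<integral>\<^sup>+q. ?g q * indicator far_part q \<partial>lborel) + ennreal C * ?b"
        by (intro add_mono order_refl mult_right_mono ennreal_leI C) auto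
      finally show ?thesis .
    qed
    have "ennreal c * (\<integral>\<^sup>+q. ?w q * indicator half_strip q \<partial>lborel)
      \<le> ennreal c' * (\<integral>\<^sup>+q. ?w q * indicator ?U q + ?w q * indicator far_part q \<partial>lborel)"
      unfolding distrib_left[symmetric] using sub
      by (intro mult_mono nn_integral_mono ennreal_leI c') (auto intro: mult_left_mono)
    also have "\<dots> = ennreal c' * (\<integral>\<^sup>+q. ?w q * indicator ?U q \<partial>lborel) + ennreal c' * (\<integral>\<^sup>+q. ?w q * indicator far_part q \<partial>lborel)"
      by (subst nn_integral_add) (auto simp: distrib_left)
    also have "\<dots> \<le> (ennreal d * (\<integral>\<^sup>+q. ?g q * indicator ?U q \<partial>lborel) + ennreal C * ?S)
      + (ennreal (1 - d) * (\<integral>\<^sup>+q. ?g q * indicator far_part q \<partial>lborel) + ennreal C * ?b)"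
      by (intro add_mono near2 far2)
    also have "\<dots> = (\<integral>\<^sup>+q. ?g q * (ennreal d * indicator ?U q + ennreal (1 - d) * indicator far_part q) \<partial>lborel) + ennreal C * ?S + ennreal C * ?b"
    proof -
      have "(\<integral>\<^sup>+q. ?g q * (ennreal d * indicator ?U q + ennreal (1 - d) * indicator far_part q) \<partial>lborel)
        = (\<integral>\<^sup>+q. ennreal d * (?g q * indicator ?U q) + ennreal (1 - d) * (?g q * indicator far_part q) \<partial>lborel)"
        by (simp only: distrib_left mult_ac)
      also have "\<dots> = ennreal d * (\<integral>\<^sup>+q. ?g q * indicator ?U q \<partial>lborel) + ennreal (1 - d) * (\<integral>\<^sup>+q. ?g q * indicator far_part q \<partial>lborel)"
        by (subst nn_integral_add) (auto simp: nn_integral_cmult)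
      finally show ?thesis by (simp only: add_ac)
    qed
    also have "\<dots> \<le> (\<integral>\<^sup>+q. ?g q * indicator half_strip q \<partial>lborel) + ennreal C * ?S + ennreal C * ?b"
      by (intro add_right_mono nn_integral_mono mult_left_mono comb) auto
    finally show "ennreal c * (\<integral>\<^sup>+q. ?w q * indicator half_strip q \<partial>lborel)
      \<le> (\<integral>\<^sup>+q. ?g q * indicator half_strip q \<partial>lborel) + ennreal C * ?S + ennreal C * ?b" .
  qed
qed

section \<open>The broken guide in strip coordinates\<close>

text \<open>
  The vector \<open>A\<close> points along the arm on the side \<open>\<sigma> = \<plusminus> 1\<close> and \<open>B\<close> along the axis of symmetry. The lengths
  are such that \<open>t\<close> in \<open>y A + t B\<close> is the distance from the boundary of the angle and that \<open>B - A\<close> is a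
  unit vector orthogonal to the arm.
\<close>

definition guide_A :: "real \<Rightarrow> real \<Rightarrow> real \<times> real" where
  "guide_A \<theta> \<sigma> = (\<sigma> * cos \<theta>, (cos \<theta>)\<^sup>2 / sin \<theta>)"

definition guide_B :: "real \<Rightarrow> real \<times> real" where
  "guide_B \<theta> = (0, 1 / sin \<theta>)"

locale guide =
  fixes \<theta> :: real
  assumes theta: "0 < \<theta>" "\<theta> < pi / 2"
begin

lemma sin_pos: "sin \<theta> > 0" using theta by (intro sin_gt_zero) auto
lemma cos_pos: "cos \<theta> > 0" using theta by (intro cos_gt_zero) auto

abbreviation "\<Omega> \<equiv> broken_guide \<theta>"
abbreviation "\<Gamma> \<equiv> guide_boundary \<theta>"

abbreviation pt :: "real \<Rightarrow> real \<times> real \<Rightarrow> real \<times> real" where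
  "pt \<sigma> \<equiv> strip_point (guide_A \<theta> \<sigma>) (guide_B \<theta>)"

lemma pt_eq: "pt \<sigma> (y, t) = (\<sigma> * cos \<theta> * y, (t + y * (cos \<theta>)\<^sup>2) / sin \<theta>)"
  by (simp add: strip_point_def guide_A_def guide_B_def add_divide_distrib add.commute mult.commute)

lemma pt_shear: "pt \<sigma> = shear (\<sigma> * cos \<theta>) (1 / sin \<theta>) (\<lambda>y. y * (cos \<theta>)\<^sup>2 / sin \<theta>)"
  by (auto simp: fun_eq_iff pt_eq shear_def add_divide_distrib)

lemma open_guide: "open \<Omega>"
proof -
  have "\<Omega> = (\<lambda>p. snd p * sin \<theta> - \<bar>fst p\<bar> * cos \<theta>) -` {0<..<1}" by (auto simp: broken_guide_def)
  moreover have "open \<dots>" by (intro open_vimage continuous_intros open_greaterThanLessThan)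
  ultimately show ?thesis by simp
qed

lemma guide_borel [measurable]: "\<Omega> \<in> sets borel" using open_guide by auto

lemma norm_guide_BA: "\<bar>\<sigma>\<bar> = 1 \<Longrightarrow> norm (guide_B \<theta> - guide_A \<theta> \<sigma>) = 1"
proof -
  assume s: "\<bar>\<sigma>\<bar> = 1"
  have "(1 - (cos \<theta>)\<^sup>2) / sin \<theta> = sin \<theta>"
    using sin_pos sin_squared_eq[of \<theta>] by (simp add: power2_eq_square field_simps)
  then have "guide_B \<theta> - guide_A \<theta> \<sigma> = (- (\<sigma> * cos \<theta>), sin \<theta>)"
    by (simp add: guide_A_def guide_B_def diff_divide_distrib)
  moreover have "\<sigma>\<^sup>2 = 1" using s by (metis power2_abs one_power2)
  ultimately show ?thesis by (simp add: norm_prod_def power_mult_distrib)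
qed

lemma pt_in_guide: "\<bar>\<sigma>\<bar> = 1 \<Longrightarrow> y \<ge> 0 \<Longrightarrow> pt \<sigma> (y, t) \<in> \<Omega> \<longleftrightarrow> 0 < t \<and> t < 1"
  using sin_pos cos_pos by (simp add: pt_eq broken_guide_def abs_mult power2_eq_square)

lemma half_integral:
  assumes F[measurable]: "F \<in> borel_measurable borel" and s: "\<sigma> = 1 \<or> \<sigma> = -1"
  shows "(\<integral>\<^sup>+p. F p * indicator \<Omega> p * indicator {p. \<sigma> * fst p > 0} p \<partial>lborel)
    = ennreal (cos \<theta> / sin \<theta>) * (\<integral>\<^sup>+q. F (pt \<sigma> q) * indicator half_strip q \<partial>lborel)"
proof -
  have m[measurable]: "{p :: real \<times> real. \<sigma> * fst p > 0} \<in> sets borel"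
    by (intro borel_open open_Collect_less continuous_intros)
  have n0: "\<sigma> * cos \<theta> \<noteq> 0" "1 / sin \<theta> \<noteq> 0" using s sin_pos cos_pos by auto
  have "(\<integral>\<^sup>+p. F p * indicator \<Omega> p * indicator {p. \<sigma> * fst p > 0} p \<partial>lborel)
    = ennreal \<bar>\<sigma> * cos \<theta> * (1 / sin \<theta>)\<bar> * (\<integral>\<^sup>+q. F (pt \<sigma> q) * indicator \<Omega> (pt \<sigma> q) * indicator {p. \<sigma> * fst p > 0} (pt \<sigma> q) \<partial>lborel)"
    unfolding pt_shear by (rule nn_integral_shear) (use n0 in auto)
  also have "\<bar>\<sigma> * cos \<theta> * (1 / sin \<theta>)\<bar> = cos \<theta> / sin \<theta>" using s sin_pos cos_pos by (auto simp: abs_mult)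
  also have "(\<integral>\<^sup>+q. F (pt \<sigma> q) * indicator \<Omega> (pt \<sigma> q) * indicator {p. \<sigma> * fst p > 0} (pt \<sigma> q) \<partial>lborel)
    = (\<integral>\<^sup>+q. F (pt \<sigma> q) * indicator half_strip q \<partial>lborel)"
  proof (rule nn_integral_cong_AE, rule AE_mp[OF AE_plane(1)[of 0]], rule AE_mp[OF AE_plane(2)[of 0]], intro AE_I2 impI)
    fix q :: "real \<times> real" assume q: "snd q \<noteq> 0" "fst q \<noteq> 0"
    obtain y t where yt: "q = (y, t)" by fastforce
    have a: "\<bar>\<sigma>\<bar> = 1" "\<sigma> * \<sigma> = 1" using s by auto
    have "\<sigma> * fst (pt \<sigma> q) = cos \<theta> * y" using a by (simp add: yt pt_eq mult.assoc[symmetric])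
    then have pos: "\<sigma> * fst (pt \<sigma> q) > 0 \<longleftrightarrow> y > 0" using cos_pos by (simp add: zero_less_mult_iff)
    show "F (pt \<sigma> q) * indicator \<Omega> (pt \<sigma> q) * indicator {p. \<sigma> * fst p > 0} (pt \<sigma> q) = F (pt \<sigma> q) * indicator half_strip q"
      using pos pt_in_guide[OF a(1), of y t] q
      by (auto simp: yt half_strip_def indicator_def)
  qed
  finally show ?thesis .
qed

text \<open>
  The two halves of the guide, without the axis of symmetry, which is a null set.
\<close>

lemma guide_integral:
  assumes F[measurable]: "F \<in> borel_measurable borel"
  shows "(\<integral>\<^sup>+p. F p * indicator \<Omega> p \<partial>lborel)
    = ennreal (cos \<theta> / sin \<theta>) * (\<integral>\<^sup>+q. F (pt 1 q) * indicator half_strip q \<partial>lborel)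
    + ennreal (cos \<theta> / sin \<theta>) * (\<integral>\<^sup>+q. F (pt (-1) q) * indicator half_strip q \<partial>lborel)"
proof -
  have m[measurable]: "{p :: real \<times> real. \<sigma> * fst p > 0} \<in> sets borel" for \<sigma>
    by (intro borel_open open_Collect_less continuous_intros)
  have "(\<integral>\<^sup>+p. F p * indicator \<Omega> p \<partial>lborel)
    = (\<integral>\<^sup>+p. F p * indicator \<Omega> p * indicator {p. 1 * fst p > 0} p + F p * indicator \<Omega> p * indicator {p. - 1 * fst p > 0} p \<partial>lborel)"
    by (rule nn_integral_cong_AE, rule AE_mp[OF AE_plane(1)[of 0]], intro AE_I2 impI) (auto split: split_indicator)
  also have "\<dots> = (\<integral>\<^sup>+p. F p * indicator \<Omega> p * indicator {p. 1 * fst p > 0} p \<partial>lborel)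
     + (\<integral>\<^sup>+p. F p * indicator \<Omega> p * indicator {p. - 1 * fst p > 0} p \<partial>lborel)"
    by (rule nn_integral_add) measurable
  finally show ?thesis by (simp only: half_integral[OF F] simp_thms)
qed

lemma boundary_eq:
  assumes g[measurable]: "g \<in> borel_measurable borel"
  shows "boundary_sq_integral \<Gamma> g = ennreal (1 / sin \<theta>) *
    ((\<integral>\<^sup>+x. ennreal ((norm (g (x, \<bar>x\<bar> * cos \<theta> / sin \<theta>)))\<^sup>2) \<partial>lborel)
     + (\<integral>\<^sup>+x. ennreal ((norm (g (x, (\<bar>x\<bar> * cos \<theta> + 1) / sin \<theta>)))\<^sup>2) \<partial>lborel))"
    and "measurable_curves \<Gamma>"
proof -
  define \<gamma> where "\<gamma> = (\<lambda>b x. (x, (\<bar>x\<bar> * cos \<theta> + b) / sin \<theta>))"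
  have cont: "continuous_on UNIV (\<gamma> b)" for b
    unfolding \<gamma>_def using sin_pos by (intro continuous_intros) auto
  have m[measurable]: "\<gamma> b \<in> borel \<rightarrow>\<^sub>M borel" for b by (rule borel_measurable_continuous_onI[OF cont])
  have G: "\<Gamma> = {\<gamma> 0, \<gamma> 1}" by (simp add: guide_boundary_def \<gamma>_def)
  have ne: "\<gamma> 0 \<noteq> \<gamma> 1"
  proof
    assume "\<gamma> 0 = \<gamma> 1"
    then have "snd (\<gamma> 0 0) = snd (\<gamma> 1 0)" by simp
    then show False using sin_pos by (simp add: \<gamma>_def)
  qed
  have speed: "norm (vector_derivative (\<gamma> b) (at x)) = 1 / sin \<theta>" if "x \<noteq> 0" for b x
  proof -
    have "((\<lambda>x. \<bar>x\<bar>) has_real_derivative sgn x) (at x)"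
    proof (cases "x > 0")
      case True
      have "((\<lambda>x. \<bar>x\<bar>) has_real_derivative 1) (at x)"
        by (rule has_field_derivative_transform_within_open[OF DERIV_ident, of "{0<..}"]) (use True in auto)
      then show ?thesis using True by simp
    next
      case False
      have "((\<lambda>x. - x) has_real_derivative - 1) (at x)" by (auto intro!: derivative_eq_intros)
      then have "((\<lambda>x. \<bar>x\<bar>) has_real_derivative - 1) (at x)"
        by (rule has_field_derivative_transform_within_open[of _ _ _ "{..<0}"]) (use False that in auto)
      then show ?thesis using False that by simp
    qed
    then have "((\<lambda>x. (\<bar>x\<bar> * cos \<theta> + b) / sin \<theta>) has_real_derivative sgn x * cos \<theta> / sin \<theta>) (at x)"
      using sin_pos by (auto intro!: derivative_eq_intros)
    then have "(\<gamma> b has_vector_derivative (1, sgn x * cos \<theta> / sin \<theta>)) (at x)"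
      unfolding \<gamma>_def by (intro has_vector_derivative_Pair) (auto simp: has_real_derivative_iff_has_vector_derivative)
    then have "vector_derivative (\<gamma> b) (at x) = (1, sgn x * cos \<theta> / sin \<theta>)" by (rule vector_derivative_at)
    moreover have "(sgn x)\<^sup>2 = 1" using that by (auto simp: sgn_if)
    then have "1 + (sgn x * cos \<theta> / sin \<theta>)\<^sup>2 = (1 / sin \<theta>)\<^sup>2"
      using sin_pos by (simp add: power_divide power_mult_distrib field_simps)
    moreover have "norm (1::real, b) = sqrt (1 + b\<^sup>2)" for b :: real by (simp add: norm_prod_def)
    ultimately show ?thesis using sin_pos by (simp only: real_sqrt_abs) simp
  qed
  have sm[measurable]: "(\<lambda>s. norm (vector_derivative (\<gamma> b) (at s))) \<in> borel_measurable borel" for b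
    by (rule measurable_discrete_difference[of "\<lambda>_. 1 / sin \<theta>" _ _ "{0}"]) (use speed in auto)
  show "measurable_curves \<Gamma>" using m sm by (auto simp: measurable_curves_def G)
  have "(\<integral>\<^sup>+s. ennreal ((norm (g (\<gamma> b s)))\<^sup>2 * norm (vector_derivative (\<gamma> b) (at s))) \<partial>lborel)
     = ennreal (1 / sin \<theta>) * (\<integral>\<^sup>+s. ennreal ((norm (g (\<gamma> b s)))\<^sup>2) \<partial>lborel)" for b
  proof -
    have "(\<integral>\<^sup>+s. ennreal ((norm (g (\<gamma> b s)))\<^sup>2 * norm (vector_derivative (\<gamma> b) (at s))) \<partial>lborel)
       = (\<integral>\<^sup>+s. ennreal (1 / sin \<theta>) * ennreal ((norm (g (\<gamma> b s)))\<^sup>2) \<partial>lborel)"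
      using sin_pos speed
      by (intro nn_integral_cong_AE AE_mp[OF AE_lborel_singleton[of 0] AE_I2]) (auto simp: ennreal_mult[symmetric] mult.commute)
    also have "\<dots> = ennreal (1 / sin \<theta>) * (\<integral>\<^sup>+s. ennreal ((norm (g (\<gamma> b s)))\<^sup>2) \<partial>lborel)"
      by (rule nn_integral_cmult) measurable
    finally show ?thesis .
  qed
  then show "boundary_sq_integral \<Gamma> g = ennreal (1 / sin \<theta>) *
    ((\<integral>\<^sup>+x. ennreal ((norm (g (x, \<bar>x\<bar> * cos \<theta> / sin \<theta>)))\<^sup>2) \<partial>lborel)
     + (\<integral>\<^sup>+x. ennreal ((norm (g (x, (\<bar>x\<bar> * cos \<theta> + 1) / sin \<theta>)))\<^sup>2) \<partial>lborel))"
    using ne by (simp add: boundary_sq_integral_def G) (simp add: \<gamma>_def distrib_left)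
qed

definition ptinv :: "real \<Rightarrow> real \<times> real \<Rightarrow> real \<times> real" where
  "ptinv \<sigma> p = (fst p / (\<sigma> * cos \<theta>), snd p * sin \<theta> - \<sigma> * fst p * cos \<theta>)"

lemma ptinv_pt: "\<sigma> * \<sigma> = 1 \<Longrightarrow> ptinv \<sigma> (pt \<sigma> q) = q"
proof -
  assume s: "\<sigma> * \<sigma> = 1"
  obtain y t where q: "q = (y, t)" by fastforce
  have "\<sigma> = 1 \<or> \<sigma> = -1" using s by (simp add: square_eq_1_iff)
  then show ?thesis using sin_pos cos_pos by (auto simp: q pt_eq ptinv_def power2_eq_square)
qed

text \<open>
  The \<open>L\<^sub>2\<close> function that represents, up to a constant, the mean value over a cell as a functional on
  functions on the guide.
\<close>

definition cell_test :: "nat \<Rightarrow> real \<Rightarrow> nat \<Rightarrow> nat \<Rightarrow> real \<times> real \<Rightarrow> complex" where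
  "cell_test n \<sigma> i j p = indicator (cell n i j) (ptinv \<sigma> p)"

lemma cell_test_measurable [measurable]: "cell_test n \<sigma> i j \<in> borel_measurable borel"
proof -
  have "continuous_on UNIV (ptinv \<sigma>)" if "\<sigma> \<noteq> 0"
    unfolding ptinv_def[abs_def] using that cos_pos by (intro continuous_intros) auto
  moreover have "continuous_on UNIV (ptinv 0)"
    unfolding ptinv_def[abs_def] by (simp, intro continuous_intros)
  ultimately have [measurable]: "ptinv \<sigma> \<in> borel \<rightarrow>\<^sub>M borel"
    by (cases "\<sigma> = 0") (auto intro: borel_measurable_continuous_onI)
  show ?thesis unfolding cell_test_def[abs_def] by measurable
qed

lemma integral_cell:
  assumes n: "n \<ge> 1" and s: "\<sigma> = 1 \<or> \<sigma> = -1" and phi: "\<phi> \<in> smooth_compact_support"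
    and ij: "i < n" "j < n"
  shows "L2_inner \<Omega> \<phi> (cell_test n \<sigma> i j) = of_real (cos \<theta> / sin \<theta>) * (\<integral>q. \<phi> (pt \<sigma> q) \<partial>leb (cell n i j))"
proof -
  note [measurable] = smooth_measurable[OF phi]
  have n0: "\<sigma> * cos \<theta> \<noteq> 0" "1 / sin \<theta> \<noteq> 0" using s sin_pos cos_pos by auto
  have a: "\<bar>\<sigma>\<bar> = 1" "\<sigma> * \<sigma> = 1" using s by auto
  have ct: "cnj (cell_test n \<sigma> i j p) = cell_test n \<sigma> i j p" for p
    by (simp add: cell_test_def indicator_def)
  have "L2_inner \<Omega> \<phi> (cell_test n \<sigma> i j) = (\<integral>p. indicator \<Omega> p *\<^sub>R (\<phi> p * cell_test n \<sigma> i j p) \<partial>lborel)"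
    by (simp add: L2_inner_def integral_restrict_space ct)
  also have "\<dots> = of_real \<bar>\<sigma> * cos \<theta> * (1 / sin \<theta>)\<bar> * (\<integral>q. indicator \<Omega> (pt \<sigma> q) *\<^sub>R (\<phi> (pt \<sigma> q) * cell_test n \<sigma> i j (pt \<sigma> q)) \<partial>lborel)"
    unfolding pt_shear by (rule integral_shear) (use n0 in auto)
  also have "\<bar>\<sigma> * cos \<theta> * (1 / sin \<theta>)\<bar> = cos \<theta> / sin \<theta>" using s sin_pos cos_pos by (auto simp: abs_mult)
  also have "(\<integral>q. indicator \<Omega> (pt \<sigma> q) *\<^sub>R (\<phi> (pt \<sigma> q) * cell_test n \<sigma> i j (pt \<sigma> q)) \<partial>lborel)
     = (\<integral>q. indicator (cell n i j) q *\<^sub>R \<phi> (pt \<sigma> q) \<partial>lborel)"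
  proof (rule integral_cong_AE)
    show "AE q in lborel. indicator \<Omega> (pt \<sigma> q) *\<^sub>R (\<phi> (pt \<sigma> q) * cell_test n \<sigma> i j (pt \<sigma> q)) = indicator (cell n i j) q *\<^sub>R \<phi> (pt \<sigma> q)"
    proof (rule AE_mp[OF AE_plane(2)[of 0]], intro AE_I2 impI)
      fix q :: "real \<times> real" assume q: "snd q \<noteq> 0"
      obtain y t where yt: "q = (y, t)" by fastforce
      show "indicator \<Omega> (pt \<sigma> q) *\<^sub>R (\<phi> (pt \<sigma> q) * cell_test n \<sigma> i j (pt \<sigma> q)) = indicator (cell n i j) q *\<^sub>R \<phi> (pt \<sigma> q)"
      proof (cases "q \<in> cell n i j")
        case True
        have "y \<ge> 0" "t \<ge> 0" using True by (auto simp: yt cell_def intro: order_trans[rotated])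
        moreover have "t < 1"
        proof -
          have "t < (real j + 1) / real n" using True by (auto simp: yt cell_def add_divide_distrib)
          also have "\<dots> \<le> 1" using ij n by (simp add: divide_le_eq)
          finally show ?thesis .
        qed
        ultimately have "pt \<sigma> q \<in> \<Omega>" using pt_in_guide[OF a(1), of y t] q yt by auto
        then show ?thesis using True by (simp add: cell_test_def ptinv_pt[OF a(2)])
      next
        case False
        then show ?thesis by (simp add: cell_test_def ptinv_pt[OF a(2)])
      qed
    qed
  qed measurable
  also have "\<dots> = (\<integral>q. \<phi> (pt \<sigma> q) \<partial>leb (cell n i j))"
    by (simp add: integral_restrict_space)
  finally show ?thesis .
qed

lemma cell_test_L2:
  assumes s: "\<sigma> = 1 \<or> \<sigma> = -1" and n: "n \<ge> 1"
  shows "cell_test n \<sigma> i j \<in> L2 \<Omega>"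
proof -
  have n0: "\<sigma> * cos \<theta> \<noteq> 0" "1 / sin \<theta> \<noteq> 0" using s sin_pos cos_pos by auto
  have a: "\<sigma> * \<sigma> = 1" using s by auto
  have "sqint \<Omega> (cell_test n \<sigma> i j) \<le> (\<integral>\<^sup>+p. ennreal ((norm (cell_test n \<sigma> i j p))\<^sup>2) \<partial>lborel)"
    by (simp add: sqint_eq) (intro nn_integral_mono, auto split: split_indicator)
  also have "\<dots> = ennreal \<bar>\<sigma> * cos \<theta> * (1 / sin \<theta>)\<bar> * (\<integral>\<^sup>+q. ennreal ((norm (cell_test n \<sigma> i j (pt \<sigma> q)))\<^sup>2) \<partial>lborel)"
    unfolding pt_shear by (rule nn_integral_shear) (use n0 in auto)
  also have "(\<integral>\<^sup>+q. ennreal ((norm (cell_test n \<sigma> i j (pt \<sigma> q)))\<^sup>2) \<partial>lborel) = (\<integral>\<^sup>+q. indicator (cell n i j) q \<partial>lborel)"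
    by (intro nn_integral_cong) (simp add: cell_test_def ptinv_pt[OF a] indicator_def)
  also have "\<dots> = emeasure lborel (cell n i j)" by simp
  also have "\<dots> = ennreal ((1 / real n)\<^sup>2)" unfolding cell_def using n by (intro emeasure_half_open_square) simp
  finally have "sqint \<Omega> (cell_test n \<sigma> i j) < \<infinity>"
    by (rule le_less_trans) (simp add: ennreal_mult_less_top)
  then show ?thesis by (auto simp: L2_iff intro!: measurable_restrict_space1)
qed

lemma boundary_half:
  assumes phi: "\<phi> \<in> smooth_compact_support" and s: "\<sigma> = 1 \<or> \<sigma> = -1"
  shows "ennreal (cos \<theta> / sin \<theta>) * ((\<integral>\<^sup>+y. ennreal ((norm (\<phi> (y *\<^sub>R guide_A \<theta> \<sigma>)))\<^sup>2) * indicator {0..} y \<partial>lborel)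
          + (\<integral>\<^sup>+y. ennreal ((norm (\<phi> (y *\<^sub>R guide_A \<theta> \<sigma> + guide_B \<theta>)))\<^sup>2) * indicator {0..} y \<partial>lborel))
    \<le> boundary_sq_integral \<Gamma> \<phi>"
proof -
  have ms[measurable]: "\<phi> \<in> borel_measurable borel" by (rule smooth_measurable[OF phi])
  define X where "X = (\<lambda>b. \<integral>\<^sup>+x. ennreal ((norm (\<phi> (x, (\<bar>x\<bar> * cos \<theta> + b) / sin \<theta>)))\<^sup>2) \<partial>lborel)"
  have "continuous_on UNIV (\<lambda>x. (x, (\<bar>x\<bar> * cos \<theta> + b) / sin \<theta>))" for b
    using sin_pos by (intro continuous_intros) auto
  then have [measurable]: "(\<lambda>x. (x, (\<bar>x\<bar> * cos \<theta> + b) / sin \<theta>)) \<in> borel \<rightarrow>\<^sub>M borel" for b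
    by (rule borel_measurable_continuous_onI)
  have X: "ennreal (cos \<theta>) * (\<integral>\<^sup>+y. ennreal ((norm (\<phi> (y *\<^sub>R guide_A \<theta> \<sigma> + b *\<^sub>R guide_B \<theta>)))\<^sup>2) * indicator {0..} y \<partial>lborel) \<le> X b" for b
  proof -
    have n0: "\<sigma> * cos \<theta> \<noteq> 0" using s cos_pos by auto
    have mX: "(\<lambda>x. ennreal ((norm (\<phi> (x, (\<bar>x\<bar> * cos \<theta> + b) / sin \<theta>)))\<^sup>2)) \<in> borel_measurable borel" by measurable
    have "ennreal (cos \<theta>) * (\<integral>\<^sup>+y. ennreal ((norm (\<phi> (y *\<^sub>R guide_A \<theta> \<sigma> + b *\<^sub>R guide_B \<theta>)))\<^sup>2) * indicator {0..} y \<partial>lborel)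
      \<le> ennreal \<bar>\<sigma> * cos \<theta>\<bar> * (\<integral>\<^sup>+y. ennreal ((norm (\<phi> (0 + \<sigma> * cos \<theta> * y, (\<bar>0 + \<sigma> * cos \<theta> * y\<bar> * cos \<theta> + b) / sin \<theta>)))\<^sup>2) \<partial>lborel)"
    proof (intro mult_mono nn_integral_mono ennreal_leI)
      show "cos \<theta> \<le> \<bar>\<sigma> * cos \<theta>\<bar>" using s by (auto simp: abs_mult)
      fix y :: real
      have "\<bar>0 + \<sigma> * cos \<theta> * y\<bar> * cos \<theta> = y * (cos \<theta>)\<^sup>2" if "y \<ge> 0"
        using s that cos_pos by (auto simp: abs_mult power2_eq_square)
      then show "ennreal ((norm (\<phi> (y *\<^sub>R guide_A \<theta> \<sigma> + b *\<^sub>R guide_B \<theta>)))\<^sup>2) * indicator {0..} y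
        \<le> ennreal ((norm (\<phi> (0 + \<sigma> * cos \<theta> * y, (\<bar>0 + \<sigma> * cos \<theta> * y\<bar> * cos \<theta> + b) / sin \<theta>)))\<^sup>2)"
        by (auto simp: guide_A_def guide_B_def add_divide_distrib mult.commute split: split_indicator)
    qed auto
    also have "\<dots> = X b" unfolding X_def by (rule nn_integral_real_affine[OF mX n0, symmetric])
    finally show ?thesis .
  qed
  have "ennreal (cos \<theta> / sin \<theta>) = ennreal (1 / sin \<theta>) * ennreal (cos \<theta>)"
    using sin_pos cos_pos by (simp add: ennreal_mult[symmetric])
  moreover have "boundary_sq_integral \<Gamma> \<phi> = ennreal (1 / sin \<theta>) * (X 0 + X 1)"
    using boundary_eq(1)[OF ms] by (simp add: X_def)
  ultimately show ?thesis
    using X[of 0] X[of 1] by (simp add: mult.assoc distrib_left add_mono mult_left_mono)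
qed

text \<open>
  The half strip estimate, added over both arms. The index \<open>(\<sigma>, i, j)\<close> consists of the side and the
  cell. Boundary values appear because smooth functions in the approximation need not vanish there.
\<close>

lemma guide_lower_bound_smooth:
  assumes c: "c < pi\<^sup>2"
  obtains I :: "(real \<times> nat \<times> nat) set" and f and C :: real where "finite I" "C \<ge> 0"
    "\<And>i. i \<in> I \<Longrightarrow> f i \<in> L2 \<Omega>"
    "\<And>\<phi>. \<phi> \<in> smooth_compact_support \<Longrightarrow> ennreal c * sqint \<Omega> \<phi> \<le> (\<Sum>e\<in>Basis. sqint \<Omega> (dpartial e \<phi>))
      + ennreal C * (\<Sum>i\<in>I. ennreal ((norm (L2_inner \<Omega> \<phi> (f i)))\<^sup>2)) + ennreal C * boundary_sq_integral \<Gamma> \<phi>"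
proof -
  define K where "K = (norm (guide_A \<theta> 1))\<^sup>2 + (norm (guide_B \<theta>))\<^sup>2"
  have K: "K \<ge> 0" by (simp add: K_def)
  have K2: "(norm (guide_A \<theta> \<sigma>))\<^sup>2 + (norm (guide_B \<theta>))\<^sup>2 \<le> K" if "\<sigma> = 1 \<or> \<sigma> = -1" for \<sigma>
    using that by (auto simp: K_def guide_A_def norm_prod_def)
  obtain n :: nat and C where n: "n \<ge> 1" and C: "C \<ge> 0" and est:
    "\<And>\<phi> A B. \<phi> \<in> smooth_compact_support \<Longrightarrow> norm (B - A) = 1 \<Longrightarrow> (norm A)\<^sup>2 + (norm B)\<^sup>2 \<le> K \<Longrightarrow>
      ennreal c * (\<integral>\<^sup>+q. ennreal ((norm (\<phi> (strip_point A B q)))\<^sup>2) * indicator half_strip q \<partial>lborel)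
      \<le> (\<integral>\<^sup>+q. ennreal (grad_sq \<phi> (strip_point A B q)) * indicator half_strip q \<partial>lborel)
        + ennreal C * (\<Sum>i<n. \<Sum>j<n. ennreal ((norm (\<integral>q. \<phi> (strip_point A B q) \<partial>leb (cell n i j)))\<^sup>2))
        + ennreal C * ((\<integral>\<^sup>+y. ennreal ((norm (\<phi> (y *\<^sub>R A)))\<^sup>2) * indicator {0..} y \<partial>lborel)
          + (\<integral>\<^sup>+y. ennreal ((norm (\<phi> (y *\<^sub>R A + B)))\<^sup>2) * indicator {0..} y \<partial>lborel))"
    using half_strip_estimate[OF c K] by blast
  define \<kappa> where "\<kappa> = cos \<theta> / sin \<theta>"
  have \<kappa>: "\<kappa> > 0" using sin_pos cos_pos by (simp add: \<kappa>_def)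
  define I where "I = {1, -1 :: real} \<times> {..<n} \<times> {..<n}"
  define f where "f = (\<lambda>(\<sigma>, i, j). cell_test n \<sigma> i j)"
  define C1 where "C1 = 2 * C + C / \<kappa>"
  have C1: "C1 \<ge> 0" "2 * C \<le> C1" "C / \<kappa> \<le> C1" using C \<kappa> by (auto simp: C1_def)
  show thesis
  proof (rule that[of I C1 f])
    show "finite I" by (simp add: I_def)
    show "C1 \<ge> 0" by fact
    show "f i \<in> L2 \<Omega>" if "i \<in> I" for i using that n by (auto simp: I_def f_def cell_test_L2)
    fix \<phi> :: "real \<times> real \<Rightarrow> complex" assume phi: "\<phi> \<in> smooth_compact_support"
    have ms[measurable]: "\<phi> \<in> borel_measurable borel" by (rule smooth_measurable[OF phi])
    note [measurable] = grad_sq_measurable[OF phi] smooth_measurable[OF dpartial_smooth[OF phi]]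
    define W where "W = (\<lambda>\<sigma>. \<integral>\<^sup>+q. ennreal ((norm (\<phi> (pt \<sigma> q)))\<^sup>2) * indicator half_strip q \<partial>lborel)"
    define G where "G = (\<lambda>\<sigma>. \<integral>\<^sup>+q. ennreal (grad_sq \<phi> (pt \<sigma> q)) * indicator half_strip q \<partial>lborel)"
    define S where "S = (\<lambda>\<sigma>. \<Sum>i<n. \<Sum>j<n. ennreal ((norm (L2_inner \<Omega> \<phi> (cell_test n \<sigma> i j)))\<^sup>2))"
    have half: "ennreal \<kappa> * (ennreal c * W \<sigma>) \<le> ennreal \<kappa> * G \<sigma> + ennreal (C / \<kappa>) * S \<sigma> + ennreal C * boundary_sq_integral \<Gamma> \<phi>"
      if s: "\<sigma> = 1 \<or> \<sigma> = -1" for \<sigma>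
    proof -
      define S' where "S' = (\<Sum>i<n. \<Sum>j<n. ennreal ((norm (\<integral>q. \<phi> (pt \<sigma> q) \<partial>leb (cell n i j)))\<^sup>2))"
      define b where "b = (\<integral>\<^sup>+y. ennreal ((norm (\<phi> (y *\<^sub>R guide_A \<theta> \<sigma>)))\<^sup>2) * indicator {0..} y \<partial>lborel)
          + (\<integral>\<^sup>+y. ennreal ((norm (\<phi> (y *\<^sub>R guide_A \<theta> \<sigma> + guide_B \<theta>)))\<^sup>2) * indicator {0..} y \<partial>lborel)"
      have "\<bar>\<sigma>\<bar> = 1" using s by auto
      then have "ennreal c * W \<sigma> \<le> G \<sigma> + ennreal C * S' + ennreal C * b"
        unfolding W_def G_def S'_def b_def using s by (intro est phi norm_guide_BA K2)
      then have "ennreal \<kappa> * (ennreal c * W \<sigma>) \<le> ennreal \<kappa> * (G \<sigma> + ennreal C * S' + ennreal C * b)"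
        by (rule mult_left_mono) simp
      also have "\<dots> = ennreal \<kappa> * G \<sigma> + ennreal C * (ennreal \<kappa> * S') + ennreal C * (ennreal \<kappa> * b)"
        by (simp add: distrib_left mult_ac)
      also have "ennreal \<kappa> * S' = ennreal (1 / \<kappa>) * S \<sigma>"
      proof -
        have "ennreal \<kappa> * ennreal ((norm (\<integral>q. \<phi> (pt \<sigma> q) \<partial>leb (cell n i j)))\<^sup>2)
           = ennreal (1 / \<kappa>) * ennreal ((norm (L2_inner \<Omega> \<phi> (cell_test n \<sigma> i j)))\<^sup>2)" if "i < n" "j < n" for i j
          using \<kappa> integral_cell[OF n s phi that]
          by (simp add: ennreal_mult[symmetric] norm_mult power_mult_distrib \<kappa>_def[symmetric] power2_eq_square)
        then show ?thesis unfolding S'_def S_def sum_distrib_left by (intro sum.cong) auto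
      qed
      also have "ennreal C * (ennreal (1 / \<kappa>) * S \<sigma>) = ennreal (C / \<kappa>) * S \<sigma>"
        using C \<kappa> by (simp add: mult.assoc[symmetric] ennreal_mult[symmetric])
      also have "ennreal \<kappa> * G \<sigma> + ennreal (C / \<kappa>) * S \<sigma> + ennreal C * (ennreal \<kappa> * b)
          \<le> ennreal \<kappa> * G \<sigma> + ennreal (C / \<kappa>) * S \<sigma> + ennreal C * boundary_sq_integral \<Gamma> \<phi>"
        unfolding b_def \<kappa>_def by (intro add_left_mono mult_left_mono boundary_half phi s) simp
      finally show ?thesis .
    qed
    have w: "sqint \<Omega> \<phi> = ennreal \<kappa> * W 1 + ennreal \<kappa> * W (-1)"
      unfolding sqint_eq[OF guide_borel] W_def \<kappa>_def by (rule guide_integral) simp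
    have g: "(\<Sum>e\<in>Basis. sqint \<Omega> (dpartial e \<phi>)) = ennreal \<kappa> * G 1 + ennreal \<kappa> * G (-1)"
    proof -
      have "(\<Sum>e\<in>Basis. sqint \<Omega> (dpartial e \<phi>)) = sqint \<Omega> (dpartial (1, 0) \<phi>) + sqint \<Omega> (dpartial (0, 1) \<phi>)"
        by (simp add: Basis_plane)
      also have "\<dots> = (\<integral>\<^sup>+p. ennreal (grad_sq \<phi> p) * indicator \<Omega> p \<partial>lborel)"
        unfolding sqint_eq[OF guide_borel] grad_sq_def
        by (subst nn_integral_add[symmetric]) (auto simp: ennreal_plus distrib_right)
      also have "\<dots> = ennreal \<kappa> * G 1 + ennreal \<kappa> * G (-1)"
        unfolding G_def \<kappa>_def by (rule guide_integral) simp
      finally show ?thesis .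
    qed
    have SI: "S 1 + S (-1) = (\<Sum>i\<in>I. ennreal ((norm (L2_inner \<Omega> \<phi> (f i)))\<^sup>2))"
    proof -
      have "(\<Sum>i\<in>I. h i) = (\<Sum>\<sigma>\<in>{1, -1}. \<Sum>i<n. \<Sum>j<n. h (\<sigma>, i, j))" for h :: "real \<times> nat \<times> nat \<Rightarrow> ennreal"
        unfolding I_def sum.cartesian_product by (simp add: case_prod_unfold)
      then show ?thesis by (simp add: f_def S_def del: sum_ennreal)
    qed
    have "ennreal c * sqint \<Omega> \<phi> = ennreal \<kappa> * (ennreal c * W 1) + ennreal \<kappa> * (ennreal c * W (-1))"
      unfolding w by (simp add: distrib_left mult.left_commute)
    also have "\<dots> \<le> (ennreal \<kappa> * G 1 + ennreal (C / \<kappa>) * S 1 + ennreal C * boundary_sq_integral \<Gamma> \<phi>)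
       + (ennreal \<kappa> * G (-1) + ennreal (C / \<kappa>) * S (-1) + ennreal C * boundary_sq_integral \<Gamma> \<phi>)"
      by (intro add_mono half) auto
    also have "\<dots> = (\<Sum>e\<in>Basis. sqint \<Omega> (dpartial e \<phi>)) + ennreal (C / \<kappa>) * (\<Sum>i\<in>I. ennreal ((norm (L2_inner \<Omega> \<phi> (f i)))\<^sup>2))
       + ennreal (2 * C) * boundary_sq_integral \<Gamma> \<phi>"
    proof -
      have "ennreal (2 * C) = ennreal C + ennreal C" using C by (simp flip: ennreal_plus)
      then show ?thesis unfolding g SI[symmetric] by (simp only: distrib_left distrib_right add_ac)
    qed
    also have "\<dots> \<le> (\<Sum>e\<in>Basis. sqint \<Omega> (dpartial e \<phi>)) + ennreal C1 * (\<Sum>i\<in>I. ennreal ((norm (L2_inner \<Omega> \<phi> (f i)))\<^sup>2))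
       + ennreal C1 * boundary_sq_integral \<Gamma> \<phi>"
      by (intro add_mono mult_right_mono ennreal_leI C1 order_refl) auto
    finally show "ennreal c * sqint \<Omega> \<phi> \<le> (\<Sum>e\<in>Basis. sqint \<Omega> (dpartial e \<phi>))
      + ennreal C1 * (\<Sum>i\<in>I. ennreal ((norm (L2_inner \<Omega> \<phi> (f i)))\<^sup>2)) + ennreal C1 * boundary_sq_integral \<Gamma> \<phi>" .
  qed
qed

end

section \<open>The lower bound on the form domain\<close>

lemma sqint_tendsto:
  assumes "\<And>n. f n \<in> L2 \<Omega>" "u \<in> L2 \<Omega>" "(\<lambda>n. sqint \<Omega> (\<lambda>x. f n x - u x)) \<longlonglongrightarrow> 0"
  shows "(\<lambda>n. sqint \<Omega> (f n)) \<longlonglongrightarrow> sqint \<Omega> u"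
proof -
  interpret semi_inner cscale "L2 \<Omega>" "L2_inner \<Omega>" by (rule L2_inner_semi_inner)
  have d: "f n - u \<in> L2 \<Omega>" for n using assms by simp
  have "(\<lambda>n. ennreal (Re (L2_inner \<Omega> (f n - u) (f n - u)))) \<longlonglongrightarrow> ennreal 0"
    using assms(3) unfolding L2_inner_self(2)[OF d] by (simp add: fun_diff_def)
  then have "(\<lambda>n. Re (L2_inner \<Omega> (f n - u) (f n - u))) \<longlonglongrightarrow> 0"
    by (subst (asm) tendsto_ennreal_iff) (auto simp: nonneg[OF d])
  then have "(\<lambda>n. Re (L2_inner \<Omega> (f n) (f n))) \<longlonglongrightarrow> Re (L2_inner \<Omega> u u)"
    using assms(1,2) by (intro tendsto_self)
  then have "(\<lambda>n. ennreal (Re (L2_inner \<Omega> (f n) (f n)))) \<longlonglongrightarrow> ennreal (Re (L2_inner \<Omega> u u))"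
    by (rule tendsto_ennrealI)
  then show ?thesis unfolding L2_inner_self(2)[OF assms(1)] L2_inner_self(2)[OF assms(2)] .
qed

context guide
begin

lemma guide_curves: "measurable_curves \<Gamma>"
  by (rule boundary_eq(2)[of "\<lambda>_. 0"]) simp

lemmas semi_inner_guide = semi_inner_H10[OF open_guide guide_curves]

text \<open>
  The estimate for smooth functions, in the limit in which the boundary term disappears. This says
  that the essential spectrum is contained in \<open>[\<pi>\<^sup>2, \<infinity>)\<close>.
\<close>

lemma guide_lower_bound:
  assumes c: "c < pi\<^sup>2"
  obtains I :: "(real \<times> nat \<times> nat) set" and f and C :: real where "finite I" "C \<ge> 0"
    "\<And>i. i \<in> I \<Longrightarrow> f i \<in> L2 \<Omega>"
    "\<And>u. u \<in> H10 \<Omega> \<Gamma> \<Longrightarrow> c * Re (L2_inner \<Omega> u u) \<le> Re (dirichlet_form \<Omega> u u)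
      + C * (\<Sum>i\<in>I. (norm (L2_inner \<Omega> u (f i)))\<^sup>2)"
proof -
  obtain I :: "(real \<times> nat \<times> nat) set" and f and C :: real where I: "finite I" "C \<ge> 0"
    "\<And>i. i \<in> I \<Longrightarrow> f i \<in> L2 \<Omega>" and est:
    "\<And>\<phi>. \<phi> \<in> smooth_compact_support \<Longrightarrow> ennreal c * sqint \<Omega> \<phi> \<le> (\<Sum>e\<in>Basis. sqint \<Omega> (dpartial e \<phi>))
      + ennreal C * (\<Sum>i\<in>I. ennreal ((norm (L2_inner \<Omega> \<phi> (f i)))\<^sup>2)) + ennreal C * boundary_sq_integral \<Gamma> \<phi>"
    by (rule guide_lower_bound_smooth[OF c], rule that)
  have main: "c * Re (L2_inner \<Omega> u u) \<le> Re (dirichlet_form \<Omega> u u) + C * (\<Sum>i\<in>I. (norm (L2_inner \<Omega> u (f i)))\<^sup>2)"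
    if u: "u \<in> H10 \<Omega> \<Gamma>" for u
  proof -
    interpret b: semi_inner cscale "H10 \<Omega> \<Gamma>" "L2_inner \<Omega>" by (rule semi_inner_guide)
    interpret a: semi_inner cscale "H10 \<Omega> \<Gamma>" "dirichlet_form \<Omega>" by (rule semi_inner_guide)
    have nn: "Re (L2_inner \<Omega> u u) \<ge> 0" "Re (dirichlet_form \<Omega> u u) \<ge> 0" "(\<Sum>i\<in>I. (norm (L2_inner \<Omega> u (f i)))\<^sup>2) \<ge> 0"
      using u by (auto intro: a.nonneg b.nonneg sum_nonneg)
    define g where "g = (\<lambda>e. weak_partial \<Omega> e u)"
    have tf: "trace_free \<Omega> \<Gamma> u g" unfolding g_def by (rule H10_imp_trace_free[OF open_guide u])
    have L: "u \<in> L2 \<Omega>" "\<And>e. e \<in> Basis \<Longrightarrow> g e \<in> L2 \<Omega>" using tf by (auto simp: trace_free_def)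
    obtain \<phi> where \<phi>: "\<And>n. \<phi> n \<in> smooth_compact_support"
      "(\<lambda>n. sqint \<Omega> (\<lambda>x. \<phi> n x - u x)) \<longlonglongrightarrow> 0"
      "\<And>e. e \<in> Basis \<Longrightarrow> (\<lambda>n. sqint \<Omega> (\<lambda>x. dpartial e (\<phi> n) x - g e x)) \<longlonglongrightarrow> 0"
      "(\<lambda>n. boundary_sq_integral \<Gamma> (\<phi> n)) \<longlonglongrightarrow> 0"
      by (rule trace_free_sequence[OF tf]) blast
    note sL = smooth_L2[OF \<phi>(1) guide_borel] smooth_L2[OF dpartial_smooth[OF \<phi>(1)] guide_borel]
    have inner: "(\<lambda>n. L2_inner \<Omega> (\<phi> n) (f i)) \<longlonglongrightarrow> L2_inner \<Omega> u (f i)" if "i \<in> I" for i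
      unfolding L2_inner_def by (intro integral_product_limit sL L L2_cnj I(3) that \<phi>(2))
    have "(\<lambda>n. ennreal c * sqint \<Omega> (\<phi> n)) \<longlonglongrightarrow> ennreal c * sqint \<Omega> u"
      by (intro ennreal_tendsto_cmult sqint_tendsto sL L \<phi>(2)) simp
    moreover have "(\<lambda>n. (\<Sum>e\<in>Basis. sqint \<Omega> (dpartial e (\<phi> n)))
      + ennreal C * (\<Sum>i\<in>I. ennreal ((norm (L2_inner \<Omega> (\<phi> n) (f i)))\<^sup>2)) + ennreal C * boundary_sq_integral \<Gamma> (\<phi> n))
      \<longlonglongrightarrow> (\<Sum>e\<in>Basis. sqint \<Omega> (g e)) + ennreal C * (\<Sum>i\<in>I. ennreal ((norm (L2_inner \<Omega> u (f i)))\<^sup>2)) + ennreal C * 0"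
      by (intro tendsto_add ennreal_tendsto_cmult tendsto_sum tendsto_ennrealI tendsto_power tendsto_norm inner
            sqint_tendsto sL L \<phi>(3) \<phi>(4)) auto
    ultimately have "ennreal c * sqint \<Omega> u \<le> (\<Sum>e\<in>Basis. sqint \<Omega> (g e)) + ennreal C * (\<Sum>i\<in>I. ennreal ((norm (L2_inner \<Omega> u (f i)))\<^sup>2)) + ennreal C * 0"
      by (rule LIMSEQ_le) (use est[OF \<phi>(1)] in auto)
    also have "(\<Sum>e\<in>Basis. sqint \<Omega> (g e)) = ennreal (Re (dirichlet_form \<Omega> u u))"
      by (rule dirichlet_form_self[OF open_guide tf, symmetric])
    also have "sqint \<Omega> u = ennreal (Re (L2_inner \<Omega> u u))" by (rule L2_inner_self(2)[OF L(1), symmetric])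
    finally have le: "ennreal c * ennreal (Re (L2_inner \<Omega> u u))
      \<le> ennreal (Re (dirichlet_form \<Omega> u u) + C * (\<Sum>i\<in>I. (norm (L2_inner \<Omega> u (f i)))\<^sup>2))"
      using nn I(2) by (simp add: ennreal_plus ennreal_mult sum_ennreal)
    show ?thesis
    proof (cases "c \<ge> 0")
      case True
      then have "ennreal (c * Re (L2_inner \<Omega> u u)) \<le> ennreal (Re (dirichlet_form \<Omega> u u) + C * (\<Sum>i\<in>I. (norm (L2_inner \<Omega> u (f i)))\<^sup>2))"
        using le nn by (simp add: ennreal_mult)
      then show ?thesis using nn I(2) by (subst (asm) ennreal_le_iff) auto
    next
      case False
      then have "c * Re (L2_inner \<Omega> u u) \<le> 0" using nn by (simp add: mult_nonpos_nonneg)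
      then show ?thesis using nn I(2) by (smt (verit) mult_nonneg_nonneg)
    qed
  qed
  show thesis by (rule that[of I C f]) (use I main in auto)
qed

end

section \<open>Transplantation between guides\<close>

text \<open>
  The chain rule expresses a partial derivative of the composition through compositions of partial
  derivatives of \<open>\<phi>\<close> with the same map, so induction on the order works.
\<close>

lemma k_times_differentiable_shear:
  assumes s: "\<And>x. (s has_real_derivative s' x) (at x)" "\<And>k. real_differentiable k s'"
  shows "(\<And>j. k_times_differentiable j \<phi>) \<Longrightarrow> k_times_differentiable k (\<lambda>p. \<phi> (shear a b (\<lambda>x. c * s x) p))"
proof (induction k arbitrary: \<phi>)
  case (Suc k)
  let ?T = "shear a b (\<lambda>x. c * s x)"
  have d: "(\<phi> has_derivative frechet_derivative \<phi> (at q)) (at q)" for q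
    by (rule k_times_differentiable_Suc_derivative[OF Suc.prems])
  have lin: "linear (frechet_derivative \<phi> (at q))" for q
    using has_derivative_bounded_linear[OF d] by (rule bounded_linear.linear)
  have T: "(?T has_derivative (\<lambda>v. (a * fst v, b * snd v + c * (s' (fst p) * fst v)))) (at p)" for p
  proof -
    have "((\<lambda>p. s (fst p)) has_derivative (\<lambda>v. s' (fst p) * fst v)) (at p)"
      using has_derivative_compose[OF has_derivative_fst[OF has_derivative_ident], of s "\<lambda>v. s' (fst p) * v" p UNIV]
        s(1)[of "fst p"] by (simp add: has_field_derivative_def)
    then show ?thesis unfolding shear_def case_prod_unfold
      by (intro has_derivative_Pair has_derivative_add has_derivative_mult_right has_derivative_fst has_derivative_snd has_derivative_ident)
  qed
  show ?case
  proof (rule k_times_differentiable_SucI[OF has_derivative_compose[OF T d]])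
    fix v :: "real \<times> real"
    have key: "frechet_derivative \<phi> (at q) (x, y) = of_real x * dpartial (1, 0) \<phi> q + of_real y * dpartial (0, 1) \<phi> q" for q x y
    proof -
      have "frechet_derivative \<phi> (at q) (x, y) = frechet_derivative \<phi> (at q) (x *\<^sub>R (1, 0) + y *\<^sub>R (0, 1))" by simp
      also have "\<dots> = of_real x * dpartial (1, 0) \<phi> q + of_real y * dpartial (0, 1) \<phi> q"
        unfolding linear_add[OF lin] linear_scale[OF lin] scaleR_conv_of_real ..
      finally show ?thesis .
    qed
    have e: "(\<lambda>x. frechet_derivative \<phi> (at (?T x)) (a * fst v, b * snd v + c * (s' (fst x) * fst v)))
      = (\<lambda>x. of_real (a * fst v) * dpartial (1, 0) \<phi> (?T x)
          + complex_of_real (b * snd v + c * (s' (fst x) * fst v)) * dpartial (0, 1) \<phi> (?T x))"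
      by (rule ext) (rule key)
    have D: "k_times_differentiable j (dpartial w \<phi>)" for j w
      using Suc.prems[of "Suc j"] unfolding k_times_differentiable.simps by blast
    have "real_differentiable k (\<lambda>x. b * snd v + c * (s' x * fst v))"
      by (rule real_differentiable_add[OF real_differentiable_const real_differentiable_mult[OF real_differentiable_const
            real_differentiable_mult[OF s(2) real_differentiable_const]]])
    then have "k_times_differentiable k (\<lambda>x. complex_of_real (b * snd v + c * (s' (fst x) * fst v)))"
      by (rule k_times_differentiable_of_real_linear[OF bounded_linear_fst])
    from k_times_differentiable_mult[OF this Suc.IH[OF D]]
    show "k_times_differentiable k (\<lambda>x. frechet_derivative \<phi> (at (?T x)) (a * fst v, b * snd v + c * (s' (fst x) * fst v)))"
      unfolding e by (rule k_times_differentiable_add[OF k_times_differentiable_cmult[OF Suc.IH[OF D]]])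
  qed
qed simp

lemma dpartial_shear:
  assumes "\<phi> \<in> smooth_compact_support" and s: "\<And>x. (s has_real_derivative s' x) (at x)"
  shows "dpartial v (\<lambda>p. \<phi> (shear a b (\<lambda>x. c * s x) p)) p
    = of_real (a * fst v) * dpartial (1, 0) \<phi> (shear a b (\<lambda>x. c * s x) p)
      + of_real (b * snd v + c * (s' (fst p) * fst v)) * dpartial (0, 1) \<phi> (shear a b (\<lambda>x. c * s x) p)"
proof -
  let ?T = "shear a b (\<lambda>x. c * s x)"
  have T: "(?T has_derivative (\<lambda>v. (a * fst v, b * snd v + c * (s' (fst p) * fst v)))) (at p)" for p
  proof -
    have "((\<lambda>p. s (fst p)) has_derivative (\<lambda>v. s' (fst p) * fst v)) (at p)"
      using has_derivative_compose[OF has_derivative_fst[OF has_derivative_ident], of s "\<lambda>v. s' (fst p) * v" p UNIV]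
        s(1)[of "fst p"] by (simp add: has_field_derivative_def)
    then show ?thesis unfolding shear_def case_prod_unfold
      by (intro has_derivative_Pair has_derivative_add has_derivative_mult_right has_derivative_fst has_derivative_snd has_derivative_ident)
  qed
  have "dpartial v (\<lambda>p. \<phi> (?T p)) p = dpartial (a * fst v, b * snd v + c * (s' (fst p) * fst v)) \<phi> (?T p)"
    using fun_cong[OF frechet_derivative_at[OF has_derivative_compose[OF T smooth_has_derivative[OF assms(1)]]], of p v] by simp
  also have "\<dots> = of_real (a * fst v) * dpartial (1, 0) \<phi> (?T p) + of_real (b * snd v + c * (s' (fst p) * fst v)) * dpartial (0, 1) \<phi> (?T p)"
    by (subst dpartial_pair[OF assms(1)]) simp
  finally show ?thesis .
qed

text \<open>
  The parameters \<open>ka\<close>, \<open>kb\<close>, \<open>kc\<close> are determined by the requirement that \<open>T\<close> maps each boundary line of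
  the narrower angle to the corresponding one of the wider angle and acts along the arms as a
  contraction composed with a rigid motion. The guides have the same width, so nothing is scaled
  across the arms.
\<close>

locale guide_pair = \<alpha>: guide \<alpha> + \<beta>: guide \<beta> for \<alpha> \<beta> :: real +
  assumes less: "\<alpha> < \<beta>"
begin

definition "ka = cos \<beta> / cos \<alpha>"
definition "kb = sin \<alpha> / sin \<beta>"
definition "kc = (ka * cos \<beta> - cos \<alpha>) / sin \<beta>"

definition T :: "real \<times> real \<Rightarrow> real \<times> real" where "T = shear ka kb (\<lambda>x. kc * \<bar>x\<bar>)"
definition TS :: "nat \<Rightarrow> real \<times> real \<Rightarrow> real \<times> real" where
  "TS m = shear ka kb (\<lambda>x. kc * smooth_abs (1 / real (Suc m)) x)"

lemma ka_pos: "ka > 0" and kb_pos: "kb > 0"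
  using \<alpha>.cos_pos \<beta>.cos_pos \<alpha>.sin_pos \<beta>.sin_pos by (auto simp: ka_def kb_def)

lemma ka_less_1: "ka < 1"
proof -
  have "cos \<beta> < cos \<alpha>" using less \<alpha>.theta \<beta>.theta by (intro cos_monotone_0_pi) auto
  then show ?thesis using \<alpha>.cos_pos by (simp add: ka_def)
qed

lemma T_eq: "T (x, z) = (ka * x, kb * z + kc * \<bar>x\<bar>)" by (simp add: T_def shear_def)

lemma T_measurable [measurable]: "T \<in> borel \<rightarrow>\<^sub>M borel"
  unfolding T_def by (rule shear_measurable) simp

lemma T_boundary: "T (x, (\<bar>x\<bar> * cos \<alpha> + b) / sin \<alpha>) = (ka * x, (\<bar>ka * x\<bar> * cos \<beta> + b) / sin \<beta>)"
proof -
  have "kb * ((\<bar>x\<bar> * cos \<alpha> + b) / sin \<alpha>) = (\<bar>x\<bar> * cos \<alpha> + b) / sin \<beta>"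
    using \<alpha>.sin_pos by (simp add: kb_def)
  moreover have "(\<bar>x\<bar> * cos \<alpha> + b) / sin \<beta> + kc * \<bar>x\<bar> = (\<bar>ka * x\<bar> * cos \<beta> + b) / sin \<beta>"
    using ka_pos \<beta>.sin_pos by (simp add: kc_def abs_mult field_simps)
  ultimately show ?thesis by (simp add: T_eq)
qed

lemma T_guide: "T p \<in> broken_guide \<beta> \<longleftrightarrow> p \<in> broken_guide \<alpha>"
proof -
  obtain x z where p: "p = (x, z)" by fastforce
  have "(kb * z + kc * \<bar>x\<bar>) * sin \<beta> = z * sin \<alpha> + (ka * cos \<beta> - cos \<alpha>) * \<bar>x\<bar>"
    using \<beta>.sin_pos by (simp add: kb_def kc_def distrib_right)
  then have eq: "(kb * z + kc * \<bar>x\<bar>) * sin \<beta> - \<bar>ka * x\<bar> * cos \<beta> = z * sin \<alpha> - \<bar>x\<bar> * cos \<alpha>"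
    using ka_pos by (simp add: abs_mult algebra_simps)
  show ?thesis unfolding p T_eq broken_guide_def by (simp only: mem_Collect_eq prod.case eq)
qed

lemma nn_integral_T:
  assumes "F \<in> borel_measurable borel"
  shows "(\<integral>\<^sup>+p. F p \<partial>lborel) = ennreal (ka * kb) * (\<integral>\<^sup>+p. F (T p) \<partial>lborel)"
  using nn_integral_shear[OF assms, of "\<lambda>x. kc * \<bar>x\<bar>" ka kb] ka_pos kb_pos by (simp add: T_def)

lemma T_measurable_leb: "T \<in> leb (broken_guide \<alpha>) \<rightarrow>\<^sub>M leb (broken_guide \<beta>)"
  by (rule measurable_restrict_space3) (auto simp: T_guide T_measurable)

lemma sqint_T:
  assumes "f \<in> borel_measurable (leb (broken_guide \<beta>))"
  shows "sqint (broken_guide \<beta>) f = ennreal (ka * kb) * sqint (broken_guide \<alpha>) (\<lambda>p. f (T p))"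
proof -
  have "(\<lambda>p. ennreal ((norm (f p))\<^sup>2)) \<in> borel_measurable (leb (broken_guide \<beta>))" using assms by measurable
  then have m: "(\<lambda>p. ennreal ((norm (f p))\<^sup>2) * indicator (broken_guide \<beta>) p) \<in> borel_measurable borel"
  proof -
    assume "(\<lambda>p. ennreal ((norm (f p))\<^sup>2)) \<in> borel_measurable (leb (broken_guide \<beta>))"
    then have "(\<lambda>p. ennreal ((norm (f p))\<^sup>2) * indicator (broken_guide \<beta>) p) \<in> borel_measurable lborel"
      by (subst (asm) borel_measurable_restrict_space_iff_ennreal) (simp_all only: sets_lborel space_lborel space_borel Int_UNIV_right \<beta>.guide_borel)
    then show ?thesis by (simp only: measurable_lborel1 measurable_lborel2)
  qed
  show ?thesis
    unfolding sqint_eq[OF \<alpha>.guide_borel] sqint_eq[OF \<beta>.guide_borel] nn_integral_T[OF m]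
    by (simp add: T_guide indicator_def)
qed

lemma L2_T: "f \<in> L2 (broken_guide \<beta>) \<Longrightarrow> (\<lambda>p. f (T p)) \<in> L2 (broken_guide \<alpha>)"
proof -
  assume f: "f \<in> L2 (broken_guide \<beta>)"
  then have m: "f \<in> borel_measurable (leb (broken_guide \<beta>))" and fin: "sqint (broken_guide \<beta>) f < \<infinity>" by (auto simp: L2_iff)
  have "(\<lambda>p. f (T p)) \<in> borel_measurable (leb (broken_guide \<alpha>))"
    by (rule measurable_compose[OF T_measurable_leb m])
  moreover have "sqint (broken_guide \<alpha>) (\<lambda>p. f (T p)) < \<infinity>"
    using fin ka_pos kb_pos unfolding sqint_T[OF m] by (auto simp: ennreal_mult_less_top)
  ultimately show ?thesis by (simp add: L2_iff)
qed

text \<open>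
  The gradient of \<open>u \<circ> T\<close>, computed by the chain rule from the gradient \<open>g\<close> of \<open>u\<close>; the kink contributes the
  sign of \<open>fst p\<close>.
\<close>

definition pull :: "(real \<times> real \<Rightarrow> real \<times> real \<Rightarrow> complex) \<Rightarrow> real \<times> real \<Rightarrow> real \<times> real \<Rightarrow> complex" where
  "pull g e p = of_real (ka * fst e) * g (1, 0) (T p) + of_real (kb * snd e + kc * (sgn (fst p) * fst e)) * g (0, 1) (T p)"

lemma sgn_measurable: "(\<lambda>p::real \<times> real. sgn (fst p)) \<in> borel_measurable borel"
  unfolding borel_prod[symmetric] by measurable

lemma pull_measurable:
  assumes "g (1, 0) \<in> borel_measurable (leb (broken_guide \<beta>))" "g (0, 1) \<in> borel_measurable (leb (broken_guide \<beta>))"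
  shows "pull g e \<in> borel_measurable (leb (broken_guide \<alpha>))"
proof -
  have [measurable]: "(\<lambda>p. g (1, 0) (T p)) \<in> borel_measurable (leb (broken_guide \<alpha>))" "(\<lambda>p. g (0, 1) (T p)) \<in> borel_measurable (leb (broken_guide \<alpha>))"
    by (rule measurable_compose[OF T_measurable_leb], rule assms)+
  have [measurable]: "(\<lambda>p::real \<times> real. sgn (fst p)) \<in> borel_measurable (leb (broken_guide \<alpha>))"
    by (intro measurable_restrict_space1) (simp add: sgn_measurable)
  show ?thesis unfolding pull_def[abs_def] by measurable
qed

lemma pull_diff: "pull g e p - pull h e p = pull (\<lambda>e p. g e p - h e p) e p"
  by (simp add: pull_def algebra_simps)

lemma pull_norm: "\<bar>fst e\<bar> \<le> 1 \<Longrightarrow> \<bar>snd e\<bar> \<le> 1 \<Longrightarrow>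
  (norm (pull g e p))\<^sup>2 \<le> 2 * ka\<^sup>2 * (norm (g (1, 0) (T p)))\<^sup>2 + 2 * (kb + \<bar>kc\<bar>)\<^sup>2 * (norm (g (0, 1) (T p)))\<^sup>2"
proof -
  assume e: "\<bar>fst e\<bar> \<le> 1" "\<bar>snd e\<bar> \<le> 1"
  have 1: "\<bar>ka * fst e\<bar> \<le> ka" using e ka_pos by (simp add: abs_mult mult_left_le)
  have "\<bar>kb * snd e\<bar> \<le> kb" using e kb_pos by (simp add: abs_mult mult_left_le)
  moreover have "\<bar>sgn (fst p) * fst e\<bar> \<le> 1" using e by (simp add: abs_mult sgn_if)
  then have "\<bar>kc * (sgn (fst p) * fst e)\<bar> \<le> \<bar>kc\<bar>" by (subst abs_mult) (rule mult_left_le, auto)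
  ultimately have 2: "\<bar>kb * snd e + kc * (sgn (fst p) * fst e)\<bar> \<le> kb + \<bar>kc\<bar>" by linarith
  have "(norm (pull g e p))\<^sup>2 \<le> 2 * (norm (of_real (ka * fst e) * g (1, 0) (T p)))\<^sup>2
      + 2 * (norm (of_real (kb * snd e + kc * (sgn (fst p) * fst e)) * g (0, 1) (T p)))\<^sup>2"
    unfolding pull_def by (rule norm_add_sq_le)
  also have "\<dots> = 2 * (\<bar>ka * fst e\<bar>\<^sup>2 * (norm (g (1, 0) (T p)))\<^sup>2) + 2 * (\<bar>kb * snd e + kc * (sgn (fst p) * fst e)\<bar>\<^sup>2 * (norm (g (0, 1) (T p)))\<^sup>2)"
    by (simp only: norm_mult norm_of_real power_mult_distrib)
  also have "\<dots> \<le> 2 * (ka\<^sup>2 * (norm (g (1, 0) (T p)))\<^sup>2) + 2 * ((kb + \<bar>kc\<bar>)\<^sup>2 * (norm (g (0, 1) (T p)))\<^sup>2)"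
    using 1 2 by (intro add_mono mult_left_mono mult_right_mono power_mono) auto
  finally show ?thesis by (simp add: mult.assoc)
qed

lemma sqint_pull_le:
  assumes "g (1, 0) \<in> borel_measurable (leb (broken_guide \<beta>))" "g (0, 1) \<in> borel_measurable (leb (broken_guide \<beta>))"
    and e: "e \<in> Basis"
  shows "sqint (broken_guide \<alpha>) (pull g e) \<le> ennreal ((2 * ka\<^sup>2 + 2 * (kb + \<bar>kc\<bar>)\<^sup>2) / (ka * kb)) * (\<Sum>e\<in>Basis. sqint (broken_guide \<beta>) (g e))"
proof -
  let ?K = "2 * ka\<^sup>2 + 2 * (kb + \<bar>kc\<bar>)\<^sup>2"
  have m[measurable]: "(\<lambda>p. g (1, 0) (T p)) \<in> borel_measurable (leb (broken_guide \<alpha>))" "(\<lambda>p. g (0, 1) (T p)) \<in> borel_measurable (leb (broken_guide \<alpha>))"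
    by (rule measurable_compose[OF T_measurable_leb], rule assms)+
  have "\<bar>fst e\<bar> \<le> 1" "\<bar>snd e\<bar> \<le> 1" using e by (auto simp: Basis_plane)
  note pn = pull_norm[OF this]
  have "sqint (broken_guide \<alpha>) (pull g e) \<le> (\<integral>\<^sup>+p. ennreal ?K * (ennreal ((norm (g (1, 0) (T p)))\<^sup>2) + ennreal ((norm (g (0, 1) (T p)))\<^sup>2)) \<partial>leb (broken_guide \<alpha>))"
    unfolding sqint_def
  proof (intro nn_integral_mono)
    fix p
    have "(norm (pull g e p))\<^sup>2 \<le> ?K * ((norm (g (1, 0) (T p)))\<^sup>2 + (norm (g (0, 1) (T p)))\<^sup>2)"
      by (rule order_trans[OF pn]) (simp add: algebra_simps)
    then have "ennreal ((norm (pull g e p))\<^sup>2) \<le> ennreal (?K * ((norm (g (1, 0) (T p)))\<^sup>2 + (norm (g (0, 1) (T p)))\<^sup>2))"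
      by (rule ennreal_leI)
    also have "\<dots> = ennreal ?K * (ennreal ((norm (g (1, 0) (T p)))\<^sup>2) + ennreal ((norm (g (0, 1) (T p)))\<^sup>2))"
      by (subst ennreal_mult) (auto simp: ennreal_plus)
    finally show "ennreal ((norm (pull g e p))\<^sup>2) \<le> ennreal ?K * (ennreal ((norm (g (1, 0) (T p)))\<^sup>2) + ennreal ((norm (g (0, 1) (T p)))\<^sup>2))" .
  qed
  also have "\<dots> = ennreal ?K * (sqint (broken_guide \<alpha>) (\<lambda>p. g (1, 0) (T p)) + sqint (broken_guide \<alpha>) (\<lambda>p. g (0, 1) (T p)))"
    unfolding sqint_def by (subst nn_integral_cmult) (auto simp: nn_integral_add)
  also have "\<dots> = ennreal (?K / (ka * kb)) * (ennreal (ka * kb) * sqint (broken_guide \<alpha>) (\<lambda>p. g (1, 0) (T p)) + ennreal (ka * kb) * sqint (broken_guide \<alpha>) (\<lambda>p. g (0, 1) (T p)))"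
    using ka_pos kb_pos
    by (simp only: distrib_left[symmetric] mult.assoc[symmetric]) (simp add: ennreal_mult[symmetric])
  also have "\<dots> = ennreal (?K / (ka * kb)) * (\<Sum>e\<in>Basis. sqint (broken_guide \<beta>) (g e))"
    using sqint_T[OF assms(1)] sqint_T[OF assms(2)] by (simp add: Basis_plane)
  finally show ?thesis .
qed

text \<open>
  Arc length is multiplied by a constant, since \<open>T\<close> is linear on each half of the boundary.
\<close>

lemma boundary_T:
  assumes "f \<in> borel_measurable borel"
  shows "boundary_sq_integral (guide_boundary \<alpha>) (\<lambda>p. f (T p)) = ennreal (sin \<beta> / (ka * sin \<alpha>)) * boundary_sq_integral (guide_boundary \<beta>) f"
proof -
  note [measurable] = assms
  define X where "X = (\<lambda>b. \<integral>\<^sup>+x. ennreal ((norm (f (x, (\<bar>x\<bar> * cos \<beta> + b) / sin \<beta>)))\<^sup>2) \<partial>lborel)"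
  have "continuous_on UNIV (\<lambda>x. (x, (\<bar>x\<bar> * cos \<beta> + b) / sin \<beta>))" for b
    using \<beta>.sin_pos by (intro continuous_intros) auto
  then have [measurable]: "(\<lambda>x. (x, (\<bar>x\<bar> * cos \<beta> + b) / sin \<beta>)) \<in> borel \<rightarrow>\<^sub>M borel" for b
    by (rule borel_measurable_continuous_onI)
  have X: "(\<integral>\<^sup>+x. ennreal ((norm (f (T (x, (\<bar>x\<bar> * cos \<alpha> + b) / sin \<alpha>))))\<^sup>2) \<partial>lborel) = ennreal (1 / ka) * X b" for b
  proof -
    have mX: "(\<lambda>x. ennreal ((norm (f (x, (\<bar>x\<bar> * cos \<beta> + b) / sin \<beta>)))\<^sup>2)) \<in> borel_measurable borel" by measurable
    have "X b = ennreal \<bar>ka\<bar> * (\<integral>\<^sup>+x. ennreal ((norm (f (0 + ka * x, (\<bar>0 + ka * x\<bar> * cos \<beta> + b) / sin \<beta>)))\<^sup>2) \<partial>lborel)"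
      unfolding X_def using ka_pos by (intro nn_integral_real_affine[OF mX]) simp
    also have "\<dots> = ennreal ka * (\<integral>\<^sup>+x. ennreal ((norm (f (T (x, (\<bar>x\<bar> * cos \<alpha> + b) / sin \<alpha>))))\<^sup>2) \<partial>lborel)"
      using ka_pos by (simp add: T_boundary)
    finally show ?thesis using ka_pos by (simp add: mult.assoc[symmetric] ennreal_mult[symmetric])
  qed
  have m: "(\<lambda>p. f (T p)) \<in> borel_measurable borel" by measurable
  have "boundary_sq_integral (guide_boundary \<alpha>) (\<lambda>p. f (T p)) = ennreal (1 / sin \<alpha>) * (ennreal (1 / ka) * X 0 + ennreal (1 / ka) * X 1)"
    using \<alpha>.boundary_eq(1)[OF m] X[of 0] X[of 1] by simp
  also have "\<dots> = ennreal (sin \<beta> / (ka * sin \<alpha>)) * (ennreal (1 / sin \<beta>) * (X 0 + X 1))"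
    using ka_pos \<alpha>.sin_pos \<beta>.sin_pos
    by (simp only: distrib_left[symmetric] mult.assoc[symmetric]) (simp add: ennreal_mult[symmetric] mult.commute)
  also have "ennreal (1 / sin \<beta>) * (X 0 + X 1) = boundary_sq_integral (guide_boundary \<beta>) f"
    using \<beta>.boundary_eq(1)[OF assms] by (simp add: X_def)
  finally show ?thesis .
qed

end

lemma smooth_abs_bounds:
  assumes "0 < e" "e \<le> 1"
  shows "\<bar>x\<bar> \<le> smooth_abs e x" "smooth_abs e x \<le> \<bar>x\<bar> + 1" "0 < smooth_abs e x" "\<bar>x / smooth_abs e x\<bar> \<le> 1"
proof -
  show 1: "\<bar>x\<bar> \<le> smooth_abs e x" unfolding smooth_abs_def using assms by (intro real_le_rsqrt) simp
  show "smooth_abs e x \<le> \<bar>x\<bar> + 1" unfolding smooth_abs_def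
    using assms by (intro real_le_lsqrt) (auto simp: power2_sum add_nonneg_nonneg)
  show 2: "0 < smooth_abs e x" unfolding smooth_abs_def using assms by (simp add: add_nonneg_pos)
  show "\<bar>x / smooth_abs e x\<bar> \<le> 1" using 1 2 by simp
qed

lemma smooth_abs_limits:
  "(\<lambda>m. smooth_abs (1 / real (Suc m)) x) \<longlonglongrightarrow> \<bar>x\<bar>"
  "(\<lambda>m. x / smooth_abs (1 / real (Suc m)) x) \<longlonglongrightarrow> sgn x"
proof -
  have "(\<lambda>m. sqrt (x\<^sup>2 + 1 / real (Suc m))) \<longlonglongrightarrow> sqrt (x\<^sup>2 + 0)"
    by (intro tendsto_intros) (use LIMSEQ_inverse_real_of_nat in \<open>simp add: inverse_eq_divide\<close>)
  then show l: "(\<lambda>m. smooth_abs (1 / real (Suc m)) x) \<longlonglongrightarrow> \<bar>x\<bar>" by (simp add: smooth_abs_def)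
  show "(\<lambda>m. x / smooth_abs (1 / real (Suc m)) x) \<longlonglongrightarrow> sgn x"
  proof (cases "x = 0")
    case False
    then have "(\<lambda>m. x / smooth_abs (1 / real (Suc m)) x) \<longlonglongrightarrow> x / \<bar>x\<bar>"
      by (intro tendsto_divide tendsto_const l) simp
    moreover have "x / \<bar>x\<bar> = sgn x" using False by (simp add: sgn_if)
    ultimately show ?thesis by simp
  qed simp
qed

lemma real_differentiable_deriv:
  assumes "real_differentiable (Suc k) s" "\<And>x. (s has_real_derivative s' x) (at x)"
  shows "real_differentiable k s'"
proof -
  obtain g where g: "\<And>x. (s has_real_derivative g x) (at x)" "real_differentiable k g" using assms(1) by auto
  have "g = s'" using DERIV_unique[OF g(1) assms(2)] by auto
  then show ?thesis using g by simp
qed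

lemma sqint_dominated_null:
  fixes f :: "nat \<Rightarrow> real \<times> real \<Rightarrow> complex"
  assumes \<Omega>: "\<Omega> \<in> sets borel" and m: "\<And>n. f n \<in> borel_measurable borel"
    and B: "\<And>n p. norm (f n p) \<le> B" and R: "\<And>n p. norm p > R \<Longrightarrow> f n p = 0" and lim: "\<And>p. (\<lambda>n. f n p) \<longlonglongrightarrow> 0"
  shows "(\<lambda>n. sqint \<Omega> (f n)) \<longlonglongrightarrow> 0"
proof -
  note [measurable] = m \<Omega>
  have "(\<lambda>n. \<integral>\<^sup>+p. ennreal ((norm (f n p))\<^sup>2) * indicator \<Omega> p \<partial>lborel) \<longlonglongrightarrow> (\<integral>\<^sup>+p. 0 \<partial>(lborel :: (real \<times> real) measure))"
  proof (rule nn_integral_dominated_convergence[where w = "\<lambda>p. ennreal (B\<^sup>2) * indicator (cball 0 R) p"])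
    show "AE p in lborel. ennreal ((norm (f n p))\<^sup>2) * indicator \<Omega> p \<le> ennreal (B\<^sup>2) * indicator (cball 0 R) p" for n
    proof (rule AE_I2)
      fix p
      have "ennreal ((norm (f n p))\<^sup>2) \<le> ennreal (B\<^sup>2)" by (intro ennreal_leI power_mono B) simp
      then show "ennreal ((norm (f n p))\<^sup>2) * indicator \<Omega> p \<le> ennreal (B\<^sup>2) * indicator (cball 0 R) p"
        using R[of p n] by (cases "norm p > R") (auto simp: indicator_def)
    qed
    show "(\<integral>\<^sup>+p. ennreal (B\<^sup>2) * indicator (cball 0 R) p \<partial>(lborel :: (real \<times> real) measure)) < \<infinity>"
      using emeasure_lborel_cball_finite[of "0 :: real \<times> real" R]
      by (subst nn_integral_cmult_indicator) (auto simp: ennreal_mult_less_top)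
    show "AE p in lborel. (\<lambda>n. ennreal ((norm (f n p))\<^sup>2) * indicator \<Omega> p) \<longlonglongrightarrow> 0"
    proof (rule AE_I2)
      fix p
      have "(\<lambda>n. ennreal ((norm (f n p))\<^sup>2)) \<longlonglongrightarrow> ennreal ((norm (0::complex))\<^sup>2)"
        by (intro tendsto_ennrealI tendsto_power tendsto_norm lim)
      then show "(\<lambda>n. ennreal ((norm (f n p))\<^sup>2) * indicator \<Omega> p) \<longlonglongrightarrow> 0"
        by (cases "p \<in> \<Omega>") auto
    qed
    show "(\<lambda>p. ennreal ((norm (f n p))\<^sup>2) * indicator \<Omega> p) \<in> borel_measurable lborel" for n by measurable
    show "(\<lambda>p. ennreal (B\<^sup>2) * indicator (cball (0 :: real \<times> real) R) p) \<in> borel_measurable lborel"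
      by (intro borel_measurable_times_ennreal borel_measurable_const borel_measurable_indicator) simp
  qed auto
  then show ?thesis by (simp add: sqint_eq[OF \<Omega>])
qed

lemma (in guide) boundary_dominated_null:
  fixes f :: "nat \<Rightarrow> real \<times> real \<Rightarrow> complex"
  assumes m: "\<And>n. f n \<in> borel_measurable borel"
    and B: "\<And>n p. norm (f n p) \<le> B" and R: "\<And>n p. norm p > R \<Longrightarrow> f n p = 0" and lim: "\<And>p. (\<lambda>n. f n p) \<longlonglongrightarrow> 0"
  shows "(\<lambda>n. boundary_sq_integral \<Gamma> (f n)) \<longlonglongrightarrow> 0"
proof -
  note [measurable] = m
  have "continuous_on UNIV (\<lambda>x. (x, (\<bar>x\<bar> * cos \<theta> + b) / sin \<theta>))" for b
    using sin_pos by (intro continuous_intros) auto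
  then have [measurable]: "(\<lambda>x. (x, (\<bar>x\<bar> * cos \<theta> + b) / sin \<theta>)) \<in> borel \<rightarrow>\<^sub>M borel" for b
    by (rule borel_measurable_continuous_onI)
  have X: "(\<lambda>n. \<integral>\<^sup>+x. ennreal ((norm (f n (x, (\<bar>x\<bar> * cos \<theta> + b) / sin \<theta>)))\<^sup>2) \<partial>lborel) \<longlonglongrightarrow> (\<integral>\<^sup>+x. 0 \<partial>(lborel :: real measure))" for b
  proof (rule nn_integral_dominated_convergence[where w = "\<lambda>x. ennreal (B\<^sup>2) * indicator {-\<bar>R\<bar>..\<bar>R\<bar>} x"])
    show "AE x in lborel. ennreal ((norm (f n (x, (\<bar>x\<bar> * cos \<theta> + b) / sin \<theta>)))\<^sup>2) \<le> ennreal (B\<^sup>2) * indicator {-\<bar>R\<bar>..\<bar>R\<bar>} x" for n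
    proof (rule AE_I2)
      fix x :: real
      let ?p = "(x, (\<bar>x\<bar> * cos \<theta> + b) / sin \<theta>)"
      have "ennreal ((norm (f n ?p))\<^sup>2) \<le> ennreal (B\<^sup>2)" by (intro ennreal_leI power_mono B) simp
      moreover have "\<bar>x\<bar> \<le> norm ?p" by (metis norm_fst_le real_norm_def)
      then have "f n ?p = 0" if "x \<notin> {-\<bar>R\<bar>..\<bar>R\<bar>}" using that by (intro R) auto
      ultimately show "ennreal ((norm (f n ?p))\<^sup>2) \<le> ennreal (B\<^sup>2) * indicator {-\<bar>R\<bar>..\<bar>R\<bar>} x"
        by (auto simp: indicator_def)
    qed
    show "(\<integral>\<^sup>+x. ennreal (B\<^sup>2) * indicator {-\<bar>R\<bar>..\<bar>R\<bar>} x \<partial>lborel) < \<infinity>"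
      by (subst nn_integral_cmult_indicator) (auto simp: ennreal_mult_less_top)
    show "AE x in lborel. (\<lambda>n. ennreal ((norm (f n (x, (\<bar>x\<bar> * cos \<theta> + b) / sin \<theta>)))\<^sup>2)) \<longlonglongrightarrow> 0"
    proof (rule AE_I2)
      fix x :: real
      have "(\<lambda>n. ennreal ((norm (f n (x, (\<bar>x\<bar> * cos \<theta> + b) / sin \<theta>)))\<^sup>2)) \<longlonglongrightarrow> ennreal ((norm (0::complex))\<^sup>2)"
        by (intro tendsto_ennrealI tendsto_power tendsto_norm lim)
      then show "(\<lambda>n. ennreal ((norm (f n (x, (\<bar>x\<bar> * cos \<theta> + b) / sin \<theta>)))\<^sup>2)) \<longlonglongrightarrow> 0" by simp
    qed
  qed auto
  have "(\<lambda>n. ennreal (1 / sin \<theta>) *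
    ((\<integral>\<^sup>+x. ennreal ((norm (f n (x, (\<bar>x\<bar> * cos \<theta> + 0) / sin \<theta>)))\<^sup>2) \<partial>lborel)
     + (\<integral>\<^sup>+x. ennreal ((norm (f n (x, (\<bar>x\<bar> * cos \<theta> + 1) / sin \<theta>)))\<^sup>2) \<partial>lborel)))
     \<longlonglongrightarrow> ennreal (1 / sin \<theta>) * ((\<integral>\<^sup>+x. 0 \<partial>(lborel :: real measure)) + (\<integral>\<^sup>+x. 0 \<partial>(lborel :: real measure)))"
    by (intro ennreal_tendsto_cmult tendsto_add X) simp
  then show ?thesis by (simp add: boundary_eq(1)[OF m])
qed

context guide_pair
begin

text \<open>
  A common bound for the supports of the compositions with \<open>T\<close> and with all smoothed maps.
\<close>

lemma preimage_bounded:
  assumes "norm (ka * x, kb * z + kc * h) < R" "\<bar>h\<bar> \<le> \<bar>x\<bar> + 1"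
  shows "norm (x, z) \<le> R / ka + (R + \<bar>kc\<bar> * (R / ka + 1)) / kb"
proof -
  have "\<bar>ka * x\<bar> < R" using assms(1) norm_fst_le[of "ka * x" "kb * z + kc * h"] by simp
  then have x: "\<bar>x\<bar> \<le> R / ka" using ka_pos by (simp add: abs_mult field_simps)
  have "\<bar>kb * z + kc * h\<bar> < R" using assms(1) norm_snd_le[of "kb * z + kc * h" "ka * x"] by simp
  moreover have "\<bar>kc * h\<bar> \<le> \<bar>kc\<bar> * (R / ka + 1)"
    unfolding abs_mult using assms(2) x by (intro mult_left_mono) auto
  ultimately have "\<bar>kb * z\<bar> \<le> R + \<bar>kc\<bar> * (R / ka + 1)" by linarith
  then have "\<bar>z\<bar> \<le> (R + \<bar>kc\<bar> * (R / ka + 1)) / kb" using kb_pos by (simp add: abs_mult field_simps)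
  moreover have "norm (x, z) \<le> \<bar>x\<bar> + \<bar>z\<bar>" using norm_Pair_le[of x z] by simp
  ultimately show ?thesis using x by linarith
qed

lemma TS_eq: "TS m (x, z) = (ka * x, kb * z + kc * smooth_abs (1 / real (Suc m)) x)"
  by (simp add: TS_def shear_def)

lemma eps_pos: "0 < 1 / real (Suc m)" "1 / real (Suc m) \<le> 1" by auto

lemma TS_smooth:
  assumes "\<phi> \<in> smooth_compact_support"
  shows "(\<lambda>p. \<phi> (TS m p)) \<in> smooth_compact_support"
proof -
  obtain R where R: "R > 0" "\<And>x. norm x \<ge> R \<Longrightarrow> \<phi> x = 0" using smooth_support_ball[OF assms] by blast
  have "bounded {p. \<phi> (TS m p) \<noteq> 0}"
    unfolding bounded_iff
  proof (intro exI ballI)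
    fix p assume "p \<in> {p. \<phi> (TS m p) \<noteq> 0}"
    then have n: "norm (TS m p) < R" using R(2)[of "TS m p"] by force
    obtain x z where p: "p = (x, z)" by fastforce
    show "norm p \<le> R / ka + (R + \<bar>kc\<bar> * (R / ka + 1)) / kb"
      unfolding p by (rule preimage_bounded[OF n[unfolded p TS_eq]])
        (use smooth_abs_bounds[OF eps_pos[of m], of x] in auto)
  qed
  moreover have "k_times_differentiable k (\<lambda>p. \<phi> (TS m p))" for k
    unfolding TS_def
  proof (rule k_times_differentiable_shear[OF smooth_abs_deriv[OF eps_pos(1)]])
    show "real_differentiable k (\<lambda>x. x / smooth_abs (1 / real (Suc m)) x)" for k
      by (rule real_differentiable_deriv[OF real_differentiable_smooth_abs[OF eps_pos(1)] smooth_abs_deriv[OF eps_pos(1)]])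
    show "k_times_differentiable j \<phi>" for j using assms unfolding smooth_compact_support_iff by blast
  qed
  ultimately show ?thesis unfolding smooth_compact_support_iff by blast
qed

lemma TS_dpartial:
  assumes "\<phi> \<in> smooth_compact_support"
  shows "dpartial v (\<lambda>p. \<phi> (TS m p)) p = of_real (ka * fst v) * dpartial (1, 0) \<phi> (TS m p)
    + of_real (kb * snd v + kc * (fst p / smooth_abs (1 / real (Suc m)) (fst p) * fst v)) * dpartial (0, 1) \<phi> (TS m p)"
  unfolding TS_def by (rule dpartial_shear[OF assms smooth_abs_deriv[OF eps_pos(1)]])

lemma TS_limit: "(\<lambda>m. TS m p) \<longlonglongrightarrow> T p"
proof -
  obtain x z where p: "p = (x, z)" by fastforce
  show ?thesis unfolding p TS_eq T_eq by (intro tendsto_intros smooth_abs_limits)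
qed

lemma smooth_TS_limit:
  assumes "\<phi> \<in> smooth_compact_support"
  shows "(\<lambda>m. \<phi> (TS m p)) \<longlonglongrightarrow> \<phi> (T p)"
proof -
  have "isCont \<phi> (T p)" using smooth_continuous[OF assms, of UNIV] by (metis continuous_on_eq_continuous_at open_UNIV UNIV_I)
  then show ?thesis using TS_limit by (rule isCont_tendsto_compose)
qed

lemma smooth_T_measurable:
  assumes "\<phi> \<in> smooth_compact_support"
  shows "(\<lambda>p. \<phi> (T p)) \<in> borel_measurable borel"
  by (rule measurable_compose[OF T_measurable smooth_measurable[OF assms]])

text \<open>
  Dominated convergence in each of the three parts of the defect: the compositions are uniformly
  bounded with supports in a fixed ball, and they converge pointwise. For the gradients this uses
  \<open>x / smooth_abs e x \<longlonglongrightarrow> sgn x\<close>.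
\<close>

lemma transplant_approximation:
  assumes phi: "\<phi> \<in> smooth_compact_support"
  shows "(\<lambda>m. sqint (broken_guide \<alpha>) (\<lambda>p. \<phi> (TS m p) - \<phi> (T p))) \<longlonglongrightarrow> 0"
    "e \<in> Basis \<Longrightarrow> (\<lambda>m. sqint (broken_guide \<alpha>) (\<lambda>p. dpartial e (\<lambda>p. \<phi> (TS m p)) p - pull (\<lambda>e. dpartial e \<phi>) e p)) \<longlonglongrightarrow> 0"
    "(\<lambda>m. boundary_sq_integral (guide_boundary \<alpha>) (\<lambda>p. \<phi> (TS m p) - \<phi> (T p))) \<longlonglongrightarrow> 0"
proof -
  note dphi = dpartial_smooth[OF phi]
  obtain R where R: "R > 0" "\<And>x. norm x \<ge> R \<Longrightarrow> \<phi> x = 0" using smooth_support_ball[OF phi] by blast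
  obtain R1 where R1: "\<And>x. norm x \<ge> R1 \<Longrightarrow> dpartial (1, 0) \<phi> x = 0" using smooth_support_ball[OF dphi] by blast
  obtain R2 where R2: "\<And>x. norm x \<ge> R2 \<Longrightarrow> dpartial (0, 1) \<phi> x = 0" using smooth_support_ball[OF dphi] by blast
  obtain B where B: "\<And>x. norm (\<phi> x) \<le> B" using smooth_bounded[OF phi] by blast
  obtain B1 where B1: "B1 \<ge> 0" "\<And>x. norm (dpartial (1, 0) \<phi> x) \<le> B1" using smooth_bounded[OF dphi] by blast
  obtain B2 where B2: "B2 \<ge> 0" "\<And>x. norm (dpartial (0, 1) \<phi> x) \<le> B2" using smooth_bounded[OF dphi] by blast
  define r where "r = max R (max R1 R2)"
  define Q where "Q = r / ka + (r + \<bar>kc\<bar> * (r / ka + 1)) / kb"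
  have out: "norm (T p) \<ge> r" "norm (TS m p) \<ge> r" if "norm p > Q" for p m
  proof -
    obtain x z where p: "p = (x, z)" by fastforce
    show "norm (T p) \<ge> r"
    proof (rule ccontr)
      assume "\<not> ?thesis"
      then have "norm (x, z) \<le> Q" unfolding p T_eq Q_def by (intro preimage_bounded[of x z "\<bar>x\<bar>"]) auto
      then show False using that p by simp
    qed
    show "norm (TS m p) \<ge> r"
    proof (rule ccontr)
      assume "\<not> ?thesis"
      then have "norm (x, z) \<le> Q" unfolding p TS_eq Q_def
        using smooth_abs_bounds[OF eps_pos[of m], of x] by (intro preimage_bounded[of x z "smooth_abs (1 / real (Suc m)) x"]) auto
      then show False using that p by simp
    qed
  qed
  have rle: "R \<le> r" "R1 \<le> r" "R2 \<le> r" by (auto simp: r_def)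
  have z: "\<phi> (T p) = 0" "\<phi> (TS m p) = 0" "dpartial (1, 0) \<phi> (T p) = 0" "dpartial (1, 0) \<phi> (TS m p) = 0"
    "dpartial (0, 1) \<phi> (T p) = 0" "dpartial (0, 1) \<phi> (TS m p) = 0" if "norm p > Q" for p m
    using out[OF that] rle R(2) R1 R2 by (meson order_trans)+
  have meas: "(\<lambda>p. \<phi> (TS m p) - \<phi> (T p)) \<in> borel_measurable borel" for m
    using smooth_measurable[OF TS_smooth[OF phi]] smooth_T_measurable[OF phi] by (rule borel_measurable_diff)
  have bd: "norm (\<phi> (TS m p) - \<phi> (T p)) \<le> 2 * B" for m p
    using norm_triangle_ineq4[of "\<phi> (TS m p)" "\<phi> (T p)"] B[of "TS m p"] B[of "T p"] by linarith
  have lim: "(\<lambda>m. \<phi> (TS m p) - \<phi> (T p)) \<longlonglongrightarrow> 0" for p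
    using smooth_TS_limit[OF phi] by (simp add: LIM_zero_iff)
  show "(\<lambda>m. sqint (broken_guide \<alpha>) (\<lambda>p. \<phi> (TS m p) - \<phi> (T p))) \<longlonglongrightarrow> 0"
    by (rule sqint_dominated_null[OF \<alpha>.guide_borel meas bd _ lim, of Q]) (simp add: z)
  show "(\<lambda>m. boundary_sq_integral (guide_boundary \<alpha>) (\<lambda>p. \<phi> (TS m p) - \<phi> (T p))) \<longlonglongrightarrow> 0"
    by (rule \<alpha>.boundary_dominated_null[OF meas bd _ lim, of Q]) (simp add: z)
  assume e: "e \<in> Basis"
  have e1: "\<bar>fst e\<bar> \<le> 1" "\<bar>snd e\<bar> \<le> 1" using e by (auto simp: Basis_plane)
  have coef: "\<bar>kb * snd e + kc * (t * fst e)\<bar> \<le> kb + \<bar>kc\<bar>" if "\<bar>t\<bar> \<le> 1" for t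
  proof -
    have "\<bar>kb * snd e\<bar> \<le> kb" using e1 kb_pos by (simp add: abs_mult mult_left_le)
    moreover have "\<bar>t * fst e\<bar> \<le> 1" unfolding abs_mult using e1 that by (intro mult_le_one) auto
    then have "\<bar>kc * (t * fst e)\<bar> \<le> \<bar>kc\<bar>" by (subst abs_mult) (rule mult_left_le, auto)
    ultimately show ?thesis by linarith
  qed
  have ca: "\<bar>ka * fst e\<bar> \<le> ka" using e1 ka_pos by (simp add: abs_mult mult_left_le)
  define B' where "B' = ka * B1 + (kb + \<bar>kc\<bar>) * B2"
  have bound: "norm (of_real (ka * fst e) * d1 + of_real (kb * snd e + kc * (t * fst e)) * d2) \<le> B'"
    if "norm d1 \<le> B1" "norm d2 \<le> B2" "\<bar>t\<bar> \<le> 1" for d1 d2 :: complex and t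
  proof -
    have "norm (of_real (ka * fst e) * d1 + of_real (kb * snd e + kc * (t * fst e)) * d2)
      \<le> \<bar>ka * fst e\<bar> * norm d1 + \<bar>kb * snd e + kc * (t * fst e)\<bar> * norm d2"
      by (rule order_trans[OF norm_triangle_ineq]) (simp only: norm_mult norm_of_real order_refl)
    also have "\<dots> \<le> B'" unfolding B'_def
      using ca coef[OF that(3)] that ka_pos kb_pos B1(1) B2(1) by (intro add_mono mult_mono) auto
    finally show ?thesis .
  qed
  show "(\<lambda>m. sqint (broken_guide \<alpha>) (\<lambda>p. dpartial e (\<lambda>p. \<phi> (TS m p)) p - pull (\<lambda>e. dpartial e \<phi>) e p)) \<longlonglongrightarrow> 0"
  proof (rule sqint_dominated_null[OF \<alpha>.guide_borel, of _ "2 * B'" Q])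
    show "(\<lambda>p. dpartial e (\<lambda>p. \<phi> (TS m p)) p - pull (\<lambda>e. dpartial e \<phi>) e p) \<in> borel_measurable borel" for m
    proof -
      note [measurable] = smooth_T_measurable[OF dphi] sgn_measurable smooth_measurable[OF dpartial_smooth[OF TS_smooth[OF phi]]]
      show ?thesis unfolding pull_def by measurable
    qed
    show "norm (dpartial e (\<lambda>p. \<phi> (TS m p)) p - pull (\<lambda>e. dpartial e \<phi>) e p) \<le> 2 * B'" for m p
    proof -
      have "norm (dpartial e (\<lambda>p. \<phi> (TS m p)) p) \<le> B'"
        unfolding TS_dpartial[OF phi] using smooth_abs_bounds(4)[OF eps_pos[of m]] by (intro bound B1 B2)
      moreover have "norm (pull (\<lambda>e. dpartial e \<phi>) e p) \<le> B'"
        unfolding pull_def by (intro bound B1 B2) (simp add: sgn_if)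
      ultimately show ?thesis
        using norm_triangle_ineq4[of "dpartial e (\<lambda>p. \<phi> (TS m p)) p" "pull (\<lambda>e. dpartial e \<phi>) e p"] by linarith
    qed
    show "dpartial e (\<lambda>p. \<phi> (TS m p)) p - pull (\<lambda>e. dpartial e \<phi>) e p = 0" if "norm p > Q" for m p
      using z[OF that] by (simp add: TS_dpartial[OF phi] pull_def)
    show "(\<lambda>m. dpartial e (\<lambda>p. \<phi> (TS m p)) p - pull (\<lambda>e. dpartial e \<phi>) e p) \<longlonglongrightarrow> 0" for p
      unfolding LIM_zero_iff TS_dpartial[OF phi] pull_def
      by (intro tendsto_add tendsto_mult tendsto_of_real tendsto_const smooth_TS_limit dphi smooth_abs_limits)
  qed
qed

text \<open>
  A smooth function close to \<open>u\<close> is composed with \<open>T\<close>, which changes the defect at most by a constant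
  factor \<open>K\<close>, and the composition is then replaced by a smooth function.
\<close>

lemma trace_free_transplant:
  assumes tf: "trace_free (broken_guide \<beta>) (guide_boundary \<beta>) u g"
  shows "trace_free (broken_guide \<alpha>) (guide_boundary \<alpha>) (\<lambda>p. u (T p)) (pull g)"
proof -
  let ?Om = "broken_guide \<alpha>" and ?G = "guide_boundary \<alpha>"
  have B: "(1, 0) \<in> (Basis :: (real \<times> real) set)" "(0, 1) \<in> (Basis :: (real \<times> real) set)" unfolding Basis_plane by simp_all
  have L: "u \<in> L2 (broken_guide \<beta>)" "\<And>e. e \<in> Basis \<Longrightarrow> g e \<in> L2 (broken_guide \<beta>)"
    using tf by (auto simp: trace_free_def)
  note mg = L2_measurable[OF L(2)[OF B(1)]] L2_measurable[OF L(2)[OF B(2)]]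
  \<comment> \<open>a common bound for the factors by which the three parts of the defect change\<close>
  define K where "K = 1 / (ka * kb) + 2 * ((2 * ka\<^sup>2 + 2 * (kb + \<bar>kc\<bar>)\<^sup>2) / (ka * kb)) + sin \<beta> / (ka * sin \<alpha>)"
  have parts: "1 / (ka * kb) > 0" "(2 * ka\<^sup>2 + 2 * (kb + \<bar>kc\<bar>)\<^sup>2) / (ka * kb) \<ge> 0" "sin \<beta> / (ka * sin \<alpha>) > 0"
    using ka_pos kb_pos \<alpha>.sin_pos \<beta>.sin_pos by auto
  have K: "K > 0" "1 / (ka * kb) \<le> K" "2 * ((2 * ka\<^sup>2 + 2 * (kb + \<bar>kc\<bar>)\<^sup>2) / (ka * kb)) \<le> K" "sin \<beta> / (ka * sin \<alpha>) \<le> K"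
    unfolding K_def using parts by linarith+
  have "\<exists>\<eta>\<in>smooth_compact_support. defect ?Om ?G (\<lambda>p. u (T p)) (pull g) \<eta> < ennreal \<epsilon>" if \<epsilon>: "\<epsilon> > 0" for \<epsilon> :: real
  proof -
    have pos: "\<epsilon> / (4 * K) > 0" using \<epsilon> K by simp
    then obtain \<phi> where phi: "\<phi> \<in> smooth_compact_support" and d: "defect (broken_guide \<beta>) (guide_boundary \<beta>) u g \<phi> < ennreal (\<epsilon> / (4 * K))"
      using tf unfolding trace_free_def by blast
    note dphi = dpartial_smooth[OF phi]
    have mphi: "\<phi> \<in> borel_measurable (leb (broken_guide \<beta>))" "\<And>v. dpartial v \<phi> \<in> borel_measurable (leb (broken_guide \<beta>))"
      using smooth_L2[OF phi \<beta>.guide_borel] smooth_L2[OF dphi \<beta>.guide_borel] by (auto simp: L2_iff)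
    define E where "E = (\<lambda>m. sqint ?Om (\<lambda>p. \<phi> (TS m p) - \<phi> (T p))
      + (\<Sum>e\<in>Basis. sqint ?Om (\<lambda>p. dpartial e (\<lambda>p. \<phi> (TS m p)) p - pull (\<lambda>e. dpartial e \<phi>) e p))
      + boundary_sq_integral ?G (\<lambda>p. \<phi> (TS m p) - \<phi> (T p)))"
    have "E \<longlonglongrightarrow> 0 + (\<Sum>e\<in>(Basis :: (real \<times> real) set). 0) + 0"
      unfolding E_def by (intro tendsto_add tendsto_sum transplant_approximation phi)
    then have "\<forall>\<^sub>F m in sequentially. E m < ennreal (\<epsilon> / 8)" using \<epsilon> by (intro order_tendstoD) auto
    then obtain m where Em: "E m < ennreal (\<epsilon> / 8)" using eventually_happens'[OF sequentially_bot] by blast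
    define \<eta> where "\<eta> = (\<lambda>p. \<phi> (TS m p))"
    have chi: "\<eta> \<in> smooth_compact_support" unfolding \<eta>_def by (rule TS_smooth[OF phi])
    have mchi: "\<eta> \<in> borel_measurable (leb ?Om)" "\<And>v. dpartial v \<eta> \<in> borel_measurable (leb ?Om)"
      using smooth_L2[OF chi \<alpha>.guide_borel] smooth_L2[OF dpartial_smooth[OF chi] \<alpha>.guide_borel] by (auto simp: L2_iff)
    have mT: "(\<lambda>p. \<phi> (T p)) \<in> borel_measurable (leb ?Om)" "(\<lambda>p. u (T p)) \<in> borel_measurable (leb ?Om)"
      by (rule measurable_compose[OF T_measurable_leb], rule mphi L2_measurable[OF L(1)])+
    define D0 where "D0 = sqint (broken_guide \<beta>) (\<lambda>x. \<phi> x - u x)"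
    define D1 where "D1 = (\<Sum>e\<in>Basis. sqint (broken_guide \<beta>) (\<lambda>x. dpartial e \<phi> x - g e x))"
    define D2 where "D2 = boundary_sq_integral (guide_boundary \<beta>) \<phi>"
    have 0: "sqint ?Om (\<lambda>p. \<phi> (T p) - u (T p)) \<le> ennreal K * D0"
    proof -
      have "sqint ?Om (\<lambda>p. \<phi> (T p) - u (T p)) = ennreal (1 / (ka * kb)) * D0"
        using sqint_T[of "\<lambda>x. \<phi> x - u x"] mphi(1) L2_measurable[OF L(1)] ka_pos kb_pos
        by (simp add: D0_def mult.assoc[symmetric] ennreal_mult[symmetric])
      then show ?thesis using K(2) by (simp add: mult_right_mono ennreal_leI)
    qed
    have 1: "(\<Sum>e\<in>Basis. sqint ?Om (\<lambda>p. pull (\<lambda>e. dpartial e \<phi>) e p - pull g e p)) \<le> ennreal K * D1"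
    proof -
      let ?k = "(2 * ka\<^sup>2 + 2 * (kb + \<bar>kc\<bar>)\<^sup>2) / (ka * kb)"
      have "(\<Sum>e\<in>(Basis :: (real \<times> real) set). sqint ?Om (\<lambda>p. pull (\<lambda>e. dpartial e \<phi>) e p - pull g e p)) \<le> (\<Sum>e\<in>(Basis :: (real \<times> real) set). ennreal ?k * D1)"
        unfolding D1_def pull_diff by (intro sum_mono sqint_pull_le) (auto intro!: borel_measurable_diff mphi mg)
      also have "\<dots> = ennreal (2 * ?k) * D1"
      proof -
        have "ennreal (2 * k) * D1 = ennreal k * D1 + ennreal k * D1" if "k \<ge> 0" for k
        proof -
          have "ennreal (2 * k) = ennreal k + ennreal k" using that by (simp flip: ennreal_plus)
          then show ?thesis by (simp only: distrib_right)
        qed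
        note double = this[OF parts(2)]
        have "(\<Sum>e\<in>(Basis :: (real \<times> real) set). c) = c + c" for c :: ennreal
          unfolding Basis_plane by (subst sum.insert) auto
        then show ?thesis by (simp only: double)
      qed
      also have "\<dots> \<le> ennreal K * D1" by (intro mult_right_mono ennreal_leI K) simp
      finally show ?thesis .
    qed
    have 2: "boundary_sq_integral ?G (\<lambda>p. \<phi> (T p)) \<le> ennreal K * D2"
      unfolding boundary_T[OF smooth_measurable[OF phi]] D2_def by (intro mult_right_mono ennreal_leI K) simp
    have mpull: "pull (\<lambda>e. dpartial e \<phi>) e \<in> borel_measurable (leb ?Om)" "pull g e \<in> borel_measurable (leb ?Om)" for e
      by (rule pull_measurable mphi mg)+
    have mTb: "(\<lambda>p. \<phi> (TS m p) - \<phi> (T p)) \<in> borel_measurable borel"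
      using smooth_measurable[OF TS_smooth[OF phi]] smooth_T_measurable[OF phi] by (rule borel_measurable_diff)
    have tri: "sqint ?Om (\<lambda>p. \<eta> p - u (T p)) \<le> 2 * sqint ?Om (\<lambda>p. \<phi> (TS m p) - \<phi> (T p)) + 2 * sqint ?Om (\<lambda>p. \<phi> (T p) - u (T p))"
      using sqint_triangle[OF mchi(1) mT] by (simp add: \<eta>_def)
    have "boundary_sq_integral ?G \<eta> \<le> 2 * boundary_sq_integral ?G (\<lambda>p. \<phi> (TS m p) - \<phi> (T p)) + 2 * boundary_sq_integral ?G (\<lambda>p. \<phi> (T p))"
      using boundary_add_le[OF \<alpha>.guide_curves mTb smooth_T_measurable[OF phi]] by (simp add: \<eta>_def)
    then have "defect ?Om ?G (\<lambda>p. u (T p)) (pull g) \<eta>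
      \<le> (2 * sqint ?Om (\<lambda>p. \<phi> (TS m p) - \<phi> (T p)) + 2 * sqint ?Om (\<lambda>p. \<phi> (T p) - u (T p)))
        + (\<Sum>e\<in>Basis. 2 * sqint ?Om (\<lambda>p. dpartial e (\<lambda>p. \<phi> (TS m p)) p - pull (\<lambda>e. dpartial e \<phi>) e p)
            + 2 * sqint ?Om (\<lambda>p. pull (\<lambda>e. dpartial e \<phi>) e p - pull g e p))
        + (2 * boundary_sq_integral ?G (\<lambda>p. \<phi> (TS m p) - \<phi> (T p)) + 2 * boundary_sq_integral ?G (\<lambda>p. \<phi> (T p)))"
      unfolding defect_def \<eta>_def[symmetric]
      by (intro add_mono sum_mono tri sqint_triangle mT mpull mchi)
    also have "\<dots> = 2 * E m + 2 * (sqint ?Om (\<lambda>p. \<phi> (T p) - u (T p))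
        + (\<Sum>e\<in>Basis. sqint ?Om (\<lambda>p. pull (\<lambda>e. dpartial e \<phi>) e p - pull g e p)) + boundary_sq_integral ?G (\<lambda>p. \<phi> (T p)))"
      unfolding E_def sum.distrib sum_distrib_left[symmetric] by (simp only: distrib_left add_ac)
    also have "\<dots> \<le> 2 * E m + 2 * (ennreal K * D0 + ennreal K * D1 + ennreal K * D2)"
      by (intro add_mono mult_left_mono 0 1 2) auto
    also have "\<dots> = 2 * E m + 2 * (ennreal K * defect (broken_guide \<beta>) (guide_boundary \<beta>) u g \<phi>)"
      unfolding defect_def D0_def D1_def D2_def by (simp only: distrib_left)
    also have "\<dots> \<le> 2 * ennreal (\<epsilon> / 8) + 2 * (ennreal K * ennreal (\<epsilon> / (4 * K)))"
      using Em d K(1) by (intro add_mono mult_left_mono less_imp_le) auto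
    also have "\<dots> = ennreal (2 * (\<epsilon> / 8)) + ennreal (2 * (K * (\<epsilon> / (4 * K))))"
    proof -
      have "ennreal (2 * x) = 2 * ennreal x" if "x \<ge> 0" for x :: real using that by (simp add: ennreal_mult)
      moreover have "ennreal (K * (\<epsilon> / (4 * K))) = ennreal K * ennreal (\<epsilon> / (4 * K))"
        using \<epsilon> K(1) by (intro ennreal_mult) auto
      moreover have "K * (\<epsilon> / (4 * K)) \<ge> 0" "\<epsilon> / 8 \<ge> 0" using \<epsilon> K(1) by auto
      ultimately show ?thesis by metis
    qed
    also have "\<dots> = ennreal (2 * (\<epsilon> / 8) + 2 * (K * (\<epsilon> / (4 * K))))"
      using \<epsilon> K(1) by (subst ennreal_plus) auto
    also have "\<dots> < ennreal \<epsilon>"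
      using \<epsilon> K(1) by (intro ennreal_lessI) auto
    finally show ?thesis using chi by blast
  qed
  moreover have "pull g e \<in> L2 ?Om" if "e \<in> Basis" for e
  proof -
    have "sqint ?Om (pull g e) \<le> ennreal ((2 * ka\<^sup>2 + 2 * (kb + \<bar>kc\<bar>)\<^sup>2) / (ka * kb)) * (\<Sum>e\<in>Basis. sqint (broken_guide \<beta>) (g e))"
      by (rule sqint_pull_le[OF mg that])
    also have "\<dots> < \<infinity>" using L(2) by (auto simp: ennreal_mult_less_top L2_iff Basis_plane)
    finally show ?thesis using pull_measurable[OF mg] by (simp add: L2_iff)
  qed
  ultimately show ?thesis using L2_T[OF L(1)] by (simp add: trace_free_def)
qed

end

context guide
begin

text \<open>
  The derivative in the direction \<open>(\<plusminus> 1, cot \<theta>)\<close> of the arms, for a function with gradient \<open>g\<close>.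
\<close>

definition arm_derivative :: "(real \<times> real \<Rightarrow> real \<times> real \<Rightarrow> complex) \<Rightarrow> real \<times> real \<Rightarrow> complex" where
  "arm_derivative g p = g (1, 0) p + of_real (sgn (fst p) * (cos \<theta> / sin \<theta>)) * g (0, 1) p"

end

context guide_pair
begin

text \<open>
  If \<open>L\<close> is the linear part of \<open>T\<close> on one side, then \<open>L L\<^sup>T\<close> is the identity minus \<open>1 - ka\<^sup>2\<close> times the
  matrix \<open>n n\<^sup>T\<close> with \<open>n = (1, s cot \<beta>)\<close>. The factor \<open>ka\<^sup>2\<close> arises from the first diagonal
  entry, and the other entries agree by the choice of \<open>kb\<close> and \<open>kc\<close>.
\<close>

lemma energy_pointwise:
  fixes x y :: complex
  assumes "s\<^sup>2 = 1"
  shows "(norm (of_real ka * x + of_real (kc * s) * y))\<^sup>2 + (norm (of_real kb * y))\<^sup>2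
    + (1 - ka\<^sup>2) * (norm (x + of_real (s * (cos \<beta> / sin \<beta>)) * y))\<^sup>2 = (norm x)\<^sup>2 + (norm y)\<^sup>2"
proof -
  define q where "q = cos \<beta> / sin \<beta>"
  have exp: "(norm (of_real a * x + of_real b * y))\<^sup>2 = a\<^sup>2 * (norm x)\<^sup>2 + 2 * a * b * (x \<bullet> y) + b\<^sup>2 * (norm y)\<^sup>2" for a b :: real
    unfolding scaleR_conv_of_real[symmetric] power2_norm_eq_inner
    by (simp add: inner_add_left inner_add_right inner_commute power2_eq_square algebra_simps)
  have c1: "ka * kc = - ((1 - ka\<^sup>2) * q)"
  proof -
    have "ka * cos \<alpha> = cos \<beta>" using \<alpha>.cos_pos by (simp add: ka_def)
    then have "ka * (ka * cos \<beta> - cos \<alpha>) = - ((1 - ka\<^sup>2) * cos \<beta>)" by (simp add: algebra_simps power2_eq_square)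
    moreover have "ka * kc = (ka * (ka * cos \<beta> - cos \<alpha>)) / sin \<beta>" by (simp add: kc_def)
    ultimately show ?thesis by (simp add: q_def)
  qed
  have c2: "kc\<^sup>2 + kb\<^sup>2 + (1 - ka\<^sup>2) * q\<^sup>2 = 1"
  proof -
    have k: "ka * cos \<alpha> = cos \<beta>" using \<alpha>.cos_pos by (simp add: ka_def)
    have "(ka * cos \<beta> - cos \<alpha>)\<^sup>2 + (sin \<alpha>)\<^sup>2 + (1 - ka\<^sup>2) * (cos \<beta>)\<^sup>2
       = (cos \<alpha>)\<^sup>2 + (sin \<alpha>)\<^sup>2 + (cos \<beta>)\<^sup>2 - 2 * (ka * cos \<alpha>) * cos \<beta>"
      by (simp add: power2_diff power_mult_distrib algebra_simps power2_eq_square)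
    also have "\<dots> = 1 - (cos \<beta>)\<^sup>2" unfolding k by (simp add: power2_eq_square)
    also have "\<dots> = (sin \<beta>)\<^sup>2" by (simp add: sin_squared_eq)
    finally have "(ka * cos \<beta> - cos \<alpha>)\<^sup>2 + (sin \<alpha>)\<^sup>2 + (1 - ka\<^sup>2) * (cos \<beta>)\<^sup>2 = (sin \<beta>)\<^sup>2" .
    moreover have "kc\<^sup>2 + kb\<^sup>2 + (1 - ka\<^sup>2) * q\<^sup>2 = ((ka * cos \<beta> - cos \<alpha>)\<^sup>2 + (sin \<alpha>)\<^sup>2 + (1 - ka\<^sup>2) * (cos \<beta>)\<^sup>2) / (sin \<beta>)\<^sup>2"
      by (simp add: kc_def kb_def q_def power_divide add_divide_distrib)
    ultimately show ?thesis using \<beta>.sin_pos by simp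
  qed
  have e1: "(norm (of_real ka * x + of_real (kc * s) * y))\<^sup>2 = ka\<^sup>2 * (norm x)\<^sup>2 + 2 * (ka * kc) * s * (x \<bullet> y) + kc\<^sup>2 * (norm y)\<^sup>2"
    unfolding exp using assms by (simp add: power_mult_distrib)
  have e2: "(norm (of_real kb * y))\<^sup>2 = kb\<^sup>2 * (norm y)\<^sup>2" by (simp add: norm_mult power_mult_distrib)
  have e3: "(norm (x + of_real (s * q) * y))\<^sup>2 = (norm x)\<^sup>2 + 2 * s * q * (x \<bullet> y) + q\<^sup>2 * (norm y)\<^sup>2"
    using exp[of 1 "s * q"] assms by (simp add: power_mult_distrib)
  have "(norm (of_real ka * x + of_real (kc * s) * y))\<^sup>2 + (norm (of_real kb * y))\<^sup>2
    + (1 - ka\<^sup>2) * (norm (x + of_real (s * q) * y))\<^sup>2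
    = (norm x)\<^sup>2 + 2 * s * (x \<bullet> y) * (ka * kc + (1 - ka\<^sup>2) * q) + (kc\<^sup>2 + kb\<^sup>2 + (1 - ka\<^sup>2) * q\<^sup>2) * (norm y)\<^sup>2"
    unfolding e1 e2 e3 by (simp add: algebra_simps)
  also have "\<dots> = (norm x)\<^sup>2 + (norm y)\<^sup>2" unfolding c1 c2 by simp
  finally show ?thesis by (simp add: q_def)
qed

text \<open>
  The transplanted function has less energy, and the loss is the energy of the derivative along the
  arms.
\<close>

lemma energy_identity:
  assumes "g (1, 0) \<in> borel_measurable (leb (broken_guide \<beta>))" "g (0, 1) \<in> borel_measurable (leb (broken_guide \<beta>))"
  shows "(\<Sum>e\<in>Basis. sqint (broken_guide \<beta>) (g e)) = ennreal (ka * kb) * (\<Sum>e\<in>Basis. sqint (broken_guide \<alpha>) (pull g e))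
    + ennreal (1 - ka\<^sup>2) * sqint (broken_guide \<beta>) (\<beta>.arm_derivative g)"
proof -
  let ?Om = "leb (broken_guide \<alpha>)"
  have [measurable]: "(\<lambda>p. g (1, 0) (T p)) \<in> borel_measurable ?Om" "(\<lambda>p. g (0, 1) (T p)) \<in> borel_measurable ?Om"
    by (rule measurable_compose[OF T_measurable_leb], rule assms)+
  have sm[measurable]: "(\<lambda>p::real \<times> real. sgn (fst p)) \<in> borel_measurable (leb S)" for S
    by (intro measurable_restrict_space1) (simp add: sgn_measurable)
  have ad_m: "\<beta>.arm_derivative g \<in> borel_measurable (leb (broken_guide \<beta>))"
    unfolding \<beta>.arm_derivative_def[abs_def] using assms by measurable
  have [measurable]: "pull g e \<in> borel_measurable ?Om" for e by (rule pull_measurable[OF assms])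
  have [measurable]: "(\<lambda>p. \<beta>.arm_derivative g (T p)) \<in> borel_measurable ?Om"
    by (rule measurable_compose[OF T_measurable_leb ad_m])
  have ka2: "1 - ka\<^sup>2 \<ge> 0" using ka_pos ka_less_1 by (simp add: power_le_one)
  have "sqint (broken_guide \<alpha>) (\<lambda>p. g (1, 0) (T p)) + sqint (broken_guide \<alpha>) (\<lambda>p. g (0, 1) (T p))
    = (\<integral>\<^sup>+p. ennreal ((norm (g (1, 0) (T p)))\<^sup>2 + (norm (g (0, 1) (T p)))\<^sup>2) \<partial>?Om)"
    unfolding sqint_def by (subst nn_integral_add[symmetric]) (auto simp: ennreal_plus)
  also have "\<dots> = (\<integral>\<^sup>+p. ennreal ((norm (pull g (1, 0) p))\<^sup>2 + (norm (pull g (0, 1) p))\<^sup>2 + (1 - ka\<^sup>2) * (norm (\<beta>.arm_derivative g (T p)))\<^sup>2) \<partial>?Om)"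
  proof (rule nn_integral_cong_AE)
    have "AE p in ?Om. fst p \<noteq> 0"
      using AE_plane(1)[of 0] \<alpha>.guide_borel by (subst AE_restrict_space_iff) auto
    then show "AE p in ?Om. ennreal ((norm (g (1, 0) (T p)))\<^sup>2 + (norm (g (0, 1) (T p)))\<^sup>2)
      = ennreal ((norm (pull g (1, 0) p))\<^sup>2 + (norm (pull g (0, 1) p))\<^sup>2 + (1 - ka\<^sup>2) * (norm (\<beta>.arm_derivative g (T p)))\<^sup>2)"
    proof (rule AE_mp, intro AE_I2 impI)
      fix p :: "real \<times> real" assume p: "fst p \<noteq> 0"
      obtain x z where xz: "p = (x, z)" by fastforce
      have s2: "(sgn x)\<^sup>2 = 1" using p xz by (auto simp: sgn_if)
      have "sgn (ka * x) = sgn x" using ka_pos by (simp add: sgn_mult)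
      then have "\<beta>.arm_derivative g (T p) = g (1, 0) (T p) + of_real (sgn x * (cos \<beta> / sin \<beta>)) * g (0, 1) (T p)"
        by (simp add: \<beta>.arm_derivative_def xz T_eq)
      moreover have "pull g (1, 0) p = of_real ka * g (1, 0) (T p) + of_real (kc * sgn x) * g (0, 1) (T p)"
        "pull g (0, 1) p = of_real kb * g (0, 1) (T p)"
        by (simp_all add: pull_def xz)
      ultimately show "ennreal ((norm (g (1, 0) (T p)))\<^sup>2 + (norm (g (0, 1) (T p)))\<^sup>2)
        = ennreal ((norm (pull g (1, 0) p))\<^sup>2 + (norm (pull g (0, 1) p))\<^sup>2 + (1 - ka\<^sup>2) * (norm (\<beta>.arm_derivative g (T p)))\<^sup>2)"
        using energy_pointwise[OF s2, of "g (1, 0) (T p)" "g (0, 1) (T p)"] by simp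
    qed
  qed
  also have "\<dots> = (\<integral>\<^sup>+p. (ennreal ((norm (pull g (1, 0) p))\<^sup>2) + ennreal ((norm (pull g (0, 1) p))\<^sup>2)) + ennreal (1 - ka\<^sup>2) * ennreal ((norm (\<beta>.arm_derivative g (T p)))\<^sup>2) \<partial>?Om)"
    using ka2 by (intro nn_integral_cong) (simp add: ennreal_plus ennreal_mult)
  also have "\<dots> = (sqint (broken_guide \<alpha>) (pull g (1, 0)) + sqint (broken_guide \<alpha>) (pull g (0, 1))) + ennreal (1 - ka\<^sup>2) * sqint (broken_guide \<alpha>) (\<lambda>p. \<beta>.arm_derivative g (T p))"
    unfolding sqint_def
    by (subst nn_integral_add, measurable, subst nn_integral_add, measurable, subst nn_integral_cmult, measurable) simp?
  finally have e: "sqint (broken_guide \<alpha>) (\<lambda>p. g (1, 0) (T p)) + sqint (broken_guide \<alpha>) (\<lambda>p. g (0, 1) (T p))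
    = (sqint (broken_guide \<alpha>) (pull g (1, 0)) + sqint (broken_guide \<alpha>) (pull g (0, 1))) + ennreal (1 - ka\<^sup>2) * sqint (broken_guide \<alpha>) (\<lambda>p. \<beta>.arm_derivative g (T p))" .
  have "(\<Sum>e\<in>Basis. sqint (broken_guide \<beta>) (g e)) = ennreal (ka * kb) * (sqint (broken_guide \<alpha>) (\<lambda>p. g (1, 0) (T p)) + sqint (broken_guide \<alpha>) (\<lambda>p. g (0, 1) (T p)))"
    using sqint_T[OF assms(1)] sqint_T[OF assms(2)] by (simp add: Basis_plane distrib_left)
  also have "\<dots> = ennreal (ka * kb) * (\<Sum>e\<in>Basis. sqint (broken_guide \<alpha>) (pull g e)) + ennreal (1 - ka\<^sup>2) * (ennreal (ka * kb) * sqint (broken_guide \<alpha>) (\<lambda>p. \<beta>.arm_derivative g (T p)))"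
    unfolding e by (simp add: Basis_plane distrib_left mult_ac)
  finally show ?thesis by (simp only: sqint_T[OF ad_m])
qed

end

section \<open>Functions that are constant along the guide vanish\<close>

text \<open>
  From \<open>\<bar>f(y)\<bar>\<^sup>2 = - \<integral> (\<bar>f\<bar>\<^sup>2)'\<close> and \<open>2 \<bar>f\<bar> \<bar>f'\<bar> \<le> \<epsilon> \<bar>f\<bar>\<^sup>2 + \<bar>f'\<bar>\<^sup>2 / \<epsilon>\<close>. The small factor in front of \<open>f\<close>
  itself is what makes the derivative control the function on a half line.
\<close>

lemma decay_pointwise:
  fixes f f' :: "real \<Rightarrow> complex"
  assumes f: "\<And>y. (f has_vector_derivative f' y) (at y)" and c: "continuous_on UNIV f'"
    and L: "\<And>y. y \<ge> L \<Longrightarrow> f y = 0" and y: "y \<ge> 0" and \<epsilon>: "\<epsilon> > 0"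
  shows "ennreal ((norm (f y))\<^sup>2) \<le> ennreal \<epsilon> * sqint {0..} f + ennreal (1 / \<epsilon>) * sqint {0..} f'"
proof -
  have cf: "continuous_on UNIV f"
    using f by (auto intro!: has_vector_derivative_continuous continuous_at_imp_continuous_on)
  define b where "b = max L y"
  have fb: "f b = 0" by (rule L) (simp add: b_def)
  have yb: "y \<le> b" by (simp add: b_def)
  have "((\<lambda>t. f t \<bullet> f t) has_vector_derivative (f t \<bullet> f' t + f' t \<bullet> f t)) (at t within {y..b})" for t
    by (rule bounded_bilinear.has_vector_derivative[OF bounded_bilinear_inner
          has_vector_derivative_at_within[OF f] has_vector_derivative_at_within[OF f]])
  then have "((\<lambda>t. f t \<bullet> f' t + f' t \<bullet> f t) has_integral (f b \<bullet> f b - f y \<bullet> f y)) {y..b}"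
    using yb by (intro fundamental_theorem_of_calculus) auto
  from has_integral_neg[OF this]
  have i1: "((\<lambda>t. - (f t \<bullet> f' t + f' t \<bullet> f t)) has_integral (norm (f y))\<^sup>2) {y..b}"
    by (simp only: fb power2_norm_eq_inner inner_zero_left diff_0 minus_minus)
  have i2: "((\<lambda>x. (norm (f x))\<^sup>2) has_integral integral {y..b} (\<lambda>x. (norm (f x))\<^sup>2)) {y..b}"
    by (intro integrable_integral integrable_continuous_real continuous_intros continuous_on_subset[OF cf]) auto
  have i3: "((\<lambda>x. (norm (f' x))\<^sup>2) has_integral integral {y..b} (\<lambda>x. (norm (f' x))\<^sup>2)) {y..b}"
    by (intro integrable_integral integrable_continuous_real continuous_intros continuous_on_subset[OF c]) auto
  have "- (f t \<bullet> f' t + f' t \<bullet> f t) \<le> \<epsilon> * (norm (f t))\<^sup>2 + 1 / \<epsilon> * (norm (f' t))\<^sup>2" for t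
  proof -
    have "0 \<le> (norm (\<epsilon> *\<^sub>R f t + f' t))\<^sup>2" by simp
    also have "\<dots> = \<epsilon> * (\<epsilon> * (norm (f t))\<^sup>2) + \<epsilon> * (f t \<bullet> f' t + f' t \<bullet> f t) + (norm (f' t))\<^sup>2"
      unfolding power2_norm_eq_inner by (simp add: inner_add_left inner_add_right inner_commute algebra_simps)
    finally have "- (\<epsilon> * (f t \<bullet> f' t + f' t \<bullet> f t)) \<le> \<epsilon> * (\<epsilon> * (norm (f t))\<^sup>2) + (norm (f' t))\<^sup>2" by simp
    then have "\<epsilon> * (- (f t \<bullet> f' t + f' t \<bullet> f t)) \<le> \<epsilon> * (\<epsilon> * (norm (f t))\<^sup>2 + 1 / \<epsilon> * (norm (f' t))\<^sup>2)"
      using \<epsilon> by (simp add: distrib_left right_diff_distrib)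
    then show ?thesis using \<epsilon> by (simp only: mult_le_cancel_left_pos)
  qed
  then have "(norm (f y))\<^sup>2 \<le> \<epsilon> * integral {y..b} (\<lambda>x. (norm (f x))\<^sup>2) + 1 / \<epsilon> * integral {y..b} (\<lambda>x. (norm (f' x))\<^sup>2)"
    by (intro has_integral_le[OF i1 has_integral_add[OF has_integral_mult_right[OF i2] has_integral_mult_right[OF i3]]]) auto
  then have "ennreal ((norm (f y))\<^sup>2) \<le> ennreal (\<epsilon> * integral {y..b} (\<lambda>x. (norm (f x))\<^sup>2) + 1 / \<epsilon> * integral {y..b} (\<lambda>x. (norm (f' x))\<^sup>2))"
    by (rule ennreal_leI)
  also have "\<dots> = ennreal \<epsilon> * sqint {y..b} f + ennreal (1 / \<epsilon>) * sqint {y..b} f'"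
    using has_integral_nonneg[OF i2] has_integral_nonneg[OF i3] \<epsilon>
    by (simp add: sqint_Icc_eq_integral[OF cf] sqint_Icc_eq_integral[OF c] ennreal_mult[symmetric] ennreal_plus[symmetric] del: ennreal_plus)
  also have "\<dots> \<le> ennreal \<epsilon> * sqint {0..} f + ennreal (1 / \<epsilon>) * sqint {0..} f'"
    using y by (intro add_mono mult_left_mono) (auto simp: sqint_eq intro!: nn_integral_mono split: split_indicator)
  finally show ?thesis .
qed

context guide
begin

text \<open>
  Integration of \<open>decay_pointwise\<close> over the part of the half strip with \<open>y < R\<close>, along the lines parallel
  to the arm.
\<close>

lemma decay_half:
  assumes phi: "\<phi> \<in> smooth_compact_support" and s: "\<sigma> = 1 \<or> \<sigma> = -1" and R: "R > 0" and \<epsilon>: "\<epsilon> > 0"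
  shows "(\<integral>\<^sup>+q. ennreal ((norm (\<phi> (pt \<sigma> q)))\<^sup>2) * indicator ({0..<R} \<times> {0..<1}) q \<partial>lborel)
    \<le> ennreal R * (ennreal \<epsilon> * (\<integral>\<^sup>+q. ennreal ((norm (\<phi> (pt \<sigma> q)))\<^sup>2) * indicator half_strip q \<partial>lborel)
      + ennreal (1 / \<epsilon>) * (\<integral>\<^sup>+q. ennreal ((norm (dpartial (guide_A \<theta> \<sigma>) \<phi> (pt \<sigma> q)))\<^sup>2) * indicator half_strip q \<partial>lborel))"
proof -
  let ?A = "guide_A \<theta> \<sigma>" and ?B = "guide_B \<theta>"
  note dphi = dpartial_smooth[OF phi]
  note [measurable] = smooth_measurable[OF phi] smooth_measurable[OF dphi]
  have pm[measurable]: "(\<lambda>q. f (pt \<sigma> q)) \<in> borel_measurable (borel \<Otimes>\<^sub>M borel)" if "f \<in> borel_measurable borel" for f :: "real \<times> real \<Rightarrow> complex"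
    unfolding borel_prod using that by measurable
  have S: "{0..<R} \<times> {0..<1} \<in> sets (borel :: (real \<times> real) measure)" by (simp add: borel_prod[symmetric])
  obtain M where M: "M > 0" "\<And>x. norm x \<ge> M \<Longrightarrow> \<phi> x = 0" using smooth_support_ball[OF phi] by blast
  have fibre: "ennreal ((norm (\<phi> (pt \<sigma> (y, t))))\<^sup>2)
     \<le> ennreal \<epsilon> * sqint {0..} (\<lambda>y. \<phi> (pt \<sigma> (y, t))) + ennreal (1 / \<epsilon>) * sqint {0..} (\<lambda>y. dpartial ?A \<phi> (pt \<sigma> (y, t)))" if "y \<ge> 0" for y t
  proof (rule decay_pointwise[OF _ _ _ that \<epsilon>])
    show "((\<lambda>y. \<phi> (pt \<sigma> (y, t))) has_vector_derivative dpartial ?A \<phi> (pt \<sigma> (y, t))) (at y)" for y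
      using smooth_directional[OF phi, of "t *\<^sub>R ?B" ?A y] by (simp add: strip_point_def add.commute)
    show "continuous_on UNIV (\<lambda>y. dpartial ?A \<phi> (pt \<sigma> (y, t)))"
      unfolding strip_point_def by (rule continuous_on_compose2[OF smooth_continuous[OF dphi, of UNIV]]) (auto intro!: continuous_intros)
    show "\<phi> (pt \<sigma> (y, t)) = 0" if "y \<ge> M / cos \<theta>" for y
    proof (rule M(2))
      have "M \<le> cos \<theta> * y" using that cos_pos by (simp add: field_simps)
      also have "\<dots> \<le> \<bar>\<sigma> * cos \<theta> * y\<bar>" using s abs_ge_self[of "cos \<theta> * y"] by auto
      also have "\<dots> \<le> norm (pt \<sigma> (y, t))" unfolding pt_eq by (metis norm_fst_le real_norm_def)
      finally show "M \<le> norm (pt \<sigma> (y, t))" .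
    qed
  qed
  have iter: "(\<integral>\<^sup>+q. ennreal ((norm (f (pt \<sigma> q)))\<^sup>2) * indicator half_strip q \<partial>lborel)
      = (\<integral>\<^sup>+t. sqint {0..} (\<lambda>y. f (pt \<sigma> (y, t))) * indicator {0..<1} t \<partial>lborel)"
    if f: "f \<in> borel_measurable borel" for f :: "real \<times> real \<Rightarrow> complex"
  proof -
    note [measurable] = f pm[OF f]
    have fm: "(\<lambda>q. ennreal ((norm (f (pt \<sigma> q)))\<^sup>2) * indicator half_strip q) \<in> borel_measurable borel"
      using half_strip_borel pm[OF f] unfolding borel_prod by measurable
    have "(\<integral>\<^sup>+q. ennreal ((norm (f (pt \<sigma> q)))\<^sup>2) * indicator half_strip q \<partial>lborel)
       = (\<integral>\<^sup>+t. \<integral>\<^sup>+y. (ennreal ((norm (f (pt \<sigma> (y, t))))\<^sup>2) * indicator {0..} y) * indicator {0..<1} t \<partial>lborel \<partial>lborel)"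
      unfolding nn_integral_plane(2)[OF fm] by (auto simp: half_strip_def indicator_def intro!: nn_integral_cong)
    then show ?thesis by (simp add: sqint_eq nn_integral_multc)
  qed
  have sm: "(\<lambda>t. sqint {0..} (\<lambda>y. f (pt \<sigma> (y, t)))) \<in> borel_measurable borel"
    if f: "f \<in> borel_measurable borel" for f :: "real \<times> real \<Rightarrow> complex"
  proof -
    note [measurable] = pm[OF f]
    show ?thesis by (simp add: sqint_eq)
  qed
  note [measurable] = sm[OF smooth_measurable[OF phi]] sm[OF smooth_measurable[OF dphi]]
  let ?F = "\<lambda>t. ennreal \<epsilon> * sqint {0..} (\<lambda>y. \<phi> (pt \<sigma> (y, t))) + ennreal (1 / \<epsilon>) * sqint {0..} (\<lambda>y. dpartial ?A \<phi> (pt \<sigma> (y, t)))"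
  have "(\<integral>\<^sup>+q. ennreal ((norm (\<phi> (pt \<sigma> q)))\<^sup>2) * indicator ({0..<R} \<times> {0..<1}) q \<partial>lborel)
     = (\<integral>\<^sup>+t. \<integral>\<^sup>+y. ennreal ((norm (\<phi> (pt \<sigma> (y, t))))\<^sup>2) * indicator ({0..<R} \<times> {0..<1}) (y, t) \<partial>lborel \<partial>lborel)"
  proof (rule nn_integral_plane(2))
    show "(\<lambda>q. ennreal ((norm (\<phi> (pt \<sigma> q)))\<^sup>2) * indicator ({0..<R} \<times> {0..<1}) q) \<in> borel_measurable borel"
      using S pm[OF smooth_measurable[OF phi]] unfolding borel_prod by measurable
  qed
  also have "\<dots> \<le> (\<integral>\<^sup>+t. \<integral>\<^sup>+y. (?F t * indicator {0..<1} t) * indicator {0..<R} y \<partial>lborel \<partial>lborel)"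
    using fibre by (intro nn_integral_mono) (auto split: split_indicator)
  also have "\<dots> = (\<integral>\<^sup>+t. (?F t * indicator {0..<1} t) * ennreal R \<partial>lborel)"
    using R by (subst nn_integral_cmult) auto
  also have "\<dots> = (\<integral>\<^sup>+t. ennreal R * (ennreal \<epsilon> * (sqint {0..} (\<lambda>y. \<phi> (pt \<sigma> (y, t))) * indicator {0..<1} t)
      + ennreal (1 / \<epsilon>) * (sqint {0..} (\<lambda>y. dpartial ?A \<phi> (pt \<sigma> (y, t))) * indicator {0..<1} t)) \<partial>lborel)"
    by (intro nn_integral_cong) (simp add: distrib_left distrib_right mult_ac)
  also have "\<dots> = ennreal R * (ennreal \<epsilon> * (\<integral>\<^sup>+t. sqint {0..} (\<lambda>y. \<phi> (pt \<sigma> (y, t))) * indicator {0..<1} t \<partial>lborel)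
      + ennreal (1 / \<epsilon>) * (\<integral>\<^sup>+t. sqint {0..} (\<lambda>y. dpartial ?A \<phi> (pt \<sigma> (y, t))) * indicator {0..<1} t \<partial>lborel))"
    by (subst nn_integral_cmult, measurable, subst nn_integral_add, measurable, subst (1 2) nn_integral_cmult, measurable)
  finally show ?thesis
    by (simp only: iter[OF smooth_measurable[OF phi]] iter[OF smooth_measurable[OF dphi]])
qed

lemma decay_guide:
  assumes phi: "\<phi> \<in> smooth_compact_support" and R: "R > 0" and \<epsilon>: "\<epsilon> > 0"
  shows "sqint (\<Omega> \<inter> {p. \<bar>fst p\<bar> < cos \<theta> * R}) \<phi>
    \<le> ennreal (R * \<epsilon>) * sqint \<Omega> \<phi> + ennreal (R / \<epsilon>) * sqint \<Omega> (arm_derivative (\<lambda>e. dpartial e \<phi>))"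
proof -
  note dphi = dpartial_smooth[OF phi]
  have mt[measurable]: "arm_derivative (\<lambda>e. dpartial e \<phi>) \<in> borel_measurable borel"
  proof -
    note [measurable] = smooth_measurable[OF dphi]
    have [measurable]: "(\<lambda>p::real \<times> real. sgn (fst p)) \<in> borel_measurable borel"
      unfolding borel_prod[symmetric] by measurable
    show ?thesis unfolding arm_derivative_def[abs_def] by measurable
  qed
  note [measurable] = smooth_measurable[OF phi] smooth_measurable[OF dphi]
  define S where "S = {p :: real \<times> real. \<bar>fst p\<bar> < cos \<theta> * R}"
  have S[measurable]: "S \<in> sets borel"
    unfolding S_def by (intro borel_open open_Collect_less continuous_intros)
  define W where "W = (\<lambda>\<sigma>. \<integral>\<^sup>+q. ennreal ((norm (\<phi> (pt \<sigma> q)))\<^sup>2) * indicator half_strip q \<partial>lborel)"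
  define D where "D = (\<lambda>\<sigma>. \<integral>\<^sup>+q. ennreal ((norm (arm_derivative (\<lambda>e. dpartial e \<phi>) (pt \<sigma> q)))\<^sup>2) * indicator half_strip q \<partial>lborel)"
  have half: "(\<integral>\<^sup>+q. (ennreal ((norm (\<phi> (pt \<sigma> q)))\<^sup>2) * indicator S (pt \<sigma> q)) * indicator half_strip q \<partial>lborel)
     \<le> ennreal (R * \<epsilon>) * W \<sigma> + ennreal (R / \<epsilon>) * D \<sigma>" if s: "\<sigma> = 1 \<or> \<sigma> = -1" for \<sigma>
  proof -
    have "(\<integral>\<^sup>+q. (ennreal ((norm (\<phi> (pt \<sigma> q)))\<^sup>2) * indicator S (pt \<sigma> q)) * indicator half_strip q \<partial>lborel)
       = (\<integral>\<^sup>+q. ennreal ((norm (\<phi> (pt \<sigma> q)))\<^sup>2) * indicator ({0..<R} \<times> {0..<1}) q \<partial>lborel)"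
    proof (rule nn_integral_cong)
      fix q :: "real \<times> real"
      obtain y t where q: "q = (y, t)" by fastforce
      have "\<bar>\<sigma> * cos \<theta> * y\<bar> = cos \<theta> * y" if "y \<ge> 0" using s that cos_pos by (auto simp: abs_mult)
      then have "pt \<sigma> q \<in> S \<longleftrightarrow> y < R" if "y \<ge> 0" using that cos_pos by (simp add: q pt_eq S_def)
      then show "(ennreal ((norm (\<phi> (pt \<sigma> q)))\<^sup>2) * indicator S (pt \<sigma> q)) * indicator half_strip q
        = ennreal ((norm (\<phi> (pt \<sigma> q)))\<^sup>2) * indicator ({0..<R} \<times> {0..<1}) q"
        by (auto simp: q half_strip_def indicator_def)
    qed
    also have "\<dots> \<le> ennreal R * (ennreal \<epsilon> * W \<sigma>
      + ennreal (1 / \<epsilon>) * (\<integral>\<^sup>+q. ennreal ((norm (dpartial (guide_A \<theta> \<sigma>) \<phi> (pt \<sigma> q)))\<^sup>2) * indicator half_strip q \<partial>lborel))"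
      unfolding W_def by (rule decay_half[OF phi s R \<epsilon>])
    also have "\<dots> \<le> ennreal R * (ennreal \<epsilon> * W \<sigma> + ennreal (1 / \<epsilon>) * D \<sigma>)"
      unfolding D_def
    proof (intro mult_left_mono add_left_mono)
      show "(\<integral>\<^sup>+q. ennreal ((norm (dpartial (guide_A \<theta> \<sigma>) \<phi> (pt \<sigma> q)))\<^sup>2) * indicator half_strip q \<partial>lborel)
        \<le> (\<integral>\<^sup>+q. ennreal ((norm (arm_derivative (\<lambda>e. dpartial e \<phi>) (pt \<sigma> q)))\<^sup>2) * indicator half_strip q \<partial>lborel)"
    proof (rule nn_integral_mono_AE, rule AE_mp[OF AE_plane(1)[of 0]], intro AE_I2 impI)
      fix q :: "real \<times> real" assume q0: "fst q \<noteq> 0"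
      obtain y t where q: "q = (y, t)" by fastforce
      show "ennreal ((norm (dpartial (guide_A \<theta> \<sigma>) \<phi> (pt \<sigma> q)))\<^sup>2) * indicator half_strip q
        \<le> ennreal ((norm (arm_derivative (\<lambda>e. dpartial e \<phi>) (pt \<sigma> q)))\<^sup>2) * indicator half_strip q"
      proof (cases "q \<in> half_strip")
        case True
        then have y: "y > 0" using q0 by (simp add: q half_strip_def)
        have sg: "sgn (fst (pt \<sigma> q)) = \<sigma>" using s y cos_pos by (auto simp: q pt_eq sgn_mult)
        have a: "\<sigma> * \<sigma> = 1" using s by auto
        have "dpartial (guide_A \<theta> \<sigma>) \<phi> (pt \<sigma> q) = of_real (\<sigma> * cos \<theta>) * arm_derivative (\<lambda>e. dpartial e \<phi>) (pt \<sigma> q)"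
        proof -
          have "(\<sigma> * cos \<theta>) * (\<sigma> * (cos \<theta> / sin \<theta>)) = (cos \<theta>)\<^sup>2 / sin \<theta>"
            using a by (simp add: power2_eq_square)
          then have "complex_of_real ((cos \<theta>)\<^sup>2 / sin \<theta>) = of_real (\<sigma> * cos \<theta>) * of_real (\<sigma> * (cos \<theta> / sin \<theta>))"
            by (simp only: of_real_mult[symmetric])
          then show ?thesis
            unfolding dpartial_pair[OF phi, where v = "guide_A \<theta> \<sigma>"] arm_derivative_def sg
            by (simp only: guide_A_def fst_conv snd_conv distrib_left mult.assoc)
        qed
        then have "norm (dpartial (guide_A \<theta> \<sigma>) \<phi> (pt \<sigma> q)) = \<bar>\<sigma> * cos \<theta>\<bar> * norm (arm_derivative (\<lambda>e. dpartial e \<phi>) (pt \<sigma> q))"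
          by (simp only: norm_mult norm_of_real)
        also have "\<dots> \<le> norm (arm_derivative (\<lambda>e. dpartial e \<phi>) (pt \<sigma> q))"
          using s by (intro mult_left_le_one_le) (auto simp: abs_mult)
        finally show ?thesis by (intro mult_right_mono ennreal_leI power_mono) auto
      qed simp
    qed
    qed auto
    also have "\<dots> = ennreal (R * \<epsilon>) * W \<sigma> + ennreal (R / \<epsilon>) * D \<sigma>"
      using R \<epsilon> by (simp add: distrib_left mult.assoc[symmetric] ennreal_mult[symmetric])
    finally show ?thesis .
  qed
  let ?\<kappa> = "ennreal (cos \<theta> / sin \<theta>)"
  have OS: "\<Omega> \<inter> S \<in> sets borel" by measurable
  have "sqint (\<Omega> \<inter> S) \<phi> = (\<integral>\<^sup>+p. (ennreal ((norm (\<phi> p))\<^sup>2) * indicator S p) * indicator \<Omega> p \<partial>lborel)"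
    unfolding sqint_eq[OF OS] by (intro nn_integral_cong) (auto simp: indicator_def)
  also have "\<dots> = ?\<kappa> * (\<integral>\<^sup>+q. (ennreal ((norm (\<phi> (pt 1 q)))\<^sup>2) * indicator S (pt 1 q)) * indicator half_strip q \<partial>lborel)
    + ?\<kappa> * (\<integral>\<^sup>+q. (ennreal ((norm (\<phi> (pt (-1) q)))\<^sup>2) * indicator S (pt (-1) q)) * indicator half_strip q \<partial>lborel)"
    by (rule guide_integral) measurable
  also have "\<dots> \<le> ?\<kappa> * (ennreal (R * \<epsilon>) * W 1 + ennreal (R / \<epsilon>) * D 1) + ?\<kappa> * (ennreal (R * \<epsilon>) * W (-1) + ennreal (R / \<epsilon>) * D (-1))"
    by (intro add_mono mult_left_mono half) auto
  also have "\<dots> = ennreal (R * \<epsilon>) * (?\<kappa> * W 1 + ?\<kappa> * W (-1)) + ennreal (R / \<epsilon>) * (?\<kappa> * D 1 + ?\<kappa> * D (-1))"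
    by (simp only: distrib_left mult_ac add_ac)
  also have "?\<kappa> * W 1 + ?\<kappa> * W (-1) = sqint \<Omega> \<phi>"
    unfolding sqint_eq[OF guide_borel] W_def by (rule guide_integral[symmetric]) simp
  also have "?\<kappa> * D 1 + ?\<kappa> * D (-1) = sqint \<Omega> (arm_derivative (\<lambda>e. dpartial e \<phi>))"
    unfolding sqint_eq[OF guide_borel] D_def by (rule guide_integral[symmetric]) simp
  finally show ?thesis by (simp add: S_def)
qed

text \<open>
  In \<open>decay_guide\<close>, applied to an approximating sequence, the second term disappears in the limit;
  letting \<open>\<epsilon>\<close> tend to zero removes the first. So \<open>u\<close> vanishes on every bounded part of the guide.
\<close>

lemma zero_of_arm_derivative_zero:
  assumes tf: "trace_free \<Omega> \<Gamma> u g" and zero: "sqint \<Omega> (arm_derivative g) = 0"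
  shows "sqint \<Omega> u = 0"
proof -
  have B: "(1, 0) \<in> (Basis :: (real \<times> real) set)" "(0, 1) \<in> (Basis :: (real \<times> real) set)" unfolding Basis_plane by simp_all
  have L: "u \<in> L2 \<Omega>" "\<And>e. e \<in> Basis \<Longrightarrow> g e \<in> L2 \<Omega>" using tf by (auto simp: trace_free_def)
  note Lm = L2_measurable[OF L(1)] L2_measurable[OF L(2)[OF B(1)]] L2_measurable[OF L(2)[OF B(2)]]
  obtain \<phi> where \<phi>: "\<And>n. \<phi> n \<in> smooth_compact_support"
    "(\<lambda>n. sqint \<Omega> (\<lambda>x. \<phi> n x - u x)) \<longlonglongrightarrow> 0"
    "\<And>e. e \<in> Basis \<Longrightarrow> (\<lambda>n. sqint \<Omega> (\<lambda>x. dpartial e (\<phi> n) x - g e x)) \<longlonglongrightarrow> 0"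
    "(\<lambda>n. boundary_sq_integral \<Gamma> (\<phi> n)) \<longlonglongrightarrow> 0"
    by (rule trace_free_sequence[OF tf]) blast
  have sgm: "(\<lambda>p::real \<times> real. sgn (fst p)) \<in> borel_measurable borel"
    unfolding borel_prod[symmetric] by measurable
  have sgm'[measurable]: "(\<lambda>p::real \<times> real. sgn (fst p)) \<in> borel_measurable (leb \<Omega>)"
    by (intro measurable_restrict_space1) (simp add: sgm)
  have dm: "dpartial e (\<phi> n) \<in> borel_measurable (leb \<Omega>)" for e n
    using smooth_L2[OF dpartial_smooth[OF \<phi>(1)] guide_borel] by (rule L2_measurable)
  have twm: "arm_derivative h \<in> borel_measurable (leb \<Omega>)"
    if [measurable]: "h (1, 0) \<in> borel_measurable (leb \<Omega>)" "h (0, 1) \<in> borel_measurable (leb \<Omega>)" for h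
    unfolding arm_derivative_def[abs_def] by measurable
  define q where "q = cos \<theta> / sin \<theta>"
  have tw: "sqint \<Omega> (arm_derivative (\<lambda>e. dpartial e (\<phi> n)))
    \<le> 2 * (2 * sqint \<Omega> (\<lambda>x. dpartial (1, 0) (\<phi> n) x - g (1, 0) x) + 2 * (ennreal (q\<^sup>2) * sqint \<Omega> (\<lambda>x. dpartial (0, 1) (\<phi> n) x - g (0, 1) x)))" for n
  proof -
    let ?d1 = "\<lambda>x. dpartial (1, 0) (\<phi> n) x - g (1, 0) x" and ?d2 = "\<lambda>x. dpartial (0, 1) (\<phi> n) x - g (0, 1) x"
    have md: "?d1 \<in> borel_measurable (leb \<Omega>)" "?d2 \<in> borel_measurable (leb \<Omega>)"
      by (intro borel_measurable_diff dm Lm)+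
    note [measurable] = md
    have md': "(\<lambda>x. of_real (sgn (fst x) * q) * ?d2 x) \<in> borel_measurable (leb \<Omega>)" by measurable
    have "arm_derivative (\<lambda>e. dpartial e (\<phi> n)) = (\<lambda>x. arm_derivative (\<lambda>e. dpartial e (\<phi> n)) x - arm_derivative g x + arm_derivative g x)" by simp
    then have "sqint \<Omega> (arm_derivative (\<lambda>e. dpartial e (\<phi> n))) \<le> 2 * sqint \<Omega> (\<lambda>x. arm_derivative (\<lambda>e. dpartial e (\<phi> n)) x - arm_derivative g x) + 2 * sqint \<Omega> (arm_derivative g)"
      using sqint_add_le[of "\<lambda>x. arm_derivative (\<lambda>e. dpartial e (\<phi> n)) x - arm_derivative g x" \<Omega> "arm_derivative g"] twm dm Lm by simp
    also have "\<dots> = 2 * sqint \<Omega> (\<lambda>x. ?d1 x + of_real (sgn (fst x) * q) * ?d2 x)"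
      unfolding zero by (simp add: arm_derivative_def q_def algebra_simps)
    also have "\<dots> \<le> 2 * (2 * sqint \<Omega> ?d1 + 2 * sqint \<Omega> (\<lambda>x. of_real (sgn (fst x) * q) * ?d2 x))"
      by (intro mult_left_mono sqint_add_le md md') simp
    also have "\<dots> \<le> 2 * (2 * sqint \<Omega> ?d1 + 2 * sqint \<Omega> (\<lambda>x. of_real q * ?d2 x))"
      unfolding sqint_def
    proof (intro mult_left_mono add_left_mono, intro nn_integral_mono ennreal_leI power_mono)
      fix x :: "real \<times> real"
      have "\<bar>sgn (fst x) * q\<bar> \<le> \<bar>q\<bar>" by (simp add: abs_mult sgn_if)
      then show "norm (of_real (sgn (fst x) * q) * ?d2 x) \<le> norm (of_real q * ?d2 x)"
        unfolding norm_mult norm_of_real by (rule mult_right_mono) simp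
    qed auto
    also have "sqint \<Omega> (\<lambda>x. of_real q * ?d2 x) = ennreal (q\<^sup>2) * sqint \<Omega> ?d2"
      using sqint_cmult[OF md(2), of "of_real q"] by simp
    finally show ?thesis .
  qed
  have "(\<lambda>n. 2 * (2 * sqint \<Omega> (\<lambda>x. dpartial (1, 0) (\<phi> n) x - g (1, 0) x) + 2 * (ennreal (q\<^sup>2) * sqint \<Omega> (\<lambda>x. dpartial (0, 1) (\<phi> n) x - g (0, 1) x)))) \<longlonglongrightarrow> 2 * (2 * 0 + 2 * (ennreal (q\<^sup>2) * 0))"
    by (intro ennreal_tendsto_cmult tendsto_add \<phi>(3) B) auto
  then have lim0: "(\<lambda>n. 2 * (2 * sqint \<Omega> (\<lambda>x. dpartial (1, 0) (\<phi> n) x - g (1, 0) x) + 2 * (ennreal (q\<^sup>2) * sqint \<Omega> (\<lambda>x. dpartial (0, 1) (\<phi> n) x - g (0, 1) x)))) \<longlonglongrightarrow> 0"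
    by (simp only: mult_zero_right add_0)
  have twlim: "(\<lambda>n. sqint \<Omega> (arm_derivative (\<lambda>e. dpartial e (\<phi> n)))) \<longlonglongrightarrow> 0"
    by (rule tendsto_sandwich[OF _ _ tendsto_const lim0]) (simp, rule always_eventually, rule allI, rule tw)
  have zeroR: "sqint (\<Omega> \<inter> {p. \<bar>fst p\<bar> < cos \<theta> * R}) u = 0" if R: "R > 0" for R
  proof -
    let ?S = "\<Omega> \<inter> {p. \<bar>fst p\<bar> < cos \<theta> * R}"
    have S: "?S \<in> sets borel"
      by (intro sets.Int guide_borel borel_open open_Collect_less continuous_intros)
    have mono: "sqint ?S f \<le> sqint \<Omega> f" for f
      unfolding sqint_eq[OF S] sqint_eq[OF guide_borel] by (intro nn_integral_mono) (auto split: split_indicator)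
    have LS: "f \<in> L2 ?S" if "f \<in> L2 \<Omega>" for f
    proof -
      have "f \<in> borel_measurable (leb \<Omega>)" using that by (rule L2_measurable)
      then have "f \<in> borel_measurable (leb ?S)"
        by (rule measurable_restrict_mono[OF _ Int_lower1])
      moreover have "sqint ?S f < \<infinity>" using mono[of f] that by (auto simp: L2_iff intro: le_less_trans)
      ultimately show ?thesis by (simp add: L2_iff)
    qed
    have "(\<lambda>n. sqint ?S (\<lambda>x. \<phi> n x - u x)) \<longlonglongrightarrow> 0"
      by (rule tendsto_sandwich[OF _ _ tendsto_const \<phi>(2)]) (simp, rule always_eventually, rule allI, rule mono)
    from sqint_tendsto[OF LS[OF smooth_L2[OF \<phi>(1) guide_borel]] LS[OF L(1)] this]
    have l1: "(\<lambda>n. sqint ?S (\<phi> n)) \<longlonglongrightarrow> sqint ?S u" .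
    have bound: "sqint ?S u \<le> ennreal (R * \<epsilon>) * sqint \<Omega> u" if \<epsilon>: "\<epsilon> > 0" for \<epsilon>
    proof -
      have "(\<lambda>n. ennreal (R * \<epsilon>) * sqint \<Omega> (\<phi> n) + ennreal (R / \<epsilon>) * sqint \<Omega> (arm_derivative (\<lambda>e. dpartial e (\<phi> n))))
        \<longlonglongrightarrow> ennreal (R * \<epsilon>) * sqint \<Omega> u + ennreal (R / \<epsilon>) * 0"
        by (intro tendsto_add ennreal_tendsto_cmult twlim sqint_tendsto[OF smooth_L2[OF \<phi>(1) guide_borel] L(1) \<phi>(2)]) simp_all
      then have "sqint ?S u \<le> ennreal (R * \<epsilon>) * sqint \<Omega> u + ennreal (R / \<epsilon>) * 0"
        by (rule LIMSEQ_le[OF l1]) (intro exI[of _ 0] allI impI, rule decay_guide[OF \<phi>(1) R \<epsilon>])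
      then show ?thesis by (simp only: mult_zero_right add_0_right)
    qed
    have fin: "sqint \<Omega> u = ennreal (Re (L2_inner \<Omega> u u))" by (rule L2_inner_self(2)[OF L(1), symmetric])
    define U where "U = \<bar>Re (L2_inner \<Omega> u u)\<bar>"
    have "sqint ?S u \<le> ennreal e" if e: "e > 0" for e :: real
    proof -
      have p: "R * (U + 1) > 0" using R by (simp add: U_def)
      have "sqint ?S u \<le> ennreal (R * (e / (R * (U + 1)))) * ennreal U"
      proof (rule order_trans[OF bound mult_left_mono])
        show "sqint \<Omega> u \<le> ennreal U" unfolding fin U_def by (intro ennreal_leI) simp
      qed (use e p in auto)
      also have "\<dots> = ennreal (R * (e / (R * (U + 1))) * U)" using R e p by (subst ennreal_mult) (auto simp: U_def)
      also have "\<dots> \<le> ennreal e"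
      proof (rule ennreal_leI)
        have "R * (e / (R * (U + 1))) * U = e * (U / (U + 1))" using R by simp
        also have "\<dots> \<le> e" using e by (intro mult_left_le) (auto simp: U_def)
        finally show "R * (e / (R * (U + 1))) * U \<le> e" .
      qed
      finally show ?thesis .
    qed
    then have "sqint ?S u \<le> 0 + ennreal e" if "e > 0" for e :: real using that by (simp only: add_0_left)
    then have "sqint ?S u \<le> 0" by (rule ennreal_le_epsilon)
    then show ?thesis by simp
  qed
  have AEn: "AE p in lborel. \<bar>fst p\<bar> < cos \<theta> * real (Suc n) \<longrightarrow> p \<in> \<Omega> \<longrightarrow> u p = 0" for n
  proof -
    let ?S = "\<Omega> \<inter> {p. \<bar>fst p\<bar> < cos \<theta> * real (Suc n)}"
    have S: "?S \<in> sets borel"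
      by (intro sets.Int guide_borel borel_open open_Collect_less continuous_intros)
    have "u \<in> borel_measurable (leb ?S)"
      by (rule measurable_restrict_mono[OF Lm(1) Int_lower1])
    then have "(\<lambda>p. ennreal ((norm (u p))\<^sup>2)) \<in> borel_measurable (leb ?S)" by measurable
    then have "AE p in leb ?S. ennreal ((norm (u p))\<^sup>2) = 0"
      using zeroR[of "real (Suc n)"] nn_integral_0_iff_AE unfolding sqint_def by (metis of_nat_0_less_iff zero_less_Suc)
    moreover have "?S \<inter> space lborel \<in> sets lborel" using S by simp
    ultimately have "AE p in lborel. p \<in> ?S \<longrightarrow> ennreal ((norm (u p))\<^sup>2) = 0" by (simp only: AE_restrict_space_iff)
    then show ?thesis by (rule AE_mp) (rule AE_I2, simp)
  qed
  have "AE p in lborel. \<forall>n. \<bar>fst p\<bar> < cos \<theta> * real (Suc n) \<longrightarrow> p \<in> \<Omega> \<longrightarrow> u p = 0"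
    by (simp only: AE_all_countable AEn simp_thms)
  then have "AE p in lborel. p \<in> \<Omega> \<longrightarrow> u p = 0"
  proof (rule AE_mp, intro AE_I2 impI)
    fix p assume a: "\<forall>n. \<bar>fst p\<bar> < cos \<theta> * real (Suc n) \<longrightarrow> p \<in> \<Omega> \<longrightarrow> u p = 0" "p \<in> \<Omega>"
    obtain n :: nat where "\<bar>fst p\<bar> / cos \<theta> < real n" using reals_Archimedean2 by blast
    then have "\<bar>fst p\<bar> < cos \<theta> * real n" using cos_pos by (simp add: divide_less_eq mult.commute)
    also have "\<dots> \<le> cos \<theta> * real (Suc n)" using cos_pos by simp
    finally show "u p = 0" using a by blast
  qed
  then have "AE p in leb \<Omega>. u p = 0" by (simp add: AE_restrict_space_iff)
  then have "sqint \<Omega> u = sqint \<Omega> (\<lambda>_. 0)" by (rule sqint_cong_AE)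
  then show ?thesis by (simp add: sqint_def)
qed

end

section \<open>Counting eigenvalues of a guide\<close>

context form_pair
begin

lemma eigfamily_mono:
  assumes "\<exists>e \<mu>. eigfamily S k e \<mu>" "S \<subseteq> S'"
  shows "\<exists>e \<mu>. eigfamily S' k e \<mu>"
proof -
  obtain e \<mu> where "eigfamily S k e \<mu>" using assms(1) by blast
  then have "eigfamily S' k e \<mu>" using assms(2) by (auto simp: eigfamily_def)
  then show ?thesis by blast
qed

lemma eigfamily_join:
  assumes f: "eigfamily S k f \<mu>" and g: "eigfamily S' m g \<nu>" and "S \<inter> S' = {}"
  shows "\<exists>e \<tau>. eigfamily (S \<union> S') (k + m) e \<tau>"
proof -
  define e where "e = (\<lambda>i. if i < k then f i else g (i - k))"
  define \<tau> where "\<tau> = (\<lambda>i. if i < k then \<mu> i else \<nu> (i - k))"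
  have 0: "b (f i) (g j) = 0" "b (g j) (f i) = 0" if "i < k" "j < m" for i j
  proof -
    have E: "f i \<in> eig (\<mu> i)" "g j \<in> eig (\<nu> j)" "\<mu> i \<noteq> \<nu> j" using f g assms(3) that by (auto simp: eigfamily_def)
    then show "b (f i) (g j) = 0" "b (g j) (f i) = 0" using eigvectors_orthogonal by metis+
  qed
  have "b.ortho (k + m) e"
    unfolding b.ortho_def
  proof (intro conjI allI impI)
    fix i j assume "i < k + m" "j < k + m"
    then show "b (e i) (e j) = (if i = j then 1 else 0)"
      using f g 0[of i "j - k"] 0[of j "i - k"] by (auto simp: e_def eigfamily_def b.ortho_def)
  qed (use f g in \<open>auto simp: e_def eigfamily_def b.ortho_def\<close>)
  moreover have "\<forall>i<k + m. e i \<in> eig (\<tau> i) \<and> \<tau> i \<in> S \<union> S'"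
    using f g by (auto simp: e_def \<tau>_def eigfamily_def)
  ultimately show ?thesis by (auto simp: eigfamily_def)
qed

end

lemma enat_le_SupD:
  assumes "enat n \<le> Sup X" "n > 0"
  shows "\<exists>x\<in>X. enat n \<le> x"
proof (rule ccontr)
  assume a: "\<not> (\<exists>x\<in>X. enat n \<le> x)"
  have "x \<le> enat (n - 1)" if "x \<in> X" for x using a that by (cases x) auto
  then have "Sup X \<le> enat (n - 1)" by (rule Sup_least)
  then show False using assms order_trans[of "enat n" "Sup X"] by fastforce
qed

lemma enat_le_add_split:
  assumes "enat n \<le> x + y"
  shows "\<exists>k m. n = k + m \<and> enat k \<le> x \<and> enat m \<le> y"
proof (cases x)
  case x: (enat p)
  show ?thesis
  proof (intro exI conjI)
    show "n = min n p + (n - min n p)" by simp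
    show "enat (n - min n p) \<le> y" using assms x by (cases y) auto
  qed (simp add: x)
next
  case infinity
  then have "n = n + 0 \<and> enat n \<le> x \<and> enat 0 \<le> y" by (simp flip: zero_enat_def)
  then show ?thesis by blast
qed

lemma L2_inner_self_pos_iff:
  assumes "f \<in> L2 \<Omega>"
  shows "Re (L2_inner \<Omega> f f) > 0 \<longleftrightarrow> \<not> (AE x in leb \<Omega>. f x = 0)"
proof -
  have "sqint \<Omega> f = 0 \<longleftrightarrow> (AE x in leb \<Omega>. ennreal ((norm (f x))\<^sup>2) = 0)"
    unfolding sqint_def
  proof (rule nn_integral_0_iff_AE)
    have "f \<in> borel_measurable (leb \<Omega>)" by (rule L2_measurable[OF assms])
    then show "(\<lambda>x. ennreal ((norm (f x))\<^sup>2)) \<in> borel_measurable (leb \<Omega>)" by measurable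
  qed
  then have "sqint \<Omega> f = 0 \<longleftrightarrow> (AE x in leb \<Omega>. f x = 0)" by simp
  then show ?thesis unfolding L2_inner_self(2)[OF assms, symmetric] ennreal_eq_0_iff by linarith
qed

lemma comb_apply: "(\<Sum>i<n. cscale (c i) (v i)) = (\<lambda>x. \<Sum>i<n. c i * v i x)" for n :: nat
proof
  show "(\<Sum>i<n. cscale (c i) (v i)) x = (\<Sum>i<n. c i * v i x)" for x
    by (induction n) (simp_all add: cscale_def)
qed

text \<open>
  The functionals required by the abstract setting are the inner products with the functions from
  \<open>guide_lower_bound\<close>, enumerated by an initial segment of the natural numbers.
\<close>

sublocale guide \<subseteq> spec: form_pair cscale "H10 (broken_guide \<theta>) (guide_boundary \<theta>)"
  "L2_inner (broken_guide \<theta>)" "dirichlet_form (broken_guide \<theta>)" "pi\<^sup>2"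
proof -
  interpret b: semi_inner cscale "H10 \<Omega> \<Gamma>" "L2_inner \<Omega>" by (rule semi_inner_guide)
  interpret a: semi_inner cscale "H10 \<Omega> \<Gamma>" "dirichlet_form \<Omega>" by (rule semi_inner_guide)
  interpret L: semi_inner cscale "L2 \<Omega>" "L2_inner \<Omega>" by (rule L2_inner_semi_inner)
  show "form_pair cscale (H10 \<Omega> \<Gamma>) (L2_inner \<Omega>) (dirichlet_form \<Omega>) (pi\<^sup>2)"
  proof unfold_locales
    show "\<exists>w\<in>H10 \<Omega> \<Gamma>. (\<lambda>n. Re (L2_inner \<Omega> (u n - w) (u n - w))) \<longlonglongrightarrow> 0 \<and>
        (\<lambda>n. Re (dirichlet_form \<Omega> (u n - w) (u n - w))) \<longlonglongrightarrow> 0"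
      if "\<And>n. u n \<in> H10 \<Omega> \<Gamma>" "\<And>\<epsilon>. \<epsilon> > 0 \<Longrightarrow> \<exists>N. \<forall>m\<ge>N. \<forall>n\<ge>N.
        Re (L2_inner \<Omega> (u m - u n) (u m - u n)) + Re (dirichlet_form \<Omega> (u m - u n) (u m - u n)) < \<epsilon>" for u
      by (rule H10_complete[OF open_guide guide_curves that])
  next
    fix c :: real assume "c < pi\<^sup>2"
    then obtain I :: "(real \<times> nat \<times> nat) set" and f and C :: real where I: "finite I" and C: "C \<ge> 0"
      and f: "\<And>i. i \<in> I \<Longrightarrow> f i \<in> L2 \<Omega>"
      and est: "\<And>u. u \<in> H10 \<Omega> \<Gamma> \<Longrightarrow> c * Re (L2_inner \<Omega> u u) \<le> Re (dirichlet_form \<Omega> u u)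
        + C * (\<Sum>i\<in>I. (norm (L2_inner \<Omega> u (f i)))\<^sup>2)"
      by (rule guide_lower_bound) blast
    obtain h where h: "bij_betw h {..<card I} I"
      using ex_bij_betw_nat_finite[OF I] by (auto simp: atLeast0LessThan)
    have hI: "h i \<in> I" if "i < card I" for i using h that by (auto simp: bij_betw_def)
    define C' where "C' = C + (\<Sum>i\<in>I. (L2_norm \<Omega> (f i))\<^sup>2)"
    have C': "C' \<ge> C" "C' \<ge> 0" using C by (auto simp: C'_def intro!: sum_nonneg add_nonneg_nonneg)
    define l where "l = (\<lambda>i u. L2_inner \<Omega> u (f (h i)))"
    have lb: "(norm (l i u))\<^sup>2 \<le> C' * Re (L2_inner \<Omega> u u)" if i: "i < card I" and u: "u \<in> H10 \<Omega> \<Gamma>" for i u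
    proof -
      have "norm (l i u) \<le> L2_norm \<Omega> u * L2_norm \<Omega> (f (h i))"
        unfolding l_def by (rule L2_inner_bound[OF H10_L2[OF u] f[OF hI[OF i]]])
      then have "(norm (l i u))\<^sup>2 \<le> (L2_norm \<Omega> u * L2_norm \<Omega> (f (h i)))\<^sup>2" by (intro power_mono) auto
      also have "\<dots> = (L2_norm \<Omega> (f (h i)))\<^sup>2 * Re (L2_inner \<Omega> u u)"
        by (simp add: power_mult_distrib L2_inner_self(3)[OF H10_L2[OF u]])
      also have "\<dots> \<le> C' * Re (L2_inner \<Omega> u u)"
      proof (rule mult_right_mono)
        have "(L2_norm \<Omega> (f (h i)))\<^sup>2 \<le> (\<Sum>i\<in>I. (L2_norm \<Omega> (f i))\<^sup>2)"
          by (rule member_le_sum[OF hI[OF i]]) (auto simp: I)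
        then show "(L2_norm \<Omega> (f (h i)))\<^sup>2 \<le> C'" using C by (simp add: C'_def)
      qed (rule b.nonneg[OF u])
      finally show ?thesis .
    qed
    have est': "c * Re (L2_inner \<Omega> u u) \<le> Re (dirichlet_form \<Omega> u u) + C' * (\<Sum>i<card I. (norm (l i u))\<^sup>2)"
      if u: "u \<in> H10 \<Omega> \<Gamma>" for u
    proof -
      have "(\<Sum>i\<in>I. (norm (L2_inner \<Omega> u (f i)))\<^sup>2) = (\<Sum>i<card I. (norm (l i u))\<^sup>2)"
        unfolding l_def by (rule sum.reindex_bij_betw[OF h, symmetric])
      then have "c * Re (L2_inner \<Omega> u u) \<le> Re (dirichlet_form \<Omega> u u) + C * (\<Sum>i<card I. (norm (l i u))\<^sup>2)"
        using est[OF u] by simp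
      also have "\<dots> \<le> Re (dirichlet_form \<Omega> u u) + C' * (\<Sum>i<card I. (norm (l i u))\<^sup>2)"
        using C' by (intro add_left_mono mult_right_mono sum_nonneg) auto
      finally show ?thesis .
    qed
    have lin: "l i (u + v) = l i u + l i v" "l i (cscale r u) = r * l i u"
      if "i < card I" "u \<in> H10 \<Omega> \<Gamma>" "v \<in> H10 \<Omega> \<Gamma>" for i u v r
      unfolding l_def using that by (simp_all add: L.add_left L.scale_left H10_L2[of _ \<Omega> \<Gamma>] f hI)
    show "\<exists>(M::nat) C l. C \<ge> 0 \<and>
       (\<forall>i<M. \<forall>u\<in>H10 \<Omega> \<Gamma>. \<forall>v\<in>H10 \<Omega> \<Gamma>. l i (u + v) = l i u + (l i v :: complex)) \<and>
       (\<forall>i<M. \<forall>u\<in>H10 \<Omega> \<Gamma>. \<forall>r. l i (cscale r u) = r * l i u) \<and>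
       (\<forall>i<M. \<forall>u\<in>H10 \<Omega> \<Gamma>. (norm (l i u))\<^sup>2 \<le> C * Re (L2_inner \<Omega> u u)) \<and>
       (\<forall>u\<in>H10 \<Omega> \<Gamma>. c * Re (L2_inner \<Omega> u u) \<le> Re (dirichlet_form \<Omega> u u) + C * (\<Sum>i<M. (norm (l i u))\<^sup>2))"
      by (rule exI[of _ "card I"], rule exI[of _ C'], rule exI[of _ l]) (simp add: C' lb est' lin)
  qed
qed

context guide
begin

lemma eigenspace_eig: "eigenspace (guide_laplacian \<theta>) \<mu> = spec.eig \<mu>"
proof -
  have "L2_inner \<Omega> (\<lambda>x. of_real \<mu> * u x) v = of_real \<mu> * L2_inner \<Omega> u v"
    if "u \<in> H10 \<Omega> \<Gamma>" "v \<in> H10 \<Omega> \<Gamma>" for u v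
    using spec.b.scale_left[OF that, of "of_real \<mu>"] by (simp add: cscale_def)
  then show ?thesis
    by (auto simp: eigenspace_def guide_laplacian_def dirichlet_laplacian_def spec.eig_def intro: L2_cmult H10_L2)
qed

lemma L2_independent_iff:
  assumes "\<And>i. i < n \<Longrightarrow> v i \<in> H10 \<Omega> \<Gamma>"
  shows "L2_independent \<Omega> n v \<longleftrightarrow>
    (\<forall>c. (\<exists>i<n. c i \<noteq> 0) \<longrightarrow> Re (L2_inner \<Omega> (\<Sum>i<n. cscale (c i) (v i)) (\<Sum>i<n. cscale (c i) (v i))) > 0)"
proof -
  have "(\<Sum>i<n. cscale (c i) (v i)) \<in> L2 \<Omega>" for c
    using assms by (intro H10_L2[of _ \<Omega> \<Gamma>] spec.b.D_sum spec.b.D_scale) auto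
  from L2_inner_self_pos_iff[OF this] show ?thesis
    unfolding L2_independent_def comb_apply by blast
qed

text \<open>
  The multiplicity is a supremum of lengths of linearly independent families. Such families may be
  orthonormalised inside the eigenspace, and suprema of extended natural numbers are attained unless
  infinite.
\<close>

lemma multiplicity_iff:
  "enat n \<le> multiplicity_of \<Omega> (guide_laplacian \<theta>) \<mu> \<longleftrightarrow> (\<exists>e. spec.eigfamily {\<mu>} n e (\<lambda>_. \<mu>))"
proof
  assume le: "enat n \<le> multiplicity_of \<Omega> (guide_laplacian \<theta>) \<mu>"
  show "\<exists>e. spec.eigfamily {\<mu>} n e (\<lambda>_. \<mu>)"
  proof (cases "n = 0")
    case True
    then show ?thesis by (simp add: spec.eigfamily_def spec.b.ortho_def)
  next
    case False
    obtain x where x: "enat n \<le> x"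
      "x \<in> {enat n | n u. (\<forall>i<n. u i \<in> spec.eig \<mu>) \<and> L2_independent \<Omega> n u}"
      using enat_le_SupD[OF le[unfolded multiplicity_of_def eigenspace_eig]] False by blast
    then obtain N v where "x = enat N" and v': "\<forall>i<N. v i \<in> spec.eig \<mu>" "L2_independent \<Omega> N v" by blast
    then have N: "n \<le> N" using x(1) by simp
    have v: "v i \<in> spec.eig \<mu>" if "i < N" for i using v' that by blast
    have vD: "v i \<in> H10 \<Omega> \<Gamma>" if "i < N" for i using v(1)[OF that] spec.eig_subset by blast
    have "\<exists>e. spec.b.ortho n e \<and> (\<forall>i<n. e i \<in> spec.eig \<mu>)"
    proof (rule spec.b.orthonormalize[OF spec.subspace_eig spec.eig_subset v _ N])
      show "Re (L2_inner \<Omega> (\<Sum>i<N. cscale (c i) (v i)) (\<Sum>i<N. cscale (c i) (v i))) > 0" if "\<exists>i<N. c i \<noteq> 0" for c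
        using L2_independent_iff[of N v, OF vD] v'(2) that by simp
    qed
    then show ?thesis by (simp add: spec.eigfamily_def)
  qed
next
  assume "\<exists>e. spec.eigfamily {\<mu>} n e (\<lambda>_. \<mu>)"
  then obtain e where e: "spec.eigfamily {\<mu>} n e (\<lambda>_. \<mu>)" by blast
  have eE: "e i \<in> spec.eig \<mu>" if "i < n" for i using e that by (simp add: spec.eigfamily_def)
  have "L2_independent \<Omega> n e"
    using L2_independent_iff[of n e] eE spec.eig_subset spec.eigfamily_form(2)[OF e] spec.sum_norm_pos by fastforce
  then show "enat n \<le> multiplicity_of \<Omega> (guide_laplacian \<theta>) \<mu>"
    unfolding multiplicity_of_def using eE by (intro Sup_upper) (auto simp: eigenspace_eig)
qed

text \<open>
  An orthonormal family is sorted by eigenvalue in one direction. In the other one, orthonormal bases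
  of finitely many eigenspaces are joined, which uses the orthogonality of different eigenspaces.
\<close>

lemma eigenvalue_count_iff:
  "enat k \<le> eigenvalue_count \<Omega> (guide_laplacian \<theta>) S \<longleftrightarrow> (\<exists>e \<mu>. spec.eigfamily S k e \<mu>)"
proof
  let ?m = "multiplicity_of \<Omega> (guide_laplacian \<theta>)"
  have fin: "\<exists>e \<mu>. spec.eigfamily F k e \<mu>" if "finite F" "enat k \<le> (\<Sum>\<mu>\<in>F. ?m \<mu>)" for F k
    using that
  proof (induction F arbitrary: k)
    case empty
    then have "k = 0" by (simp add: zero_enat_def)
    then show ?case by (simp add: spec.eigfamily_def spec.b.ortho_def)
  next
    case (insert \<nu> F)
    then have "enat k \<le> ?m \<nu> + (\<Sum>\<mu>\<in>F. ?m \<mu>)" by simp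
    then obtain p q where pq: "k = p + q" "enat p \<le> ?m \<nu>" "enat q \<le> (\<Sum>\<mu>\<in>F. ?m \<mu>)"
      using enat_le_add_split by blast
    obtain f where f: "spec.eigfamily {\<nu>} p f (\<lambda>_. \<nu>)" using pq(2) multiplicity_iff by blast
    obtain g \<mu> where g: "spec.eigfamily F q g \<mu>" using insert.IH[OF pq(3)] by blast
    show ?case using spec.eigfamily_join[OF f g] insert.hyps pq(1) by auto
  qed
  assume le: "enat k \<le> eigenvalue_count \<Omega> (guide_laplacian \<theta>) S"
  show "\<exists>e \<mu>. spec.eigfamily S k e \<mu>"
  proof (cases "k = 0")
    case True
    then show ?thesis by (simp add: spec.eigfamily_def spec.b.ortho_def)
  next
    case False
    from enat_le_SupD[OF le[unfolded eigenvalue_count_def]] False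
    obtain F where F: "finite F" "F \<subseteq> S" "enat k \<le> (\<Sum>\<mu>\<in>F. ?m \<mu>)" by auto
    show ?thesis by (rule spec.eigfamily_mono[OF fin[OF F(1,3)] F(2)])
  qed
next
  let ?m = "multiplicity_of \<Omega> (guide_laplacian \<theta>)"
  assume "\<exists>e \<mu>. spec.eigfamily S k e \<mu>"
  then obtain e \<mu> where e: "spec.eigfamily S k e \<mu>" by blast
  let ?I = "\<lambda>\<nu>. {i \<in> {..<k}. \<mu> i = \<nu>}"
  have m: "enat (card (?I \<nu>)) \<le> ?m \<nu>" for \<nu>
  proof -
    obtain h where h: "bij_betw h {..<card (?I \<nu>)} (?I \<nu>)"
      using ex_bij_betw_nat_finite[of "?I \<nu>"] by (auto simp: atLeast0LessThan)
    have hI: "h i < k" "\<mu> (h i) = \<nu>" if "i < card (?I \<nu>)" for i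
      using bij_betwE[OF h] that by auto
    have inj: "h i = h j \<longleftrightarrow> i = j" if "i < card (?I \<nu>)" "j < card (?I \<nu>)" for i j
      using bij_betw_imp_inj_on[OF h] that by (auto simp: inj_on_def)
    have "spec.eigfamily {\<nu>} (card (?I \<nu>)) (e \<circ> h) (\<lambda>_. \<nu>)"
      unfolding spec.eigfamily_def spec.b.ortho_def
    proof (intro conjI allI impI)
      fix i assume i: "i < card (?I \<nu>)"
      show "(e \<circ> h) i \<in> H10 \<Omega> \<Gamma>" using e hI(1)[OF i] by (simp add: spec.eigfamily_def spec.b.ortho_def)
      have "e (h i) \<in> spec.eig (\<mu> (h i))" using e hI(1)[OF i] by (simp add: spec.eigfamily_def)
      then show "(e \<circ> h) i \<in> spec.eig \<nu>" by (simp add: hI(2)[OF i])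
      fix j assume j: "j < card (?I \<nu>)"
      have "L2_inner \<Omega> (e (h i)) (e (h j)) = (if h i = h j then 1 else 0)"
        using e hI(1)[OF i] hI(1)[OF j] unfolding spec.eigfamily_def spec.b.ortho_def by blast
      then show "L2_inner \<Omega> ((e \<circ> h) i) ((e \<circ> h) j) = (if i = j then 1 else 0)" by (simp add: inj[OF i j])
    qed simp
    then show ?thesis using multiplicity_iff by blast
  qed
  have "k = (\<Sum>i<k. 1)" by simp
  also have "\<dots> = (\<Sum>\<nu>\<in>\<mu> ` {..<k}. \<Sum>i\<in>?I \<nu>. 1)" by (rule sum.image_gen) simp
  finally have "k = (\<Sum>\<nu>\<in>\<mu> ` {..<k}. card (?I \<nu>))" by simp
  then have "enat k = (\<Sum>\<nu>\<in>\<mu> ` {..<k}. enat (card (?I \<nu>)))"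
    by (simp only: of_nat_eq_enat[symmetric] of_nat_sum[symmetric])
  also have "\<dots> \<le> (\<Sum>\<nu>\<in>\<mu> ` {..<k}. ?m \<nu>)" by (intro sum_mono m)
  also have "\<dots> \<le> eigenvalue_count \<Omega> (guide_laplacian \<theta>) S"
    unfolding eigenvalue_count_def using e by (intro SUP_upper) (auto simp: spec.eigfamily_def)
  finally show "enat k \<le> eigenvalue_count \<Omega> (guide_laplacian \<theta>) S" .
qed

text \<open>
  The definite description denotes the number found in \<open>nth_eigenvalue_exists\<close>; it is unique because
  having \<open>j\<close> eigenvalues \<open>\<le> x\<close> excludes having fewer than \<open>j\<close> below any \<open>y > x\<close>.
\<close>

lemma guide_eigenvalue_characterization:
  assumes j: "1 \<le> j" and ex: "\<exists>e \<nu>. spec.eigfamily {..<pi\<^sup>2} j e \<nu>"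
  shows "guide_eigenvalue j \<theta> < pi\<^sup>2" "\<exists>e \<nu>. spec.eigfamily {..guide_eigenvalue j \<theta>} j e \<nu>"
    "\<nexists>e \<nu>. spec.eigfamily {..<guide_eigenvalue j \<theta>} j e \<nu>"
proof -
  obtain \<mu> where \<mu>: "\<mu> < pi\<^sup>2" "\<exists>e \<nu>. spec.eigfamily {..\<mu>} j e \<nu>" "\<nexists>e \<nu>. spec.eigfamily {..<\<mu>} j e \<nu>"
    by (rule spec.nth_eigenvalue_exists[OF j ex])
  have "guide_eigenvalue j \<theta> = \<mu>"
    unfolding guide_eigenvalue_def nth_eigenvalue_def not_le[symmetric] eigenvalue_count_iff
  proof (rule the_equality)
    fix \<nu> assume \<nu>: "(\<nexists>e \<tau>. spec.eigfamily {..<\<nu>} j e \<tau>) \<and> (\<exists>e \<tau>. spec.eigfamily {..\<nu>} j e \<tau>)"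
    have "\<not> x < y" if "\<exists>e \<tau>. spec.eigfamily {..x} j e \<tau>" "\<nexists>e \<tau>. spec.eigfamily {..<y} j e \<tau>" for x y
    proof
      assume "x < y"
      then have "{..x} \<subseteq> {..<y}" by auto
      from spec.eigfamily_mono[OF that(1) this] show False using that(2) by contradiction
    qed
    from this[OF \<mu>(2) conjunct1[OF \<nu>]] this[OF conjunct2[OF \<nu>] \<mu>(3)]
    show "\<nu> = \<mu>" by linarith
  qed (rule conjI[OF \<mu>(3,2)])
  then show "guide_eigenvalue j \<theta> < pi\<^sup>2" "\<exists>e \<nu>. spec.eigfamily {..guide_eigenvalue j \<theta>} j e \<nu>"
    "\<nexists>e \<nu>. spec.eigfamily {..<guide_eigenvalue j \<theta>} j e \<nu>"
    by (simp_all only: \<mu> not_False_eq_True)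
qed

end

section \<open>Monotonicity of the eigenvalues\<close>

context guide_pair
begin

text \<open>
  The Rayleigh quotient decreases strictly: the norm only acquires the Jacobian factor \<open>ka * kb\<close>, and
  the energy loss is positive since the derivative along the arms does not vanish.
\<close>

lemma transplanted_form_values:
  assumes w: "w \<in> H10 (broken_guide \<beta>) (guide_boundary \<beta>)"
    and pos: "Re (L2_inner (broken_guide \<beta>) w w) > 0"
  shows "(\<lambda>p. w (T p)) \<in> H10 (broken_guide \<alpha>) (guide_boundary \<alpha>)"
    "Re (L2_inner (broken_guide \<beta>) w w) = ka * kb * Re (L2_inner (broken_guide \<alpha>) (\<lambda>p. w (T p)) (\<lambda>p. w (T p)))"
    "ka * kb * Re (dirichlet_form (broken_guide \<alpha>) (\<lambda>p. w (T p)) (\<lambda>p. w (T p))) < Re (dirichlet_form (broken_guide \<beta>) w w)"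
proof -
  define g where "g = (\<lambda>e. weak_partial (broken_guide \<beta>) e w)"
  let ?v = "\<lambda>p. w (T p)"
  have tf: "trace_free (broken_guide \<beta>) (guide_boundary \<beta>) w g"
    unfolding g_def by (rule H10_imp_trace_free[OF \<beta>.open_guide w])
  have tf': "trace_free (broken_guide \<alpha>) (guide_boundary \<alpha>) ?v (pull g)" by (rule trace_free_transplant[OF tf])
  show v: "?v \<in> H10 (broken_guide \<alpha>) (guide_boundary \<alpha>)" by (rule trace_free_imp_H10[OF \<alpha>.open_guide tf'])
  have kk: "ka * kb > 0" using ka_pos kb_pos by simp
  have "ennreal (Re (L2_inner (broken_guide \<beta>) w w)) = ennreal (ka * kb * Re (L2_inner (broken_guide \<alpha>) ?v ?v))"
    using sqint_T[OF L2_measurable[OF H10_L2[OF w]]] kk \<alpha>.spec.b.nonneg[OF v]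
    by (simp add: L2_inner_self(2)[OF H10_L2[OF w]] L2_inner_self(2)[OF H10_L2[OF v], symmetric] ennreal_mult)
  then show "Re (L2_inner (broken_guide \<beta>) w w) = ka * kb * Re (L2_inner (broken_guide \<alpha>) ?v ?v)"
    using \<beta>.spec.b.nonneg[OF w] \<alpha>.spec.b.nonneg[OF v] kk by (subst (asm) ennreal_inj) auto
  have B: "(1, 0) \<in> (Basis :: (real \<times> real) set)" "(0, 1) \<in> (Basis :: (real \<times> real) set)" unfolding Basis_plane by simp_all
  have gm: "g (1, 0) \<in> borel_measurable (leb (broken_guide \<beta>))" "g (0, 1) \<in> borel_measurable (leb (broken_guide \<beta>))"
    using tf B by (auto simp: trace_free_def intro: L2_measurable)
  let ?x = "sqint (broken_guide \<beta>) (\<beta>.arm_derivative g)"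
  have k1: "1 - ka\<^sup>2 > 0" using ka_pos ka_less_1 by (simp add: power_less_one_iff)
  have e: "ennreal (Re (dirichlet_form (broken_guide \<beta>) w w))
    = ennreal (ka * kb) * ennreal (Re (dirichlet_form (broken_guide \<alpha>) ?v ?v)) + ennreal (1 - ka\<^sup>2) * ?x"
    using energy_identity[OF gm] dirichlet_form_self[OF \<beta>.open_guide tf] dirichlet_form_self[OF \<alpha>.open_guide tf'] by simp
  have x0: "?x \<noteq> 0"
    using \<beta>.zero_of_arm_derivative_zero[OF tf] L2_inner_self(2)[OF H10_L2[OF w]] pos by auto
  have "?x \<noteq> \<infinity>"
  proof
    assume "?x = \<infinity>"
    then have "ennreal (Re (dirichlet_form (broken_guide \<beta>) w w)) = \<infinity>"
      unfolding e using k1 by (simp add: ennreal_mult_top)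
    then show False by simp
  qed
  then obtain x where x: "x > 0" "?x = ennreal x" using x0
    by (cases ?x) (auto simp: less_le)
  have "ennreal (Re (dirichlet_form (broken_guide \<beta>) w w))
    = ennreal (ka * kb * Re (dirichlet_form (broken_guide \<alpha>) ?v ?v) + (1 - ka\<^sup>2) * x)"
    unfolding e x(2) using kk k1 x(1) \<alpha>.spec.a.nonneg[OF v] by (simp add: ennreal_mult ennreal_plus)
  then have "Re (dirichlet_form (broken_guide \<beta>) w w) = ka * kb * Re (dirichlet_form (broken_guide \<alpha>) ?v ?v) + (1 - ka\<^sup>2) * x"
    using \<beta>.spec.a.nonneg[OF w] \<alpha>.spec.a.nonneg[OF v] kk k1 x(1) by (subst (asm) ennreal_inj) auto
  moreover have "(1 - ka\<^sup>2) * x > 0" using k1 x(1) by simp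
  ultimately show "ka * kb * Re (dirichlet_form (broken_guide \<alpha>) ?v ?v) < Re (dirichlet_form (broken_guide \<beta>) w w)" by linarith
qed

text \<open>
  On the span of the eigenfunctions for eigenvalues \<open>\<le> \<mu>\<close> the quotient is at most \<open>\<mu>\<close>, so it is less than
  \<open>\<mu>\<close> on the transplanted span, which serves as a trial space.
\<close>

lemma eigfamily_transplant:
  assumes e: "\<beta>.spec.eigfamily {..\<mu>} k e \<nu>" and \<mu>: "\<mu> \<le> pi\<^sup>2"
  shows "\<exists>e \<nu>. \<alpha>.spec.eigfamily {..<\<mu>} k e \<nu>"
proof (rule \<alpha>.spec.trial_space[of k "\<lambda>i p. e i (T p)", OF _ \<mu>])
  have kk: "ka * kb > 0" using ka_pos kb_pos by simp
  show "(\<lambda>p. e i (T p)) \<in> H10 (broken_guide \<alpha>) (guide_boundary \<alpha>)" if "i < k" for i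
  proof (rule transplanted_form_values(1))
    have o: "\<beta>.spec.b.ortho k e" using e by (simp add: \<beta>.spec.eigfamily_def)
    show "e i \<in> H10 (broken_guide \<beta>) (guide_boundary \<beta>)" using o that by (simp add: \<beta>.spec.b.ortho_def)
    show "Re (L2_inner (broken_guide \<beta>) (e i) (e i)) > 0" using o that by (simp add: \<beta>.spec.b.ortho_def)
  qed
  fix c :: "nat \<Rightarrow> complex" assume c: "\<exists>i<k. c i \<noteq> 0"
  define w where "w = (\<Sum>i<k. cscale (c i) (e i))"
  note form = \<beta>.spec.eigfamily_form[OF e, of c, folded w_def]
  have pos: "Re (L2_inner (broken_guide \<beta>) w w) > 0" unfolding form(2) by (rule \<beta>.spec.sum_norm_pos[OF c])
  have comb: "(\<Sum>i<k. cscale (c i) (\<lambda>p. e i (T p))) = (\<lambda>p. w (T p))" unfolding w_def comb_apply ..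
  note val = transplanted_form_values[OF form(1) pos]
  have "Re (dirichlet_form (broken_guide \<beta>) w w) \<le> \<mu> * Re (L2_inner (broken_guide \<beta>) w w)"
    unfolding form(2,3) sum_distrib_left using e by (intro sum_mono mult_right_mono) (auto simp: \<beta>.spec.eigfamily_def)
  then have "ka * kb * Re (dirichlet_form (broken_guide \<alpha>) (\<lambda>p. w (T p)) (\<lambda>p. w (T p)))
    < ka * kb * (\<mu> * Re (L2_inner (broken_guide \<alpha>) (\<lambda>p. w (T p)) (\<lambda>p. w (T p))))"
    using val(2,3) by (simp add: mult_ac)
  then show "Re (dirichlet_form (broken_guide \<alpha>) (\<Sum>i<k. cscale (c i) (\<lambda>p. e i (T p))) (\<Sum>i<k. cscale (c i) (\<lambda>p. e i (T p))))
    < \<mu> * Re (L2_inner (broken_guide \<alpha>) (\<Sum>i<k. cscale (c i) (\<lambda>p. e i (T p))) (\<Sum>i<k. cscale (c i) (\<lambda>p. e i (T p))))"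
    unfolding comb using kk by (simp only: mult_less_cancel_left_pos)
qed

lemma eigenvalues_below_threshold_transplant:
  assumes "\<exists>e \<nu>. \<beta>.spec.eigfamily {..<pi\<^sup>2} k e \<nu>"
  shows "\<exists>e \<nu>. \<alpha>.spec.eigfamily {..<pi\<^sup>2} k e \<nu>"
proof -
  have "{..<pi\<^sup>2} \<subseteq> {..pi\<^sup>2}" by auto
  from \<beta>.spec.eigfamily_mono[OF assms this]
  obtain e \<nu> where "\<beta>.spec.eigfamily {..pi\<^sup>2} k e \<nu>" by blast
  from eigfamily_transplant[OF this order_refl] show ?thesis .
qed

text \<open>
  There are \<open>j\<close> eigenvalues of \<open>\<Omega>\<^sub>\<beta>\<close> up to \<open>\<lambda>\<^sub>j(\<beta>)\<close>, hence \<open>j\<close> eigenvalues of \<open>\<Omega>\<^sub>\<alpha>\<close> strictly below that number.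
\<close>

lemma guide_eigenvalue_strict:
  assumes j: "1 \<le> j" and ex: "\<exists>e \<nu>. \<beta>.spec.eigfamily {..<pi\<^sup>2} j e \<nu>"
  shows "guide_eigenvalue j \<alpha> < guide_eigenvalue j \<beta>"
proof (rule ccontr)
  assume "\<not> guide_eigenvalue j \<alpha> < guide_eigenvalue j \<beta>"
  then have "{..<guide_eigenvalue j \<beta>} \<subseteq> {..<guide_eigenvalue j \<alpha>}" by auto
  note less = \<alpha>.spec.eigfamily_mono[OF _ this]
  note val = \<beta>.guide_eigenvalue_characterization[OF j ex]
  obtain e \<nu> where "\<beta>.spec.eigfamily {..guide_eigenvalue j \<beta>} j e \<nu>" using val(2) by blast
  from less[OF eigfamily_transplant[OF this less_imp_le[OF val(1)]]]
    \<alpha>.guide_eigenvalue_characterization(3)[OF j eigenvalues_below_threshold_transplant[OF ex]]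
  show False by contradiction
qed

end

theorem theorem1:
  fixes k :: nat and \<beta> :: real
  assumes "1 \<le> k"
    and "0 < \<beta>" and "\<beta> < pi / 2"
    and "enat k \<le> guide_count_below \<beta> (pi\<^sup>2)"
  shows "(\<forall>\<alpha>\<in>{0<..<\<beta>}. enat k \<le> guide_count_below \<alpha> (pi\<^sup>2)) \<and>
         (\<forall>j\<in>{1..k}. strict_mono_on {0<..\<beta>} (guide_eigenvalue j))"
proof
  have pair: "guide_pair x y" if "0 < x" "x < y" "y \<le> \<beta>" for x y
    using that assms(3) by unfold_locales auto
  have count: "enat k \<le> guide_count_below x (pi\<^sup>2)" if "0 < x" "x \<le> \<beta>" for x
  proof (cases "x = \<beta>")
    case False
    then interpret guide_pair x \<beta> using pair that by simp
    have "\<exists>e \<nu>. \<beta>.spec.eigfamily {..<pi\<^sup>2} k e \<nu>"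
      using assms(4) by (simp only: guide_count_below_def \<beta>.eigenvalue_count_iff)
    from eigenvalues_below_threshold_transplant[OF this] show ?thesis
      by (simp only: guide_count_below_def \<alpha>.eigenvalue_count_iff)
  qed (use assms(4) in simp)
  then show "\<forall>\<alpha>\<in>{0<..<\<beta>}. enat k \<le> guide_count_below \<alpha> (pi\<^sup>2)" by simp
  show "\<forall>j\<in>{1..k}. strict_mono_on {0<..\<beta>} (guide_eigenvalue j)"
  proof (intro ballI strict_mono_onI)
    fix j x y assume j: "j \<in> {1..k}" and xy: "x \<in> {0<..\<beta>}" "y \<in> {0<..\<beta>}" "x < y"
    then interpret guide_pair x y using pair by simp
    have "enat k \<le> guide_count_below y (pi\<^sup>2)" using count xy by simp
    then have "enat j \<le> guide_count_below y (pi\<^sup>2)" using j by (simp add: order_trans[of "enat j" "enat k"])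
    then have "\<exists>e \<nu>. \<beta>.spec.eigfamily {..<pi\<^sup>2} j e \<nu>"
      by (simp only: guide_count_below_def \<beta>.eigenvalue_count_iff)
    then show "guide_eigenvalue j x < guide_eigenvalue j y" using guide_eigenvalue_strict j by simp
  qed
qed

end
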